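(* Let $(E,J)\to(M,I)$ be a holomorphic vector bundle over a complex manifold, considered as a real bundle with fiberwise complex structure $J$, and let $g$ and $g'$ be two fiberwise metrics on $E$ compatible with $J$. Let $\mathcal{D}'^{0,1}\in\Gamma(T^{*0,1}\otimes\mathfrak{so}(E^{1,0}\oplus E^{*1,0}))$ be such that $\overline{\partial}+\mathcal{D}'^{0,1}$ is a $\overline{\partial}$-operator on $E^{1,0}\oplus E^{*1,0}$. Then there exists a fiber preserving biholomorphism between $(\mathcal{T}(E,g),\mathcal{J}^{(\nabla^{Ch}+\mathcal{D}_g,I)})$ and $(\mathcal{T}(E,g'),\mathcal{J}^{(\nabla^{Ch'}+\mathcal{D}_{g'},I)})$.
   Context: Fiberwise metrics are positive definite. $E^{1,0}$ and $E^{0,1}$ are the $\pm i$ eigenbundles of $J$ in $E_{\mathbb{C}}=E\otimes_{\mathbb{R}}\mathbb{C}$; $E^{1,0}$ is a holomorphic bundle with dual $E^{*1,0}$, and $\overline{\partial}$ is the natural $\overline{\partial}$-operator on $E^{1,0}\oplus E^{*1,0}$. $T^{*0,1}$ is the bundle of $(0,1)$-forms on $M$. $\mathfrak{so}(E^{1,0}\oplus E^{*1,0})$ is taken with respect to $\langle X+\mu,Y+\nu\rangle=\frac12(\mu(Y)+\nu(X))$. A $\overline{\partial}$-operator is required to square to zero. $\nabla^{Ch}$ and $\nabla^{Ch'}$ are the Chern connections of $(E,J)$ with $g$ and $g'$, considered as real connections on $E$. Definition of $\mathcal{D}_g$: $g:E^{0,1}\to E^{*1,0}$ is the isomorphism given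 by the $\mathbb{C}$-bilinear extension of $g$, and $\mathcal{D}_g^{0,1}$ is the $(0,1)$-form with values in $\mathrm{End}(E_{\mathbb{C}})$ such that $\nabla^{Ch(0,1)}+\mathcal{D}_g^{0,1}$ corresponds to $\overline{\partial}+\mathcal{D}'^{0,1}$ under the isomorphism $1\oplus g:E_{\mathbb{C}}=E^{1,0}\oplus E^{0,1}\to E^{1,0}\oplus E^{*1,0}$; that is, $\mathcal{D}_g^{0,1}=(1\oplus g)^{-1}\mathcal{D}'^{0,1}(1\oplus g)$. Then $\mathcal{D}_g=\mathcal{D}_g^{0,1}+\overline{\mathcal{D}_g^{0,1}}$, so that $\nabla^{Ch}+\mathcal{D}_g$ is a real $g$-metric connection on $E$ with curvature of type $(1,1)$. $\mathcal{D}_{g'}$ is defined in the same way from $g'$ and the same $\mathcal{D}'^{0,1}$. $\mathcal{T}=\mathcal{T}(E,g)=\{K\in\mathrm{End}\,E:K^2=-1,\ g(K\cdot,K\cdot)=g(\cdot,\cdot)\}$ with projection $\pi$ to $M$. For a connection $\nabla$ with $\nabla g=0$, $T_K\mathcal{T}=V_K\mathcal{T}\oplus H^\nabla_K\mathcal{T}$, where $V_K\mathcal{T}=\{A\in\mathfrak{o}(E_{\pi(K)},g):AK+KA=0\}$ is the vertical space and $H^\nabla_K\mathcal{T}$ is the set of velocities at $t=0$ of $\nabla$-parallel translates of $K$ along curves in $M$ starting at $\pi(K)$; $v^\nabla$ denotes the horizontal lift of $v\in T_{\pi(K)}M$. $\mathcal{J}^{(\nabla,I)}$ is defined by $\mathcal{J}^{(\nabla,I)}A=KA$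 for $A\in V_K\mathcal{T}$ and $\mathcal{J}^{(\nabla,I)}v^\nabla=(Iv)^\nabla$. *)

theory Defs
  imports "HOL-Analysis.Analysis" "HOL-Library.Function_Algebras"
begin

section \<open>Smooth and holomorphic functions on open subsets of model spaces\<close>

text \<open>Meant for open \<open>S\<close> and finite-dimensional domains, where continuity of all iterated
  directional derivatives is the usual \<open>C\<^sup>k\<close> condition.\<close>

primrec Ck_on ::
  "nat \<Rightarrow> 'a::real_normed_vector set \<Rightarrow> ('a \<Rightarrow> 'b::real_normed_vector) \<Rightarrow> bool" where
  "Ck_on 0 S f \<longleftrightarrow> continuous_on S f"
| "Ck_on (Suc k) S f \<longleftrightarrow> (\<forall>x\<in>S. f differentiable (at x)) \<and>
     (\<forall>v. Ck_on k S (\<lambda>x. frechet_derivative f (at x) v))"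

definition smooth_on ::
  "'a::real_normed_vector set \<Rightarrow> ('a \<Rightarrow> 'b::real_normed_vector) \<Rightarrow> bool" where
  "smooth_on S f \<longleftrightarrow> (\<forall>k. Ck_on k S f)"

definition several_holomorphic_on :: "(complex^'n) set \<Rightarrow> (complex^'n::finite \<Rightarrow> complex) \<Rightarrow> bool"
  where "several_holomorphic_on S f \<longleftrightarrow>
    (\<forall>z\<in>S. \<exists>f'. (f has_derivative f') (at z) \<and> (\<forall>c v. f' (c *s v) = c * f' v))"

section \<open>Atlases, curves, tangent vectors, smooth maps between subsets\<close>

type_synonym ('p, 'a) chart = "'p set \<times> ('p \<Rightarrow> 'a)"

text \<open>A tangent vector is given by its components in every chart around its base point (and, by
  convention, by 0 for all other charts).\<close>

type_synonym ('p, 'a) tvec = "('p, 'a) chart \<Rightarrow> 'a"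

definition chart_inv :: "('p, 'a) chart \<Rightarrow> 'a \<Rightarrow> 'p" where
  "chart_inv c = inv_into (fst c) (snd c)"

definition smooth_curve ::
  "('p, 'a::real_normed_vector) chart set \<Rightarrow> real set \<Rightarrow> (real \<Rightarrow> 'p) \<Rightarrow> bool" where
  "smooth_curve A T \<gamma> \<longleftrightarrow> \<gamma> ` T \<subseteq> (\<Union>c\<in>A. fst c) \<and>
     (\<forall>c\<in>A. open {t\<in>T. \<gamma> t \<in> fst c} \<and> smooth_on {t\<in>T. \<gamma> t \<in> fst c} (\<lambda>t. snd c (\<gamma> t)))"

definition velocity ::
  "('p, 'a::real_normed_vector) chart set \<Rightarrow> (real \<Rightarrow> 'p) \<Rightarrow> real \<Rightarrow> ('p, 'a) tvec" where
  "velocity A \<gamma> t = (\<lambda>c. if c \<in> A \<and> \<gamma> t \<in> fst c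
     then vector_derivative (\<lambda>\<tau>. snd c (\<gamma> \<tau>)) (at t) else 0)"

text \<open>Tangent vectors at \<open>p\<close> to a subset \<open>S\<close> of the manifold with atlas \<open>A\<close>; the usual tangent
  space if \<open>S\<close> is an embedded submanifold, in particular if \<open>S\<close> is the whole manifold.\<close>

definition tangent_space ::
  "('p, 'a::real_normed_vector) chart set \<Rightarrow> 'p set \<Rightarrow> 'p \<Rightarrow> ('p, 'a) tvec set" where
  "tangent_space A S p = {\<xi>. \<exists>\<epsilon>>0. \<exists>\<gamma>. smooth_curve A {-\<epsilon><..<\<epsilon>} \<gamma> \<and>
     \<gamma> ` {-\<epsilon><..<\<epsilon>} \<subseteq> S \<and> \<gamma> 0 = p \<and> \<xi> = velocity A \<gamma> 0}"

definition tscale :: "real \<Rightarrow> ('p, 'a::real_vector) tvec \<Rightarrow> ('p, 'a) tvec" where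
  "tscale r \<xi> = (\<lambda>c. r *\<^sub>R \<xi> c)"

definition coord_vec ::
  "('p, 'a::real_normed_vector) chart set \<Rightarrow> ('p, 'a) chart \<Rightarrow> 'p \<Rightarrow> 'a \<Rightarrow> ('p, 'a) tvec" where
  "coord_vec A c x a = velocity A (\<lambda>t. chart_inv c (snd c x + t *\<^sub>R a)) 0"

definition smooth_map ::
  "('p, 'a::real_normed_vector) chart set \<Rightarrow> 'p set \<Rightarrow>
   ('q, 'b::real_normed_vector) chart set \<Rightarrow> ('p \<Rightarrow> 'q) \<Rightarrow> bool" where
  "smooth_map A S A' F \<longleftrightarrow> (\<forall>p\<in>S. \<exists>c\<in>A. \<exists>d\<in>A'. p \<in> fst c \<and> F p \<in> fst d \<and>
     (\<exists>W G. open W \<and> snd c p \<in> W \<and> smooth_on W G \<and>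
        (\<forall>q\<in>S \<inter> fst c. snd c q \<in> W \<longrightarrow> F q \<in> fst d \<and> snd d (F q) = G (snd c q))))"

definition differential ::
  "('p, 'a::real_normed_vector) chart set \<Rightarrow> 'p set \<Rightarrow>
   ('q, 'b::real_normed_vector) chart set \<Rightarrow> ('p \<Rightarrow> 'q) \<Rightarrow> 'p \<Rightarrow> ('p, 'a) tvec \<Rightarrow> ('q, 'b) tvec"
  where
  "differential A S A' F p \<xi> = (THE \<eta>. \<exists>\<epsilon>>0. \<exists>\<gamma>. smooth_curve A {-\<epsilon><..<\<epsilon>} \<gamma> \<and>
     \<gamma> ` {-\<epsilon><..<\<epsilon>} \<subseteq> S \<and> \<gamma> 0 = p \<and> \<xi> = velocity A \<gamma> 0 \<and>
     \<eta> = velocity A' (\<lambda>t. F (\<gamma> t)) 0)"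

text \<open>Biholomorphisms between embedded submanifolds \<open>S\<close>, \<open>S'\<close> carrying (almost) complex structures
  \<open>Jop\<close>, \<open>Jop'\<close>: diffeomorphisms whose differential intertwines these.\<close>

definition biholomorphism where
  "biholomorphism A S Jop A' S' Jop' F \<longleftrightarrow>
     bij_betw F S S' \<and> smooth_map A S A' F \<and> smooth_map A' S' A (inv_into S F) \<and>
     (\<forall>p\<in>S. \<forall>\<xi>\<in>tangent_space A S p.
        differential A S A' F p (Jop p \<xi>) = Jop' (F p) (differential A S A' F p \<xi>))"

definition complex_manifold :: "('m::topological_space, complex^'n::finite) chart set \<Rightarrow> bool"
  where
  "complex_manifold A \<longleftrightarrow> (\<Union>c\<in>A. fst c) = UNIV \<and>
     (\<forall>c\<in>A. open (fst c) \<and> open (snd c ` fst c) \<and>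
        homeomorphism (fst c) (snd c ` fst c) (snd c) (chart_inv c)) \<and>
     (\<forall>c\<in>A. \<forall>d\<in>A. \<forall>k. several_holomorphic_on (snd c ` (fst c \<inter> fst d))
        (\<lambda>z. snd d (chart_inv c z) $ k))"

definition cplx_I :: "('m, complex^'n::finite) tvec \<Rightarrow> ('m, complex^'n) tvec" where
  "cplx_I \<xi> = (\<lambda>c. \<i> *s \<xi> c)"

definition smooth_fun ::
  "('m, complex^'n::finite) chart set \<Rightarrow> 'm set \<Rightarrow> ('m \<Rightarrow> 'b::real_normed_vector) \<Rightarrow> bool" where
  "smooth_fun A U f \<longleftrightarrow> (\<forall>c\<in>A. smooth_on (snd c ` (U \<inter> fst c)) (\<lambda>z. f (chart_inv c z)))"

definition holomorphic_fun ::
  "('m, complex^'n::finite) chart set \<Rightarrow> 'm set \<Rightarrow> ('m \<Rightarrow> complex) \<Rightarrow> bool" where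
  "holomorphic_fun A U f \<longleftrightarrow>
     (\<forall>c\<in>A. several_holomorphic_on (snd c ` (U \<inter> fst c)) (\<lambda>z. f (chart_inv c z)))"

text \<open>\<open>dfun A f x v\<close> is the derivative \<open>df(v)\<close>; by the chain rule it does not depend on the chart.\<close>

definition dfun ::
  "('m, complex^'n::finite) chart set \<Rightarrow> ('m \<Rightarrow> 'b::real_normed_vector) \<Rightarrow> 'm \<Rightarrow>
   ('m, complex^'n) tvec \<Rightarrow> 'b" where
  "dfun A f x v = (let c = (SOME c. c \<in> A \<and> x \<in> fst c)
     in frechet_derivative (\<lambda>z. f (chart_inv c z)) (at (snd c x)) (v c))"

text \<open>A (0,1)-form is encoded by its restriction to real tangent vectors: a real-linear form \<open>\<alpha>\<close> with
  \<open>\<alpha>(Iv) = -i \<alpha>(v)\<close>. Thus \<open>dbar f (v) = (df(v) + i df(Iv)) / 2\<close>.\<close>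

definition dbar_fun ::
  "('m, complex^'n::finite) chart set \<Rightarrow> ('m \<Rightarrow> complex) \<Rightarrow> 'm \<Rightarrow> ('m, complex^'n) tvec \<Rightarrow> complex"
  where "dbar_fun A f x v = (dfun A f x v + \<i> * dfun A f x (cplx_I v)) / 2"

definition dbar_vec ::
  "('m, complex^'n::finite) chart set \<Rightarrow> ('m \<Rightarrow> complex^'r::finite) \<Rightarrow> 'm \<Rightarrow>
   ('m, complex^'n) tvec \<Rightarrow> complex^'r" where
  "dbar_vec A f x v = (\<chi> i. dbar_fun A (\<lambda>y. f y $ i) x v)"

section \<open>Holomorphic vector bundles\<close>

text \<open>The fibers are real vector subspaces of one ambient real vector space \<open>'v\<close>, which carries no
  topology and has no geometric meaning: e.g. the algebraic direct sum of all fibers will do, so this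
  is no restriction. \<open>bJ x\<close> is the complex structure of the fiber over \<open>x\<close>. A local trivialization
  is given by the corresponding local holomorphic frame \<open>e\<^sub>1, \<dots>, e\<^sub>r\<close> over an open set; the topology
  and smooth structure of the total space are the ones induced by the frames.\<close>

record ('m, 'n, 'v, 'r) hbundle =
  charts :: "('m, complex^'n) chart set"
  fiber :: "'m \<Rightarrow> 'v set"
  bJ :: "'m \<Rightarrow> 'v \<Rightarrow> 'v"
  frames :: "('m set \<times> ('r \<Rightarrow> 'm \<Rightarrow> 'v)) set"

definition real_linear_on ::
  "'v::real_vector set \<Rightarrow> ('v \<Rightarrow> 'w::real_vector) \<Rightarrow> bool" where
  "real_linear_on S f \<longleftrightarrow> (\<forall>u\<in>S. \<forall>w\<in>S. f (u + w) = f u + f w) \<and>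
     (\<forall>r. \<forall>u\<in>S. f (r *\<^sub>R u) = r *\<^sub>R f u)"

definition fscale ::
  "('m, 'n::finite, 'v::real_vector, 'r::finite) hbundle \<Rightarrow> 'm \<Rightarrow> complex \<Rightarrow> 'v \<Rightarrow> 'v" where
  "fscale B x c u = Re c *\<^sub>R u + Im c *\<^sub>R bJ B x u"

definition comb ::
  "('m, 'n::finite, 'v::real_vector, 'r::finite) hbundle \<Rightarrow> ('r \<Rightarrow> 'm \<Rightarrow> 'v) \<Rightarrow> 'm \<Rightarrow>
   complex^'r \<Rightarrow> 'v" where
  "comb B e x a = (\<Sum>i\<in>UNIV. fscale B x (a $ i) (e i x))"

definition coord ::
  "('m, 'n::finite, 'v::real_vector, 'r::finite) hbundle \<Rightarrow> ('r \<Rightarrow> 'm \<Rightarrow> 'v) \<Rightarrow> 'm \<Rightarrow>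
   'v \<Rightarrow> complex^'r" where
  "coord B e x = inv (comb B e x)"

definition holomorphic_vector_bundle ::
  "('m::topological_space, 'n::finite, 'v::real_vector, 'r::finite) hbundle \<Rightarrow> bool" where
  "holomorphic_vector_bundle B \<longleftrightarrow>
     complex_manifold (charts B) \<and>
     (\<forall>x. subspace (fiber B x) \<and> bJ B x ` fiber B x \<subseteq> fiber B x \<and>
        real_linear_on (fiber B x) (bJ B x) \<and> (\<forall>u\<in>fiber B x. bJ B x (bJ B x u) = - u)) \<and>
     (\<Union>(V, e)\<in>frames B. V) = UNIV \<and>
     (\<forall>(V, e)\<in>frames B. open V \<and> (\<forall>x\<in>V. bij_betw (comb B e x) UNIV (fiber B x))) \<and>
     (\<forall>(V, e)\<in>frames B. \<forall>(V', e')\<in>frames B. \<forall>i j.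
        holomorphic_fun (charts B) (V \<inter> V') (\<lambda>x. coord B e' x (e i x) $ j))"

abbreviation tang ::
  "('m, 'n::finite, 'v::real_vector, 'r::finite) hbundle \<Rightarrow> 'm \<Rightarrow> ('m, complex^'n) tvec set" where
  "tang B x \<equiv> tangent_space (charts B) UNIV x"

definition smooth_section ::
  "('m, 'n::finite, 'v::real_vector, 'r::finite) hbundle \<Rightarrow> 'm set \<Rightarrow> ('m \<Rightarrow> 'v) \<Rightarrow> bool" where
  "smooth_section B U s \<longleftrightarrow> (\<forall>x\<in>U. s x \<in> fiber B x) \<and>
     (\<forall>(V, e)\<in>frames B. smooth_fun (charts B) (U \<inter> V) (\<lambda>x. coord B e x (s x)))"

definition frame_at ::
  "('m, 'n::finite, 'v::real_vector, 'r::finite) hbundle \<Rightarrow> 'm \<Rightarrow> 'r \<Rightarrow> 'm \<Rightarrow> 'v" where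
  "frame_at B x = snd (SOME f. f \<in> frames B \<and> x \<in> fst f)"

text \<open>The operator \<open>dbar\<close> of the holomorphic bundle \<open>(E,J)\<close>; independent of the frame since the
  transition functions are holomorphic.\<close>

definition dbar_E ::
  "('m, 'n::finite, 'v::real_vector, 'r::finite) hbundle \<Rightarrow> ('m \<Rightarrow> 'v) \<Rightarrow> 'm \<Rightarrow>
   ('m, complex^'n) tvec \<Rightarrow> 'v" where
  "dbar_E B s x v = (let e = frame_at B x
     in comb B e x (dbar_vec (charts B) (\<lambda>y. coord B e y (s y)) x v))"

section \<open>Metrics and connections\<close>

definition compatible_metric ::
  "('m::topological_space, 'n::finite, 'v::real_vector, 'r::finite) hbundle \<Rightarrow>
   ('m \<Rightarrow> 'v \<Rightarrow> 'v \<Rightarrow> real) \<Rightarrow> bool" where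
  "compatible_metric B g \<longleftrightarrow>
     (\<forall>x. (\<forall>u\<in>fiber B x. real_linear_on (fiber B x) (g x u)) \<and>
        (\<forall>u\<in>fiber B x. \<forall>w\<in>fiber B x. g x u w = g x w u \<and>
            g x (bJ B x u) (bJ B x w) = g x u w) \<and>
        (\<forall>u\<in>fiber B x. u \<noteq> 0 \<longrightarrow> g x u u > 0)) \<and>
     (\<forall>U s t. open U \<and> smooth_section B U s \<and> smooth_section B U t \<longrightarrow>
        smooth_fun (charts B) U (\<lambda>x. g x (s x) (t x)))"

text \<open>Real connections on \<open>E\<close>, as operators on locally defined sections; \<open>nabla s x v\<close> is the covariant
  derivative of \<open>s\<close> at \<open>x\<close> in direction \<open>v\<close>.\<close>

definition is_connection ::
  "('m::topological_space, 'n::finite, 'v::real_vector, 'r::finite) hbundle \<Rightarrow>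
   (('m \<Rightarrow> 'v) \<Rightarrow> 'm \<Rightarrow> ('m, complex^'n) tvec \<Rightarrow> 'v) \<Rightarrow> bool" where
  "is_connection B nabla \<longleftrightarrow> (\<forall>U s. open U \<and> smooth_section B U s \<longrightarrow>
     (\<forall>c\<in>charts B. \<forall>a. smooth_section B (U \<inter> fst c)
        (\<lambda>x. nabla s x (coord_vec (charts B) c x a))) \<and>
     (\<forall>x\<in>U. \<forall>v\<in>tang B x. nabla s x v \<in> fiber B x \<and>
        (\<forall>w\<in>tang B x. nabla s x (v + w) = nabla s x v + nabla s x w) \<and>
        (\<forall>r. nabla s x (tscale r v) = r *\<^sub>R nabla s x v)) \<and>
     (\<forall>t. smooth_section B U t \<longrightarrow> (\<forall>x\<in>U. \<forall>v\<in>tang B x.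
        nabla (\<lambda>y. s y + t y) x v = nabla s x v + nabla t x v)) \<and>
     (\<forall>f. smooth_fun (charts B) U f \<longrightarrow> (\<forall>x\<in>U. \<forall>v\<in>tang B x.
        nabla (\<lambda>y. f y *\<^sub>R s y) x v = dfun (charts B) f x v *\<^sub>R s x + f x *\<^sub>R nabla s x v)) \<and>
     (\<forall>t. (\<forall>x\<in>U. s x = t x) \<longrightarrow> (\<forall>x\<in>U. \<forall>v\<in>tang B x. nabla s x v = nabla t x v)))"

text \<open>The last condition says that the (0,1)-part \<open>(nabla v + J nabla (I v)) / 2\<close> equals \<open>dbar\<close>.\<close>

definition chern_connection ::
  "('m::topological_space, 'n::finite, 'v::real_vector, 'r::finite) hbundle \<Rightarrow>
   ('m \<Rightarrow> 'v \<Rightarrow> 'v \<Rightarrow> real) \<Rightarrow>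
   (('m \<Rightarrow> 'v) \<Rightarrow> 'm \<Rightarrow> ('m, complex^'n) tvec \<Rightarrow> 'v) \<Rightarrow> bool" where
  "chern_connection B g nabla \<longleftrightarrow> is_connection B nabla \<and>
     (\<forall>U s t. open U \<and> smooth_section B U s \<and> smooth_section B U t \<longrightarrow>
        (\<forall>x\<in>U. \<forall>v\<in>tang B x. dfun (charts B) (\<lambda>y. g y (s y) (t y)) x v =
            g x (nabla s x v) (t x) + g x (s x) (nabla t x v))) \<and>
     (\<forall>U s. open U \<and> smooth_section B U s \<longrightarrow> (\<forall>x\<in>U. \<forall>v\<in>tang B x.
        nabla (\<lambda>y. bJ B y (s y)) x v = bJ B x (nabla s x v) \<and>
        (1/2) *\<^sub>R (nabla s x v + bJ B x (nabla s x (cplx_I v))) = dbar_E B s x v))"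

section \<open>The complexification and the bundle \<open>W = E\<^sup>1\<^sup>,\<^sup>0 \<oplus> E\<^sup>*\<^sup>1\<^sup>,\<^sup>0\<close>\<close>

text \<open>The pair \<open>(u, w)\<close> stands for \<open>u + i w\<close> in the complexification.\<close>

type_synonym 'v cplxf = "'v \<times> 'v"

definition cscale :: "complex \<Rightarrow> 'v::real_vector cplxf \<Rightarrow> 'v cplxf" where
  "cscale c z = (Re c *\<^sub>R fst z - Im c *\<^sub>R snd z, Re c *\<^sub>R snd z + Im c *\<^sub>R fst z)"

definition cconj :: "'v::real_vector cplxf \<Rightarrow> 'v cplxf" where
  "cconj z = (fst z, - snd z)"

definition EC :: "('m, 'n::finite, 'v::real_vector, 'r::finite) hbundle \<Rightarrow> 'm \<Rightarrow> 'v cplxf set" where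
  "EC B x = fiber B x \<times> fiber B x"

definition JC ::
  "('m, 'n::finite, 'v::real_vector, 'r::finite) hbundle \<Rightarrow> 'm \<Rightarrow> 'v cplxf \<Rightarrow> 'v cplxf" where
  "JC B x z = (bJ B x (fst z), bJ B x (snd z))"

definition gC ::
  "('m \<Rightarrow> 'v \<Rightarrow> 'v \<Rightarrow> real) \<Rightarrow> 'm \<Rightarrow> 'v cplxf \<Rightarrow> 'v cplxf \<Rightarrow> complex" where
  "gC g x z w = Complex (g x (fst z) (fst w) - g x (snd z) (snd w))
                        (g x (fst z) (snd w) + g x (snd z) (fst w))"

definition E10 :: "('m, 'n::finite, 'v::real_vector, 'r::finite) hbundle \<Rightarrow> 'm \<Rightarrow> 'v cplxf set" where
  "E10 B x = {z \<in> EC B x. JC B x z = cscale \<i> z}"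

definition E01 :: "('m, 'n::finite, 'v::real_vector, 'r::finite) hbundle \<Rightarrow> 'm \<Rightarrow> 'v cplxf set" where
  "E01 B x = {z \<in> EC B x. JC B x z = cscale (-\<i>) z}"

definition pr10 ::
  "('m, 'n::finite, 'v::real_vector, 'r::finite) hbundle \<Rightarrow> 'm \<Rightarrow> 'v cplxf \<Rightarrow> 'v cplxf" where
  "pr10 B x z = cscale (1/2) (z - cscale \<i> (JC B x z))"

definition pr01 ::
  "('m, 'n::finite, 'v::real_vector, 'r::finite) hbundle \<Rightarrow> 'm \<Rightarrow> 'v cplxf \<Rightarrow> 'v cplxf" where
  "pr01 B x z = cscale (1/2) (z + cscale \<i> (JC B x z))"

text \<open>Linear functionals on \<open>E\<^sup>1\<^sup>,\<^sup>0\<close>, made extensional by the value 0 outside.\<close>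

definition E10dual ::
  "('m, 'n::finite, 'v::real_vector, 'r::finite) hbundle \<Rightarrow> 'm \<Rightarrow> ('v cplxf \<Rightarrow> complex) set" where
  "E10dual B x = {\<mu>. (\<forall>z\<in>E10 B x. \<forall>w\<in>E10 B x. \<mu> (z + w) = \<mu> z + \<mu> w) \<and>
     (\<forall>c. \<forall>z\<in>E10 B x. \<mu> (cscale c z) = c * \<mu> z) \<and> (\<forall>z. z \<notin> E10 B x \<longrightarrow> \<mu> z = 0)}"

type_synonym 'v wvec = "'v cplxf \<times> ('v cplxf \<Rightarrow> complex)"

definition W_fiber :: "('m, 'n::finite, 'v::real_vector, 'r::finite) hbundle \<Rightarrow> 'm \<Rightarrow> 'v wvec set" where
  "W_fiber B x = E10 B x \<times> E10dual B x"

definition wscale :: "complex \<Rightarrow> 'v::real_vector wvec \<Rightarrow> 'v wvec" where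
  "wscale c w = (cscale c (fst w), \<lambda>z. c * snd w z)"

definition wpair :: "'v wvec \<Rightarrow> 'v wvec \<Rightarrow> complex" where
  "wpair w w' = (snd w (fst w') + snd w' (fst w)) / 2"

text \<open>A frame \<open>e\<close> of \<open>(E,J)\<close> gives the frame \<open>(e\<^sub>j - i J e\<^sub>j) / 2\<close> of \<open>E\<^sup>1\<^sup>,\<^sup>0\<close> and the dual frame of
  its dual, and \<open>W_comb\<close>, \<open>W_coord\<close> refer to these.\<close>

definition comb10 ::
  "('m, 'n::finite, 'v::real_vector, 'r::finite) hbundle \<Rightarrow> ('r \<Rightarrow> 'm \<Rightarrow> 'v) \<Rightarrow> 'm \<Rightarrow>
   complex^'r \<Rightarrow> 'v cplxf" where
  "comb10 B e x a = (\<Sum>i\<in>UNIV. cscale (a $ i) (pr10 B x (e i x, 0)))"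

definition W_comb ::
  "('m, 'n::finite, 'v::real_vector, 'r::finite) hbundle \<Rightarrow> ('r \<Rightarrow> 'm \<Rightarrow> 'v) \<Rightarrow> 'm \<Rightarrow>
   (complex^'r) \<times> (complex^'r) \<Rightarrow> 'v wvec" where
  "W_comb B e x p = (comb10 B e x (fst p),
     \<lambda>z. if z \<in> E10 B x then (\<Sum>i\<in>UNIV. snd p $ i * inv (comb10 B e x) z $ i) else 0)"

definition W_coord ::
  "('m, 'n::finite, 'v::real_vector, 'r::finite) hbundle \<Rightarrow> ('r \<Rightarrow> 'm \<Rightarrow> 'v) \<Rightarrow> 'm \<Rightarrow>
   'v wvec \<Rightarrow> (complex^'r) \<times> (complex^'r)" where
  "W_coord B e x = inv (W_comb B e x)"

definition smooth_W_section ::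
  "('m, 'n::finite, 'v::real_vector, 'r::finite) hbundle \<Rightarrow> 'm set \<Rightarrow> ('m \<Rightarrow> 'v wvec) \<Rightarrow> bool"
  where
  "smooth_W_section B U s \<longleftrightarrow> (\<forall>x\<in>U. s x \<in> W_fiber B x) \<and>
     (\<forall>(V, e)\<in>frames B. smooth_fun (charts B) (U \<inter> V) (\<lambda>x. W_coord B e x (s x)))"

definition dbar_W ::
  "('m, 'n::finite, 'v::real_vector, 'r::finite) hbundle \<Rightarrow> ('m \<Rightarrow> 'v wvec) \<Rightarrow> 'm \<Rightarrow>
   ('m, complex^'n) tvec \<Rightarrow> 'v wvec" where
  "dbar_W B s x v = (let e = frame_at B x in W_comb B e x
     (dbar_vec (charts B) (\<lambda>y. fst (W_coord B e y (s y))) x v,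
      dbar_vec (charts B) (\<lambda>y. snd (W_coord B e y (s y))) x v))"

text \<open>Operators \<open>D\<close> from sections of \<open>W\<close> to \<open>W\<close>-valued (0,1)-forms with \<open>D (f s) = (dbar f) s + f D s\<close>
  and \<open>D \<circ> D = 0\<close>, where \<open>D\<close> is extended to (0,1)-forms as usual. The last condition is
  \<open>(D (D s)) (\<partial>\<^sub>a, \<partial>\<^sub>b) = D\<^sub>a (D\<^sub>b s) - D\<^sub>b (D\<^sub>a s) = 0\<close> for coordinate vector fields with constant
  components \<open>a\<close>, \<open>b\<close>; there is no bracket term, because the (0,1)-parts of these commute.\<close>

definition dbar_operator_W ::
  "('m::topological_space, 'n::finite, 'v::real_vector, 'r::finite) hbundle \<Rightarrow>
   (('m \<Rightarrow> 'v wvec) \<Rightarrow> 'm \<Rightarrow> ('m, complex^'n) tvec \<Rightarrow> 'v wvec) \<Rightarrow> bool" where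
  "dbar_operator_W B D \<longleftrightarrow> (\<forall>U s. open U \<and> smooth_W_section B U s \<longrightarrow>
     (\<forall>c\<in>charts B. \<forall>a. smooth_W_section B (U \<inter> fst c)
        (\<lambda>x. D s x (coord_vec (charts B) c x a))) \<and>
     (\<forall>x\<in>U. \<forall>v\<in>tang B x. D s x v \<in> W_fiber B x \<and>
        (\<forall>w\<in>tang B x. D s x (v + w) = D s x v + D s x w) \<and>
        (\<forall>r. D s x (tscale r v) = wscale (of_real r) (D s x v)) \<and>
        D s x (cplx_I v) = wscale (-\<i>) (D s x v)) \<and>
     (\<forall>t. smooth_W_section B U t \<longrightarrow> (\<forall>x\<in>U. \<forall>v\<in>tang B x.
        D (\<lambda>y. s y + t y) x v = D s x v + D t x v)) \<and>
     (\<forall>f. smooth_fun (charts B) U f \<longrightarrow> (\<forall>x\<in>U. \<forall>v\<in>tang B x.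
        D (\<lambda>y. wscale (f y) (s y)) x v =
          wscale (dbar_fun (charts B) f x v) (s x) + wscale (f x) (D s x v))) \<and>
     (\<forall>t. (\<forall>x\<in>U. s x = t x) \<longrightarrow> (\<forall>x\<in>U. \<forall>v\<in>tang B x. D s x v = D t x v)) \<and>
     (\<forall>c\<in>charts B. \<forall>a b. \<forall>x\<in>U \<inter> fst c.
        D (\<lambda>y. D s y (coord_vec (charts B) c y b)) x (coord_vec (charts B) c x a) =
        D (\<lambda>y. D s y (coord_vec (charts B) c y a)) x (coord_vec (charts B) c x b)))"

text \<open>Smooth sections of \<open>T\<^sup>*\<^sup>0\<^sup>,\<^sup>1 \<otimes> so(W)\<close>.\<close>

definition so_form01 ::
  "('m::topological_space, 'n::finite, 'v::real_vector, 'r::finite) hbundle \<Rightarrow>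
   ('m \<Rightarrow> ('m, complex^'n) tvec \<Rightarrow> 'v wvec \<Rightarrow> 'v wvec) \<Rightarrow> bool" where
  "so_form01 B D' \<longleftrightarrow>
     (\<forall>x. \<forall>v\<in>tang B x. \<forall>w\<in>W_fiber B x. D' x v w \<in> W_fiber B x \<and>
        (\<forall>w'\<in>W_fiber B x. D' x v (w + w') = D' x v w + D' x v w' \<and>
            wpair (D' x v w) w' + wpair w (D' x v w') = 0) \<and>
        (\<forall>c. D' x v (wscale c w) = wscale c (D' x v w)) \<and>
        (\<forall>v'\<in>tang B x. D' x (v + v') w = D' x v w + D' x v' w) \<and>
        (\<forall>r. D' x (tscale r v) w = wscale (of_real r) (D' x v w)) \<and>
        D' x (cplx_I v) w = wscale (-\<i>) (D' x v w)) \<and>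
     (\<forall>U s. open U \<and> smooth_W_section B U s \<longrightarrow>
        (\<forall>c\<in>charts B. \<forall>a. smooth_W_section B (U \<inter> fst c)
           (\<lambda>x. D' x (coord_vec (charts B) c x a) (s x))))"

text \<open>The isomorphism \<open>1 \<oplus> g\<close> from \<open>E\<^sup>1\<^sup>,\<^sup>0 \<oplus> E\<^sup>0\<^sup>,\<^sup>1\<close> to \<open>W\<close>.\<close>

definition g_iso ::
  "('m, 'n::finite, 'v::real_vector, 'r::finite) hbundle \<Rightarrow> ('m \<Rightarrow> 'v \<Rightarrow> 'v \<Rightarrow> real) \<Rightarrow> 'm \<Rightarrow>
   'v cplxf \<Rightarrow> 'v cplxf \<Rightarrow> complex" where
  "g_iso B g x \<xi> = (\<lambda>z. if z \<in> E10 B x then gC g x \<xi> z else 0)"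

definition one_plus_g ::
  "('m, 'n::finite, 'v::real_vector, 'r::finite) hbundle \<Rightarrow> ('m \<Rightarrow> 'v \<Rightarrow> 'v \<Rightarrow> real) \<Rightarrow> 'm \<Rightarrow>
   'v cplxf \<Rightarrow> 'v wvec" where
  "one_plus_g B g x z = (pr10 B x z, g_iso B g x (pr01 B x z))"

definition Dg01 ::
  "('m, 'n::finite, 'v::real_vector, 'r::finite) hbundle \<Rightarrow> ('m \<Rightarrow> 'v \<Rightarrow> 'v \<Rightarrow> real) \<Rightarrow>
   ('m \<Rightarrow> ('m, complex^'n) tvec \<Rightarrow> 'v wvec \<Rightarrow> 'v wvec) \<Rightarrow>
   'm \<Rightarrow> ('m, complex^'n) tvec \<Rightarrow> 'v cplxf \<Rightarrow> 'v cplxf" where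
  "Dg01 B g D' x v z = inv_into (EC B x) (one_plus_g B g x) (D' x v (one_plus_g B g x z))"

definition DgC ::
  "('m, 'n::finite, 'v::real_vector, 'r::finite) hbundle \<Rightarrow> ('m \<Rightarrow> 'v \<Rightarrow> 'v \<Rightarrow> real) \<Rightarrow>
   ('m \<Rightarrow> ('m, complex^'n) tvec \<Rightarrow> 'v wvec \<Rightarrow> 'v wvec) \<Rightarrow>
   'm \<Rightarrow> ('m, complex^'n) tvec \<Rightarrow> 'v cplxf \<Rightarrow> 'v cplxf" where
  "DgC B g D' x v z = Dg01 B g D' x v z + cconj (Dg01 B g D' x v (cconj z))"

text \<open>\<open>DgC\<close> commutes with conjugation, so on a real vector \<open>(u, 0)\<close> its value has the form \<open>(w, 0)\<close>.\<close>

definition Dg ::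
  "('m, 'n::finite, 'v::real_vector, 'r::finite) hbundle \<Rightarrow> ('m \<Rightarrow> 'v \<Rightarrow> 'v \<Rightarrow> real) \<Rightarrow>
   ('m \<Rightarrow> ('m, complex^'n) tvec \<Rightarrow> 'v wvec \<Rightarrow> 'v wvec) \<Rightarrow>
   'm \<Rightarrow> ('m, complex^'n) tvec \<Rightarrow> 'v \<Rightarrow> 'v" where
  "Dg B g D' x v u = fst (DgC B g D' x v (u, 0))"

section \<open>The twistor space and its almost complex structure\<close>

text \<open>Endomorphisms of a fiber are made extensional by the value 0 outside.\<close>

definition End_fiber ::
  "('m, 'n::finite, 'v::real_vector, 'r::finite) hbundle \<Rightarrow> 'm \<Rightarrow> ('v \<Rightarrow> 'v) set" where
  "End_fiber B x = {K. real_linear_on (fiber B x) K \<and> K ` fiber B x \<subseteq> fiber B x \<and>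
     (\<forall>u. u \<notin> fiber B x \<longrightarrow> K u = 0)}"

text \<open>The atlas of the total space of the real bundle \<open>End E\<close>: a chart of the base and a frame give
  coordinates of \<open>(x, K)\<close>, namely those of \<open>x\<close> and the matrix of \<open>K\<close>, as a real-linear map.\<close>

type_synonym ('n, 'r) End_model = "(complex^'n) \<times> ((complex^'r) \<Rightarrow>\<^sub>L (complex^'r))"

definition End_charts ::
  "('m, 'n::finite, 'v::real_vector, 'r::finite) hbundle \<Rightarrow>
   ('m \<times> ('v \<Rightarrow> 'v), ('n, 'r) End_model) chart set" where
  "End_charts B = {({(x, K). x \<in> fst c \<inter> V \<and> K \<in> End_fiber B x},
       \<lambda>(x, K). (snd c x, Blinfun (\<lambda>a. coord B e x (K (comb B e x a))))) | c V e.
     c \<in> charts B \<and> (V, e) \<in> frames B}"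

definition twistor_space ::
  "('m, 'n::finite, 'v::real_vector, 'r::finite) hbundle \<Rightarrow> ('m \<Rightarrow> 'v \<Rightarrow> 'v \<Rightarrow> real) \<Rightarrow>
   ('m \<times> ('v \<Rightarrow> 'v)) set" where
  "twistor_space B g = {(x, K). K \<in> End_fiber B x \<and> (\<forall>u\<in>fiber B x. K (K u) = - u) \<and>
     (\<forall>u\<in>fiber B x. \<forall>w\<in>fiber B x. g x (K u) (K w) = g x u w)}"

definition vertical_space ::
  "('m, 'n::finite, 'v::real_vector, 'r::finite) hbundle \<Rightarrow> ('m \<Rightarrow> 'v \<Rightarrow> 'v \<Rightarrow> real) \<Rightarrow>
   'm \<times> ('v \<Rightarrow> 'v) \<Rightarrow> ('v \<Rightarrow> 'v) set" where
  "vertical_space B g p = {A \<in> End_fiber B (fst p).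
     (\<forall>u\<in>fiber B (fst p). \<forall>w\<in>fiber B (fst p). g (fst p) (A u) w + g (fst p) u (A w) = 0) \<and>
     (\<forall>u\<in>fiber B (fst p). A (snd p u) + snd p (A u) = 0)}"

text \<open>\<open>A\<close> regarded as a vector tangent to the fiber of \<open>End E\<close>.\<close>

definition vert ::
  "('m, 'n::finite, 'v::real_vector, 'r::finite) hbundle \<Rightarrow> 'm \<times> ('v \<Rightarrow> 'v) \<Rightarrow> ('v \<Rightarrow> 'v) \<Rightarrow>
   ('m \<times> ('v \<Rightarrow> 'v), ('n, 'r) End_model) tvec" where
  "vert B p A = velocity (End_charts B) (\<lambda>t. (fst p, \<lambda>u. snd p u + t *\<^sub>R A u)) 0"

definition smooth_section_along ::
  "('m, 'n::finite, 'v::real_vector, 'r::finite) hbundle \<Rightarrow> real set \<Rightarrow> (real \<Rightarrow> 'm) \<Rightarrow>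
   (real \<Rightarrow> 'v) \<Rightarrow> bool" where
  "smooth_section_along B T \<gamma> \<sigma> \<longleftrightarrow> (\<forall>t\<in>T. \<sigma> t \<in> fiber B (\<gamma> t)) \<and>
     (\<forall>(V, e)\<in>frames B. smooth_on {t\<in>T. \<gamma> t \<in> V} (\<lambda>t. coord B e (\<gamma> t) (\<sigma> t)))"

text \<open>The covariant derivative \<open>D\<sigma>/dt\<close> of a section along a curve. If \<open>\<sigma> = \<Sum> a\<^sub>j(t) e\<^sub>j(\<gamma>(t))\<close> it is
  \<open>\<Sum> a\<^sub>j' e\<^sub>j + nabla (\<Sum> a\<^sub>j e\<^sub>j) (\<gamma>')\<close>, the \<open>a\<^sub>j\<close> in the second term being frozen at time \<open>t\<close>; they
  are complex, and the connection need not be complex linear.\<close>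

definition cov_deriv_along ::
  "('m, 'n::finite, 'v::real_vector, 'r::finite) hbundle \<Rightarrow>
   (('m \<Rightarrow> 'v) \<Rightarrow> 'm \<Rightarrow> ('m, complex^'n) tvec \<Rightarrow> 'v) \<Rightarrow>
   (real \<Rightarrow> 'm) \<Rightarrow> (real \<Rightarrow> 'v) \<Rightarrow> real \<Rightarrow> 'v" where
  "cov_deriv_along B nabla \<gamma> \<sigma> t = (let e = frame_at B (\<gamma> t); a = (\<lambda>\<tau>. coord B e (\<gamma> \<tau>) (\<sigma> \<tau>))
     in comb B e (\<gamma> t) (vector_derivative a (at t)) +
        nabla (\<lambda>y. comb B e y (a t)) (\<gamma> t) (velocity (charts B) \<gamma> t))"

text \<open>\<open>\<kappa>\<close> is a parallel section of \<open>End E\<close> along \<open>\<gamma>\<close>, for the induced connection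
  \<open>(D\<kappa>/dt) \<sigma> = D(\<kappa> \<sigma>)/dt - \<kappa> (D\<sigma>/dt)\<close>.\<close>

definition parallel_End_along ::
  "('m, 'n::finite, 'v::real_vector, 'r::finite) hbundle \<Rightarrow>
   (('m \<Rightarrow> 'v) \<Rightarrow> 'm \<Rightarrow> ('m, complex^'n) tvec \<Rightarrow> 'v) \<Rightarrow>
   real set \<Rightarrow> (real \<Rightarrow> 'm) \<Rightarrow> (real \<Rightarrow> 'v \<Rightarrow> 'v) \<Rightarrow> bool" where
  "parallel_End_along B nabla T \<gamma> \<kappa> \<longleftrightarrow>
     smooth_curve (charts B) T \<gamma> \<and> smooth_curve (End_charts B) T (\<lambda>t. (\<gamma> t, \<kappa> t)) \<and>
     (\<forall>\<sigma>. smooth_section_along B T \<gamma> \<sigma> \<longrightarrow> (\<forall>t\<in>T.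
        cov_deriv_along B nabla \<gamma> (\<lambda>\<tau>. \<kappa> \<tau> (\<sigma> \<tau>)) t = \<kappa> t (cov_deriv_along B nabla \<gamma> \<sigma> t)))"

definition horizontal_lift ::
  "('m, 'n::finite, 'v::real_vector, 'r::finite) hbundle \<Rightarrow>
   (('m \<Rightarrow> 'v) \<Rightarrow> 'm \<Rightarrow> ('m, complex^'n) tvec \<Rightarrow> 'v) \<Rightarrow>
   'm \<times> ('v \<Rightarrow> 'v) \<Rightarrow> ('m, complex^'n) tvec \<Rightarrow>
   ('m \<times> ('v \<Rightarrow> 'v), ('n, 'r) End_model) tvec" where
  "horizontal_lift B nabla p v = (THE h. \<exists>\<epsilon>>0. \<exists>\<gamma> \<kappa>.
     parallel_End_along B nabla {-\<epsilon><..<\<epsilon>} \<gamma> \<kappa> \<and> (\<gamma> 0, \<kappa> 0) = p \<and>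
     velocity (charts B) \<gamma> 0 = v \<and> h = velocity (End_charts B) (\<lambda>t. (\<gamma> t, \<kappa> t)) 0)"

definition twistor_acs ::
  "('m, 'n::finite, 'v::real_vector, 'r::finite) hbundle \<Rightarrow> ('m \<Rightarrow> 'v \<Rightarrow> 'v \<Rightarrow> real) \<Rightarrow>
   (('m \<Rightarrow> 'v) \<Rightarrow> 'm \<Rightarrow> ('m, complex^'n) tvec \<Rightarrow> 'v) \<Rightarrow> 'm \<times> ('v \<Rightarrow> 'v) \<Rightarrow>
   ('m \<times> ('v \<Rightarrow> 'v), ('n, 'r) End_model) tvec \<Rightarrow>
   ('m \<times> ('v \<Rightarrow> 'v), ('n, 'r) End_model) tvec" where
  "twistor_acs B g nabla p \<xi> = (THE \<eta>. \<exists>A\<in>vertical_space B g p. \<exists>v\<in>tang B (fst p).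
     \<xi> = vert B p A + horizontal_lift B nabla p v \<and>
     \<eta> = vert B p (snd p \<circ> A) + horizontal_lift B nabla p (cplx_I v))"

end

theory Submission
  imports Defs "HOL-Complex_Analysis.Complex_Analysis"
begin

text \<open>The twistor space consists of the orthogonal complex structures \<open>K\<close> of the fibers. Such a \<open>K\<close> is the same as
  its \<open>-i\<close>-eigenspace \<open>{u + i K u}\<close>, a maximal isotropic subspace of \<open>E\<^sub>\<complex>\<close>. The isomorphism \<open>1 \<oplus> g\<close> carries it to a
  maximal isotropic subspace of \<open>W = E\<^sup>1\<^sup>,\<^sup>0 \<oplus> E\<^sup>*\<^sup>1\<^sup>,\<^sup>0\<close>, a bundle that does not depend on the metric. The
  biholomorphism matches \<open>K\<close> with the \<open>K'\<close>, orthogonal for \<open>g'\<close>, that has the same subspace of \<open>W\<close>.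

  Put \<open>\<Phi> = (1 \<oplus> g')\<^sup>-\<^sup>1 (1 \<oplus> g)\<close>. It is the identity on \<open>E\<^sup>1\<^sup>,\<^sup>0\<close> and \<open>h\<close> on \<open>E\<^sup>0\<^sup>,\<^sup>1\<close>, where \<open>g = g'(h -, -)\<close>. One has
  \<open>\<Phi> (u + i K u) = P u + i K' (P u)\<close> with the real operator \<open>P = ((1 + J K) + h (1 - J K)) / 2\<close>, and
  \<open>K' = P K P\<^sup>-\<^sup>1\<close>. Invertibility of \<open>P\<close> follows from the definiteness of the metrics
  (\<open>transport_op_invertible\<close>), orthogonality of \<open>K'\<close> from isotropy (\<open>transport_cs_ortho\<close>). Exchanging \<open>g\<close> and
  \<open>g'\<close> inverts the construction, so it is a bijection (\<open>Fmap_bij\<close>), and it is smooth in both directions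
  because \<open>h\<close> is smooth (\<open>Fmap_smooth\<close>).

  The almost complex structure of the twistor space depends only on the \<open>(0,1)\<close>-part of the connection: a
  tangent vector and its image under the structure are related by the condition that the
  \<open>(0,1)\<close>-derivative preserves sections of the eigenspace bundle (\<open>acs_comp_iff\<close>, \<open>twistor_acs_eq\<close>). For
  \<open>\<nabla>\<^sup>C\<^sup>h + \<D>\<^sub>g\<close> the \<open>(0,1)\<close>-part corresponds under \<open>1 \<oplus> g\<close> to the Dolbeault operator of \<open>W\<close> plus \<open>D'\<close>, and the same
  holds for \<open>g'\<close>; hence \<open>\<Phi>\<close> intertwines the \<open>(0,1)\<close>-parts for the two metrics. In a holomorphic frame this
  splits into a relation between the two Chern forms and the derivative of \<open>h\<close> (\<open>chern_ratio\<close>) and an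
  algebraic relation between \<open>\<D>\<^sub>g\<close> and \<open>\<D>\<^sub>g'\<close> (\<open>Dg_intertwine\<close>). As \<open>\<Phi>\<close> carries eigenspaces to eigenspaces, the
  characterization of the almost complex structure for \<open>g\<close> becomes that for \<open>g'\<close>
  (\<open>acs_comp_transport\<close>, \<open>Fmap_holomorphic\<close>).

  The analytic part makes these formulas available in charts. Holomorphic transition functions are
  smooth by Cauchy's formula on complex lines. Linear differential equations give parallel transport,
  hence horizontal lifts and, combined with Cayley transforms in the fiber, curves in the twistor space
  with any given vertical and horizontal velocity. Bump functions show that a parallel curve of
  endomorphisms has vanishing covariant derivative in every frame.\<close>

section \<open>Calculus of functions with continuous iterated directional derivatives\<close>

lemma frechet_derivative_cong_open:
  assumes "open S" "x \<in> S" "\<And>y. y \<in> S \<Longrightarrow> f y = g y"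
  shows "frechet_derivative f (at x) = frechet_derivative g (at x)"
proof -
  have "(f has_derivative D) (at x) \<longleftrightarrow> (g has_derivative D) (at x)" for D
    using assms has_derivative_transform_within_open[of f D x UNIV S g]
      has_derivative_transform_within_open[of g D x UNIV S f] by auto
  then show ?thesis
    unfolding frechet_derivative_def by simp
qed

lemma Ck_on_cong:
  assumes "open S" "\<And>x. x \<in> S \<Longrightarrow> f x = g x" "Ck_on k S f"
  shows "Ck_on k S g"
  using assms
proof (induction k arbitrary: f g)
  case 0
  then show ?case by (simp cong: continuous_on_cong)
next
  case (Suc k)
  have "g differentiable at x" if "x \<in> S" for x
    using Suc.prems that has_derivative_transform_within_open[of f _ x UNIV S g]
    by (auto simp: differentiable_def) blast
  moreover have "Ck_on k S (\<lambda>x. frechet_derivative g (at x) v)" for v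
    by (rule Suc.IH[of "\<lambda>x. frechet_derivative f (at x) v"])
       (use Suc.prems frechet_derivative_cong_open[of S _ f g] in auto)
  ultimately show ?case by simp
qed

lemma Ck_on_subset: "Ck_on k S f \<Longrightarrow> T \<subseteq> S \<Longrightarrow> Ck_on k T f"
  by (induction k arbitrary: f) (auto intro: continuous_on_subset)

lemma Ck_on_SucI:
  assumes "open S" "\<And>x. x \<in> S \<Longrightarrow> (f has_derivative f' x) (at x)"
    "\<And>v. Ck_on k S (\<lambda>x. f' x v)"
  shows "Ck_on (Suc k) S f"
proof -
  have "frechet_derivative f (at x) = f' x" if "x \<in> S" for x
    using assms(2)[OF that] by (metis frechet_derivative_at)
  then have "Ck_on k S (\<lambda>x. frechet_derivative f (at x) v)" for v
    by (intro Ck_on_cong[OF assms(1) _ assms(3)[of v]]) auto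
  then show ?thesis
    using assms(2) by (auto simp: differentiable_def)
qed

lemmas frechet_derivative_worksI = frechet_derivative_works[THEN iffD1]

lemma Ck_on_Suc_deriv:
  "Ck_on (Suc k) S f \<Longrightarrow> x \<in> S \<Longrightarrow> (f has_derivative frechet_derivative f (at x)) (at x)"
  by (simp add: frechet_derivative_works[symmetric])

lemma Ck_on_SucD: "Ck_on (Suc k) S f \<Longrightarrow> Ck_on k S f"
proof (induction k arbitrary: f)
  case 0
  then show ?case
    by (auto intro!: continuous_at_imp_continuous_on differentiable_imp_continuous_within)
next
  case (Suc k)
  then show ?case by (metis Ck_on.simps(2))
qed

lemma Ck_on_const: "open S \<Longrightarrow> Ck_on k S (\<lambda>x. c)"
proof (induction k arbitrary: c)
  case (Suc k)
  show ?case
    by (rule Ck_on_SucI[where f'="\<lambda>x v. 0"]) (use Suc in \<open>auto intro: has_derivative_const\<close>)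
qed simp

lemma Ck_on_linear:
  assumes "open S" "bounded_linear L"
  shows "Ck_on k S L"
proof (cases k)
  case 0
  then show ?thesis using assms linear_continuous_on by auto
next
  case (Suc j)
  show ?thesis unfolding Suc
    by (rule Ck_on_SucI[where f'="\<lambda>x. L"])
       (use assms in \<open>auto intro: bounded_linear_imp_has_derivative Ck_on_const\<close>)
qed

lemma Ck_on_add:
  assumes "open S"
  shows "Ck_on k S p \<Longrightarrow> Ck_on k S q \<Longrightarrow> Ck_on k S (\<lambda>x. p x + q x)"
proof (induction k arbitrary: p q)
  case 0
  then show ?case by (auto intro: continuous_on_add)
next
  case (Suc k)
  show ?case
  proof (rule Ck_on_SucI[OF \<open>open S\<close>])
    show "((\<lambda>x. p x + q x) has_derivative
        (\<lambda>v. frechet_derivative p (at x) v + frechet_derivative q (at x) v)) (at x)"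
      if "x \<in> S" for x
      by (intro has_derivative_add Ck_on_Suc_deriv[OF Suc.prems(1) that]
          Ck_on_Suc_deriv[OF Suc.prems(2) that])
    show "Ck_on k S (\<lambda>x. frechet_derivative p (at x) v + frechet_derivative q (at x) v)" for v
      using Suc by simp
  qed
qed

lemma Ck_on_bilinear:
  assumes bl: "bounded_bilinear b" and "open S"
  shows "Ck_on k S f \<Longrightarrow> Ck_on k S g \<Longrightarrow> Ck_on k S (\<lambda>x. b (f x) (g x))"
proof (induction k arbitrary: f g)
  case 0
  then show ?case by (auto intro: bounded_bilinear.continuous_on[OF bl])
next
  case (Suc k)
  have "Ck_on k S f" "Ck_on k S g" using Suc.prems Ck_on_SucD by blast+
  then have "Ck_on k S (\<lambda>x. b (f x) (frechet_derivative g (at x) v) +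
      b (frechet_derivative f (at x) v) (g x))" for v
    using Suc.IH Suc.prems by (intro Ck_on_add[OF \<open>open S\<close>]) auto
  then show ?case
    by (intro Ck_on_SucI[OF \<open>open S\<close> bounded_bilinear.FDERIV[OF bl]])
       (use Suc.prems Ck_on_Suc_deriv in blast)+
qed

lemma Ck_on_compose_linear:
  assumes "bounded_linear L" "open S"
  shows "Ck_on k S f \<Longrightarrow> Ck_on k S (\<lambda>x. L (f x))"
proof (induction k arbitrary: f)
  case 0
  then show ?case using assms by (auto intro: bounded_linear.continuous_on)
next
  case (Suc k)
  show ?case
    by (rule Ck_on_SucI[where f'="\<lambda>x v. L (frechet_derivative f (at x) v)"])
       (use Suc assms in \<open>auto intro: bounded_linear.has_derivative frechet_derivative_worksI\<close>)
qed

text \<open>The chain rule for directional derivatives writes the derivative of the inner function as a finite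
  combination of fixed directions. This predicate asks for exactly that, so that it covers Euclidean
  spaces and, with the topology of the operator norm, spaces of linear maps between them alike.\<close>

definition fin_dim :: "'a::real_normed_vector itself \<Rightarrow> bool" where
  "fin_dim _ \<longleftrightarrow> (\<exists>(n::nat) \<phi> b. (\<forall>k<n. bounded_linear (\<phi> k)) \<and>
     (\<forall>y::'a. y = (\<Sum>k<n. \<phi> k y *\<^sub>R b k)))"

lemma fin_dimI:
  fixes b :: "'i \<Rightarrow> 'a::real_normed_vector"
  assumes "finite I" "\<And>i. i \<in> I \<Longrightarrow> bounded_linear (\<phi> i)"
    "\<And>y. y = (\<Sum>i\<in>I. \<phi> i y *\<^sub>R b i)"
  shows "fin_dim TYPE('a)"
proof -
  obtain h where h: "bij_betw h {0..<card I} I"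
    using ex_bij_betw_nat_finite[OF assms(1)] by auto
  have "y = (\<Sum>k<card I. \<phi> (h k) y *\<^sub>R b (h k))" for y
    using sum.reindex_bij_betw[OF h, of "\<lambda>i. \<phi> i y *\<^sub>R b i"] assms(3)[of y]
    by (simp add: atLeast0LessThan)
  moreover have "\<forall>k<card I. bounded_linear (\<phi> (h k))"
    using assms(2) bij_betwE[OF h] by simp
  ultimately show ?thesis unfolding fin_dim_def
    by (intro exI[of _ "card I"] exI[of _ "\<lambda>k. \<phi> (h k)"] exI[of _ "\<lambda>k. b (h k)"]) auto
qed

lemma fin_dim_euclidean: "fin_dim TYPE('a::euclidean_space)"
  by (rule fin_dimI[where I=Basis and \<phi>="\<lambda>i y. y \<bullet> i" and b="\<lambda>i. i"])
     (auto simp: euclidean_representation bounded_linear_inner_left)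

lemma bounded_linear_entry: "bounded_linear (\<lambda>M. blinfun_apply M a \<bullet> b)"
  by (intro bounded_linear_compose[OF bounded_linear_inner_left] blinfun.bounded_linear_left)

definition elem_op :: "'a::euclidean_space \<Rightarrow> 'b::euclidean_space \<Rightarrow> 'a \<Rightarrow>\<^sub>L 'b" where
  "elem_op i j = Blinfun (\<lambda>x. (x \<bullet> i) *\<^sub>R j)"

lemma elem_op_apply: "blinfun_apply (elem_op i j) x = (x \<bullet> i) *\<^sub>R j"
  unfolding elem_op_def
  by (subst bounded_linear_Blinfun_apply)
     (auto intro: bounded_linear_compose[OF bounded_linear_scaleR_left bounded_linear_inner_left])

lemma blinfun_elem_op_sum:
  "(M::'a::euclidean_space \<Rightarrow>\<^sub>L 'b::euclidean_space) =
     (\<Sum>i\<in>Basis. \<Sum>j\<in>Basis. (M i \<bullet> j) *\<^sub>R elem_op i j)"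
proof (rule blinfun_eqI)
  fix x
  have "M x = M (\<Sum>i\<in>Basis. (x \<bullet> i) *\<^sub>R i)" by (simp add: euclidean_representation)
  also have "\<dots> = (\<Sum>i\<in>Basis. (x \<bullet> i) *\<^sub>R M i)"
    by (simp add: blinfun.sum_right blinfun.scaleR_right)
  also have "\<dots> = (\<Sum>i\<in>Basis. (x \<bullet> i) *\<^sub>R (\<Sum>j\<in>Basis. (M i \<bullet> j) *\<^sub>R j))"
    by (simp add: euclidean_representation)
  finally show "M x = (\<Sum>i\<in>Basis. \<Sum>j\<in>Basis. (M i \<bullet> j) *\<^sub>R elem_op i j) x"
    by (simp add: blinfun.sum_left blinfun.scaleR_left elem_op_apply scaleR_sum_right mult.commute)
qed

lemma fin_dim_blinfun: "fin_dim TYPE('a::euclidean_space \<Rightarrow>\<^sub>L 'b::euclidean_space)"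
proof (rule fin_dimI[where I="(Basis::'a set) \<times> (Basis::'b set)"
      and \<phi>="\<lambda>(i, j) M. blinfun_apply M i \<bullet> j" and b="\<lambda>(i, j). elem_op i j"])
  show "finite ((Basis::'a set) \<times> (Basis::'b set))" by simp
  show "bounded_linear ((\<lambda>(i, j) M. blinfun_apply M i \<bullet> j) ij)" for ij :: "'a \<times> 'b"
    by (auto simp: bounded_linear_entry split: prod.split)
  show "y = (\<Sum>ij\<in>Basis \<times> Basis. (\<lambda>(i, j) M. blinfun_apply M i \<bullet> j) ij y *\<^sub>R
      (\<lambda>(i, j). elem_op i j) ij)" for y :: "'a \<Rightarrow>\<^sub>L 'b"
    by (subst blinfun_elem_op_sum) (simp add: sum.cartesian_product case_prod_unfold)
qed

lemma fin_dim_prod: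
  assumes "fin_dim TYPE('a::real_normed_vector)" "fin_dim TYPE('b::real_normed_vector)"
  shows "fin_dim TYPE('a \<times> 'b)"
proof -
  obtain n \<phi> b where 1: "\<forall>k<n. bounded_linear (\<phi> k)" "\<And>y::'a. y = (\<Sum>k<(n::nat). \<phi> k y *\<^sub>R b k)"
    using assms(1) unfolding fin_dim_def by auto
  obtain m \<psi> c where 2: "\<forall>k<m. bounded_linear (\<psi> k)" "\<And>y::'b. y = (\<Sum>k<(m::nat). \<psi> k y *\<^sub>R c k)"
    using assms(2) unfolding fin_dim_def by auto
  show ?thesis
  proof (rule fin_dimI[where I="{..<n} <+> {..<m}"])
    show "finite ({..<n} <+> {..<m})" by simp
    show "bounded_linear (case_sum (\<lambda>k y. \<phi> k (fst y)) (\<lambda>k y. \<psi> k (snd y)) i)"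
      if "i \<in> {..<n} <+> {..<m}" for i
      using that bounded_linear_compose[OF 1(1)[rule_format] bounded_linear_fst]
        bounded_linear_compose[OF 2(1)[rule_format] bounded_linear_snd] by auto
    show "y = (\<Sum>i\<in>{..<n} <+> {..<m}. case_sum (\<lambda>k y. \<phi> k (fst y)) (\<lambda>k y. \<psi> k (snd y)) i y *\<^sub>R
        case_sum (\<lambda>k. (b k, 0)) (\<lambda>k. (0, c k)) i)" for y
    proof (rule prod_eqI)
      show "fst y = fst (\<Sum>i\<in>{..<n} <+> {..<m}. case_sum (\<lambda>k y. \<phi> k (fst y)) (\<lambda>k y. \<psi> k (snd y)) i y *\<^sub>R
        case_sum (\<lambda>k. (b k, 0)) (\<lambda>k. (0, c k)) i)"
        by (subst 1(2)) (simp add: sum.Plus fst_sum)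
      show "snd y = snd (\<Sum>i\<in>{..<n} <+> {..<m}. case_sum (\<lambda>k y. \<phi> k (fst y)) (\<lambda>k y. \<psi> k (snd y)) i y *\<^sub>R
        case_sum (\<lambda>k. (b k, 0)) (\<lambda>k. (0, c k)) i)"
        by (subst 2(2)) (simp add: sum.Plus snd_sum)
    qed
  qed
qed

lemma Ck_on_sum:
  assumes "open S" "\<And>i. i \<in> I \<Longrightarrow> Ck_on k S (f i)"
  shows "Ck_on k S (\<lambda>x. \<Sum>i\<in>I. f i x)"
  using assms(2)
  by (induction I rule: infinite_finite_induct)
     (auto intro!: Ck_on_const Ck_on_add assms(1))

text \<open>By the chain rule the directional derivative of the composite is a sum of products of a coordinate
  of \<open>f'\<close> with a directional derivative of \<open>g\<close> at \<open>f\<close>; the order of differentiability of all factors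
  has dropped by one, so induction applies.\<close>

lemma Ck_on_compose:
  fixes f :: "'a::real_normed_vector \<Rightarrow> 'b::real_normed_vector" and g :: "'b \<Rightarrow> 'c::real_normed_vector"
  assumes fd: "fin_dim TYPE('b)" and S: "open S" and T: "open T" "f ` S \<subseteq> T"
  shows "Ck_on k S f \<Longrightarrow> Ck_on k T g \<Longrightarrow> Ck_on k S (\<lambda>x. g (f x))"
proof (induction k arbitrary: g)
  case 0
  then show ?case using T continuous_on_compose2[of T g S f] by simp
next
  case (Suc k)
  obtain n \<phi> b where 1: "\<forall>k<n. bounded_linear (\<phi> k)" "\<And>y::'b. y = (\<Sum>k<(n::nat). \<phi> k y *\<^sub>R b k)"
    using fd unfolding fin_dim_def by auto
  have f': "(f has_derivative frechet_derivative f (at x)) (at x)" if "x \<in> S" for x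
    using Ck_on_Suc_deriv[OF Suc.prems(1) that] .
  have g': "(g has_derivative frechet_derivative g (at (f x))) (at (f x))" if "x \<in> S" for x
    by (rule Ck_on_Suc_deriv[OF Suc.prems(2)]) (use T that in blast)
  have eq: "(\<Sum>i<n. \<phi> i (frechet_derivative f (at x) v) *\<^sub>R frechet_derivative g (at (f x)) (b i))
     = frechet_derivative g (at (f x)) (frechet_derivative f (at x) v)" if x: "x \<in> S" for x v
  proof -
    have lin: "linear (frechet_derivative g (at (f x)))"
      using has_derivative_linear[OF g'[OF x]] .
    show ?thesis
      by (subst 1(2)[of "frechet_derivative f (at x) v"])
         (simp only: linear_sum[OF lin] linear_cmul[OF lin])
  qed
  have f: "Ck_on k S f" using Suc.prems(1) by (rule Ck_on_SucD)
  have df: "Ck_on k S (\<lambda>x. frechet_derivative f (at x) v)" for v using Suc.prems(1) by simp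
  have dg: "Ck_on k T (\<lambda>y. frechet_derivative g (at y) v)" for v using Suc.prems(2) by simp
  have "Ck_on k S (\<lambda>x. \<Sum>i<n. \<phi> i (frechet_derivative f (at x) v) *\<^sub>R
      frechet_derivative g (at (f x)) (b i))" for v
  proof (rule Ck_on_sum[OF S])
    fix i assume "i \<in> {..<n}"
    then have "bounded_linear (\<phi> i)" using 1(1) by simp
    from Ck_on_compose_linear[OF this S df]
    show "Ck_on k S (\<lambda>x. \<phi> i (frechet_derivative f (at x) v) *\<^sub>R frechet_derivative g (at (f x)) (b i))"
      by (rule Ck_on_bilinear[OF bounded_bilinear_scaleR S _ Suc.IH[OF f dg]])
  qed
  then have "Ck_on k S (\<lambda>x. frechet_derivative g (at (f x)) (frechet_derivative f (at x) v))" for v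
    by (rule Ck_on_cong[OF S eq, rotated])
  then show ?case
    by (intro Ck_on_SucI[OF S diff_chain_at[unfolded o_def, OF f' g']])
qed

lemma smooth_on_cong:
  "open S \<Longrightarrow> (\<And>x. x \<in> S \<Longrightarrow> f x = g x) \<Longrightarrow> smooth_on S f \<Longrightarrow> smooth_on S g"
  unfolding smooth_on_def by (meson Ck_on_cong)

lemma smooth_on_subset: "smooth_on S f \<Longrightarrow> T \<subseteq> S \<Longrightarrow> smooth_on T f"
  unfolding smooth_on_def by (meson Ck_on_subset)

lemma smooth_on_const: "open S \<Longrightarrow> smooth_on S (\<lambda>x. c)"
  unfolding smooth_on_def by (blast intro: Ck_on_const)

lemma smooth_on_linear: "open S \<Longrightarrow> bounded_linear L \<Longrightarrow> smooth_on S L"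
  unfolding smooth_on_def by (meson Ck_on_linear)

lemma smooth_on_bilinear:
  "bounded_bilinear b \<Longrightarrow> open S \<Longrightarrow> smooth_on S f \<Longrightarrow> smooth_on S g \<Longrightarrow>
   smooth_on S (\<lambda>x. b (f x) (g x))"
  unfolding smooth_on_def by (blast intro: Ck_on_bilinear)

lemma smooth_on_compose_linear:
  "bounded_linear L \<Longrightarrow> open S \<Longrightarrow> smooth_on S f \<Longrightarrow> smooth_on S (\<lambda>x. L (f x))"
  unfolding smooth_on_def by (blast intro: Ck_on_compose_linear)

lemma smooth_on_add:
  "open S \<Longrightarrow> smooth_on S f \<Longrightarrow> smooth_on S g \<Longrightarrow> smooth_on S (\<lambda>x. f x + g x)"
  unfolding smooth_on_def by (blast intro: Ck_on_add)

lemma smooth_on_sum: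
  "open S \<Longrightarrow> (\<And>i. i \<in> I \<Longrightarrow> smooth_on S (f i)) \<Longrightarrow> smooth_on S (\<lambda>x. \<Sum>i\<in>I. f i x)"
  unfolding smooth_on_def by (blast intro: Ck_on_sum)

lemma smooth_on_minus: "open S \<Longrightarrow> smooth_on S f \<Longrightarrow> smooth_on S (\<lambda>x. - f x)"
  by (rule smooth_on_compose_linear[OF bounded_linear_minus[OF bounded_linear_ident]])

lemma smooth_on_diff:
  "open S \<Longrightarrow> smooth_on S f \<Longrightarrow> smooth_on S g \<Longrightarrow> smooth_on S (\<lambda>x. f x - g x)"
  using smooth_on_add[OF _ _ smooth_on_minus, of S f g] by simp

lemma smooth_on_Pair:
  assumes "open S" "smooth_on S f" "smooth_on S g"
  shows "smooth_on S (\<lambda>x. (f x, g x))"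
proof -
  have "bounded_linear (\<lambda>a. (a, 0))" "bounded_linear (\<lambda>b. (0, b))"
    by (auto intro: bounded_linear_Pair bounded_linear_zero bounded_linear_ident)
  from smooth_on_add[OF assms(1) smooth_on_compose_linear[OF this(1) assms(1,2)]
      smooth_on_compose_linear[OF this(2) assms(1,3)]]
  show ?thesis by simp
qed

lemma smooth_on_compose:
  fixes f :: "'a::real_normed_vector \<Rightarrow> 'b::real_normed_vector"
  assumes "fin_dim TYPE('b)" "open S" "open T" "f ` S \<subseteq> T" "smooth_on S f" "smooth_on T g"
  shows "smooth_on S (\<lambda>x. g (f x))"
  using assms Ck_on_compose unfolding smooth_on_def by blast

lemma smooth_on_has_derivative:
  "smooth_on S f \<Longrightarrow> x \<in> S \<Longrightarrow> (f has_derivative frechet_derivative f (at x)) (at x)"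
  unfolding smooth_on_def using Ck_on_Suc_deriv by blast

lemma smooth_on_frechet_derivative:
  "smooth_on S f \<Longrightarrow> smooth_on S (\<lambda>x. frechet_derivative f (at x) v)"
  unfolding smooth_on_def by (metis Ck_on.simps(2))

lemma smooth_on_continuous_on: "smooth_on S f \<Longrightarrow> continuous_on S f"
  unfolding smooth_on_def using Ck_on.simps(1) by blast

lemma smooth_on_vector_derivative:
  fixes f :: "real \<Rightarrow> 'b::real_normed_vector"
  assumes "smooth_on S f" "x \<in> S"
  shows "(f has_vector_derivative vector_derivative f (at x)) (at x)"
  using smooth_on_has_derivative[OF assms]
  by (meson differentiableI vector_derivative_works)

lemma frechet_derivative_real:
  fixes f :: "real \<Rightarrow> 'b::real_normed_vector"
  assumes "smooth_on S f" "x \<in> S"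
  shows "frechet_derivative f (at x) 1 = vector_derivative f (at x)"
  using smooth_on_vector_derivative[OF assms] frechet_derivative_at[of f _ x]
  unfolding has_vector_derivative_def by (metis scaleR_one)

lemma smooth_on_vector_derivative_smooth:
  fixes f :: "real \<Rightarrow> 'b::real_normed_vector"
  assumes "open S" "smooth_on S f"
  shows "smooth_on S (\<lambda>t. vector_derivative f (at t))"
  by (rule smooth_on_cong[OF assms(1) _ smooth_on_frechet_derivative[OF assms(2), of 1]])
     (rule frechet_derivative_real[OF assms(2)])

lemma smooth_on_blinfun_apply:
  "open S \<Longrightarrow> smooth_on S M \<Longrightarrow> smooth_on S f \<Longrightarrow> smooth_on S (\<lambda>x. blinfun_apply (M x) (f x))"
  by (rule smooth_on_bilinear[OF bounded_bilinear_blinfun_apply])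

lemma smooth_on_blinfun_compose:
  "open S \<Longrightarrow> smooth_on S M \<Longrightarrow> smooth_on S N \<Longrightarrow> smooth_on S (\<lambda>x. M x o\<^sub>L N x)"
  by (rule smooth_on_bilinear[OF bounded_bilinear_blinfun_compose])

lemma smooth_on_blinfunI:
  fixes M :: "'a::real_normed_vector \<Rightarrow> 'b::euclidean_space \<Rightarrow>\<^sub>L 'c::euclidean_space"
  assumes "open S" "\<And>i. i \<in> Basis \<Longrightarrow> smooth_on S (\<lambda>x. M x i)"
  shows "smooth_on S M"
proof -
  have "smooth_on S (\<lambda>x. \<Sum>i\<in>Basis. \<Sum>j\<in>Basis. (M x i \<bullet> j) *\<^sub>R elem_op i j)"
    using assms by (intro smooth_on_sum smooth_on_bilinear[OF bounded_bilinear_scaleR] smooth_on_const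
        smooth_on_compose_linear[OF bounded_linear_inner_left]) auto
  then show ?thesis by (simp flip: blinfun_elem_op_sum)
qed

subsection \<open>Inversion of linear maps\<close>

definition invertible_op :: "('a::euclidean_space \<Rightarrow>\<^sub>L 'a) \<Rightarrow> bool" where
  "invertible_op M \<longleftrightarrow> (\<forall>a. blinfun_apply M a = 0 \<longrightarrow> a = 0)"

text \<open>An inverse within the space of operators, so that inverting is a map whose smoothness can be
  discussed.\<close>

definition binv :: "('a::euclidean_space \<Rightarrow>\<^sub>L 'a) \<Rightarrow> 'a \<Rightarrow>\<^sub>L 'a" where
  "binv M = Blinfun (inv (blinfun_apply M))"

lemma linear_blinfun_apply: "linear (blinfun_apply M)"
  using blinfun.bounded_linear_right bounded_linear.linear by blast

lemma Blinfun_apply_linear: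
  "linear f \<Longrightarrow> blinfun_apply (Blinfun f) = (f :: 'a::euclidean_space \<Rightarrow> 'b::euclidean_space)"
  by (simp add: bounded_linear_Blinfun_apply linear_conv_bounded_linear)

lemma binv_apply:
  assumes "invertible_op M"
  shows "M (binv M a) = a" "binv M (M a) = a"
proof -
  have inj: "inj (blinfun_apply M)"
    using assms linear_injective_0[OF linear_blinfun_apply] unfolding invertible_op_def by blast
  have surj: "surj (blinfun_apply M)"
    using linear_injective_imp_surjective[OF linear_blinfun_apply inj] by simp
  have "linear (inv (blinfun_apply M))"
    using inj_linear_imp_inv_bounded_linear[OF blinfun.bounded_linear_right inj]
    by (rule bounded_linear.linear)
  then have "blinfun_apply (binv M) = inv (blinfun_apply M)"
    unfolding binv_def by (rule Blinfun_apply_linear)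
  then show "M (binv M a) = a" "binv M (M a) = a"
    using inj surj by (auto simp: surj_f_inv_f)
qed

lemma invertible_opI: "(\<And>a. blinfun_apply N (blinfun_apply M a) = a) \<Longrightarrow> invertible_op M"
  unfolding invertible_op_def by (metis blinfun.zero_right)

lemma binv_unique: "(\<And>a. blinfun_apply N (blinfun_apply M a) = a) \<Longrightarrow> binv M = N"
  by (metis binv_apply(1) blinfun_eqI invertible_opI)

lemma invertible_op_perturb:
  assumes M: "invertible_op M" and N: "norm (binv M) * norm (N - M) \<le> 1/2"
  shows "invertible_op N" "norm (binv N) \<le> 2 * norm (binv M)"
proof -
  have *: "norm a \<le> 2 * norm (binv M) * norm (N a)" for a
  proof -
    have "a = binv M (N a) - binv M ((N - M) a)"
      using binv_apply[OF M] by (simp add: blinfun.diff_left blinfun.diff_right)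
    then have "norm a \<le> norm (binv M (N a)) + norm (binv M ((N - M) a))"
      by (metis norm_triangle_ineq4)
    also have "norm (binv M ((N - M) a)) \<le> norm (binv M) * (norm (N - M) * norm a)"
      by (meson dual_order.trans mult_left_mono norm_blinfun norm_ge_zero)
    also have "\<dots> \<le> 1/2 * norm a"
      using mult_right_mono[OF N norm_ge_zero[of a]] by (simp add: mult.assoc)
    also have "norm (binv M (N a)) \<le> norm (binv M) * norm (N a)" by (rule norm_blinfun)
    finally show ?thesis by simp
  qed
  show 1: "invertible_op N"
    unfolding invertible_op_def by (metis "*" mult_zero_right norm_le_zero_iff norm_zero)
  show "norm (binv N) \<le> 2 * norm (binv M)"
    by (rule norm_blinfun_bound) (use * binv_apply[OF 1] in \<open>auto, metis\<close>)
qed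

lemma open_invertible_op: "open {M::'a::euclidean_space \<Rightarrow>\<^sub>L 'a. invertible_op M}"
  unfolding open_dist
proof safe
  fix M :: "'a \<Rightarrow>\<^sub>L 'a" assume M: "invertible_op M"
  define e where "e = 1 / (2 * (norm (binv M) + 1))"
  have pos: "norm (binv M) + 1 > 0" using norm_ge_zero[of "binv M"] by linarith
  have "invertible_op N" if "dist N M < e" for N
  proof (rule invertible_op_perturb[OF M])
    have "norm (binv M) * norm (N - M) \<le> (norm (binv M) + 1) * e"
      using that pos by (intro mult_mono) (auto simp: dist_norm)
    also have "\<dots> = 1/2" using pos unfolding e_def by (simp add: field_simps)
    finally show "norm (binv M) * norm (N - M) \<le> 1/2" .
  qed
  then show "\<exists>e>0. \<forall>N. dist N M < e \<longrightarrow> N \<in> {M. invertible_op M}"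
    using pos by (intro exI[of _ e]) (auto simp: e_def)
qed

lemma binv_diff:
  assumes "invertible_op M" "invertible_op N"
  shows "binv N - binv M = - (binv N o\<^sub>L (N - M) o\<^sub>L binv M)"
  by (rule blinfun_eqI)
     (simp add: blinfun.bilinear_simps binv_apply[OF assms(1)] binv_apply[OF assms(2)])

lemma continuous_on_binv: "continuous_on {M::'a::euclidean_space \<Rightarrow>\<^sub>L 'a. invertible_op M} binv"
proof (rule continuous_at_imp_continuous_on, safe)
  fix M :: "'a \<Rightarrow>\<^sub>L 'a" assume M: "invertible_op M"
  define C where "C = norm (binv M)"
  have ev: "\<forall>\<^sub>F N in at M. invertible_op N"
    using open_invertible_op M eventually_at_topological by blast
  have "((\<lambda>N. C * norm (N - M)) \<longlongrightarrow> C * norm (M - M)) (at M)"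
    by (intro tendsto_intros)
  then have ev2: "\<forall>\<^sub>F N in at M. C * norm (N - M) < 1/2"
    by (rule order_tendstoD) simp
  have "((\<lambda>N. binv N - binv M) \<longlongrightarrow> 0) (at M)"
  proof (rule Lim_null_comparison)
    show "\<forall>\<^sub>F N in at M. norm (binv N - binv M) \<le> 2 * C * norm (N - M) * C"
      using ev ev2
    proof eventually_elim
      case (elim N)
      have "norm (binv N - binv M) = norm (binv N o\<^sub>L (N - M) o\<^sub>L binv M)"
        using binv_diff[OF M elim(1)] by simp
      also have "\<dots> \<le> norm (binv N) * norm (N - M) * C"
        unfolding C_def by (meson dual_order.trans mult_right_mono norm_blinfun_compose norm_ge_zero)
      also have "\<dots> \<le> 2 * C * norm (N - M) * C"
        using invertible_op_perturb(2)[OF M, of N] elim(2)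
        by (intro mult_right_mono) (auto simp: C_def)
      finally show ?case .
    qed
    have "((\<lambda>N. 2 * C * norm (N - M) * C) \<longlongrightarrow> 2 * C * norm (M - M) * C) (at M)"
      by (intro tendsto_intros)
    then show "((\<lambda>N. 2 * C * norm (N - M) * C) \<longlongrightarrow> 0) (at M)" by simp
  qed
  then show "isCont binv M"
    unfolding isCont_def using LIM_zero_cancel by blast
qed

text \<open>The difference quotient is controlled by the resolvent identity of \<open>binv_diff\<close> and by the continuity
  of inversion.\<close>

lemma has_derivative_binv:
  fixes M :: "'a::euclidean_space \<Rightarrow>\<^sub>L 'a"
  assumes M: "invertible_op M"
  shows "(binv has_derivative (\<lambda>H. - (binv M o\<^sub>L H o\<^sub>L binv M))) (at M)"
proof -
  have bl: "bounded_linear (\<lambda>H. - (binv M o\<^sub>L H o\<^sub>L binv M))"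
    by (intro bounded_linear_minus bounded_linear_compose[OF bounded_bilinear.bounded_linear_left[OF bounded_bilinear_blinfun_compose]
        bounded_bilinear.bounded_linear_right[OF bounded_bilinear_blinfun_compose]])
  define C where "C = norm (binv M)"
  have ev: "\<forall>\<^sub>F N in at M. invertible_op N"
    using open_invertible_op M eventually_at_topological by blast
  have evn: "\<forall>\<^sub>F N in at M. N \<noteq> M" by (simp add: eventually_at_filter)
  have cont: "(binv \<longlongrightarrow> binv M) (at M)"
    using continuous_on_binv M open_invertible_op
    by (metis continuous_on_eq_continuous_at isCont_def mem_Collect_eq)
  have "((\<lambda>N. norm ((binv N - binv M) - (- (binv M o\<^sub>L (N - M) o\<^sub>L binv M))) / norm (N - M)) \<longlongrightarrow> 0) (at M)"
  proof (rule Lim_null_comparison)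
    show "\<forall>\<^sub>F N in at M. norm (norm ((binv N - binv M) - (- (binv M o\<^sub>L (N - M) o\<^sub>L binv M))) / norm (N - M))
        \<le> norm (binv N - binv M) * C"
      using ev evn
    proof eventually_elim
      case (elim N)
      have "(binv N - binv M) - (- (binv M o\<^sub>L (N - M) o\<^sub>L binv M))
          = - ((binv N - binv M) o\<^sub>L (N - M) o\<^sub>L binv M)"
        unfolding binv_diff[OF M elim(1)]
        by (rule blinfun_eqI) (simp add: blinfun.bilinear_simps binv_apply[OF M] binv_apply[OF elim(1)])
      then have "norm ((binv N - binv M) - (- (binv M o\<^sub>L (N - M) o\<^sub>L binv M)))
          = norm ((binv N - binv M) o\<^sub>L (N - M) o\<^sub>L binv M)"
        by simp
      also have "\<dots> \<le> norm (binv N - binv M) * norm (N - M) * C"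
        unfolding C_def by (meson dual_order.trans mult_right_mono norm_blinfun_compose norm_ge_zero)
      finally show ?case
        using elim(2) unfolding real_norm_def abs_divide abs_norm_cancel
        by (simp add: divide_le_eq mult_ac)
    qed
    have "((\<lambda>N. norm (binv N - binv M) * C) \<longlongrightarrow> norm (binv M - binv M) * C) (at M)"
      by (intro tendsto_intros cont)
    then show "((\<lambda>N. norm (binv N - binv M) * C) \<longlongrightarrow> 0) (at M)" by simp
  qed
  then show ?thesis
    unfolding has_derivative_iff_norm using bl by blast
qed

text \<open>The derivative \<open>H \<mapsto> - M\<^sup>-\<^sup>1 H M\<^sup>-\<^sup>1\<close> is bilinear in \<open>M\<^sup>-\<^sup>1\<close>, hence as often differentiable as inversion
  itself, and one more derivative is gained at each step.\<close>

lemma smooth_on_binv: "smooth_on {M::'a::euclidean_space \<Rightarrow>\<^sub>L 'a. invertible_op M} binv"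
  unfolding smooth_on_def
proof
  fix k show "Ck_on k {M::'a \<Rightarrow>\<^sub>L 'a. invertible_op M} binv"
  proof (induction k)
    case 0
    then show ?case by (simp add: continuous_on_binv)
  next
    case (Suc k)
    note o = open_invertible_op[where 'a='a]
    show ?case
    proof (rule Ck_on_SucI[OF o has_derivative_binv])
      fix H :: "'a \<Rightarrow>\<^sub>L 'a"
      show "Ck_on k {M. invertible_op M} (\<lambda>x. - (binv x o\<^sub>L H o\<^sub>L binv x))"
        by (intro Ck_on_compose_linear[OF bounded_linear_minus[OF bounded_linear_ident] o]
            Ck_on_bilinear[OF bounded_bilinear_blinfun_compose o] Suc Ck_on_const o)
    qed simp
  qed
qed

lemma smooth_on_binv_comp:
  fixes M :: "'b::real_normed_vector \<Rightarrow> 'a::euclidean_space \<Rightarrow>\<^sub>L 'a"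
  assumes "open S" "smooth_on S M" "\<And>x. x \<in> S \<Longrightarrow> invertible_op (M x)"
  shows "smooth_on S (\<lambda>x. binv (M x))"
  by (rule smooth_on_compose[OF fin_dim_blinfun assms(1) open_invertible_op _ assms(2) smooth_on_binv])
     (use assms in auto)

section \<open>Holomorphic functions of several variables are smooth\<close>

lemma bounded_linear_vscale_left: "bounded_linear (\<lambda>c::complex. c *s (v::complex^'n::finite))"
proof -
  have "linear (\<lambda>c::complex. c *s v)"
    by (rule linearI) (auto simp: vec_eq_iff algebra_simps)
  then show ?thesis by (simp add: linear_conv_bounded_linear)
qed

lemma bounded_linear_vscale_right: "bounded_linear (\<lambda>v::complex^'n::finite. (c::complex) *s v)"
proof -
  have "linear (\<lambda>v::complex^'n. c *s v)"
    by (rule linearI) (auto simp: vec_eq_iff algebra_simps)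
  then show ?thesis by (simp add: linear_conv_bounded_linear)
qed

lemma norm_vscale: "norm ((c::complex) *s (v::complex^'n::finite)) = norm c * norm v"
  by (simp add: norm_vec_def norm_mult L2_set_right_distrib)

lemma several_holomorphic_onD:
  assumes "several_holomorphic_on S f" "z \<in> S"
  shows "(f has_derivative frechet_derivative f (at z)) (at z)"
    "frechet_derivative f (at z) (c *s v) = c * frechet_derivative f (at z) v"
  using assms unfolding several_holomorphic_on_def
  by (metis frechet_derivative_at)+

lemma several_holomorphic_on_cong:
  assumes "open S" "\<And>z. z \<in> S \<Longrightarrow> f z = g z" "several_holomorphic_on S f"
  shows "several_holomorphic_on S g"
  using assms unfolding several_holomorphic_on_def
  by (metis has_derivative_transform_within_open)

definition circ :: "real \<Rightarrow> real \<Rightarrow> complex" where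
  "circ r t = of_real r * exp (2 * of_real pi * \<i> * of_real t)"

lemma norm_circ: "norm (circ r t) = \<bar>r\<bar>"
  by (simp add: circ_def norm_mult)

lemma continuous_on_circ: "continuous_on T (circ r)"
  unfolding circ_def by (intro continuous_intros)

text \<open>Cauchy's formula on the complex line through \<open>z\<close> in direction \<open>v\<close>. It expresses the derivative
  by values of \<open>f\<close> itself, so that continuity and differentiability pass from \<open>f\<close> to its
  derivatives.\<close>

lemma directional_Cauchy_formula:
  fixes f :: "complex^'n::finite \<Rightarrow> complex"
  assumes "several_holomorphic_on S f" "open S" "z0 \<in> S"
  obtains \<rho> r where "\<rho> > 0" "r > 0" "ball z0 \<rho> \<subseteq> S"
    "\<And>z t. z \<in> ball z0 \<rho> \<Longrightarrow> z + circ r t *s v \<in> S"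
    "\<And>z. z \<in> ball z0 \<rho> \<Longrightarrow> frechet_derivative f (at z) v =
       integral (cbox 0 1) (\<lambda>t. inverse (circ r t) * f (z + circ r t *s v))"
proof -
  obtain e where e: "e > 0" "ball z0 e \<subseteq> S"
    using assms(2,3) openE by blast
  define r where "r = e / (4 * (norm v + 1))"
  have pos: "norm v + 1 > 0" using norm_ge_zero[of v] by linarith
  then have r: "r > 0" using e by (simp add: r_def)
  have "r * norm v \<le> r * (norm v + 1)" using r by simp
  also have "\<dots> = e / 4" using pos by (simp add: r_def field_simps)
  finally have rv: "r * norm v \<le> e / 4" .
  have inS: "z + \<zeta> *s v \<in> S" if "z \<in> ball z0 (e/2)" "norm \<zeta> < 2 * r" for z \<zeta>
  proof -
    have "norm (\<zeta> *s v) \<le> 2 * (r * norm v)"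
      using that mult_right_mono[of "norm \<zeta>" "2 * r" "norm v"] by (simp add: norm_vscale mult.assoc)
    then have "dist z0 (z + \<zeta> *s v) < e"
      using that rv norm_triangle_ineq4[of "z0 - z" "\<zeta> *s v"] by (auto simp: dist_norm algebra_simps)
    then show ?thesis using e by auto
  qed
  show thesis
  proof (rule that[of "e/2" r])
    show "e / 2 > 0" "r > 0" using e r by auto
    show "ball z0 (e/2) \<subseteq> S" using e by auto
    show "z + circ r t *s v \<in> S" if "z \<in> ball z0 (e/2)" for z t
      using inS[OF that, of "circ r t"] r by (simp add: norm_circ)
    fix z assume z: "z \<in> ball z0 (e/2)"
    define \<phi> where "\<phi> = (\<lambda>\<zeta>. f (z + \<zeta> *s v))"
    have der: "(\<phi> has_field_derivative frechet_derivative f (at (z + \<zeta> *s v)) v) (at \<zeta>)"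
      if "norm \<zeta> < 2 * r" for \<zeta>
    proof -
      have 1: "((\<lambda>\<zeta>. z + \<zeta> *s v) has_derivative (\<lambda>h. h *s v)) (at \<zeta>)"
        using has_derivative_add[OF has_derivative_const[of z]
            bounded_linear_imp_has_derivative[OF bounded_linear_vscale_left[of v]]] by simp
      have "(\<phi> has_derivative (\<lambda>h. frechet_derivative f (at (z + \<zeta> *s v)) (h *s v))) (at \<zeta>)"
        using diff_chain_at[OF 1 several_holomorphic_onD(1)[OF assms(1) inS[OF z that]]]
        by (simp add: \<phi>_def o_def)
      then show ?thesis
        using several_holomorphic_onD(2)[OF assms(1) inS[OF z that]]
        by (simp add: has_field_derivative_def mult.commute[of _ "frechet_derivative f (at (z + \<zeta> *s v)) v"])
    qed
    have hol: "\<phi> holomorphic_on ball 0 (2 * r)"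
      unfolding holomorphic_on_open[OF open_ball] by (intro ballI exI, rule der) simp
    have sub: "cball 0 r \<subseteq> ball 0 (2 * r)" "ball 0 r \<subseteq> ball (0::complex) (2 * r)"
      using r by auto
    have "(\<phi> has_field_derivative (1 / (2 * of_real pi * \<i>) *
        contour_integral (circlepath 0 r) (\<lambda>u. \<phi> u / (u-0)^2))) (at 0)"
      using hol sub r by (intro Cauchy_derivative_integral_circlepath)
        (auto intro: holomorphic_on_imp_continuous_on holomorphic_on_subset)
    then have "frechet_derivative f (at z) v = 1 / (2 * of_real pi * \<i>) *
        contour_integral (circlepath 0 r) (\<lambda>u. \<phi> u / (u-0)^2)"
      using der[of 0] r DERIV_unique by (fastforce simp: vector_smult_lzero)
    also have "\<dots> = 1 / (2 * of_real pi * \<i>) * integral {0..1} (\<lambda>t. \<phi> (circ r t) / (circ r t)^2 *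
        (2 * of_real pi * \<i> * circ r t))"
    proof -
      have "vector_derivative (circlepath 0 r) (at t) = 2 * of_real pi * \<i> * circ r t" for t
        using vector_derivative_at[OF has_vector_derivative_circlepath[of 0 r t UNIV]]
        by (simp add: circ_def)
      moreover have "circlepath 0 r t = circ r t" for t by (simp add: circlepath circ_def)
      ultimately show ?thesis unfolding contour_integral_integral by simp
    qed
    also have "\<dots> = integral {0..1} (\<lambda>t. 1 / (2 * of_real pi * \<i>) * (\<phi> (circ r t) / (circ r t)^2 *
        (2 * of_real pi * \<i> * circ r t)))"
      by (rule integral_mult_right[symmetric])
    also have "(\<lambda>t. 1 / (2 * of_real pi * \<i>) * (\<phi> (circ r t) / (circ r t)^2 *
        (2 * of_real pi * \<i> * circ r t))) = (\<lambda>t. inverse (circ r t) * f (z + circ r t *s v))"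
    proof
      fix t
      have "circ r t \<noteq> 0" using norm_circ[of r t] r by auto
      then show "1 / (2 * of_real pi * \<i>) * (\<phi> (circ r t) / (circ r t)^2 *
        (2 * of_real pi * \<i> * circ r t)) = inverse (circ r t) * f (z + circ r t *s v)"
        by (simp add: \<phi>_def field_simps power2_eq_square)
    qed
    finally show "frechet_derivative f (at z) v =
       integral (cbox 0 1) (\<lambda>t. inverse (circ r t) * f (z + circ r t *s v))" by simp
  qed
qed

lemma continuous_on_circle_shift:
  fixes v :: "complex^'n::finite"
  assumes "continuous_on S G" "\<And>z t. z \<in> U \<Longrightarrow> z + circ r t *s v \<in> S"
  shows "continuous_on (U \<times> T) (\<lambda>(z, t). G (z + circ r t *s v))"
proof -
  have "continuous_on (U \<times> T) (\<lambda>p. fst p + circ r (snd p) *s v)"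
    by (intro continuous_on_add continuous_on_fst continuous_on_id
        bounded_linear.continuous_on[OF bounded_linear_vscale_left]
        continuous_on_compose2[OF continuous_on_circ[of UNIV] continuous_on_snd]) auto
  moreover have "(\<lambda>p. fst p + circ r (snd p) *s v) ` (U \<times> T) \<subseteq> S" using assms(2) by auto
  ultimately show ?thesis
    unfolding case_prod_unfold by (rule continuous_on_compose2[OF assms(1)])
qed

lemma several_holomorphic_continuous_on:
  assumes "several_holomorphic_on S f"
  shows "continuous_on S f"
  by (rule continuous_at_imp_continuous_on)
     (use has_derivative_continuous[OF several_holomorphic_onD(1)[OF assms]] in auto)

lemma several_holomorphic_directional_continuous:
  assumes "several_holomorphic_on S f" "open S"
  shows "continuous_on S (\<lambda>z. frechet_derivative f (at z) v)"
proof (rule continuous_at_imp_continuous_on, rule)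
  fix z0 assume "z0 \<in> S"
  then obtain \<rho> r where *: "\<rho> > 0" "r > 0" "ball z0 \<rho> \<subseteq> S"
    "\<And>z t. z \<in> ball z0 \<rho> \<Longrightarrow> z + circ r t *s v \<in> S"
    "\<And>z. z \<in> ball z0 \<rho> \<Longrightarrow> frechet_derivative f (at z) v =
       integral (cbox 0 1) (\<lambda>t. inverse (circ r t) * f (z + circ r t *s v))"
    using directional_Cauchy_formula[OF assms, of z0 v] by blast
  have nz: "circ r t \<noteq> 0" for t using norm_circ[of r t] *(2) by auto
  have "continuous_on (ball z0 \<rho> \<times> cbox 0 1) (\<lambda>(z, t). inverse (circ r t) * f (z + circ r t *s v))"
    unfolding case_prod_unfold
    by (intro continuous_on_mult continuous_on_inverse
        continuous_on_compose2[OF continuous_on_circ[of UNIV r] continuous_on_snd]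
        continuous_on_circle_shift[OF several_holomorphic_continuous_on[OF assms(1)] *(4), unfolded case_prod_unfold])
      (auto simp: nz)
  from integral_continuous_on_param[OF this]
  have "continuous_on (ball z0 \<rho>) (\<lambda>z. frechet_derivative f (at z) v)"
    by (rule continuous_on_eq) (rule *(5)[symmetric])
  then show "isCont (\<lambda>z. frechet_derivative f (at z) v) z0"
    using *(1) by (simp add: continuous_on_eq_continuous_at)
qed

text \<open>Differentiation under the integral sign in Cauchy's formula: the integrand depends complex
  differentiably on the base point, hence so does the integral.\<close>

lemma several_holomorphic_frechet_derivative:
  fixes f :: "complex^'n::finite \<Rightarrow> complex"
  assumes "several_holomorphic_on S f" "open S"
  shows "several_holomorphic_on S (\<lambda>z. frechet_derivative f (at z) v)"
  unfolding several_holomorphic_on_def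
proof
  fix z0 assume "z0 \<in> S"
  then obtain \<rho> r where *: "\<rho> > 0" "r > 0"
    "ball z0 \<rho> \<subseteq> S"
    "\<And>z t. z \<in> ball z0 \<rho> \<Longrightarrow> z + circ r t *s v \<in> S"
    "\<And>z. z \<in> ball z0 \<rho> \<Longrightarrow> frechet_derivative f (at z) v =
       integral (cbox 0 1) (\<lambda>t. inverse (circ r t) * f (z + circ r t *s v))"
    using directional_Cauchy_formula[OF assms, of z0 v] by blast
  have nz: "circ r t \<noteq> 0" for t using norm_circ[of r t] *(2) by auto
  define Df where "Df = (\<lambda>z. Blinfun (frechet_derivative f (at z)))"
  have Df: "blinfun_apply (Df z) = frechet_derivative f (at z)" if "z \<in> S" for z
    unfolding Df_def using several_holomorphic_onD(1)[OF assms(1) that]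
    by (simp add: bounded_linear_Blinfun_apply has_derivative_bounded_linear)
  have contDf: "continuous_on S Df"
  proof (rule continuous_on_blinfun_componentwise)
    fix i :: "complex^'n"
    show "continuous_on S (\<lambda>x. blinfun_apply (Df x) i)"
      using several_holomorphic_directional_continuous[OF assms, of i]
      by (rule continuous_on_eq) (simp add: Df)
  qed
  define Fx where "Fx = (\<lambda>z t. blinfun_mult_right (inverse (circ r t)) o\<^sub>L Df (z + circ r t *s v))"
  have contF: "continuous_on (ball z0 \<rho> \<times> cbox 0 1) (\<lambda>(z, t). Fx z t)"
    unfolding case_prod_unfold Fx_def
    by (intro bounded_bilinear.continuous_on[OF bounded_bilinear_blinfun_compose]
        bounded_linear.continuous_on[OF bounded_linear_blinfun_mult_right]
        continuous_on_inverse continuous_on_compose2[OF continuous_on_circ[of UNIV r] continuous_on_snd]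
        continuous_on_circle_shift[OF contDf *(4), unfolded case_prod_unfold])
      (auto simp: nz)
  have "((\<lambda>z. integral (cbox 0 1) (\<lambda>t. inverse (circ r t) * f (z + circ r t *s v)))
      has_derivative integral (cbox 0 1) (Fx z0)) (at z0 within ball z0 \<rho>)"
  proof (rule leibniz_rule[OF _ _ contF])
    show "z0 \<in> ball z0 \<rho>" "convex (ball z0 \<rho>)" using *(1) by auto
    fix z assume z: "z \<in> ball z0 \<rho>"
    show "(\<lambda>t. inverse (circ r t) * f (z + circ r t *s v)) integrable_on cbox 0 1"
    proof (rule integrable_continuous)
      have "continuous_on ({z} \<times> cbox 0 1) (\<lambda>(z, t). f (z + circ r t *s v))"
        by (rule continuous_on_circle_shift[OF several_holomorphic_continuous_on[OF assms(1)]])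
          (use *(4) z in auto)
      then have "continuous_on (cbox 0 1) (\<lambda>t. (\<lambda>(z, t). f (z + circ r t *s v)) (z, t))"
        by (rule continuous_on_compose2) (auto intro: continuous_intros)
      then have "continuous_on (cbox 0 1) (\<lambda>t. f (z + circ r t *s v))" by simp
      then show "continuous_on (cbox 0 1) (\<lambda>t. inverse (circ r t) * f (z + circ r t *s v))"
        by (intro continuous_on_mult continuous_on_inverse continuous_on_circ) (auto simp: nz)
    qed
    fix t
    have 1: "((\<lambda>z. z + circ r t *s v) has_derivative (\<lambda>h. h)) (at z)"
      by (auto intro!: derivative_eq_intros)
    have 2: "((\<lambda>z. f (z + circ r t *s v)) has_derivative frechet_derivative f (at (z + circ r t *s v))) (at z)"
      using diff_chain_at[OF 1 several_holomorphic_onD(1)[OF assms(1) *(4)[OF z]]] by (simp add: o_def)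
    have "((\<lambda>z. inverse (circ r t) * f (z + circ r t *s v)) has_derivative blinfun_apply (Fx z t)) (at z)"
      using has_derivative_mult_right[OF 2, of "inverse (circ r t)"]
      by (rule has_derivative_eq_rhs) (auto simp: Fx_def Df[OF *(4)[OF z]])
    then show "((\<lambda>z. inverse (circ r t) * f (z + circ r t *s v)) has_derivative blinfun_apply (Fx z t))
        (at z within ball z0 \<rho>)"
      by (rule has_derivative_at_withinI)
  qed
  then have "((\<lambda>z. integral (cbox 0 1) (\<lambda>t. inverse (circ r t) * f (z + circ r t *s v)))
      has_derivative integral (cbox 0 1) (Fx z0)) (at z0)"
    using *(1) by (simp add: at_within_open[OF _ open_ball])
  then have der: "((\<lambda>z. frechet_derivative f (at z) v) has_derivative integral (cbox 0 1) (Fx z0)) (at z0)"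
    by (rule has_derivative_transform_within_open[of _ _ _ _ "ball z0 \<rho>"]) (use * in auto)
  have intF: "Fx z0 integrable_on cbox 0 1"
  proof (rule integrable_continuous)
    have "continuous_on (cbox 0 1) (\<lambda>t. (\<lambda>(z, t). Fx z t) (z0, t))"
      by (rule continuous_on_compose2[OF contF]) (auto intro: continuous_intros simp: *(1))
    then show "continuous_on (cbox 0 1) (Fx z0)" by simp
  qed
  have "integral (cbox 0 1) (Fx z0) (c *s w) = c * integral (cbox 0 1) (Fx z0) w" for c w
  proof -
    have "integral (cbox 0 1) (Fx z0) (c *s w) = integral (cbox 0 1) (\<lambda>t. c * Fx z0 t w)"
      unfolding blinfun_apply_integral[OF intF]
      using several_holomorphic_onD(2)[OF assms(1) *(4)] *(1)
      by (intro integral_cong) (simp add: Fx_def Df[OF *(4)])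
    then show ?thesis
      unfolding blinfun_apply_integral[OF intF] by simp
  qed
  then show "\<exists>f'. ((\<lambda>z. frechet_derivative f (at z) v) has_derivative f') (at z0) \<and>
      (\<forall>c v. f' (c *s v) = c * f' v)"
    using der by blast
qed

lemma several_holomorphic_imp_smooth:
  assumes "several_holomorphic_on S f" "open S"
  shows "smooth_on S f"
proof -
  have "Ck_on k S f" for k
    using assms
  proof (induction k arbitrary: f)
    case 0
    then show ?case by (simp add: several_holomorphic_continuous_on)
  next
    case (Suc k)
    show ?case
      by (rule Ck_on_SucI[OF Suc.prems(2) several_holomorphic_onD(1)[OF Suc.prems(1)]])
         (use Suc several_holomorphic_frechet_derivative in auto)
  qed
  then show ?thesis by (simp add: smooth_on_def)
qed

section \<open>Linear differential equations\<close>

text \<open>The equation expresses \<open>U'\<close> by \<open>U\<close> and smooth data, so a solution that is \<open>k\<close> times differentiable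
  is \<open>k + 1\<close> times differentiable.\<close>

lemma smooth_on_ode_solution:
  fixes U :: "real \<Rightarrow> 'a::euclidean_space \<Rightarrow>\<^sub>L 'a"
  assumes "open T" "smooth_on T A"
    "\<And>t. t \<in> T \<Longrightarrow> (U has_vector_derivative A t o\<^sub>L U t) (at t)"
  shows "smooth_on T U"
proof -
  have "Ck_on k T U" for k
  proof (induction k)
    case 0
    then show ?case
      using assms(3) by (auto intro!: continuous_at_imp_continuous_on has_vector_derivative_continuous)
  next
    case (Suc k)
    have "Ck_on k T (\<lambda>t. r *\<^sub>R (A t o\<^sub>L U t))" for r
      using assms(2) Suc assms(1)
      by (intro Ck_on_compose_linear[OF bounded_linear_scaleR_right]
          Ck_on_bilinear[OF bounded_bilinear_blinfun_compose]) (auto simp: smooth_on_def)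
    then show ?case
      by (intro Ck_on_SucI[OF assms(1) assms(3)[unfolded has_vector_derivative_def]])
  qed
  then show ?thesis by (simp add: smooth_on_def)
qed

text \<open>The contraction principle is applied with initial value 1 at the left end of a short interval,
  where the operator is a contraction by 1/4. This also keeps the solution within distance 1/2 of the
  identity, hence invertible; multiplication by the inverse of the value at 0 then normalizes it.\<close>

lemma linear_ode_exists:
  fixes A :: "real \<Rightarrow> 'a::euclidean_space \<Rightarrow>\<^sub>L 'a"
  assumes T: "open T" "0 \<in> T" and A: "smooth_on T A"
  obtains \<delta> U where "\<delta> > 0" "{-\<delta><..<\<delta>} \<subseteq> T" "U 0 = id_blinfun" "smooth_on {-\<delta><..<\<delta>} U"
    "\<And>t. t \<in> {-\<delta><..<\<delta>} \<Longrightarrow> invertible_op (U t)"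
    "\<And>t. t \<in> {-\<delta><..<\<delta>} \<Longrightarrow> (U has_vector_derivative A t o\<^sub>L U t) (at t)"
proof -
  obtain e where e: "e > 0" "cball 0 e \<subseteq> T"
    using T open_contains_cball by blast
  then have eT: "{-e..e} \<subseteq> T" by (auto simp: subset_iff dist_norm)
  have contA: "continuous_on T A" using A by (rule smooth_on_continuous_on)
  have "compact (A ` {-e..e})"
    using continuous_on_subset[OF contA eT] compact_Icc by (rule compact_continuous_image)
  then have "bounded (A ` {-e..e})" by (rule compact_imp_bounded)
  then obtain C where "C > 0" "\<forall>x\<in>A ` {-e..e}. norm x \<le> C"
    unfolding bounded_pos by blast
  then have C: "C > 0" "\<And>t. t \<in> {-e..e} \<Longrightarrow> norm (A t) \<le> C" by auto
  \<comment> \<open>The interval has length \<open>2 \<delta>\<close>, which makes the integral operator a contraction by 1/4.\<close>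
  define \<delta> where "\<delta> = min e (1 / (8 * C))"
  have "\<delta> \<le> 1 / (8 * C)" by (simp add: \<delta>_def)
  then have "\<delta> * (8 * C) \<le> 1" using C(1) by (simp add: pos_le_divide_eq)
  then have \<delta>: "\<delta> > 0" "\<delta> \<le> e" "2 * \<delta> * C \<le> 1/4"
    using e(1) C(1) by (auto simp: \<delta>_def)
  have \<delta>T: "{-\<delta>..\<delta>} \<subseteq> T" using \<delta> eT by auto
  have CA: "norm (A t) \<le> C" if "t \<in> {-\<delta>..\<delta>}" for t using C(2) \<delta> that by auto
  define c where "c = (\<lambda>t. max (-\<delta>) (min \<delta> t))"
  have c: "c t \<in> {-\<delta>..\<delta>}" for t using \<delta> by (auto simp: c_def)
  have c_id: "c t = t" if "t \<in> {-\<delta>..\<delta>}" for t using that by (auto simp: c_def)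
  have contc: "continuous_on UNIV c" unfolding c_def by (intro continuous_intros)
  have contW: "continuous_on {-\<delta>..\<delta>} (\<lambda>s. A s o\<^sub>L f s)" if "continuous_on UNIV f" for f :: "real \<Rightarrow> 'a \<Rightarrow>\<^sub>L 'a"
    by (rule bounded_bilinear.continuous_on[OF bounded_bilinear_blinfun_compose
        continuous_on_subset[OF contA \<delta>T] continuous_on_subset[OF that subset_UNIV]])
  define I where "I = (\<lambda>(f :: real \<Rightarrow> 'a \<Rightarrow>\<^sub>L 'a) t. integral {-\<delta>..c t} (\<lambda>s. A s o\<^sub>L f s))"
  have I_bound: "norm (I f t) \<le> 1/4 * D"
    if "continuous_on UNIV f" "\<And>s. norm (f s) \<le> D" for f :: "real \<Rightarrow> 'a \<Rightarrow>\<^sub>L 'a" and D t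
  proof -
    have D: "D \<ge> 0" using that(2)[of 0] norm_ge_zero order_trans by blast
    have "norm (I f t) \<le> (C * D) * (c t - (-\<delta>))"
      unfolding I_def
    proof (rule integral_bound)
      show "- \<delta> \<le> c t" using c[of t] by auto
      show "continuous_on {-\<delta>..c t} (\<lambda>s. A s o\<^sub>L f s)"
        by (rule continuous_on_subset[OF contW[OF that(1)]]) (use c[of t] in auto)
      fix s assume "s \<in> {-\<delta>..c t}"
      then have "norm (A s) \<le> C" using CA c[of t] by auto
      then have "norm (A s) * norm (f s) \<le> C * D" using that(2) C by (intro mult_mono) auto
      then show "norm (A s o\<^sub>L f s) \<le> C * D" using norm_blinfun_compose order_trans by blast
    qed
    also have "\<dots> \<le> (C * D) * (2 * \<delta>)" using c[of t] C D by (intro mult_left_mono) auto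
    also have "\<dots> = (2 * \<delta> * C) * D" by simp
    also have "\<dots> \<le> 1/4 * D" using \<delta>(3) D by (rule mult_right_mono)
    finally show ?thesis .
  qed
  have I_cont: "continuous_on UNIV (I f)" if "continuous_on UNIV f" for f :: "real \<Rightarrow> 'a \<Rightarrow>\<^sub>L 'a"
  proof -
    have "continuous_on {-\<delta>..\<delta>} (\<lambda>t. integral {-\<delta>..t} (\<lambda>s. A s o\<^sub>L f s))"
      by (rule indefinite_integral_continuous_1[OF integrable_continuous_real[OF contW[OF that]]])
    from continuous_on_compose2[OF this contc] c show ?thesis unfolding I_def by blast
  qed
  define \<Phi> where "\<Phi> = (\<lambda>f :: real \<Rightarrow>\<^sub>C ('a \<Rightarrow>\<^sub>L 'a). Bcontfun (\<lambda>t. id_blinfun + I (apply_bcontfun f) t))"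
  have bc: "(\<lambda>t. id_blinfun + I (apply_bcontfun f) t) \<in> bcontfun" for f :: "real \<Rightarrow>\<^sub>C ('a \<Rightarrow>\<^sub>L 'a)"
  proof (rule bcontfun_normI)
    show "continuous_on UNIV (\<lambda>t. id_blinfun + I (apply_bcontfun f) t)"
      by (intro continuous_on_add continuous_on_const I_cont) auto
    show "norm (id_blinfun + I (apply_bcontfun f) t) \<le> norm (id_blinfun :: 'a \<Rightarrow>\<^sub>L 'a) + 1/4 * norm f" for t
      using I_bound[of "apply_bcontfun f" "norm f" t] norm_bounded[of f]
      by (intro norm_triangle_le add_left_mono) auto
  qed
  have \<Phi>: "apply_bcontfun (\<Phi> f) t = id_blinfun + I (apply_bcontfun f) t" for f t
    unfolding \<Phi>_def using bc[of f] by (simp add: Bcontfun_inverse)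
  have I_diff: "I (apply_bcontfun f) t - I (apply_bcontfun h) t = I (apply_bcontfun (f - h)) t" for f h t
  proof -
    have int: "(\<lambda>s. A s o\<^sub>L apply_bcontfun f s) integrable_on {-\<delta>..c t}" for f :: "real \<Rightarrow>\<^sub>C ('a \<Rightarrow>\<^sub>L 'a)"
      by (rule integrable_continuous_real, rule continuous_on_subset[OF contW]) (use c[of t] in auto)
    show ?thesis
      unfolding I_def using integral_diff[OF int[of f] int[of h]]
      by (simp add: bounded_bilinear.diff_right[OF bounded_bilinear_blinfun_compose])
  qed
  have "\<exists>!f. \<Phi> f = f"
  proof (rule banach_fix_type[of "1/4"])
    have "dist (\<Phi> f) (\<Phi> h) \<le> 1/4 * dist f h" for f h
    proof (rule dist_bound)
      fix t
      have "dist (\<Phi> f t) (\<Phi> h t) = norm (I (apply_bcontfun f) t - I (apply_bcontfun h) t)"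
        by (simp add: dist_norm \<Phi>)
      also have "\<dots> \<le> 1/4 * norm (f - h)"
        unfolding I_diff by (rule I_bound) (auto simp: norm_bounded simp del: minus_bcontfun.rep_eq)
      finally show "dist (\<Phi> f t) (\<Phi> h t) \<le> 1/4 * dist f h" by (simp add: dist_norm)
    qed
    then show "\<forall>x y. dist (\<Phi> x) (\<Phi> y) \<le> 1/4 * dist x y" by blast
  qed auto
  then obtain f where f: "\<Phi> f = f" by blast
  define V where "V = apply_bcontfun f"
  have V: "V t = id_blinfun + I V t" for t using \<Phi>[of f t] f by (simp add: V_def)
  have contV: "continuous_on UNIV V" unfolding V_def by auto
  have "norm f \<le> 1 + 1/4 * norm f"
  proof (rule norm_bound)
    fix t
    have "norm (V t) \<le> norm (id_blinfun :: 'a \<Rightarrow>\<^sub>L 'a) + 1/4 * norm f"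
      unfolding V[of t] using I_bound[OF contV, of "norm f" t] norm_bounded[of f]
      by (intro norm_triangle_le add_left_mono) (auto simp: V_def)
    then show "norm (apply_bcontfun f t) \<le> 1 + 1/4 * norm f"
      using norm_blinfun_id_le[where 'a='a] unfolding V_def by linarith
  qed
  then have nf: "norm f \<le> 2" by simp
  have invV: "invertible_op (V t)" for t
  proof (rule invertible_op_perturb(1)[of id_blinfun])
    show "invertible_op (id_blinfun :: 'a \<Rightarrow>\<^sub>L 'a)" by (simp add: invertible_op_def)
    have "binv (id_blinfun :: 'a \<Rightarrow>\<^sub>L 'a) = id_blinfun" by (rule binv_unique) simp
    then have "norm (binv (id_blinfun :: 'a \<Rightarrow>\<^sub>L 'a)) \<le> 1" using norm_blinfun_id_le[where 'a='a] by simp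
    moreover have "norm (V t - id_blinfun) \<le> 1/2"
      using I_bound[OF contV, of "norm f" t] norm_bounded[of f] nf V[of t] by (simp add: V_def)
    ultimately show "norm (binv (id_blinfun :: 'a \<Rightarrow>\<^sub>L 'a)) * norm (V t - id_blinfun) \<le> 1/2"
      using mult_mono[of "norm (binv (id_blinfun :: 'a \<Rightarrow>\<^sub>L 'a))" 1 "norm (V t - id_blinfun)" "1/2"]
      by simp
  qed
  have derV: "(V has_vector_derivative A t o\<^sub>L V t) (at t)" if t: "t \<in> {-\<delta><..<\<delta>}" for t
  proof -
    have "((\<lambda>u. integral {-\<delta>..u} (\<lambda>s. A s o\<^sub>L V s)) has_vector_derivative A t o\<^sub>L V t) (at t within {-\<delta>..\<delta>})"
      using integral_has_vector_derivative[OF contW[OF contV]] t by auto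
    then have "((\<lambda>u. integral {-\<delta>..u} (\<lambda>s. A s o\<^sub>L V s)) has_vector_derivative A t o\<^sub>L V t) (at t)"
      using t at_within_Icc_at[of "-\<delta>" t \<delta>] by auto
    then have "((\<lambda>u. id_blinfun + integral {-\<delta>..u} (\<lambda>s. A s o\<^sub>L V s)) has_vector_derivative A t o\<^sub>L V t) (at t)"
      by (auto intro!: derivative_eq_intros)
    then show ?thesis
    proof (rule has_vector_derivative_transform_within_open[of _ _ _ "{-\<delta><..<\<delta>}"])
      fix u assume "u \<in> {-\<delta><..<\<delta>}"
      then have "c u = u" using c_id by simp
      then show "id_blinfun + integral {-\<delta>..u} (\<lambda>s. A s o\<^sub>L V s) = V u"
        by (subst V[of u]) (simp only: I_def)
    qed (use t in auto)
  qed
  define U where "U = (\<lambda>t. V t o\<^sub>L binv (V 0))"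
  show thesis
  proof (rule that[of \<delta> U])
    show "\<delta> > 0" "{-\<delta><..<\<delta>} \<subseteq> T" using \<delta> \<delta>T by auto
    show "U 0 = id_blinfun"
      unfolding U_def by (rule blinfun_eqI) (simp add: binv_apply[OF invV])
    show derU: "(U has_vector_derivative A t o\<^sub>L U t) (at t)" if "t \<in> {-\<delta><..<\<delta>}" for t

    proof -
      have "A t o\<^sub>L V t o\<^sub>L binv (V 0) = A t o\<^sub>L (V t o\<^sub>L binv (V 0))" by (rule blinfun_eqI) simp
      then show ?thesis
        using bounded_linear.has_vector_derivative[OF bounded_bilinear.bounded_linear_left[OF
            bounded_bilinear_blinfun_compose, of "binv (V 0)"] derV[OF that]]
        by (simp add: U_def)
    qed
    show "smooth_on {-\<delta><..<\<delta>} U"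
      by (rule smooth_on_ode_solution[OF _ smooth_on_subset[OF A] derU]) (use \<delta>T in auto)
    show "invertible_op (U t)" for t
      by (rule invertible_opI[of "V 0 o\<^sub>L binv (V t)"]) (simp add: U_def binv_apply[OF invV])
  qed
qed

section \<open>Smooth bump functions\<close>

text \<open>The derivatives of the standard function \<open>exp (-1/x)\<close> are combinations of these functions, which
  makes the induction on the order of differentiability possible.\<close>

definition flat :: "nat \<Rightarrow> real \<Rightarrow> real" where
  "flat n x = (if x > 0 then inverse x ^ n * exp (- inverse x) else 0)"

lemma flat_tendsto_0: "((\<lambda>x. flat n x) \<longlongrightarrow> 0) (at 0)"
proof -
  have "((\<lambda>x::real. x ^ n / exp x) \<longlongrightarrow> 0) at_top"
    by (rule tendsto_power_div_exp_0)
  then have "((\<lambda>x::real. inverse x ^ n / exp (inverse x)) \<longlongrightarrow> 0) (at_right 0)"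
    by (rule filterlim_compose) (rule filterlim_inverse_at_top_right)
  then have "((\<lambda>x. flat n x) \<longlongrightarrow> 0) (at_right 0)"
    by (rule Lim_transform_eventually)
       (auto simp: eventually_at_right_field flat_def exp_minus field_simps intro!: exI[of _ 1])
  moreover have "((\<lambda>x. flat n x) \<longlongrightarrow> 0) (at_left 0)"
    by (rule Lim_transform_eventually[OF tendsto_const])
       (auto simp: eventually_at_left_field flat_def intro!: exI[of _ "-1"])
  ultimately show ?thesis by (simp add: filterlim_at_split)
qed

lemma flat_derivative:
  "(flat n has_real_derivative (flat (n + 2) x - of_nat n * flat (n + 1) x)) (at x)"
proof (cases x "0::real" rule: linorder_cases)
  case less
  have "((\<lambda>x. 0) has_real_derivative 0) (at x)" by simp
  then have "(flat n has_real_derivative 0) (at x)"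
    by (rule has_field_derivative_transform_within_open[of _ _ _ "{..<0}"])
       (use less in \<open>auto simp: flat_def\<close>)
  then show ?thesis using less by (simp add: flat_def)
next
  case equal
  have "((\<lambda>h. (flat n (0 + h) - flat n 0) / h) \<longlongrightarrow> 0) (at 0)"
    by (rule Lim_transform_eventually[OF flat_tendsto_0[of "Suc n"]])
       (auto simp: eventually_at_filter flat_def field_simps)
  then show ?thesis using equal by (simp add: DERIV_def flat_def)
next
  case greater
  have "((\<lambda>x. inverse x ^ n * exp (- inverse x)) has_real_derivative
      (flat (n + 2) x - of_nat n * flat (n + 1) x)) (at x)"
  proof -
    define y where "y = inverse x"
    have "((\<lambda>y. y ^ n * exp (- y)) has_real_derivative
        (of_nat n * y ^ (n - 1) * exp (- y) - y ^ n * exp (- y))) (at (inverse x))"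
      unfolding y_def by (auto intro!: derivative_eq_intros simp: algebra_simps)
    from DERIV_chain2[OF this DERIV_inverse[of x UNIV]] greater
    have "((\<lambda>x. inverse x ^ n * exp (- inverse x)) has_real_derivative
        (of_nat n * y ^ (n - 1) * exp (- y) - y ^ n * exp (- y)) * - (y * y)) (at x)"
      by (simp add: y_def numeral_2_eq_2)
    moreover have "(of_nat n * y ^ (n - 1) * exp (- y) - y ^ n * exp (- y)) * - (y * y)
        = flat (n + 2) x - of_nat n * flat (n + 1) x"
      using greater by (cases n) (simp_all add: flat_def y_def algebra_simps)
    ultimately show ?thesis by simp
  qed
  then show ?thesis
    by (rule has_field_derivative_transform_within_open[of _ _ _ "{0<..}"])
       (use greater in \<open>auto simp: flat_def\<close>)
qed

lemma smooth_on_flat: "smooth_on UNIV (flat n)"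
proof -
  have "Ck_on k UNIV (flat n)" for k
  proof (induction k arbitrary: n)
    case 0
    then show ?case
      using flat_derivative by (auto intro!: continuous_at_imp_continuous_on DERIV_isCont)
  next
    case (Suc k)
    have "Ck_on k UNIV (\<lambda>x. (flat (n + 2) x + (- of_nat n) *\<^sub>R flat (n + 1) x))" for v
      by (intro Ck_on_add Ck_on_compose_linear[OF bounded_linear_scaleR_right] Suc) auto
    then have "Ck_on k UNIV (\<lambda>x. v *\<^sub>R (flat (n + 2) x + (- of_nat n) *\<^sub>R flat (n + 1) x))" for v
      by (intro Ck_on_compose_linear[OF bounded_linear_scaleR_right]) auto
    then show ?case
      by (intro Ck_on_SucI[OF open_UNIV flat_derivative[unfolded has_field_derivative_def]])
         (simp add: mult.commute)
  qed
  then show ?thesis by (simp add: smooth_on_def)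
qed

lemma smooth_bump_exists:
  assumes "d > (0::real)"
  obtains \<beta> :: "real \<Rightarrow> real" where "smooth_on UNIV \<beta>" "\<beta> 0 = 1" "\<And>t. \<bar>t\<bar> \<ge> d \<Longrightarrow> \<beta> t = 0"
proof -
  define \<beta> where "\<beta> t = flat 0 (d * d - t * t) / flat 0 (d * d)" for t
  have "smooth_on UNIV (\<lambda>t::real. d * d - t * t)"
    by (intro smooth_on_diff smooth_on_const smooth_on_bilinear[OF bounded_bilinear_mult]
        smooth_on_linear bounded_linear_ident) auto
  then have "smooth_on UNIV (\<lambda>t. flat 0 (d * d - t * t))"
    using smooth_on_compose[OF fin_dim_euclidean open_UNIV open_UNIV _ _ smooth_on_flat] by simp
  then have "smooth_on UNIV \<beta>" unfolding \<beta>_def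
    by (intro smooth_on_compose_linear[OF bounded_linear_divide]) auto
  moreover have "\<beta> 0 = 1" using assms by (simp add: \<beta>_def flat_def)
  moreover have "\<beta> t = 0" if "\<bar>t\<bar> \<ge> d" for t
  proof -
    have "d * d \<le> \<bar>t\<bar> * \<bar>t\<bar>" using that assms by (intro mult_mono) auto
    then show ?thesis by (simp add: \<beta>_def flat_def)
  qed
  ultimately show thesis using that by blast
qed

section \<open>Linear algebra of one fiber\<close>

text \<open>A bilinear form on a fiber is represented, in the coordinates of a frame, by the operator \<open>G\<close> for which
  \<open>G a \<bullet> b\<close> is its value; \<open>J\<close> is multiplication by \<open>i\<close>.\<close>

definition herm :: "('a::euclidean_space \<Rightarrow>\<^sub>L 'a) \<Rightarrow> ('a \<Rightarrow>\<^sub>L 'a) \<Rightarrow> bool" where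
  "herm J G \<longleftrightarrow> (\<forall>a. J (J a) = - a) \<and> (\<forall>a b. G a \<bullet> b = G b \<bullet> a) \<and>
     (\<forall>a b. G (J a) \<bullet> J b = G a \<bullet> b) \<and> (\<forall>a. a \<noteq> 0 \<longrightarrow> G a \<bullet> a > 0)"

definition ortho_cs :: "('a::euclidean_space \<Rightarrow>\<^sub>L 'a) \<Rightarrow> ('a \<Rightarrow>\<^sub>L 'a) set" where
  "ortho_cs G = {M. (\<forall>a. blinfun_apply M (M a) = - a) \<and> (\<forall>a b. G (M a) \<bullet> M b = G a \<bullet> b)}"

text \<open>The operator \<open>h\<close> with \<open>g = g'(h -, -)\<close>. Both isomorphisms \<open>1 \<oplus> g\<close> and \<open>1 \<oplus> g'\<close> have the same target,
  and \<open>\<Phi> = (1 \<oplus> g')\<^sup>-\<^sup>1 (1 \<oplus> g)\<close> is 1 on \<open>E\<^sup>1\<^sup>,\<^sup>0\<close> and \<open>h\<close> on \<open>E\<^sup>0\<^sup>,\<^sup>1\<close>.\<close>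

definition ratio_op :: "('a::euclidean_space \<Rightarrow>\<^sub>L 'a) \<Rightarrow> ('a \<Rightarrow>\<^sub>L 'a) \<Rightarrow> 'a \<Rightarrow>\<^sub>L 'a" where
  "ratio_op G G' = binv G' o\<^sub>L G"

text \<open>The real and the imaginary part of \<open>\<Phi> (u + i w)\<close> are \<open>PhR J h u w\<close> and \<open>PhI J h u w\<close>: the projections
  of \<open>u + i w\<close> to \<open>E\<^sup>1\<^sup>,\<^sup>0\<close> and \<open>E\<^sup>0\<^sup>,\<^sup>1\<close> have the real parts \<open>(u + J w)/2\<close> and \<open>(u - J w)/2\<close>.\<close>

definition PhR :: "('a::euclidean_space \<Rightarrow>\<^sub>L 'a) \<Rightarrow> ('a \<Rightarrow>\<^sub>L 'a) \<Rightarrow> 'a \<Rightarrow> 'a \<Rightarrow> 'a" where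
  "PhR J h u w = (1/2) *\<^sub>R (u + J w + h (u - J w))"

definition PhI :: "('a::euclidean_space \<Rightarrow>\<^sub>L 'a) \<Rightarrow> ('a \<Rightarrow>\<^sub>L 'a) \<Rightarrow> 'a \<Rightarrow> 'a \<Rightarrow> 'a" where
  "PhI J h u w = (1/2) *\<^sub>R (w - J u + h (w + J u))"

text \<open>With \<open>P = transport_op J h M\<close> the image under \<open>\<Phi>\<close> of the eigenvector \<open>u + i M u\<close> of \<open>M\<close> has real part
  \<open>P u\<close> and imaginary part \<open>P (M u)\<close>. It is therefore an eigenvector \<open>w + i M' w\<close> of \<open>M' = P M P\<^sup>-\<^sup>1\<close>, which
  is \<open>transport_cs J h M\<close>.\<close>

definition transport_op ::
  "('a::euclidean_space \<Rightarrow>\<^sub>L 'a) \<Rightarrow> ('a \<Rightarrow>\<^sub>L 'a) \<Rightarrow> ('a \<Rightarrow>\<^sub>L 'a) \<Rightarrow> 'a \<Rightarrow>\<^sub>L 'a" where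
  "transport_op J h M = (1/2) *\<^sub>R (id_blinfun + (J o\<^sub>L M) + (h o\<^sub>L (id_blinfun - (J o\<^sub>L M))))"

definition transport_cs ::
  "('a::euclidean_space \<Rightarrow>\<^sub>L 'a) \<Rightarrow> ('a \<Rightarrow>\<^sub>L 'a) \<Rightarrow> ('a \<Rightarrow>\<^sub>L 'a) \<Rightarrow> 'a \<Rightarrow>\<^sub>L 'a" where
  "transport_cs J h M = transport_op J h M o\<^sub>L M o\<^sub>L binv (transport_op J h M)"

lemma transport_op_apply: "transport_op J h M u = (1/2) *\<^sub>R (u + J (M u) + h (u - J (M u)))"
  by (simp add: transport_op_def blinfun.bilinear_simps)

lemma herm_invertible: "herm J G \<Longrightarrow> invertible_op G"
  unfolding herm_def invertible_op_def by (metis inner_zero_left less_irrefl)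

lemma herm_skew: "herm J G \<Longrightarrow> G (J a) \<bullet> b = - (G a \<bullet> J b)"
  unfolding herm_def by (metis blinfun.minus_right inner_minus_right minus_equation_iff)

lemma ortho_cs_skew: "M \<in> ortho_cs G \<Longrightarrow> G (M a) \<bullet> b = - (G a \<bullet> M b)"
  unfolding ortho_cs_def by simp (metis inner_minus_right minus_equation_iff)

lemma herm_eqI:
  assumes "herm J G" "\<And>b. G a \<bullet> b = G a' \<bullet> b"
  shows "a = a'"
proof -
  have "G a = G a'" using assms(2) vector_eq_rdot by blast
  then show ?thesis by (metis assms(1) binv_apply(2) herm_invertible)
qed

lemma ratio_op_apply: "herm J G' \<Longrightarrow> G' (ratio_op G G' a) = G a"
  by (simp add: ratio_op_def binv_apply herm_invertible)

lemma ratio_op_J: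
  assumes "herm J G" "herm J G'"
  shows "ratio_op G G' (J a) = J (ratio_op G G' a)"
  by (rule herm_eqI[OF assms(2)])
     (simp add: ratio_op_apply[OF assms(2)] herm_skew[OF assms(1)] herm_skew[OF assms(2)])

lemma ratio_op_inverse:
  assumes "herm J G" "herm J G'"
  shows "ratio_op G' G (ratio_op G G' a) = a"
  by (rule herm_eqI[OF assms(1)]) (simp add: ratio_op_apply[OF assms(2)] ratio_op_apply[OF assms(1)])

context
  fixes J G G' h M :: "'a::euclidean_space \<Rightarrow>\<^sub>L 'a"
  assumes G: "herm J G" and G': "herm J G'" and h: "h = ratio_op G G'" and M: "M \<in> ortho_cs G"
begin

private lemma JJ: "J (J a) = - a" using G by (simp add: herm_def)
private lemma MM: "M (M a) = - a" using M by (simp add: ortho_cs_def)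
private lemma G'h: "G' (h a) = G a" unfolding h by (rule ratio_op_apply[OF G'])
private lemma hJ: "h (J a) = J (h a)" unfolding h by (rule ratio_op_J[OF G G'])

private lemma sym: "G a \<bullet> b = G b \<bullet> a" "G' a \<bullet> b = G' b \<bullet> a"
  using G G' by (simp_all add: herm_def)

private lemma orth: "G (J a) \<bullet> J b = G a \<bullet> b" "G' (J a) \<bullet> J b = G' a \<bullet> b" "G (M a) \<bullet> M b = G a \<bullet> b"
  using G G' M by (simp_all add: herm_def ortho_cs_def)

text \<open>Isotropy of the space of vectors \<open>u + i M u\<close> for the complex bilinear extension of \<open>G\<close>, written with
  the components of type \<open>(1,0)\<close> and \<open>(0,1)\<close>: only mixed products survive, because \<open>E\<^sup>1\<^sup>,\<^sup>0\<close> and \<open>E\<^sup>0\<^sup>,\<^sup>1\<close> are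
  isotropic.\<close>

private lemma cross: "G (u + J (M u)) \<bullet> (w - J (M w)) + G (u - J (M u)) \<bullet> (w + J (M w)) = 0"
  using orth(1)[of "M u" "M w"] orth(3)[of u w]
  by (simp add: blinfun.bilinear_simps inner_diff_left inner_diff_right inner_add_left inner_add_right)

text \<open>The mixed terms cancel by isotropy, and \<open>G' h = G\<close> turns the form on the \<open>(0,1)\<close>-part into \<open>G\<close>.\<close>

lemma transport_op_metric:
  "4 * (G' (transport_op J h M u) \<bullet> transport_op J h M w) =
     G' (u + J (M u)) \<bullet> (w + J (M w)) + G (u - J (M u)) \<bullet> h (w - J (M w))"
proof -
  define a b c d where "a = u + J (M u)" and "b = u - J (M u)" and "c = w + J (M w)" and "d = w - J (M w)"
  have "4 * (G' (transport_op J h M u) \<bullet> transport_op J h M w) = G' (a + h b) \<bullet> (c + h d)"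
    by (simp add: transport_op_apply a_def b_def c_def d_def blinfun.scaleR_right)
  also have "\<dots> = G' a \<bullet> c + G b \<bullet> h d + (G a \<bullet> d + G b \<bullet> c)"
    by (simp add: blinfun.add_right inner_add_left inner_add_right G'h sym(2)[of a "h d"] sym(1)[of d a])
  also have "G a \<bullet> d + G b \<bullet> c = 0" using cross[of u w] by (simp add: a_def b_def c_def d_def)
  finally show ?thesis by (simp add: a_def b_def c_def d_def)
qed

text \<open>The two summands of the preceding formula are nonnegative for \<open>w = u\<close>. This is where positive
  definiteness enters: it guarantees that the transported isotropic space is again the graph of a real
  complex structure.\<close>

lemma transport_op_invertible: "invertible_op (transport_op J h M)"
  unfolding invertible_op_def
proof safe
  fix u assume "transport_op J h M u = 0"
  then have 0: "G' (u + J (M u)) \<bullet> (u + J (M u)) + G (u - J (M u)) \<bullet> h (u - J (M u)) = 0"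
    using transport_op_metric[of u u] by simp
  have pos: "G' a \<bullet> a \<ge> 0" for a using G' unfolding herm_def by (metis inner_zero_right less_eq_real_def)
  have "G b \<bullet> h b = G' (h b) \<bullet> h b" for b by (simp add: G'h)
  then have z: "G' (u + J (M u)) \<bullet> (u + J (M u)) = 0" "G' (h (u - J (M u))) \<bullet> h (u - J (M u)) = 0"
    using 0 pos[of "u + J (M u)"] pos[of "h (u - J (M u))"] by auto
  have zero: "a = 0" if "G' a \<bullet> a = 0" for a using that G' unfolding herm_def by force
  have "u + J (M u) = 0" "h (u - J (M u)) = 0" using z zero by auto
  moreover have "u - J (M u) = 0"
    using \<open>h (u - J (M u)) = 0\<close> ratio_op_inverse[OF G G', of "u - J (M u)"] by (simp add: h)
  ultimately have "2 *\<^sub>R u = 0" by (metis add.right_neutral add_diff_cancel eq_iff_diff_eq_0 scaleR_2)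
  then show "u = 0" by simp
qed

lemma transport_cs_apply: "transport_cs J h M (transport_op J h M u) = transport_op J h M (M u)"
  by (simp add: transport_cs_def binv_apply[OF transport_op_invertible])

lemma transport_op_PhR: "PhR J h u (M u) = transport_op J h M u"
  by (simp add: PhR_def transport_op_apply)

lemma transport_op_PhI: "PhI J h u (M u) = transport_op J h M (M u)"
  by (simp add: PhI_def transport_op_apply MM blinfun.bilinear_simps)

lemma transport_cs_ortho: "transport_cs J h M \<in> ortho_cs G'"
  unfolding ortho_cs_def
proof safe
  let ?P = "transport_op J h M" and ?K = "transport_cs J h M"
  note inv = binv_apply[OF transport_op_invertible]
  fix a b
  show "?K (?K a) = - a"
    using transport_cs_apply[of "binv ?P a"] transport_cs_apply[of "M (binv ?P a)"]
    by (simp add: inv MM blinfun.minus_right)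
  have "G' (?P (M u)) \<bullet> ?P (M w) = G' (?P u) \<bullet> ?P w" for u w
  proof -
    have 1: "M u + J (M (M u)) = - J (u + J (M u))" "M u - J (M (M u)) = J (u - J (M u))" for u
      by (simp_all add: MM JJ blinfun.bilinear_simps)
    have "4 * (G' (?P (M u)) \<bullet> ?P (M w)) = 4 * (G' (?P u) \<bullet> ?P w)"
      unfolding transport_op_metric 1 by (simp only: hJ orth inner_minus_left inner_minus_right
          blinfun.minus_right minus_minus)
    then show ?thesis by simp
  qed
  from this[of "binv ?P a" "binv ?P b"]
  show "G' (?K a) \<bullet> ?K b = G' a \<bullet> b"
    using transport_cs_apply[of "binv ?P a"] transport_cs_apply[of "binv ?P b"] by (simp add: inv)
qed

text \<open>Exchanging the metrics inverts \<open>transport_op\<close>: in terms of \<open>a = u + J K u\<close> and \<open>b = u - J K u\<close>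
  the value \<open>P u\<close> is \<open>(a + h b) / 2\<close>, and \<open>P u + J K' (P u) = a\<close>, \<open>P u - J K' (P u) = h b\<close>.\<close>

lemma transport_op_inverse:
  "transport_op J (ratio_op G' G) (transport_cs J h M) (transport_op J h M u) = u"
proof -
  let ?P = "transport_op J h M"
  have JP: "J (?P (M u)) = (1/2) *\<^sub>R (u + J (M u) - h (u - J (M u)))"
    by (simp add: transport_op_apply MM JJ hJ[symmetric] blinfun.bilinear_simps)
  have 1: "?P u + J (?P (M u)) = u + J (M u)" "?P u - J (?P (M u)) = h (u - J (M u))"
    unfolding JP unfolding transport_op_apply by (simp_all add: algebra_simps flip: scaleR_left.add)
  have "transport_op J (ratio_op G' G) (transport_cs J h M) (?P u) =
      (1/2) *\<^sub>R (u + J (M u) + (u - J (M u)))"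
    unfolding transport_op_apply[of J "ratio_op G' G"] transport_cs_apply 1
    using ratio_op_inverse[OF G G', of "u - J (M u)"] by (simp add: h)
  then show ?thesis by (simp flip: scaleR_2)
qed

lemma transport_cs_inverse: "transport_cs J (ratio_op G' G) (transport_cs J h M) = M"
proof (rule blinfun_eqI)
  fix a
  let ?P = "transport_op J h M" and ?P' = "transport_op J (ratio_op G' G) (transport_cs J h M)"
  have P': "binv ?P' = ?P"
  proof (rule binv_unique)
    fix b show "?P (?P' b) = b"
      using transport_op_inverse[of "binv ?P b"] by (simp add: binv_apply[OF transport_op_invertible])
  qed
  show "transport_cs J (ratio_op G' G) (transport_cs J h M) a = M a"
    unfolding transport_cs_def[of J "ratio_op G' G"]
    by (simp add: P' transport_cs_apply transport_op_inverse)
qed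

end

subsection \<open>The infinitesimal form of holomorphicity\<close>

text \<open>Let \<open>\<Theta>1\<close> and \<open>\<Theta>2\<close> be the connection forms in directions \<open>v\<close> and \<open>I v\<close>. A tangent vector over \<open>v\<close>
  with matrix component \<open>X\<close> has vertical part \<open>X + [\<Theta>1, M]\<close>; the image under the almost complex
  structure lies over \<open>I v\<close> and has vertical part \<open>M (X + [\<Theta>1, M])\<close>, hence this matrix component.\<close>

definition acs_comp :: "('a::euclidean_space \<Rightarrow>\<^sub>L 'a) \<Rightarrow> ('a \<Rightarrow>\<^sub>L 'a) \<Rightarrow> ('a \<Rightarrow>\<^sub>L 'a) \<Rightarrow> ('a \<Rightarrow>\<^sub>L 'a) \<Rightarrow> 'a \<Rightarrow>\<^sub>L 'a"
  where "acs_comp M \<Theta>1 \<Theta>2 X =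
    (M o\<^sub>L (X + (\<Theta>1 o\<^sub>L M) - (M o\<^sub>L \<Theta>1))) - ((\<Theta>2 o\<^sub>L M) - (M o\<^sub>L \<Theta>2))"

text \<open>A section \<open>u + i M u\<close> of the eigenspace bundle has the derivative
  \<open>(- Y u + \<Theta>1 u - \<Theta>2 (M u)) + i (X u + \<Theta>1 (M u) + \<Theta>2 u)\<close> in the direction \<open>v + i I v\<close>, if \<open>M\<close> changes by \<open>X\<close>
  along \<open>v\<close> and by \<open>Y\<close> along \<open>I v\<close>. The almost complex structure is thus characterized by the
  condition that this derivative stays in the eigenspace, a condition on the \<open>(0,1)\<close>-part of the
  connection only.\<close>

lemma acs_comp_iff:
  assumes "\<And>a. blinfun_apply M (M a) = - a"
  shows "Y = acs_comp M \<Theta>1 \<Theta>2 X \<longleftrightarrow>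
    (\<forall>u. M (- Y u + \<Theta>1 u - \<Theta>2 (M u)) = X u + \<Theta>1 (M u) + \<Theta>2 u)"
proof
  assume Y: "Y = acs_comp M \<Theta>1 \<Theta>2 X"
  show "\<forall>u. M (- Y u + \<Theta>1 u - \<Theta>2 (M u)) = X u + \<Theta>1 (M u) + \<Theta>2 u"
    unfolding Y acs_comp_def using assms by (simp add: blinfun.bilinear_simps)
next
  assume *: "\<forall>u. M (- Y u + \<Theta>1 u - \<Theta>2 (M u)) = X u + \<Theta>1 (M u) + \<Theta>2 u"
  show "Y = acs_comp M \<Theta>1 \<Theta>2 X"
  proof (rule blinfun_eqI)
    fix u
    have "- (- Y u + \<Theta>1 u - \<Theta>2 (M u)) = M (X u + \<Theta>1 (M u) + \<Theta>2 u)"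
      using * assms by metis
    then have "Y u = M (X u + \<Theta>1 (M u) + \<Theta>2 u) + \<Theta>1 u - \<Theta>2 (M u)" by (simp add: algebra_simps)
    then show "Y u = acs_comp M \<Theta>1 \<Theta>2 X u"
      unfolding acs_comp_def using assms by (simp add: blinfun.bilinear_simps)
  qed
qed

text \<open>The last two hypotheses are the real and imaginary part of
  \<open>\<theta>' \<Phi> - \<Phi> \<theta> + d\<Phi>(v) + i d\<Phi>(I v) = 0\<close> with \<open>\<theta> = \<Theta>1 + i \<Theta>2\<close>, that is, \<open>\<Phi>\<close> intertwines the two
  \<open>(0,1)\<close>-connections; \<open>X'\<close>, \<open>Y'\<close> are the derivatives of \<open>P M P\<^sup>-\<^sup>1\<close> and \<open>D1\<close>, \<open>D2\<close> those of \<open>P\<close>. Since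
  \<open>\<Phi>\<close> maps \<open>u + i M u\<close> to \<open>P u + i M' (P u)\<close>, it carries the criterion of the preceding lemma for \<open>M\<close> to
  that for \<open>M'\<close>.\<close>

lemma acs_comp_transport:
  fixes J M M' P h h1 h2 X Y X' Y' D1 D2 \<Theta>1 \<Theta>2 \<Theta>1' \<Theta>2' :: "'a::euclidean_space \<Rightarrow>\<^sub>L 'a"
  assumes JJ: "\<And>a. J (J a) = - a" and MM: "\<And>a. M (M a) = - a" and MM': "\<And>a. M' (M' a) = - a"
    and P: "\<And>u. P u = (1/2) *\<^sub>R (u + J (M u) + h (u - J (M u)))"
    and PM: "\<And>u. M' (P u) = P (M u)" and surj: "invertible_op P"
    and D1: "\<And>u. D1 u = (1/2) *\<^sub>R (J (X u) + h1 (u - J (M u)) - h (J (X u)))"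
    and D2: "\<And>u. D2 u = (1/2) *\<^sub>R (J (Y u) + h2 (u - J (M u)) - h (J (Y u)))"
    and X: "\<And>u. X (M u) = - M (X u)" and Y: "\<And>u. Y (M u) = - M (Y u)"
    and X': "\<And>u. X' (P u) + M' (D1 u) = D1 (M u) + P (X u)"
    and Y': "\<And>u. Y' (P u) + M' (D2 u) = D2 (M u) + P (Y u)"
    and Ydef: "Y = acs_comp M \<Theta>1 \<Theta>2 X"
    and R: "\<And>u w. \<Theta>1' (PhR J h u w) - \<Theta>2' (PhI J h u w) =
        PhR J h (\<Theta>1 u - \<Theta>2 w) (\<Theta>1 w + \<Theta>2 u) - (1/2) *\<^sub>R (h1 (u - J w) - h2 (w + J u))"
    and I: "\<And>u w. \<Theta>1' (PhI J h u w) + \<Theta>2' (PhR J h u w) =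
        PhI J h (\<Theta>1 u - \<Theta>2 w) (\<Theta>1 w + \<Theta>2 u) - (1/2) *\<^sub>R (h1 (w + J u) + h2 (u - J w))"
  shows "Y' = acs_comp M' \<Theta>1' \<Theta>2' X'"
  unfolding acs_comp_iff[OF MM']
proof
  fix a
  define u where "u = binv P a"
  have a: "a = P u" by (simp add: u_def binv_apply[OF surj])
  \<comment> \<open>The derivative of the eigenspace section at \<open>u\<close> is \<open>t + i M t\<close>.\<close>
  define t where "t = - Y u + \<Theta>1 u - \<Theta>2 (M u)"
  have Mt: "M t = X u + \<Theta>1 (M u) + \<Theta>2 u"
    using Ydef unfolding acs_comp_iff[OF MM] t_def by blast
  have PhR: "PhR J h u (M u) = P u" for u by (simp add: PhR_def P)
  have PhI: "PhI J h u (M u) = M' (P u)" for u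
    unfolding PM by (simp add: PhI_def P MM blinfun.bilinear_simps)
  have PhR_add: "PhR J h (u + u') (w + w') = PhR J h u w + PhR J h u' w'" for u u' w w'
    by (simp add: PhR_def blinfun.bilinear_simps algebra_simps)
  have PhI_add: "PhI J h (u + u') (w + w') = PhI J h u w + PhI J h u' w'" for u u' w w'
    by (simp add: PhI_def blinfun.bilinear_simps algebra_simps)
  have D1R: "(1/2) *\<^sub>R h1 (u - J (M u)) + PhR J h 0 (X u) = D1 u"
    by (simp add: D1 PhR_def blinfun.bilinear_simps algebra_simps)
  have D1I: "(1/2) *\<^sub>R h1 (M u + J u) + PhI J h 0 (X u) = M' (D1 u) + X' (P u)"
    using X'[of u] by (simp add: D1 PhI_def P X MM blinfun.bilinear_simps algebra_simps flip: scaleR_left.add)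
  have D2R: "(1/2) *\<^sub>R h2 (u - J (M u)) + PhR J h 0 (Y u) = D2 u"
    by (simp add: D2 PhR_def blinfun.bilinear_simps algebra_simps)
  have D2I: "(1/2) *\<^sub>R h2 (M u + J u) + PhI J h 0 (Y u) = M' (D2 u) + Y' (P u)"
    using Y'[of u] by (simp add: D2 PhI_def P Y MM blinfun.bilinear_simps algebra_simps flip: scaleR_left.add)
  have i_lin: "PhR J h (- Y u) 0 = - PhI J h 0 (Y u)" "PhI J h (- Y u) 0 = PhR J h 0 (Y u)"
    by (simp_all add: PhR_def PhI_def blinfun.bilinear_simps algebra_simps)
  have tR: "PhR J h t (M t) = PhR J h 0 (X u) - PhI J h 0 (Y u) +
      PhR J h (\<Theta>1 u - \<Theta>2 (M u)) (\<Theta>1 (M u) + \<Theta>2 u)"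
    using PhR_add[of "- Y u" "\<Theta>1 u - \<Theta>2 (M u)" "X u" "\<Theta>1 (M u) + \<Theta>2 u"] PhR_add[of "- Y u" 0 0 "X u"]
    unfolding Mt by (simp add: t_def i_lin algebra_simps)
  have tI: "PhI J h t (M t) = PhI J h 0 (X u) + PhR J h 0 (Y u) +
      PhI J h (\<Theta>1 u - \<Theta>2 (M u)) (\<Theta>1 (M u) + \<Theta>2 u)"
    using PhI_add[of "- Y u" "\<Theta>1 u - \<Theta>2 (M u)" "X u" "\<Theta>1 (M u) + \<Theta>2 u"] PhI_add[of "- Y u" 0 0 "X u"]
    unfolding Mt by (simp add: t_def i_lin algebra_simps)
  have "- Y' (P u) + \<Theta>1' (P u) - \<Theta>2' (M' (P u)) = P t - (D1 u - M' (D2 u))"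
  proof -
    have 1: "(1/2) *\<^sub>R (h1 (u - J (M u)) - h2 (M u + J u)) =
        (D1 u - PhR J h 0 (X u)) - (M' (D2 u) + Y' (P u) - PhI J h 0 (Y u))"
      by (simp only: D1R[symmetric] D2I[symmetric]) (simp add: scaleR_right_diff_distrib)
    have 2: "PhR J h (\<Theta>1 u - \<Theta>2 (M u)) (\<Theta>1 (M u) + \<Theta>2 u) = P t - PhR J h 0 (X u) + PhI J h 0 (Y u)"
      using tR unfolding PhR by simp
    have "- Y' (P u) + \<Theta>1' (P u) - \<Theta>2' (M' (P u)) = - Y' (P u) + (\<Theta>1' (P u) - \<Theta>2' (M' (P u)))"
      by simp
    then show ?thesis
      using R[of u "M u"] unfolding PhR PhI 1 2 by simp
  qed
  moreover have "X' (P u) + \<Theta>1' (M' (P u)) + \<Theta>2' (P u) = M' (P t) - (M' (D1 u) + D2 u)"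
  proof -
    have 1: "(1/2) *\<^sub>R (h1 (M u + J u) + h2 (u - J (M u))) =
        (M' (D1 u) + X' (P u) - PhI J h 0 (X u)) + (D2 u - PhR J h 0 (Y u))"
      by (simp only: D1I[symmetric] D2R[symmetric]) (simp add: scaleR_right_distrib)
    have 2: "PhI J h (\<Theta>1 u - \<Theta>2 (M u)) (\<Theta>1 (M u) + \<Theta>2 u) =
        M' (P t) - PhI J h 0 (X u) - PhR J h 0 (Y u)"
      using tI unfolding PhI by simp
    have "X' (P u) + \<Theta>1' (M' (P u)) + \<Theta>2' (P u) = X' (P u) + (\<Theta>1' (M' (P u)) + \<Theta>2' (P u))"
      by simp
    then show ?thesis
      using I[of u "M u"] unfolding PhR PhI 1 2 by simp
  qed
  ultimately show "M' (- Y' a + \<Theta>1' a - \<Theta>2' (M' a)) = X' a + \<Theta>1' (M' a) + \<Theta>2' a"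
    unfolding a by (simp add: blinfun.bilinear_simps MM')
qed

text \<open>In a holomorphic frame the Chern form satisfies \<open>\<Gamma>(I v) = J \<Gamma>(v)\<close>. Subtracting from the metric
  condition for \<open>v\<close> at \<open>a\<close> the one for \<open>I v\<close> at \<open>J a\<close> cancels the term \<open>G a \<bullet> \<Gamma> b\<close> and leaves \<open>2 G \<Gamma> a\<close>, which
  determines \<open>\<Gamma>\<close> by the derivatives of \<open>G\<close>. Differentiating \<open>G = G' h\<close> relates those for \<open>G\<close> and \<open>G'\<close>.
  The result says that \<open>h\<close> intertwines the \<open>(0,1)\<close>-parts of the two connections on \<open>E\<^sup>0\<^sup>,\<^sup>1\<close>.\<close>

lemma chern_ratio:
  fixes J G G' h \<Gamma> \<Gamma>' G1 G2 G1' G2' h1 h2 :: "'a::euclidean_space \<Rightarrow>\<^sub>L 'a"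
  assumes G: "herm J G" and G': "herm J G'" and h: "h = ratio_op G G'"
    and d1: "\<And>a b. G1 a \<bullet> b = G (\<Gamma> a) \<bullet> b + G a \<bullet> \<Gamma> b"
    and d2: "\<And>a b. G2 a \<bullet> b = G (J (\<Gamma> a)) \<bullet> b + G a \<bullet> J (\<Gamma> b)"
    and d1': "\<And>a b. G1' a \<bullet> b = G' (\<Gamma>' a) \<bullet> b + G' a \<bullet> \<Gamma>' b"
    and d2': "\<And>a b. G2' a \<bullet> b = G' (J (\<Gamma>' a)) \<bullet> b + G' a \<bullet> J (\<Gamma>' b)"
    and \<Gamma>J: "\<And>a. \<Gamma> (J a) = J (\<Gamma> a)" and \<Gamma>J': "\<And>a. \<Gamma>' (J a) = J (\<Gamma>' a)"
    and h1: "\<And>a. G1' (h a) + G' (h1 a) = G1 a" and h2: "\<And>a. G2' (h a) + G' (h2 a) = G2 a"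
  shows "h (\<Gamma> a) = \<Gamma>' (h a) + (1/2) *\<^sub>R (h1 a - J (h2 a))"
proof (rule herm_eqI[OF G'])
  fix b
  have JJ: "J (J b) = - b" for b using G by (simp add: herm_def)
  have orth: "G (J a) \<bullet> J b = G a \<bullet> b" "G' (J a) \<bullet> J b = G' a \<bullet> b" for a b
    using G G' by (simp_all add: herm_def)
  have 1: "2 * (G (\<Gamma> a) \<bullet> b) = G1 a \<bullet> b + G2 a \<bullet> J b"
    by (simp add: d1 d2 orth \<Gamma>J JJ inner_minus_right)
  have 2: "2 * (G' (\<Gamma>' (h a)) \<bullet> b) = G1' (h a) \<bullet> b + G2' (h a) \<bullet> J b"
    by (simp add: d1' d2' orth \<Gamma>J' JJ inner_minus_right)
  have "2 * (G' (h (\<Gamma> a)) \<bullet> b) = 2 * (G (\<Gamma> a) \<bullet> b)"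
    by (simp add: h ratio_op_apply[OF G'])
  also have "\<dots> = (G1' (h a) + G' (h1 a)) \<bullet> b + (G2' (h a) + G' (h2 a)) \<bullet> J b"
    unfolding 1 h1 h2 ..
  also have "\<dots> = 2 * (G' (\<Gamma>' (h a)) \<bullet> b) + G' (h1 a) \<bullet> b + G' (h2 a) \<bullet> J b"
    unfolding 2 by (simp add: inner_add_left)
  also have "G' (h2 a) \<bullet> J b = - (G' (J (h2 a)) \<bullet> b)" by (simp add: herm_skew[OF G'])
  finally show "G' (h (\<Gamma> a)) \<bullet> b = G' (\<Gamma>' (h a) + (1/2) *\<^sub>R (h1 a - J (h2 a))) \<bullet> b"
    by (simp add: blinfun.bilinear_simps inner_add_left inner_diff_left field_simps)
qed

text \<open>The connection form is \<open>\<Gamma> + \<Delta>1\<close> at \<open>v\<close> and \<open>J \<Gamma> + \<Delta>2\<close> at \<open>I v\<close>. The Chern part \<open>\<Gamma> + i J \<Gamma>\<close> vanishes on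
  \<open>E\<^sup>1\<^sup>,\<^sup>0\<close>, and on \<open>E\<^sup>0\<^sup>,\<^sup>1\<close> the relation between \<open>h\<close>, \<open>\<Gamma>\<close> and \<open>\<Gamma>'\<close> accounts for the derivative of \<open>\<Phi>\<close>; the
  rest \<open>\<Delta>\<close> is intertwined without any derivative.\<close>

lemma intertwine_sum:
  fixes J h h1 h2 \<Gamma> \<Gamma>' \<Delta>1 \<Delta>2 \<Delta>1' \<Delta>2' :: "'a::euclidean_space \<Rightarrow>\<^sub>L 'a"
  assumes JJ: "\<And>a. J (J a) = - a" and hJ: "\<And>a. h (J a) = J (h a)"
    and h1J: "\<And>a. h1 (J a) = J (h1 a)" and h2J: "\<And>a. h2 (J a) = J (h2 a)"
    and \<Gamma>J: "\<And>a. \<Gamma> (J a) = J (\<Gamma> a)" and \<Gamma>J': "\<And>a. \<Gamma>' (J a) = J (\<Gamma>' a)"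
    and ratio: "\<And>a. h (\<Gamma> a) = \<Gamma>' (h a) + (1/2) *\<^sub>R (h1 a - J (h2 a))"
    and R: "\<And>u w. \<Delta>1' (PhR J h u w) - \<Delta>2' (PhI J h u w) = PhR J h (\<Delta>1 u - \<Delta>2 w) (\<Delta>1 w + \<Delta>2 u)"
    and I: "\<And>u w. \<Delta>1' (PhI J h u w) + \<Delta>2' (PhR J h u w) = PhI J h (\<Delta>1 u - \<Delta>2 w) (\<Delta>1 w + \<Delta>2 u)"
  shows "(\<Gamma>' + \<Delta>1') (PhR J h u w) - ((J o\<^sub>L \<Gamma>') + \<Delta>2') (PhI J h u w) =
        PhR J h ((\<Gamma> + \<Delta>1) u - ((J o\<^sub>L \<Gamma>) + \<Delta>2) w) ((\<Gamma> + \<Delta>1) w + ((J o\<^sub>L \<Gamma>) + \<Delta>2) u)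
        - (1/2) *\<^sub>R (h1 (u - J w) - h2 (w + J u))" (is ?R)
    and "(\<Gamma>' + \<Delta>1') (PhI J h u w) + ((J o\<^sub>L \<Gamma>') + \<Delta>2') (PhR J h u w) =
        PhI J h ((\<Gamma> + \<Delta>1) u - ((J o\<^sub>L \<Gamma>) + \<Delta>2) w) ((\<Gamma> + \<Delta>1) w + ((J o\<^sub>L \<Gamma>) + \<Delta>2) u)
        - (1/2) *\<^sub>R (h1 (w + J u) + h2 (u - J w))" (is ?I)
proof -
  have PhR_add: "PhR J h (u + u') (w + w') = PhR J h u w + PhR J h u' w'" for u u' w w'
    by (simp add: PhR_def blinfun.bilinear_simps algebra_simps)
  have PhI_add: "PhI J h (u + u') (w + w') = PhI J h u w + PhI J h u' w'" for u u' w w'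
    by (simp add: PhI_def blinfun.bilinear_simps algebra_simps)
  have cR: "\<Gamma>' (PhR J h u w) - J (\<Gamma>' (PhI J h u w)) = PhR J h (\<Gamma> u - J (\<Gamma> w)) (\<Gamma> w + J (\<Gamma> u))
     - (1/2) *\<^sub>R (h1 (u - J w) - h2 (w + J u))"
  proof -
    have "\<Gamma>' (PhR J h u w) - J (\<Gamma>' (PhI J h u w)) = \<Gamma>' (h (u - J w))"
      by (simp add: PhR_def PhI_def blinfun.bilinear_simps \<Gamma>J' hJ JJ algebra_simps flip: scaleR_left.add)
    moreover have "PhR J h (\<Gamma> u - J (\<Gamma> w)) (\<Gamma> w + J (\<Gamma> u)) = h (\<Gamma> (u - J w))"
      by (simp add: PhR_def blinfun.bilinear_simps \<Gamma>J hJ JJ algebra_simps flip: scaleR_left.add)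
    moreover have "J (h2 (u - J w)) = h2 (w + J u)"
      by (simp add: blinfun.bilinear_simps h2J JJ)
    ultimately show ?thesis by (simp add: ratio algebra_simps)
  qed
  have cI: "\<Gamma>' (PhI J h u w) + J (\<Gamma>' (PhR J h u w)) = PhI J h (\<Gamma> u - J (\<Gamma> w)) (\<Gamma> w + J (\<Gamma> u))
     - (1/2) *\<^sub>R (h1 (w + J u) + h2 (u - J w))"
  proof -
    have "\<Gamma>' (PhI J h u w) + J (\<Gamma>' (PhR J h u w)) = \<Gamma>' (h (w + J u))"
      by (simp add: PhR_def PhI_def blinfun.bilinear_simps \<Gamma>J' hJ JJ algebra_simps flip: scaleR_left.add)
    moreover have "PhI J h (\<Gamma> u - J (\<Gamma> w)) (\<Gamma> w + J (\<Gamma> u)) = h (\<Gamma> (w + J u))"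
      by (simp add: PhI_def blinfun.bilinear_simps \<Gamma>J hJ JJ algebra_simps flip: scaleR_left.add)
    moreover have "J (h2 (w + J u)) = - h2 (u - J w)"
      by (simp add: blinfun.bilinear_simps h2J JJ)
    ultimately show ?thesis by (simp add: ratio algebra_simps)
  qed
  have eq: "((\<Gamma> + \<Delta>1) u - ((J o\<^sub>L \<Gamma>) + \<Delta>2) w) = (\<Gamma> u - J (\<Gamma> w)) + (\<Delta>1 u - \<Delta>2 w)"
    "((\<Gamma> + \<Delta>1) w + ((J o\<^sub>L \<Gamma>) + \<Delta>2) u) = (\<Gamma> w + J (\<Gamma> u)) + (\<Delta>1 w + \<Delta>2 u)"
    by (simp_all add: blinfun.bilinear_simps algebra_simps)
  show ?R
    unfolding eq PhR_add using cR R[of u w] by (simp add: blinfun.bilinear_simps algebra_simps)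
  show ?I
    unfolding eq PhI_add using cI I[of u w] by (simp add: blinfun.bilinear_simps algebra_simps)
qed

section \<open>Complex manifolds in charts\<close>

lemma Ck_on_UN:
  "(\<And>i. i \<in> I \<Longrightarrow> open (U i)) \<Longrightarrow> (\<And>i. i \<in> I \<Longrightarrow> Ck_on k (U i) f) \<Longrightarrow> Ck_on k (\<Union>i\<in>I. U i) f"
proof (induction k arbitrary: f)
  case 0
  then show ?case by (auto intro: continuous_on_open_UN)
qed auto

lemma smooth_on_local:
  assumes "\<And>x. x \<in> S \<Longrightarrow> \<exists>U. open U \<and> x \<in> U \<and> smooth_on U f"
  shows "smooth_on S f"
proof -
  obtain U where U: "\<And>x. x \<in> S \<Longrightarrow> open (U x) \<and> x \<in> U x \<and> smooth_on (U x) f"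
    using assms by metis
  then have "Ck_on k (\<Union>x\<in>S. U x) f" for k
    by (intro Ck_on_UN) (auto simp: smooth_on_def)
  then have "smooth_on (\<Union>x\<in>S. U x) f" by (simp add: smooth_on_def)
  then show ?thesis by (rule smooth_on_subset) (use U in auto)
qed

lemma bounded_linear_axis: "bounded_linear (\<lambda>c. axis k c :: 'a::euclidean_space^'n::finite)"
proof -
  have "linear (\<lambda>c. axis k c :: 'a^'n)"
    by (rule linearI) (auto simp: vec_eq_iff axis_def)
  then show ?thesis by (simp add: linear_conv_bounded_linear)
qed

lemma smooth_on_vecI:
  fixes f :: "'b::real_normed_vector \<Rightarrow> 'a::euclidean_space^'n::finite"
  assumes "open S" "\<And>k. smooth_on S (\<lambda>z. f z $ k)"
  shows "smooth_on S f"
proof -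
  have "f = (\<lambda>z. \<Sum>k\<in>UNIV. axis k (f z $ k))"
    by (auto simp: fun_eq_iff vec_eq_iff axis_def)
  moreover have "smooth_on S (\<lambda>z. \<Sum>k\<in>UNIV. axis k (f z $ k))"
    by (intro smooth_on_sum smooth_on_compose_linear[OF bounded_linear_axis] assms)
  ultimately show ?thesis by simp
qed

locale complex_mfd =
  fixes A :: "('m::topological_space, complex^'n::finite) chart set"
  assumes cm: "complex_manifold A"
begin

lemma chart_open: "c \<in> A \<Longrightarrow> open (fst c)"
  and chart_homeo: "c \<in> A \<Longrightarrow> homeomorphism (fst c) (snd c ` fst c) (snd c) (chart_inv c)"
  and chart_image_open: "c \<in> A \<Longrightarrow> open (snd c ` fst c)"
  using cm unfolding complex_manifold_def by auto

lemma ex_chart: obtains c where "c \<in> A" "x \<in> fst c"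
  using cm unfolding complex_manifold_def by blast

lemma chart_inv_left [simp]: "c \<in> A \<Longrightarrow> x \<in> fst c \<Longrightarrow> chart_inv c (snd c x) = x"
  using chart_homeo unfolding homeomorphism_def by blast

lemma chart_inv_right: "c \<in> A \<Longrightarrow> z \<in> snd c ` fst c \<Longrightarrow> snd c (chart_inv c z) = z"
  and chart_inv_mem: "c \<in> A \<Longrightarrow> z \<in> snd c ` fst c \<Longrightarrow> chart_inv c z \<in> fst c"
  by auto

lemma chart_img_open: "c \<in> A \<Longrightarrow> open U \<Longrightarrow> open (snd c ` (U \<inter> fst c))"
  using homeomorphism_imp_open_map[OF chart_homeo, of c "U \<inter> fst c"] chart_image_open[of c]
  by (metis inf_commute openin_open_Int openin_open_trans)

lemma chart_img_iff: "c \<in> A \<Longrightarrow> z \<in> snd c ` (U \<inter> fst c) \<longleftrightarrow> z \<in> snd c ` fst c \<and> chart_inv c z \<in> U"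
  by force

definition tr where "tr c d = (\<lambda>z. snd d (chart_inv c z))"

text \<open>The factor by which the components of tangent vectors change between two charts.\<close>

definition dtr where "dtr c d x = frechet_derivative (tr c d) (at (snd c x))"

lemma tr_smooth:
  assumes "c \<in> A" "d \<in> A"
  shows "smooth_on (snd c ` (fst d \<inter> fst c)) (tr c d)"
proof -
  have *: "open (snd c ` (fst d \<inter> fst c))" using assms by (intro chart_img_open chart_open)
  have "several_holomorphic_on (snd c ` (fst d \<inter> fst c)) (\<lambda>z. tr c d z $ k)" for k
    using cm assms unfolding complex_manifold_def tr_def by (auto simp: Int_commute)
  then show ?thesis
    using * by (intro smooth_on_vecI several_holomorphic_imp_smooth)
qed

lemma tr_has_derivative:
  assumes "c \<in> A" "d \<in> A" "x \<in> fst c" "x \<in> fst d"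
  shows "(tr c d has_derivative dtr c d x) (at (snd c x))"
  unfolding dtr_def by (rule smooth_on_has_derivative[OF tr_smooth[OF assms(1,2)]]) (use assms in auto)

lemma dtr_linear: "c \<in> A \<Longrightarrow> d \<in> A \<Longrightarrow> x \<in> fst c \<Longrightarrow> x \<in> fst d \<Longrightarrow> linear (dtr c d x)"
  using tr_has_derivative has_derivative_linear by blast

lemma dtr_cscale:
  assumes "c \<in> A" "d \<in> A" "x \<in> fst c" "x \<in> fst d"
  shows "dtr c d x (\<zeta> *s v) = \<zeta> *s dtr c d x v"
proof -
  have "dtr c d x (\<zeta> *s v) $ k = \<zeta> * dtr c d x v $ k" for k
  proof -
    have h: "several_holomorphic_on (snd c ` (fst d \<inter> fst c)) (\<lambda>z. tr c d z $ k)"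
      using cm assms unfolding complex_manifold_def tr_def by (auto simp: Int_commute)
    have "((\<lambda>z. tr c d z $ k) has_derivative (\<lambda>v. dtr c d x v $ k)) (at (snd c x))"
      using bounded_linear.has_derivative[OF bounded_linear_vec_nth tr_has_derivative[OF assms]] .
    then have "frechet_derivative (\<lambda>z. tr c d z $ k) (at (snd c x)) = (\<lambda>v. dtr c d x v $ k)"
      by (metis frechet_derivative_at)
    then show ?thesis
      using several_holomorphic_onD(2)[OF h, of "snd c x" \<zeta> v] assms by (metis IntI imageI)
  qed
  then show ?thesis by (simp add: vec_eq_iff)
qed

lemma velocity_change_chart:
  assumes "c \<in> A" "d \<in> A" "\<gamma> t \<in> fst c" "\<gamma> t \<in> fst d" "open T" "t \<in> T" "\<gamma> ` T \<subseteq> fst c"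
    and der: "((\<lambda>\<tau>. snd c (\<gamma> \<tau>)) has_vector_derivative a) (at t)"
  shows "((\<lambda>\<tau>. snd d (\<gamma> \<tau>)) has_vector_derivative dtr c d (\<gamma> t) a) (at t)"
proof -
  have "((\<lambda>\<tau>. tr c d (snd c (\<gamma> \<tau>))) has_vector_derivative dtr c d (\<gamma> t) a) (at t)"
    using diff_chain_at[OF der[unfolded has_vector_derivative_def] tr_has_derivative[OF assms(1-4)]]
    unfolding has_vector_derivative_def o_def
    by (simp add: linear_cmul[OF dtr_linear[OF assms(1-4)]])
  then show ?thesis
    by (rule has_vector_derivative_transform_within_open[OF _ assms(5,6)])
       (use assms in \<open>auto simp: tr_def image_subset_iff\<close>)
qed

lemma smooth_curve_in_chart:
  assumes "c \<in> A" "open T" "smooth_on T z" "z ` T \<subseteq> snd c ` fst c"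
  shows "smooth_curve A T (\<lambda>t. chart_inv c (z t))"
  unfolding smooth_curve_def
proof (intro conjI ballI)
  show "(\<lambda>t. chart_inv c (z t)) ` T \<subseteq> (\<Union>c\<in>A. fst c)"
    using cm by (auto simp: complex_manifold_def)
  fix d assume d: "d \<in> A"
  have eq: "{t \<in> T. chart_inv c (z t) \<in> fst d} = {t \<in> T. z t \<in> snd c ` (fst d \<inter> fst c)}"
    using assms(4) by (auto simp: chart_img_iff[OF assms(1)])
  have o: "open (snd c ` (fst d \<inter> fst c))" using assms d by (intro chart_img_open chart_open)
  show op: "open {t \<in> T. chart_inv c (z t) \<in> fst d}"
    unfolding eq using continuous_open_preimage[OF smooth_on_continuous_on[OF assms(3)] assms(2) o]
    by (simp add: vimage_def Int_def)
  have "smooth_on {t \<in> T. chart_inv c (z t) \<in> fst d} (\<lambda>t. tr c d (z t))"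
    by (rule smooth_on_compose[OF fin_dim_euclidean op o _ smooth_on_subset[OF assms(3)] tr_smooth[OF assms(1) d]])
       (unfold eq, auto)
  then show "smooth_on {t \<in> T. chart_inv c (z t) \<in> fst d} (\<lambda>t. snd d (chart_inv c (z t)))"
    by (simp add: tr_def)
qed

lemma line_in_chart:
  assumes "c \<in> A" "x \<in> fst c"
  obtains \<epsilon> where "\<epsilon> > 0" "\<And>t. t \<in> {-\<epsilon><..<\<epsilon>} \<Longrightarrow> snd c x + t *\<^sub>R a \<in> snd c ` fst c"
    "smooth_curve A {-\<epsilon><..<\<epsilon>} (\<lambda>t. chart_inv c (snd c x + t *\<^sub>R a))"
proof -
  have "open ((\<lambda>t::real. snd c x + t *\<^sub>R a) -` (snd c ` fst c))"
    by (intro open_vimage chart_image_open assms continuous_intros)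
  moreover have "0 \<in> (\<lambda>t::real. snd c x + t *\<^sub>R a) -` (snd c ` fst c)" using assms by simp
  ultimately obtain \<epsilon> where \<epsilon>: "\<epsilon> > 0" "ball 0 \<epsilon> \<subseteq> (\<lambda>t::real. snd c x + t *\<^sub>R a) -` (snd c ` fst c)"
    by (meson openE)
  then have *: "snd c x + t *\<^sub>R a \<in> snd c ` fst c" if "t \<in> {-\<epsilon><..<\<epsilon>}" for t
    using that by (auto simp: subset_iff dist_norm)
  have "smooth_curve A {-\<epsilon><..<\<epsilon>} (\<lambda>t. chart_inv c (snd c x + t *\<^sub>R a))"
  proof (rule smooth_curve_in_chart[OF assms(1) open_greaterThanLessThan])
    show "smooth_on {-\<epsilon><..<\<epsilon>} (\<lambda>t. snd c x + t *\<^sub>R a)"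
      by (intro smooth_on_add smooth_on_const smooth_on_linear bounded_linear_scaleR_left) auto
  qed (use * in auto)
  then show thesis using that \<epsilon>(1) * by blast
qed

lemma coord_vec_apply:
  assumes "c \<in> A" "x \<in> fst c"
  shows "coord_vec A c x a d = (if d \<in> A \<and> x \<in> fst d then dtr c d x a else 0)"
proof -
  obtain \<epsilon> where \<epsilon>: "\<epsilon> > 0" "\<And>t. t \<in> {-\<epsilon><..<\<epsilon>} \<Longrightarrow> snd c x + t *\<^sub>R a \<in> snd c ` fst c"
    using line_in_chart[OF assms, of a] by blast
  have "((\<lambda>\<tau>. snd c x + \<tau> *\<^sub>R a) has_vector_derivative a) (at 0)"
    by (auto intro!: derivative_eq_intros)
  then have "((\<lambda>\<tau>. snd c (chart_inv c (snd c x + \<tau> *\<^sub>R a))) has_vector_derivative a) (at 0)"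
    by (rule has_vector_derivative_transform_within_open[of _ _ _ "{-\<epsilon><..<\<epsilon>}"])
       (use \<epsilon> assms in \<open>auto simp: chart_inv_right\<close>)
  from velocity_change_chart[OF assms(1) _ _ _ _ _ _ this, of d "{-\<epsilon><..<\<epsilon>}"]
  have "d \<in> A \<Longrightarrow> x \<in> fst d \<Longrightarrow> vector_derivative (\<lambda>t. snd d (chart_inv c (snd c x + t *\<^sub>R a))) (at 0) = dtr c d x a"
    using \<epsilon> assms chart_inv_mem[OF assms(1)] by (intro vector_derivative_at) (simp add: image_subset_iff)
  then show ?thesis
    using assms by (simp add: coord_vec_def velocity_def)
qed

lemma dtr_same: "c \<in> A \<Longrightarrow> x \<in> fst c \<Longrightarrow> dtr c c x a = a"
proof -
  assume c: "c \<in> A" "x \<in> fst c"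
  have "(tr c c has_derivative (\<lambda>h. h)) (at (snd c x))"
    by (rule has_derivative_transform_within_open[of "\<lambda>z. z" _ _ _ "snd c ` fst c"])
       (use c in \<open>auto simp: tr_def intro: chart_image_open\<close>)
  then show ?thesis
    using tr_has_derivative[OF c(1) c(1) c(2) c(2)] has_derivative_unique by metis
qed

lemma coord_vec_same [simp]: "c \<in> A \<Longrightarrow> x \<in> fst c \<Longrightarrow> coord_vec A c x a c = a"
  by (simp add: coord_vec_apply dtr_same)

lemma velocity_eq_coord_vec:
  assumes "smooth_curve A T \<gamma>" "open T" "t \<in> T" "c \<in> A" "\<gamma> t \<in> fst c"
  shows "velocity A \<gamma> t = coord_vec A c (\<gamma> t) (velocity A \<gamma> t c)"
proof
  fix d
  let ?T = "{t\<in>T. \<gamma> t \<in> fst c}"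
  have sm: "open ?T" "smooth_on ?T (\<lambda>t. snd c (\<gamma> t))"
    using assms unfolding smooth_curve_def by auto
  have "((\<lambda>\<tau>. snd c (\<gamma> \<tau>)) has_vector_derivative velocity A \<gamma> t c) (at t)"
    using smooth_on_vector_derivative[OF sm(2), of t] assms by (simp add: velocity_def)
  from velocity_change_chart[OF assms(4) _ assms(5) _ sm(1) _ _ this, of d] assms
  have "d \<in> A \<Longrightarrow> \<gamma> t \<in> fst d \<Longrightarrow> vector_derivative (\<lambda>\<tau>. snd d (\<gamma> \<tau>)) (at t) = dtr c d (\<gamma> t) (velocity A \<gamma> t c)"
    by (intro vector_derivative_at) auto
  then show "velocity A \<gamma> t d = coord_vec A c (\<gamma> t) (velocity A \<gamma> t c) d"
    using assms by (auto simp: velocity_def coord_vec_apply)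
qed

lemma coord_vec_tangent:
  assumes "c \<in> A" "x \<in> fst c"
  shows "coord_vec A c x a \<in> tangent_space A UNIV x"
proof -
  obtain \<epsilon> where "\<epsilon> > 0" "smooth_curve A {-\<epsilon><..<\<epsilon>} (\<lambda>t. chart_inv c (snd c x + t *\<^sub>R a))"
    using line_in_chart[OF assms] by blast
  then show ?thesis
    unfolding tangent_space_def coord_vec_def using assms
    by (auto intro!: exI[of _ \<epsilon>] exI[of _ "\<lambda>t. chart_inv c (snd c x + t *\<^sub>R a)"])
qed

text \<open>A tangent vector assigns components to all charts; it is determined by one of them. Tangent vectors
  can thus be replaced by their coordinates.\<close>

lemma tangent_eq_coord_vec:
  assumes "v \<in> tangent_space A UNIV x" "c \<in> A" "x \<in> fst c"
  shows "v = coord_vec A c x (v c)"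
  using assms velocity_eq_coord_vec unfolding tangent_space_def by fastforce

lemma velocity_tangent:
  assumes "smooth_curve A T \<gamma>" "open T" "t \<in> T"
  shows "velocity A \<gamma> t \<in> tangent_space A UNIV (\<gamma> t)"
proof -
  obtain c where "c \<in> A" "\<gamma> t \<in> fst c" using ex_chart by blast
  then show ?thesis
    using velocity_eq_coord_vec[OF assms] coord_vec_tangent by metis
qed

lemma coord_vec_linear:
  assumes "c \<in> A" "x \<in> fst c"
  shows "coord_vec A c x (a + b) = coord_vec A c x a + coord_vec A c x b"
    "coord_vec A c x (r *\<^sub>R a) = tscale r (coord_vec A c x a)"
    "coord_vec A c x (\<i> *s a) = cplx_I (coord_vec A c x a)"
  using assms linear_add[OF dtr_linear] linear_cmul[OF dtr_linear] dtr_cscale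
  by (auto simp: fun_eq_iff coord_vec_apply tscale_def cplx_I_def)

lemma cplx_I_tangent: "v \<in> tangent_space A UNIV x \<Longrightarrow> cplx_I v \<in> tangent_space A UNIV x"
  by (metis coord_vec_linear(3) coord_vec_tangent ex_chart tangent_eq_coord_vec)

lemma dfun_eq:
  assumes c: "c \<in> A" "x \<in> fst c" and v: "v \<in> tangent_space A UNIV x"
    and D: "((\<lambda>z. f (chart_inv c z)) has_derivative D) (at (snd c x))"
  shows "dfun A f x v = D (v c)"
proof -
  define d where "d = (SOME c. c \<in> A \<and> x \<in> fst c)"
  have d: "d \<in> A" "x \<in> fst d" unfolding d_def by (rule someI2[of _ c]; use c in blast)+
  have s: "tr d c (snd d x) = snd c x" using c d by (simp add: tr_def)
  have "((\<lambda>z. f (chart_inv c (tr d c z))) has_derivative (\<lambda>h. D (dtr d c x h))) (at (snd d x))"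
    using diff_chain_at[OF tr_has_derivative[OF d(1) c(1) d(2) c(2)], of "\<lambda>z. f (chart_inv c z)" D] D
    by (simp add: s o_def)
  then have "((\<lambda>z. f (chart_inv d z)) has_derivative (\<lambda>h. D (dtr d c x h))) (at (snd d x))"
    by (rule has_derivative_transform_within_open[of _ _ _ _ "snd d ` (fst c \<inter> fst d)"])
       (use c d chart_img_open[OF d(1) chart_open[OF c(1)]] in \<open>auto simp: tr_def\<close>)
  then have "dfun A f x v = D (dtr d c x (v d))"
    unfolding dfun_def d_def[symmetric] Let_def by (metis frechet_derivative_at)
  also have "dtr d c x (v d) = v c"
    using tangent_eq_coord_vec[OF v d] c d by (metis coord_vec_apply)
  finally show ?thesis .
qed

lemma smooth_fun_subset: "smooth_fun A U f \<Longrightarrow> V \<subseteq> U \<Longrightarrow> smooth_fun A V f"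
  unfolding smooth_fun_def by (meson Int_mono image_mono order_refl smooth_on_subset)

lemma smooth_fun_has_derivative:
  assumes "smooth_fun A U f" "x \<in> U" "c \<in> A" "x \<in> fst c"
  shows "((\<lambda>z. f (chart_inv c z)) has_derivative
     frechet_derivative (\<lambda>z. f (chart_inv c z)) (at (snd c x))) (at (snd c x))"
  by (rule smooth_on_has_derivative[of "snd c ` (U \<inter> fst c)"])
     (use assms in \<open>auto simp: smooth_fun_def\<close>)

lemma smooth_fun_cong:
  assumes "open U" "\<And>x. x \<in> U \<Longrightarrow> f x = g x" "smooth_fun A U f"
  shows "smooth_fun A U g"
  unfolding smooth_fun_def
proof
  fix c assume c: "c \<in> A"
  show "smooth_on (snd c ` (U \<inter> fst c)) (\<lambda>z. g (chart_inv c z))"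
    by (rule smooth_on_cong[of _ "\<lambda>z. f (chart_inv c z)"])
       (use assms c chart_img_open in \<open>auto simp: smooth_fun_def\<close>)
qed

lemma smooth_fun_const: "open U \<Longrightarrow> smooth_fun A U (\<lambda>x. c)"
  unfolding smooth_fun_def by (intro ballI, rule smooth_on_const) (simp_all add: chart_img_open)

lemma smooth_fun_bilinear:
  "bounded_bilinear b \<Longrightarrow> open U \<Longrightarrow> smooth_fun A U f \<Longrightarrow> smooth_fun A U g \<Longrightarrow>
   smooth_fun A U (\<lambda>x. b (f x) (g x))"
  unfolding smooth_fun_def by (intro ballI, rule smooth_on_bilinear) (simp_all add: chart_img_open)

lemma smooth_fun_linear:
  "bounded_linear L \<Longrightarrow> open U \<Longrightarrow> smooth_fun A U f \<Longrightarrow> smooth_fun A U (\<lambda>x. L (f x))"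
  unfolding smooth_fun_def by (intro ballI, rule smooth_on_compose_linear) (simp_all add: chart_img_open)

lemma smooth_fun_add:
  "open U \<Longrightarrow> smooth_fun A U f \<Longrightarrow> smooth_fun A U g \<Longrightarrow> smooth_fun A U (\<lambda>x. f x + g x)"
  unfolding smooth_fun_def by (intro ballI, rule smooth_on_add) (simp_all add: chart_img_open)

lemma smooth_fun_sum:
  "open U \<Longrightarrow> (\<And>i. i \<in> I \<Longrightarrow> smooth_fun A U (f i)) \<Longrightarrow> smooth_fun A U (\<lambda>x. \<Sum>i\<in>I. f i x)"
  unfolding smooth_fun_def by (intro ballI, rule smooth_on_sum) (simp_all add: chart_img_open)

lemma smooth_fun_vecI:
  "open U \<Longrightarrow> (\<And>k. smooth_fun A U (\<lambda>x. f x $ k :: 'a::euclidean_space)) \<Longrightarrow>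
   smooth_fun A U (f :: 'm \<Rightarrow> 'a^'k::finite)"
  unfolding smooth_fun_def by (intro ballI, rule smooth_on_vecI) (simp_all add: chart_img_open)

lemma smooth_fun_blinfunI:
  fixes M :: "'m \<Rightarrow> 'a::euclidean_space \<Rightarrow>\<^sub>L 'b::euclidean_space"
  shows "open U \<Longrightarrow> (\<And>i. i \<in> Basis \<Longrightarrow> smooth_fun A U (\<lambda>x. M x i)) \<Longrightarrow> smooth_fun A U M"
  unfolding smooth_fun_def by (intro ballI, rule smooth_on_blinfunI) (simp_all add: chart_img_open)

lemma smooth_fun_binv:
  fixes M :: "'m \<Rightarrow> 'a::euclidean_space \<Rightarrow>\<^sub>L 'a"
  shows "open U \<Longrightarrow> smooth_fun A U M \<Longrightarrow> (\<And>x. x \<in> U \<Longrightarrow> invertible_op (M x)) \<Longrightarrow>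
    smooth_fun A U (\<lambda>x. binv (M x))"
  unfolding smooth_fun_def
proof
  fix c assume *: "open U" "\<forall>c\<in>A. smooth_on (snd c ` (U \<inter> fst c)) (\<lambda>z. M (chart_inv c z))"
    "\<And>x. x \<in> U \<Longrightarrow> invertible_op (M x)" "c \<in> A"
  show "smooth_on (snd c ` (U \<inter> fst c)) (\<lambda>z. binv (M (chart_inv c z)))"
    by (rule smooth_on_binv_comp) (use * chart_img_open chart_img_iff[of c] in auto)
qed

lemma holomorphic_fun_smooth: "open U \<Longrightarrow> holomorphic_fun A U f \<Longrightarrow> smooth_fun A U f"
  unfolding smooth_fun_def holomorphic_fun_def
  by (intro ballI, rule several_holomorphic_imp_smooth) (simp_all add: chart_img_open)

lemma holomorphic_dbar_fun:
  assumes "holomorphic_fun A U f" "x \<in> U" and v: "v \<in> tangent_space A UNIV x"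
  shows "dbar_fun A f x v = 0"
proof -
  obtain c where c: "c \<in> A" "x \<in> fst c" using ex_chart by blast
  have "several_holomorphic_on (snd c ` (U \<inter> fst c)) (\<lambda>z. f (chart_inv c z))"
    using assms c by (simp add: holomorphic_fun_def)
  moreover have "snd c x \<in> snd c ` (U \<inter> fst c)" using c assms by blast
  ultimately obtain D where D: "((\<lambda>z. f (chart_inv c z)) has_derivative D) (at (snd c x))"
    "\<And>a v. D (a *s v) = a * D v"
    unfolding several_holomorphic_on_def by blast
  show ?thesis
    unfolding dbar_fun_def dfun_eq[OF c v D(1)] dfun_eq[OF c cplx_I_tangent[OF v] D(1)]
    using D(2)[of \<i> "v c"] by (simp add: cplx_I_def)
qed

lemma curve_fun_derivative:
  assumes \<gamma>: "smooth_curve A T \<gamma>" "open T" "t \<in> T" and f: "smooth_fun A U f" "\<gamma> t \<in> U"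
  shows "((\<lambda>\<tau>. f (\<gamma> \<tau>)) has_vector_derivative dfun A f (\<gamma> t) (velocity A \<gamma> t)) (at t)"
proof -
  obtain c where c: "c \<in> A" "\<gamma> t \<in> fst c" using ex_chart by blast
  let ?T = "{t\<in>T. \<gamma> t \<in> fst c}"
  have sm: "open ?T" "smooth_on ?T (\<lambda>t. snd c (\<gamma> t))"
    using \<gamma> c unfolding smooth_curve_def by auto
  have 1: "((\<lambda>\<tau>. snd c (\<gamma> \<tau>)) has_vector_derivative velocity A \<gamma> t c) (at t)"
    using smooth_on_vector_derivative[OF sm(2), of t] \<gamma> c by (simp add: velocity_def)
  note 2 = smooth_fun_has_derivative[OF f c]
  have "((\<lambda>\<tau>. f (chart_inv c (snd c (\<gamma> \<tau>)))) has_vector_derivative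
      dfun A f (\<gamma> t) (velocity A \<gamma> t)) (at t)"
    using diff_chain_at[OF 1[unfolded has_vector_derivative_def] 2]
    unfolding has_vector_derivative_def o_def dfun_eq[OF c velocity_tangent[OF \<gamma>] 2]
    by (simp add: linear_cmul[OF has_derivative_linear[OF 2]])
  then show ?thesis
    by (rule has_vector_derivative_transform_within_open[OF _ sm(1)]) (use \<gamma> c in auto)
qed

lemma curve_fun_smooth:
  assumes \<gamma>: "smooth_curve A T \<gamma>" "open T" and f: "smooth_fun A U f" "open U" "\<gamma> ` T \<subseteq> U"
  shows "smooth_on T (\<lambda>t. f (\<gamma> t))"
proof (rule smooth_on_local)
  fix t assume t: "t \<in> T"
  obtain c where c: "c \<in> A" "\<gamma> t \<in> fst c" using ex_chart by blast
  let ?T = "{t\<in>T. \<gamma> t \<in> fst c}"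
  have sm: "open ?T" "smooth_on ?T (\<lambda>t. snd c (\<gamma> t))"
    using \<gamma> c unfolding smooth_curve_def by auto
  have "smooth_on ?T (\<lambda>t. f (chart_inv c (snd c (\<gamma> t))))"
    by (rule smooth_on_compose[OF fin_dim_euclidean sm(1) chart_img_open[OF c(1) f(2)] _ sm(2)])
       (use f c in \<open>auto simp: smooth_fun_def\<close>)
  then have "smooth_on ?T (\<lambda>t. f (\<gamma> t))"
    by (rule smooth_on_cong[OF sm(1), rotated]) (use c in auto)
  then show "\<exists>V. open V \<and> t \<in> V \<and> smooth_on V (\<lambda>t. f (\<gamma> t))"
    using sm(1) t c by blast
qed

text \<open>Smoothness of a curve only refers to charts; continuity is recovered by covering the preimage with
  the preimages of open sets in chart images.\<close>

lemma smooth_curve_preimage_open: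
  assumes \<gamma>: "smooth_curve A T \<gamma>" and U: "open U"
  shows "open {t\<in>T. \<gamma> t \<in> U}"
proof -
  have "{t\<in>T. \<gamma> t \<in> U} = (\<Union>c\<in>A. {t\<in>{t\<in>T. \<gamma> t \<in> fst c}. snd c (\<gamma> t) \<in> snd c ` (U \<inter> fst c)})"
  proof (intro set_eqI iffI)
    fix t assume t: "t \<in> {t\<in>T. \<gamma> t \<in> U}"
    obtain c where "c \<in> A" "\<gamma> t \<in> fst c" using ex_chart by blast
    then show "t \<in> (\<Union>c\<in>A. {t\<in>{t\<in>T. \<gamma> t \<in> fst c}. snd c (\<gamma> t) \<in> snd c ` (U \<inter> fst c)})"
      using t by blast
  next
    fix t assume "t \<in> (\<Union>c\<in>A. {t\<in>{t\<in>T. \<gamma> t \<in> fst c}. snd c (\<gamma> t) \<in> snd c ` (U \<inter> fst c)})"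
    then obtain c where c: "c \<in> A" "t \<in> T" "\<gamma> t \<in> fst c" "snd c (\<gamma> t) \<in> snd c ` (U \<inter> fst c)" by blast
    have "chart_inv c (snd c (\<gamma> t)) \<in> U" using c(4) unfolding chart_img_iff[OF c(1)] by blast
    then show "t \<in> {t\<in>T. \<gamma> t \<in> U}" using c by simp
  qed
  moreover have "open {t\<in>{t\<in>T. \<gamma> t \<in> fst c}. snd c (\<gamma> t) \<in> snd c ` (U \<inter> fst c)}" if "c \<in> A" for c
    using continuous_open_preimage[OF smooth_on_continuous_on _ chart_img_open[OF that U],
        of "{t\<in>T. \<gamma> t \<in> fst c}" "\<lambda>t. snd c (\<gamma> t)"] \<gamma> that
    by (simp add: smooth_curve_def vimage_def Int_def)
  ultimately show ?thesis by auto
qed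

lemma smooth_curve_subset:
  assumes "smooth_curve A T \<gamma>" "open T'" "T' \<subseteq> T"
  shows "smooth_curve A T' \<gamma>"
  unfolding smooth_curve_def
proof (intro conjI ballI)
  show "\<gamma> ` T' \<subseteq> (\<Union>c\<in>A. fst c)" using assms unfolding smooth_curve_def by blast
  fix c assume c: "c \<in> A"
  have eq: "{t\<in>T'. \<gamma> t \<in> fst c} = T' \<inter> {t\<in>T. \<gamma> t \<in> fst c}" using assms(3) by auto
  show "open {t\<in>T'. \<gamma> t \<in> fst c}" "smooth_on {t\<in>T'. \<gamma> t \<in> fst c} (\<lambda>t. snd c (\<gamma> t))"
    unfolding eq using assms c unfolding smooth_curve_def by (auto intro: smooth_on_subset)
qed

end

section \<open>Holomorphic bundles in frames\<close>

type_synonym 'r cop = "(complex^'r) \<Rightarrow>\<^sub>L (complex^'r)"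

definition Jop :: "('r::finite) cop" where
  "Jop = Blinfun (\<lambda>a. \<i> *s a)"

lemma Jop_apply [simp]: "Jop a = \<i> *s a"
  unfolding Jop_def by (simp add: bounded_linear_Blinfun_apply bounded_linear_vscale_right)

locale hol_bundle =
  fixes B :: "('m::topological_space, 'n::finite, 'v::real_vector, 'r::finite) hbundle"
  assumes hvb: "holomorphic_vector_bundle B"

sublocale hol_bundle \<subseteq> complex_mfd "charts B"
  using hvb by unfold_locales (simp add: holomorphic_vector_bundle_def)

context hol_bundle
begin

abbreviation isfr where "isfr V e \<equiv> (V, e) \<in> frames B"

lemma fiber_subspace: "subspace (fiber B x)"
  and J_mem: "u \<in> fiber B x \<Longrightarrow> bJ B x u \<in> fiber B x"
  and J_lin: "real_linear_on (fiber B x) (bJ B x)"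
  and JJ: "u \<in> fiber B x \<Longrightarrow> bJ B x (bJ B x u) = - u"
  using hvb[unfolded holomorphic_vector_bundle_def, THEN conjunct2, THEN conjunct1, THEN spec, of x]
  by (auto simp: image_subset_iff)

lemma fiber_add: "u \<in> fiber B x \<Longrightarrow> w \<in> fiber B x \<Longrightarrow> u + w \<in> fiber B x"
  and fiber_scale: "u \<in> fiber B x \<Longrightarrow> r *\<^sub>R u \<in> fiber B x"
  and fiber_0: "0 \<in> fiber B x"
  using fiber_subspace subspace_add subspace_scale subspace_0 by blast+

lemma fiber_neg: "u \<in> fiber B x \<Longrightarrow> - u \<in> fiber B x"
  using fiber_subspace subspace_neg by blast

lemma fiber_diff: "u \<in> fiber B x \<Longrightarrow> w \<in> fiber B x \<Longrightarrow> u - w \<in> fiber B x"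
  using fiber_subspace subspace_diff by blast

lemma J_add: "u \<in> fiber B x \<Longrightarrow> w \<in> fiber B x \<Longrightarrow> bJ B x (u + w) = bJ B x u + bJ B x w"
  and J_scale: "u \<in> fiber B x \<Longrightarrow> bJ B x (r *\<^sub>R u) = r *\<^sub>R bJ B x u"
  using J_lin unfolding real_linear_on_def by blast+

lemma J_neg: "u \<in> fiber B x \<Longrightarrow> bJ B x (- u) = - bJ B x u"
  using J_scale[of u x "-1"] by simp

lemma J_diff: "u \<in> fiber B x \<Longrightarrow> w \<in> fiber B x \<Longrightarrow> bJ B x (u - w) = bJ B x u - bJ B x w"
  using J_add[of u x "- w"] by (simp add: J_neg fiber_neg)

lemma frame_open: "isfr V e \<Longrightarrow> open V"
  and frame_bij: "isfr V e \<Longrightarrow> x \<in> V \<Longrightarrow> bij_betw (comb B e x) UNIV (fiber B x)"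
  using hvb[unfolded holomorphic_vector_bundle_def, THEN conjunct2, THEN conjunct2, THEN conjunct2, THEN conjunct1]
  by auto

lemma ex_frame: obtains V e where "isfr V e" "x \<in> V"
proof -
  have "x \<in> (\<Union>(V, e)\<in>frames B. V)" using hvb unfolding holomorphic_vector_bundle_def by simp
  then show thesis using that by blast
qed

lemma frame_at: obtains V where "isfr V (frame_at B x)" "x \<in> V"
proof -
  obtain V e where "isfr V e" "x \<in> V" by (rule ex_frame)
  then have "(V, e) \<in> frames B \<and> x \<in> fst (V, e)" by simp
  then have "(SOME f. f \<in> frames B \<and> x \<in> fst f) \<in> frames B \<and> x \<in> fst (SOME f. f \<in> frames B \<and> x \<in> fst f)"
    by (rule someI)
  then show thesis
    using that[of "fst (SOME f. f \<in> frames B \<and> x \<in> fst f)"] unfolding frame_at_def by simp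
qed

lemma comb_add: "comb B e x (a + b) = comb B e x a + comb B e x b"
  by (simp add: comb_def fscale_def scaleR_left_distrib sum.distrib algebra_simps)

lemma comb_scale: "comb B e x (r *\<^sub>R a) = r *\<^sub>R comb B e x a"
  by (simp add: comb_def fscale_def scaleR_sum_right scaleR_right_distrib)

lemma comb_0: "comb B e x 0 = 0"
  using comb_scale[of e x 0 0] by simp

lemma comb_neg: "comb B e x (- a) = - comb B e x a"
  using comb_scale[of e x "-1" a] by simp

lemma comb_diff: "comb B e x (a - b) = comb B e x a - comb B e x b"
  using comb_add[of e x a "- b"] by (simp add: comb_neg)

lemma comb_sum: "comb B e x (\<Sum>i\<in>I. f i) = (\<Sum>i\<in>I. comb B e x (f i))"
  by (induction I rule: infinite_finite_induct) (auto simp: comb_add comb_0)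

lemma comb_mem: "isfr V e \<Longrightarrow> x \<in> V \<Longrightarrow> comb B e x a \<in> fiber B x"
  using frame_bij unfolding bij_betw_def by blast

lemma coord_comb: "isfr V e \<Longrightarrow> x \<in> V \<Longrightarrow> coord B e x (comb B e x a) = a"
  using frame_bij unfolding coord_def bij_betw_def by (metis inv_f_f)

lemma comb_coord: "isfr V e \<Longrightarrow> x \<in> V \<Longrightarrow> u \<in> fiber B x \<Longrightarrow> comb B e x (coord B e x u) = u"
  using frame_bij unfolding coord_def bij_betw_def by (metis f_inv_into_f)

lemma coord_unique: "isfr V e \<Longrightarrow> x \<in> V \<Longrightarrow> comb B e x a = u \<Longrightarrow> coord B e x u = a"
  using coord_comb by blast

lemma frame_vec: "comb B e x (axis i 1) = e i x"
proof -
  have "comb B e x (axis i 1) = (\<Sum>j\<in>UNIV. if j = i then e j x else 0)"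
    unfolding comb_def fscale_def axis_def by (intro sum.cong) auto
  then show ?thesis by simp
qed

lemma frame_mem: "isfr V e \<Longrightarrow> x \<in> V \<Longrightarrow> e i x \<in> fiber B x"
  using comb_mem[of V e x "axis i 1"] by (simp add: frame_vec)

lemma fscale_i: "u \<in> fiber B x \<Longrightarrow> bJ B x (fscale B x c u) = fscale B x (\<i> * c) u"
  by (simp add: fscale_def J_add J_scale JJ fiber_add fiber_scale J_mem)

lemma fscale_mem: "u \<in> fiber B x \<Longrightarrow> fscale B x c u \<in> fiber B x"
  by (simp add: fscale_def fiber_add fiber_scale J_mem)

lemma J_sum: "(\<And>i. i \<in> I \<Longrightarrow> f i \<in> fiber B x) \<Longrightarrow>
   bJ B x (\<Sum>i\<in>I. f i) = (\<Sum>i\<in>I. bJ B x (f i)) \<and> (\<Sum>i\<in>I. f i) \<in> fiber B x"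
proof (induction I rule: infinite_finite_induct)
  case (insert i I)
  then show ?case by (simp add: J_add fiber_add)
qed (use J_scale[OF fiber_0, of x 0] fiber_0 in auto)

lemma comb_J:
  assumes "isfr V e" "x \<in> V"
  shows "comb B e x (\<i> *s a) = bJ B x (comb B e x a)"
  unfolding comb_def using J_sum[of UNIV "\<lambda>i. fscale B x (a $ i) (e i x)" x]
    fscale_i[OF frame_mem[OF assms]] fscale_mem[OF frame_mem[OF assms]] by simp

lemma coord_add: "isfr V e \<Longrightarrow> x \<in> V \<Longrightarrow> u \<in> fiber B x \<Longrightarrow> w \<in> fiber B x \<Longrightarrow>
    coord B e x (u + w) = coord B e x u + coord B e x w"
  by (rule coord_unique) (simp_all add: comb_add comb_coord)

lemma coord_scale: "isfr V e \<Longrightarrow> x \<in> V \<Longrightarrow> u \<in> fiber B x \<Longrightarrow>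
    coord B e x (r *\<^sub>R u) = r *\<^sub>R coord B e x u"
  by (rule coord_unique) (simp_all add: comb_scale comb_coord)

lemma coord_J: "isfr V e \<Longrightarrow> x \<in> V \<Longrightarrow> u \<in> fiber B x \<Longrightarrow>
    coord B e x (bJ B x u) = \<i> *s coord B e x u"
  by (rule coord_unique) (simp_all add: comb_J comb_coord)

definition rep :: "('r \<Rightarrow> 'm \<Rightarrow> 'v) \<Rightarrow> 'm \<Rightarrow> ('v \<Rightarrow> 'v) \<Rightarrow> 'r cop" where
  "rep e x K = Blinfun (\<lambda>a. coord B e x (K (comb B e x a)))"

definition unrep :: "('r \<Rightarrow> 'm \<Rightarrow> 'v) \<Rightarrow> 'm \<Rightarrow> ('r cop) \<Rightarrow> 'v \<Rightarrow> 'v" where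
  "unrep e x M = (\<lambda>u. if u \<in> fiber B x then comb B e x (M (coord B e x u)) else 0)"

lemma rep_apply:
  assumes e: "isfr V e" "x \<in> V" and K: "\<And>u. u \<in> fiber B x \<Longrightarrow> K u \<in> fiber B x" "real_linear_on (fiber B x) K"
  shows "rep e x K a = coord B e x (K (comb B e x a))"
    and "comb B e x (rep e x K a) = K (comb B e x a)"
proof -
  have "linear (\<lambda>a. coord B e x (K (comb B e x a)))"
    using K comb_mem[OF e] unfolding real_linear_on_def
    by (intro linearI) (simp_all add: comb_add comb_scale coord_add[OF e] coord_scale[OF e])
  then show 1: "rep e x K a = coord B e x (K (comb B e x a))"
    unfolding rep_def by (simp add: Blinfun_apply_linear)
  show "comb B e x (rep e x K a) = K (comb B e x a)"
    unfolding 1 by (rule comb_coord[OF e K(1)[OF comb_mem[OF e]]])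
qed

lemma End_fiberD: "K \<in> End_fiber B x \<Longrightarrow> u \<in> fiber B x \<Longrightarrow> K u \<in> fiber B x"
    "K \<in> End_fiber B x \<Longrightarrow> real_linear_on (fiber B x) K"
    "K \<in> End_fiber B x \<Longrightarrow> u \<notin> fiber B x \<Longrightarrow> K u = 0"
  unfolding End_fiber_def by blast+

lemma rep_End:
  assumes "isfr V e" "x \<in> V" "K \<in> End_fiber B x"
  shows "rep e x K a = coord B e x (K (comb B e x a))" "comb B e x (rep e x K a) = K (comb B e x a)"
  using rep_apply[OF assms(1,2), of K] End_fiberD[OF assms(3)] by blast+

lemma unrep_End:
  assumes e: "isfr V e" "x \<in> V"
  shows "unrep e x M \<in> End_fiber B x"
  unfolding End_fiber_def unrep_def real_linear_on_def
  by (auto simp: fiber_add fiber_scale comb_mem[OF e] coord_add[OF e] coord_scale[OF e]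
      blinfun.add_right blinfun.scaleR_right comb_add comb_scale)

lemma unrep_apply: "isfr V e \<Longrightarrow> x \<in> V \<Longrightarrow> unrep e x M (comb B e x a) = comb B e x (M a)"
  by (simp add: unrep_def comb_mem coord_comb)

lemma rep_unrep: "isfr V e \<Longrightarrow> x \<in> V \<Longrightarrow> rep e x (unrep e x M) = M"
  by (rule blinfun_eqI) (simp add: rep_End(1)[OF _ _ unrep_End] unrep_apply coord_comb)

lemma End_eqI:
  assumes "isfr V e" "x \<in> V" "K \<in> End_fiber B x" "L \<in> End_fiber B x" "rep e x K = rep e x L"
  shows "K = L"
proof
  fix u
  show "K u = L u"
  proof (cases "u \<in> fiber B x")
    case True
    then have "u = comb B e x (coord B e x u)" using assms by (simp add: comb_coord)
    then show ?thesis using rep_End(2)[OF assms(1,2)] assms(3-5) by metis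
  qed (use End_fiberD(3) assms in metis)
qed

definition tmat :: "('r \<Rightarrow> 'm \<Rightarrow> 'v) \<Rightarrow> ('r \<Rightarrow> 'm \<Rightarrow> 'v) \<Rightarrow> 'm \<Rightarrow> 'r cop" where
  "tmat e e' x = Blinfun (\<lambda>a. coord B e' x (comb B e x a))"

lemma tmat_apply:
  assumes e: "isfr V e" "x \<in> V" and e': "isfr V' e'" "x \<in> V'"
  shows "tmat e e' x a = coord B e' x (comb B e x a)"
proof -
  have "linear (\<lambda>a. coord B e' x (comb B e x a))"
    using comb_mem[OF e] by (intro linearI) (simp_all add: comb_add comb_scale coord_add[OF e'] coord_scale[OF e'])
  then show ?thesis unfolding tmat_def by (simp add: Blinfun_apply_linear)
qed

lemma comb_tmat: "isfr V e \<Longrightarrow> x \<in> V \<Longrightarrow> isfr V' e' \<Longrightarrow> x \<in> V' \<Longrightarrow>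
    comb B e' x (tmat e e' x a) = comb B e x a"
  by (simp add: tmat_apply comb_coord comb_mem)

lemma tmat_coord: "isfr V e \<Longrightarrow> x \<in> V \<Longrightarrow> isfr V' e' \<Longrightarrow> x \<in> V' \<Longrightarrow> u \<in> fiber B x \<Longrightarrow>
    tmat e e' x (coord B e x u) = coord B e' x u"
  by (simp add: tmat_apply comb_coord)

lemma coord_comb_component:
  assumes e: "isfr V e" "x \<in> V" and e': "isfr V' e'" "x \<in> V'"
  shows "coord B e' x (comb B e x a) $ j = (\<Sum>i\<in>UNIV. a $ i * coord B e' x (e i x) $ j)"
proof -
  have 1: "coord B e' x (fscale B x c u) = c *s coord B e' x u" if "u \<in> fiber B x" for c u
  proof -
    have "coord B e' x (fscale B x c u) = Re c *\<^sub>R coord B e' x u + Im c *\<^sub>R (\<i> *s coord B e' x u)"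
      using that by (simp add: fscale_def coord_add[OF e'] coord_scale[OF e'] coord_J[OF e'] fiber_scale J_mem)
    also have "\<dots> = c *s coord B e' x u"
      by (simp add: vec_eq_iff complex_eq_iff)
    finally show ?thesis .
  qed
  have "(\<Sum>i\<in>I. fscale B x (a $ i) (e i x)) \<in> fiber B x \<and>
     coord B e' x (\<Sum>i\<in>I. fscale B x (a $ i) (e i x)) = (\<Sum>i\<in>I. a $ i *s coord B e' x (e i x))" for I
  proof (induction I rule: infinite_finite_induct)
    case (insert i I)
    then show ?case
      using frame_mem[OF e, of i] by (simp add: fiber_add fscale_mem coord_add[OF e'] 1)
  qed (use coord_unique[OF e' comb_0] fiber_0 in auto)
  then show ?thesis unfolding comb_def by simp
qed

text \<open>Transition functions are required to be holomorphic for frames; smoothness of everything that is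
  defined in frames rests on the smoothness of holomorphic functions.\<close>

lemma trans_holomorphic:
  assumes "isfr V e" "isfr V' e'"
  shows "holomorphic_fun (charts B) (V \<inter> V') (\<lambda>x. coord B e' x (e i x) $ j)"
proof -
  have "\<forall>(V, e)\<in>frames B. \<forall>(V', e')\<in>frames B. \<forall>i j.
      holomorphic_fun (charts B) (V \<inter> V') (\<lambda>x. coord B e' x (e i x) $ j)"
    using hvb unfolding holomorphic_vector_bundle_def by (elim conjE)
  from bspec[OF this assms(1), simplified] have "\<forall>(V', e')\<in>frames B. \<forall>i j.
      holomorphic_fun (charts B) (V \<inter> V') (\<lambda>x. coord B e' x (e i x) $ j)" .
  from bspec[OF this assms(2), simplified] show ?thesis by blast
qed

lemma coord_comb_holomorphic:
  assumes e: "isfr V e" and e': "isfr V' e'"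
  shows "holomorphic_fun (charts B) (V \<inter> V') (\<lambda>x. coord B e' x (comb B e x a) $ j)"
  unfolding holomorphic_fun_def
proof
  fix c assume c: "c \<in> charts B"
  let ?S = "snd c ` (V \<inter> V' \<inter> fst c)"
  have h: "several_holomorphic_on ?S (\<lambda>z. coord B e' (chart_inv c z) (e i (chart_inv c z)) $ j)" for i
    using trans_holomorphic[OF e e'] c unfolding holomorphic_fun_def by blast
  have 1: "several_holomorphic_on ?S (\<lambda>z. \<Sum>i\<in>UNIV. a $ i * coord B e' (chart_inv c z) (e i (chart_inv c z)) $ j)"
    unfolding several_holomorphic_on_def
  proof
    fix z assume z: "z \<in> ?S"
    define D where "D i = frechet_derivative (\<lambda>z. coord B e' (chart_inv c z) (e i (chart_inv c z)) $ j) (at z)" for i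
    have D: "((\<lambda>z. coord B e' (chart_inv c z) (e i (chart_inv c z)) $ j) has_derivative D i) (at z)"
      "D i (k *s v) = k * D i v" for i k v
      unfolding D_def using several_holomorphic_onD[OF h z] by blast+
    have "((\<lambda>z. \<Sum>i\<in>UNIV. a $ i * coord B e' (chart_inv c z) (e i (chart_inv c z)) $ j) has_derivative
        (\<lambda>v. \<Sum>i\<in>UNIV. a $ i * D i v)) (at z)"
      by (intro has_derivative_sum has_derivative_mult_right D)
    moreover have "(\<Sum>i\<in>UNIV. a $ i * D i (c *s v)) = c * (\<Sum>i\<in>UNIV. a $ i * D i v)" for c v
      by (simp add: D(2) sum_distrib_left mult_ac)
    ultimately show "\<exists>f'. ((\<lambda>z. \<Sum>i\<in>UNIV. a $ i * coord B e' (chart_inv c z) (e i (chart_inv c z)) $ j)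
        has_derivative f') (at z) \<and> (\<forall>c v. f' (c *s v) = c * f' v)" by blast
  qed
  show "several_holomorphic_on ?S (\<lambda>z. coord B e' (chart_inv c z) (comb B e (chart_inv c z) a) $ j)"
  proof (rule several_holomorphic_on_cong[OF _ _ 1])
    show "open ?S" by (intro chart_img_open c open_Int frame_open[OF e] frame_open[OF e'])
    fix z assume "z \<in> ?S"
    then have "chart_inv c z \<in> V" "chart_inv c z \<in> V'" using chart_img_iff[OF c, of z "V \<inter> V'"] by auto
    then show "(\<Sum>i\<in>UNIV. a $ i * coord B e' (chart_inv c z) (e i (chart_inv c z)) $ j) =
        coord B e' (chart_inv c z) (comb B e (chart_inv c z) a) $ j"
      using coord_comb_component[OF e _ e'] by simp
  qed
qed

lemma tmat_smooth:
  assumes e: "isfr V e" and e': "isfr V' e'"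
  shows "smooth_fun (charts B) (V \<inter> V') (tmat e e')"
proof (rule smooth_fun_blinfunI)
  show o: "open (V \<inter> V')" using frame_open e e' by blast
  fix a :: "complex^'r"
  have "smooth_fun (charts B) (V \<inter> V') (\<lambda>x. coord B e' x (comb B e x a))"
    by (intro smooth_fun_vecI o holomorphic_fun_smooth coord_comb_holomorphic e e')
  then show "smooth_fun (charts B) (V \<inter> V') (\<lambda>x. tmat e e' x a)"
    by (rule smooth_fun_cong[OF o, rotated]) (simp add: tmat_apply[OF e _ e'])
qed

lemma smooth_fun_apply:
  "open U \<Longrightarrow> smooth_fun (charts B) U M \<Longrightarrow> smooth_fun (charts B) U f \<Longrightarrow>
   smooth_fun (charts B) U (\<lambda>x. blinfun_apply (M x) (f x))"
  by (rule smooth_fun_bilinear[OF bounded_bilinear_blinfun_apply])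

lemma smooth_section_comb:
  assumes e: "isfr V e" and U: "open U" "U \<subseteq> V" and f: "smooth_fun (charts B) U f"
  shows "smooth_section B U (\<lambda>x. comb B e x (f x))"
  unfolding smooth_section_def
proof (intro conjI ballI, goal_cases)
  case (1 x)
  then show ?case using comb_mem[OF e] U by blast
next
  case (2 p)
  obtain V' e' where p: "p = (V', e')" by (cases p)
  with 2 have e': "isfr V' e'" by simp
  have o: "open (U \<inter> V')" using U frame_open[OF e'] by blast
  have "smooth_fun (charts B) (U \<inter> V') (\<lambda>x. tmat e e' x (f x))"
    by (rule smooth_fun_apply[OF o smooth_fun_subset[OF tmat_smooth[OF e e']] smooth_fun_subset[OF f]])
       (use U in auto)
  then have "smooth_fun (charts B) (U \<inter> V') (\<lambda>x. coord B e' x (comb B e x (f x)))"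
    by (rule smooth_fun_cong[OF o, rotated]) (use U in \<open>auto simp: tmat_apply[OF e _ e']\<close>)
  then show ?case by (simp add: p)
qed

lemma smooth_section_coord:
  "smooth_section B U s \<Longrightarrow> isfr V e \<Longrightarrow> smooth_fun (charts B) (U \<inter> V) (\<lambda>x. coord B e x (s x))"
  unfolding smooth_section_def by blast

subsection \<open>Metrics in frames\<close>

definition gmat :: "('m \<Rightarrow> 'v \<Rightarrow> 'v \<Rightarrow> real) \<Rightarrow> ('r \<Rightarrow> 'm \<Rightarrow> 'v) \<Rightarrow> 'm \<Rightarrow> 'r cop" where
  "gmat g e x = Blinfun (\<lambda>a. \<Sum>b\<in>Basis. g x (comb B e x a) (comb B e x b) *\<^sub>R b)"

lemma metricD:
  assumes "compatible_metric B g" "u \<in> fiber B x" "w \<in> fiber B x"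
  shows "g x u w = g x w u" "g x (bJ B x u) (bJ B x w) = g x u w" "u \<noteq> 0 \<Longrightarrow> g x u u > 0"
    "real_linear_on (fiber B x) (g x u)"
proof -
  note h = assms(1)[unfolded compatible_metric_def, THEN conjunct1, THEN spec, of x]
  show "g x u w = g x w u" "g x (bJ B x u) (bJ B x w) = g x u w"
    using h[THEN conjunct2, THEN conjunct1] assms(2,3) by blast+
  show "u \<noteq> 0 \<Longrightarrow> g x u u > 0"
    using h[THEN conjunct2, THEN conjunct2] assms(2) by blast
  show "real_linear_on (fiber B x) (g x u)"
    using h[THEN conjunct1] assms(2) by blast
qed

lemma metric_lin:
  assumes "compatible_metric B g" "u \<in> fiber B x" "w \<in> fiber B x" "w' \<in> fiber B x"
  shows "g x u (w + w') = g x u w + g x u w'" "g x u (r *\<^sub>R w) = r * g x u w"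
    "g x (w + w') u = g x w u + g x w' u" "g x (r *\<^sub>R w) u = r * g x w u"
  using metricD(4)[OF assms(1,2,2)] metricD(1)[OF assms(1)] assms(2-4) fiber_add fiber_scale
  unfolding real_linear_on_def by simp_all

lemma metric_sum:
  assumes g: "compatible_metric B g" and u: "u \<in> fiber B x" and f: "\<And>i. i \<in> I \<Longrightarrow> f i \<in> fiber B x"
  shows "g x u (\<Sum>i\<in>I. f i) = (\<Sum>i\<in>I. g x u (f i))"
  using f
proof (induction I rule: infinite_finite_induct)
  case (insert i I)
  then show ?case using J_sum[of I f x] by (simp add: metric_lin(1)[OF g u])
qed (use metric_lin(2)[OF g u fiber_0 fiber_0, of 0] in auto)

lemma gmat_apply:
  assumes e: "isfr V e" "x \<in> V" and g: "compatible_metric B g"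
  shows "gmat g e x a \<bullet> b = g x (comb B e x a) (comb B e x b)"
proof -
  note m = comb_mem[OF e]
  have "linear (\<lambda>a. \<Sum>b\<in>Basis. g x (comb B e x a) (comb B e x b) *\<^sub>R b)"
    by (rule linearI)
       (simp_all add: comb_add comb_scale metric_lin(3,4)[OF g m m m] scaleR_left_distrib sum.distrib scaleR_sum_right)
  then have 1: "gmat g e x a = (\<Sum>b\<in>Basis. g x (comb B e x a) (comb B e x b) *\<^sub>R b)"
    unfolding gmat_def by (simp add: Blinfun_apply_linear)
  have "g x (comb B e x a) (comb B e x b) = g x (comb B e x a) (comb B e x (\<Sum>i\<in>Basis. (b \<bullet> i) *\<^sub>R i))"
    by (simp add: euclidean_representation)
  also have "\<dots> = (\<Sum>i\<in>Basis. g x (comb B e x a) (comb B e x ((b \<bullet> i) *\<^sub>R i)))"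
    unfolding comb_sum by (rule metric_sum[OF g m m])
  also have "\<dots> = (\<Sum>i\<in>Basis. (b \<bullet> i) * g x (comb B e x a) (comb B e x i))"
    by (simp add: comb_scale metric_lin(2)[OF g m m m])
  finally show ?thesis
    unfolding 1 by (simp add: inner_sum_left inner_commute[of b] mult.commute)
qed

lemma gmat_herm:
  assumes e: "isfr V e" "x \<in> V" and g: "compatible_metric B g"
  shows "herm Jop (gmat g e x)"
proof -
  have "comb B e x a \<noteq> 0" if "a \<noteq> 0" for a using that coord_comb[OF e] comb_0 by metis
  moreover have "\<i> *s (\<i> *s a) = - a" for a :: "complex^'r" by (simp add: vec_eq_iff)
  ultimately show ?thesis
    unfolding herm_def gmat_apply[OF e g] Jop_apply comb_J[OF e]
    using metricD[OF g comb_mem[OF e] comb_mem[OF e]] by simp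
qed

lemma gmat_smooth:
  assumes e: "isfr V e" and g: "compatible_metric B g"
  shows "smooth_fun (charts B) V (gmat g e)"
proof (rule smooth_fun_blinfunI)
  show o: "open V" using e by (rule frame_open)
  fix a :: "complex^'r"
  have sec: "smooth_section B V (\<lambda>x. comb B e x a)" for a
    by (rule smooth_section_comb[OF e o order_refl smooth_fun_const[OF o]])
  have 1: "smooth_fun (charts B) V (\<lambda>x. g x (comb B e x a) (comb B e x b))" for b
    using g[unfolded compatible_metric_def, THEN conjunct2, THEN spec, THEN spec, THEN spec, THEN mp]
      sec o by blast
  have "smooth_fun (charts B) V (\<lambda>x. \<Sum>b\<in>Basis. g x (comb B e x a) (comb B e x b) *\<^sub>R b)"
    by (intro smooth_fun_sum o smooth_fun_bilinear[OF bounded_bilinear_scaleR] smooth_fun_const 1)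
  then show "smooth_fun (charts B) V (\<lambda>x. gmat g e x a)"
  proof (rule smooth_fun_cong[OF o, rotated])
    fix x assume x: "x \<in> V"
    show "(\<Sum>b\<in>Basis. g x (comb B e x a) (comb B e x b) *\<^sub>R b) = gmat g e x a"
      unfolding gmat_apply[OF e x g, symmetric] by (rule euclidean_representation)
  qed
qed

subsection \<open>Connections in frames\<close>

definition cform where
  "cform nabla e x v = Blinfun (\<lambda>a. coord B e x (nabla (\<lambda>y. comb B e y a) x v))"

lemma const_section: "isfr V e \<Longrightarrow> smooth_section B V (\<lambda>x. comb B e x a)"
  by (rule smooth_section_comb) (auto intro: frame_open smooth_fun_const)

lemma connD:
  assumes n: "is_connection B nabla" and U: "open U" and s: "smooth_section B U s"
  shows "c \<in> charts B \<Longrightarrow> smooth_section B (U \<inter> fst c) (\<lambda>x. nabla s x (coord_vec (charts B) c x a))"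
    and "x \<in> U \<Longrightarrow> v \<in> tang B x \<Longrightarrow> nabla s x v \<in> fiber B x"
    and "x \<in> U \<Longrightarrow> v \<in> tang B x \<Longrightarrow> w \<in> tang B x \<Longrightarrow> nabla s x (v + w) = nabla s x v + nabla s x w"
    and "x \<in> U \<Longrightarrow> v \<in> tang B x \<Longrightarrow> nabla s x (tscale r v) = r *\<^sub>R nabla s x v"
    and "smooth_section B U t \<Longrightarrow> x \<in> U \<Longrightarrow> v \<in> tang B x \<Longrightarrow>
        nabla (\<lambda>y. s y + t y) x v = nabla s x v + nabla t x v"
    and "smooth_fun (charts B) U f \<Longrightarrow> x \<in> U \<Longrightarrow> v \<in> tang B x \<Longrightarrow>
        nabla (\<lambda>y. f y *\<^sub>R s y) x v = dfun (charts B) f x v *\<^sub>R s x + f x *\<^sub>R nabla s x v"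
    and "(\<And>x. x \<in> U \<Longrightarrow> s x = t x) \<Longrightarrow> x \<in> U \<Longrightarrow> v \<in> tang B x \<Longrightarrow> nabla s x v = nabla t x v"
proof -
  note h = n[unfolded is_connection_def, THEN spec, THEN spec, THEN mp, OF conjI[OF U s]]
  note h2 = h[THEN conjunct2] and h3 = h[THEN conjunct2, THEN conjunct2]
    and h4 = h[THEN conjunct2, THEN conjunct2, THEN conjunct2]
  show "c \<in> charts B \<Longrightarrow> smooth_section B (U \<inter> fst c) (\<lambda>x. nabla s x (coord_vec (charts B) c x a))"
    using h[THEN conjunct1] by blast
  show "x \<in> U \<Longrightarrow> v \<in> tang B x \<Longrightarrow> nabla s x v \<in> fiber B x"
    "x \<in> U \<Longrightarrow> v \<in> tang B x \<Longrightarrow> w \<in> tang B x \<Longrightarrow> nabla s x (v + w) = nabla s x v + nabla s x w"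
    "x \<in> U \<Longrightarrow> v \<in> tang B x \<Longrightarrow> nabla s x (tscale r v) = r *\<^sub>R nabla s x v"
    using h2[THEN conjunct1] by blast+
  show "smooth_section B U t \<Longrightarrow> x \<in> U \<Longrightarrow> v \<in> tang B x \<Longrightarrow>
        nabla (\<lambda>y. s y + t y) x v = nabla s x v + nabla t x v"
    using h3[THEN conjunct1] by blast
  show "smooth_fun (charts B) U f \<Longrightarrow> x \<in> U \<Longrightarrow> v \<in> tang B x \<Longrightarrow>
        nabla (\<lambda>y. f y *\<^sub>R s y) x v = dfun (charts B) f x v *\<^sub>R s x + f x *\<^sub>R nabla s x v"
    using h4[THEN conjunct1] by blast
  show "(\<And>x. x \<in> U \<Longrightarrow> s x = t x) \<Longrightarrow> x \<in> U \<Longrightarrow> v \<in> tang B x \<Longrightarrow> nabla s x v = nabla t x v"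
    using h4[THEN conjunct2] by blast
qed

lemma dfun_const:
  assumes "v \<in> tang B x"
  shows "dfun (charts B) (\<lambda>y. r) x v = 0"
proof -
  obtain c where c: "c \<in> charts B" "x \<in> fst c" by (rule ex_chart)
  show ?thesis by (rule dfun_eq[OF c assms]) (rule has_derivative_const)
qed

lemma dfun_linear:
  assumes L: "bounded_linear L" and f: "smooth_fun (charts B) U f" "x \<in> U" and v: "v \<in> tang B x"
  shows "dfun (charts B) (\<lambda>y. L (f y)) x v = L (dfun (charts B) f x v)"
proof -
  obtain c where c: "c \<in> charts B" "x \<in> fst c" by (rule ex_chart)
  note d = smooth_fun_has_derivative[OF f c]
  show ?thesis
    unfolding dfun_eq[OF c v d] by (rule dfun_eq[OF c v bounded_linear.has_derivative[OF L d]])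
qed

context
  fixes nabla V e
  assumes n: "is_connection B nabla" and e: "isfr V e"
begin

lemma cform_apply:
  assumes x: "x \<in> V" and v: "v \<in> tang B x"
  shows "cform nabla e x v a = coord B e x (nabla (\<lambda>y. comb B e y a) x v)"
    and "comb B e x (cform nabla e x v a) = nabla (\<lambda>y. comb B e y a) x v"
proof -
  note s = connD[OF n frame_open[OF e] const_section[OF e]]
  have mem: "nabla (\<lambda>y. comb B e y a) x v \<in> fiber B x" for a by (rule s(2)[OF x v])
  have "linear (\<lambda>a. coord B e x (nabla (\<lambda>y. comb B e y a) x v))"
  proof (rule linearI)
    fix a b r
    show "coord B e x (nabla (\<lambda>y. comb B e y (a + b)) x v) =
        coord B e x (nabla (\<lambda>y. comb B e y a) x v) + coord B e x (nabla (\<lambda>y. comb B e y b) x v)"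
      unfolding comb_add s(5)[OF const_section[OF e] x v] by (rule coord_add[OF e x mem mem])
    show "coord B e x (nabla (\<lambda>y. comb B e y (r *\<^sub>R a)) x v) =
        r *\<^sub>R coord B e x (nabla (\<lambda>y. comb B e y a) x v)"
      unfolding comb_scale s(6)[OF smooth_fun_const[OF frame_open[OF e]] x v] dfun_const[OF v]
      by (simp add: coord_scale[OF e x mem])
  qed
  then show 1: "cform nabla e x v a = coord B e x (nabla (\<lambda>y. comb B e y a) x v)"
    unfolding cform_def by (simp add: Blinfun_apply_linear)
  show "comb B e x (cform nabla e x v a) = nabla (\<lambda>y. comb B e y a) x v"
    unfolding 1 by (rule comb_coord[OF e x mem])
qed

lemma cform_add:
  assumes x: "x \<in> V" and v: "v \<in> tang B x" "w \<in> tang B x" and vw: "v + w \<in> tang B x"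
  shows "cform nabla e x (v + w) = cform nabla e x v + cform nabla e x w"
proof (rule blinfun_eqI)
  note s = connD[OF n frame_open[OF e] const_section[OF e]]
  fix a show "cform nabla e x (v + w) a = (cform nabla e x v + cform nabla e x w) a"
    unfolding cform_apply(1)[OF x vw] s(3)[OF x v] plus_blinfun.rep_eq cform_apply(1)[OF x v(1)] cform_apply(1)[OF x v(2)]
    by (rule coord_add[OF e x s(2)[OF x v(1)] s(2)[OF x v(2)]])
qed

lemma cform_scale:
  assumes x: "x \<in> V" and v: "v \<in> tang B x" and rv: "tscale r v \<in> tang B x"
  shows "cform nabla e x (tscale r v) = r *\<^sub>R cform nabla e x v"
proof (rule blinfun_eqI)
  note s = connD[OF n frame_open[OF e] const_section[OF e]]
  fix a show "cform nabla e x (tscale r v) a = (r *\<^sub>R cform nabla e x v) a"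
    unfolding cform_apply(1)[OF x rv] s(4)[OF x v] scaleR_blinfun.rep_eq cform_apply(1)[OF x v]
    by (rule coord_scale[OF e x s(2)[OF x v]])
qed

lemma cform_coord_vec:
  assumes x: "x \<in> V" and c: "c \<in> charts B" "x \<in> fst c"
  shows "cform nabla e x (coord_vec (charts B) c x a) =
    (\<Sum>b\<in>Basis. (a \<bullet> b) *\<^sub>R cform nabla e x (coord_vec (charts B) c x b))"
proof -
  have "linear (\<lambda>a. cform nabla e x (coord_vec (charts B) c x a))"
  proof (rule linearI)
    fix a b r
    show "cform nabla e x (coord_vec (charts B) c x (a + b)) =
        cform nabla e x (coord_vec (charts B) c x a) + cform nabla e x (coord_vec (charts B) c x b)"
      using cform_add[OF x coord_vec_tangent[OF c, of a] coord_vec_tangent[OF c, of b]]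
        coord_vec_tangent[OF c, of "a + b"] unfolding coord_vec_linear[OF c] by blast
    show "cform nabla e x (coord_vec (charts B) c x (r *\<^sub>R a)) = r *\<^sub>R cform nabla e x (coord_vec (charts B) c x a)"
      using cform_scale[OF x coord_vec_tangent[OF c, of a]] coord_vec_tangent[OF c, of "r *\<^sub>R a"]
      unfolding coord_vec_linear[OF c] by blast
  qed
  from linear_sum[OF this, of "\<lambda>b. (a \<bullet> b) *\<^sub>R b" Basis] linear_cmul[OF this]
  show ?thesis by (simp add: euclidean_representation)
qed

lemma cform_smooth:
  assumes c: "c \<in> charts B"
  shows "smooth_fun (charts B) (V \<inter> fst c) (\<lambda>x. cform nabla e x (coord_vec (charts B) c x a))"
proof (rule smooth_fun_blinfunI)
  show o: "open (V \<inter> fst c)" using frame_open[OF e] chart_open[OF c] by blast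
  fix b :: "complex^'r"
  have "smooth_section B (V \<inter> fst c) (\<lambda>x. nabla (\<lambda>y. comb B e y b) x (coord_vec (charts B) c x a))"
    by (rule connD(1)[OF n frame_open[OF e] const_section[OF e] c])
  from smooth_section_coord[OF this e]
  have "smooth_fun (charts B) (V \<inter> fst c) (\<lambda>x. coord B e x (nabla (\<lambda>y. comb B e y b) x (coord_vec (charts B) c x a)))"
    by (rule smooth_fun_subset) auto
  then show "smooth_fun (charts B) (V \<inter> fst c) (\<lambda>x. cform nabla e x (coord_vec (charts B) c x a) b)"
    by (rule smooth_fun_cong[OF o, rotated])
       (use cform_apply(1)[OF _ coord_vec_tangent[OF c]] in auto)
qed

text \<open>The Leibniz rule determines a connection on the domain of a frame by its form.\<close>

lemma nabla_comb:
  assumes U: "open U" "U \<subseteq> V" and f: "smooth_fun (charts B) U f" and x: "x \<in> U" and v: "v \<in> tang B x"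
  shows "nabla (\<lambda>y. comb B e y (f y)) x v =
    comb B e x (dfun (charts B) f x v + cform nabla e x v (f x))"
proof -
  have xV: "x \<in> V" using x U by blast
  have sb: "smooth_section B U (\<lambda>y. comb B e y b)" for b
    by (rule smooth_section_comb[OF e U smooth_fun_const[OF U(1)]])
  have fb: "smooth_fun (charts B) U (\<lambda>y. f y \<bullet> b)" for b
    by (rule smooth_fun_linear[OF bounded_linear_inner_left U(1) f])
  have st: "smooth_section B U (\<lambda>y. (f y \<bullet> b) *\<^sub>R comb B e y b)" for b
    unfolding comb_scale[symmetric]
    by (intro smooth_section_comb[OF e U] smooth_fun_bilinear[OF bounded_bilinear_scaleR] fb smooth_fun_const U)
  have summand: "nabla (\<lambda>y. (f y \<bullet> b) *\<^sub>R comb B e y b) x v =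
      comb B e x ((dfun (charts B) f x v \<bullet> b) *\<^sub>R b + cform nabla e x v ((f x \<bullet> b) *\<^sub>R b))" for b
    unfolding connD(6)[OF n U(1) sb fb x v] dfun_linear[OF bounded_linear_inner_left f x v]
    by (simp add: comb_add comb_scale blinfun.scaleR_right cform_apply(2)[OF xV v])
  have "smooth_section B U (\<lambda>y. \<Sum>b\<in>I. (f y \<bullet> b) *\<^sub>R comb B e y b) \<and>
      nabla (\<lambda>y. \<Sum>b\<in>I. (f y \<bullet> b) *\<^sub>R comb B e y b) x v =
      comb B e x (\<Sum>b\<in>I. (dfun (charts B) f x v \<bullet> b) *\<^sub>R b + cform nabla e x v ((f x \<bullet> b) *\<^sub>R b))"
    if "finite I" for I
    using that
  proof (induction I rule: finite_induct)
    case empty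
    have "nabla (\<lambda>y. 0) x v = comb B e x (cform nabla e x v 0)"
      using cform_apply(2)[OF xV v, of 0] by (simp add: comb_0)
    then show ?case
      using sb[of 0] by (simp add: comb_0 blinfun.zero_right)
  next
    case (insert b I)
    have eq: "(\<lambda>y. (f y \<bullet> b) *\<^sub>R comb B e y b + (\<Sum>b\<in>I. (f y \<bullet> b) *\<^sub>R comb B e y b)) =
       (\<lambda>y. comb B e y (\<Sum>b\<in>insert b I. (f y \<bullet> b) *\<^sub>R b))"
      using insert(1,2) by (simp add: comb_sum comb_scale comb_add)
    have "smooth_section B U (\<lambda>y. (f y \<bullet> b) *\<^sub>R comb B e y b + (\<Sum>b\<in>I. (f y \<bullet> b) *\<^sub>R comb B e y b))"
      unfolding eq
      by (intro smooth_section_comb[OF e U] smooth_fun_sum smooth_fun_bilinear[OF bounded_bilinear_scaleR] fb smooth_fun_const U)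
    moreover note connD(5)[OF n U(1) st conjunct1[OF insert.IH] x v, of b]
    ultimately show ?case
      using insert by (simp add: summand comb_add)
  qed
  from this[of Basis] have "nabla (\<lambda>y. \<Sum>b\<in>Basis. (f y \<bullet> b) *\<^sub>R comb B e y b) x v =
      comb B e x (\<Sum>b\<in>Basis. (dfun (charts B) f x v \<bullet> b) *\<^sub>R b + cform nabla e x v ((f x \<bullet> b) *\<^sub>R b))"
    by simp
  moreover have "(\<lambda>y. \<Sum>b\<in>Basis. (f y \<bullet> b) *\<^sub>R comb B e y b) = (\<lambda>y. comb B e y (f y))"
    by (simp add: comb_scale[symmetric] comb_sum[symmetric] euclidean_representation)
  ultimately show ?thesis
    by (simp add: sum.distrib blinfun.sum_right[symmetric] euclidean_representation)
qed

text \<open>The definition of the covariant derivative along a curve singles out one frame at each point. In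
  another frame, the derivative of the transition matrix is the difference between the two
  connection forms, by the Leibniz rule.\<close>

lemma cov_deriv_in_frame:
  assumes \<gamma>: "smooth_curve (charts B) T \<gamma>" "open T" "t \<in> T" and tV: "\<gamma> t \<in> V"
    and \<sigma>: "smooth_section_along B T \<gamma> \<sigma>"
  shows "cov_deriv_along B nabla \<gamma> \<sigma> t = comb B e (\<gamma> t)
    (vector_derivative (\<lambda>\<tau>. coord B e (\<gamma> \<tau>) (\<sigma> \<tau>)) (at t) +
     cform nabla e (\<gamma> t) (velocity (charts B) \<gamma> t) (coord B e (\<gamma> t) (\<sigma> t)))"
proof -
  define e0 where "e0 = frame_at B (\<gamma> t)"
  obtain V0 where e0: "isfr V0 e0" "\<gamma> t \<in> V0" unfolding e0_def by (rule frame_at)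
  define a a0 where "a = (\<lambda>\<tau>. coord B e (\<gamma> \<tau>) (\<sigma> \<tau>))" and "a0 = (\<lambda>\<tau>. coord B e0 (\<gamma> \<tau>) (\<sigma> \<tau>))"
  define v where "v = velocity (charts B) \<gamma> t"
  have v: "v \<in> tang B (\<gamma> t)" unfolding v_def by (rule velocity_tangent[OF \<gamma>])
  have o: "open (V0 \<inter> V)" using frame_open e0 e by blast
  define T' where "T' = {\<tau>\<in>T. \<gamma> \<tau> \<in> V0 \<inter> V}"
  have T': "open T'" "t \<in> T'" unfolding T'_def
    using smooth_curve_preimage_open[OF \<gamma>(1) o] \<gamma>(3) tV e0 by auto
  have "smooth_on {t\<in>T. \<gamma> t \<in> V0} a0" using \<sigma> e0(1) unfolding smooth_section_along_def a0_def by blast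
  then have da0: "(a0 has_vector_derivative vector_derivative a0 (at t)) (at t)"
    by (rule smooth_on_vector_derivative) (use \<gamma>(3) e0 in auto)
  have dT: "((\<lambda>\<tau>. tmat e0 e (\<gamma> \<tau>)) has_vector_derivative dfun (charts B) (tmat e0 e) (\<gamma> t) v) (at t)"
    unfolding v_def by (rule curve_fun_derivative[OF \<gamma> tmat_smooth[OF e0(1) e]]) (use e0 tV in auto)
  have "((\<lambda>\<tau>. tmat e0 e (\<gamma> \<tau>) (a0 \<tau>)) has_vector_derivative
      tmat e0 e (\<gamma> t) (vector_derivative a0 (at t)) + dfun (charts B) (tmat e0 e) (\<gamma> t) v (a0 t)) (at t)"
    by (rule bounded_bilinear.has_vector_derivative[OF bounded_bilinear_blinfun_apply dT da0])
  then have "(a has_vector_derivative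
      tmat e0 e (\<gamma> t) (vector_derivative a0 (at t)) + dfun (charts B) (tmat e0 e) (\<gamma> t) v (a0 t)) (at t)"
  proof (rule has_vector_derivative_transform_within_open[OF _ T'])
    fix \<tau> assume "\<tau> \<in> T'"
    then show "tmat e0 e (\<gamma> \<tau>) (a0 \<tau>) = a \<tau>"
      using \<sigma> unfolding a0_def a_def T'_def smooth_section_along_def
      by (auto intro: tmat_coord[OF e0(1) _ e])
  qed
  then have da: "vector_derivative a (at t) =
      tmat e0 e (\<gamma> t) (vector_derivative a0 (at t)) + dfun (charts B) (tmat e0 e) (\<gamma> t) v (a0 t)"
    by (rule vector_derivative_at)
  have at: "a t = tmat e0 e (\<gamma> t) (a0 t)"
    using \<sigma> \<gamma>(3) unfolding a0_def a_def smooth_section_along_def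
    by (auto intro: tmat_coord[OF e0 e tV, symmetric])
  have "nabla (\<lambda>y. comb B e0 y (a0 t)) (\<gamma> t) v = nabla (\<lambda>y. comb B e y (tmat e0 e y (a0 t))) (\<gamma> t) v"
  proof (rule connD(7)[OF n o])
    show "smooth_section B (V0 \<inter> V) (\<lambda>y. comb B e0 y (a0 t))"
      by (rule smooth_section_comb[OF e0(1) o _ smooth_fun_const[OF o]]) auto
    show "comb B e0 x (a0 t) = comb B e x (tmat e0 e x (a0 t))" if "x \<in> V0 \<inter> V" for x
      using comb_tmat[OF e0(1) _ e] that by auto
  qed (use e0 tV v in auto)
  also have "\<dots> = comb B e (\<gamma> t) (dfun (charts B) (\<lambda>y. tmat e0 e y (a0 t)) (\<gamma> t) v +
      cform nabla e (\<gamma> t) v (tmat e0 e (\<gamma> t) (a0 t)))"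
    by (rule nabla_comb[OF o _ smooth_fun_apply[OF o tmat_smooth[OF e0(1) e] smooth_fun_const[OF o]] _ v])
       (use e0 tV in auto)
  also have "dfun (charts B) (\<lambda>y. tmat e0 e y (a0 t)) (\<gamma> t) v = dfun (charts B) (tmat e0 e) (\<gamma> t) v (a0 t)"
    by (rule dfun_linear[OF blinfun.bounded_linear_left tmat_smooth[OF e0(1) e] _ v]) (use e0 tV in auto)
  finally have "cov_deriv_along B nabla \<gamma> \<sigma> t = comb B e0 (\<gamma> t) (vector_derivative a0 (at t)) +
      comb B e (\<gamma> t) (dfun (charts B) (tmat e0 e) (\<gamma> t) v (a0 t) + cform nabla e (\<gamma> t) v (a t))"
    unfolding cov_deriv_along_def Let_def e0_def[symmetric] v_def[symmetric] at by (simp add: a0_def)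
  also have "comb B e0 (\<gamma> t) (vector_derivative a0 (at t)) = comb B e (\<gamma> t) (tmat e0 e (\<gamma> t) (vector_derivative a0 (at t)))"
    by (rule comb_tmat[OF e0 e tV, symmetric])
  finally show ?thesis
    unfolding a_def[symmetric] v_def[symmetric] using da
    by (simp add: comb_add[symmetric] a_def add.assoc)
qed

end

end

section \<open>Curves of fiber endomorphisms\<close>

context hol_bundle
begin

definition echart :: "('m, complex^'n) chart \<Rightarrow> 'm set \<Rightarrow> ('r \<Rightarrow> 'm \<Rightarrow> 'v) \<Rightarrow>
    ('m \<times> ('v \<Rightarrow> 'v), ('n, 'r) End_model) chart" where
  "echart c V e = ({(x, K). x \<in> fst c \<inter> V \<and> K \<in> End_fiber B x}, \<lambda>(x, K). (snd c x, rep e x K))"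

lemma End_charts_eq: "End_charts B = {echart c V e | c V e. c \<in> charts B \<and> isfr V e}"
  by (simp add: End_charts_def echart_def rep_def)

lemma mem_echart: "p \<in> fst (echart c V e) \<longleftrightarrow> fst p \<in> fst c \<and> fst p \<in> V \<and> snd p \<in> End_fiber B (fst p)"
  by (cases p) (simp add: echart_def)

lemma snd_echart: "snd (echart c V e) p = (snd c (fst p), rep e (fst p) (snd p))"
  by (cases p) (simp add: echart_def)

lemma echart_mem: "c \<in> charts B \<Longrightarrow> isfr V e \<Longrightarrow> echart c V e \<in> End_charts B"
  unfolding End_charts_eq by blast

lemma End_chartsE:
  assumes "C \<in> End_charts B" obtains c V e where "c \<in> charts B" "isfr V e" "C = echart c V e"
  using assms unfolding End_charts_eq by blast

lemma rep_tmat: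
  assumes e: "isfr V e" "x \<in> V" and e': "isfr V' e'" "x \<in> V'" and K: "K \<in> End_fiber B x"
  shows "rep e' x K = tmat e e' x o\<^sub>L rep e x K o\<^sub>L tmat e' e x"
proof (rule blinfun_eqI)
  fix a
  show "rep e' x K a = (tmat e e' x o\<^sub>L rep e x K o\<^sub>L tmat e' e x) a"
    using comb_tmat[OF e' e, of a] rep_End[OF e K, of "tmat e' e x a"]
    by (simp add: rep_End(1)[OF e' K] tmat_apply[OF e e'])
qed

lemma End_curve_mem:
  assumes "smooth_curve (End_charts B) T \<Gamma>" "t \<in> T"
  shows "snd (\<Gamma> t) \<in> End_fiber B (fst (\<Gamma> t))"
proof -
  have "\<Gamma> t \<in> (\<Union>c\<in>End_charts B. fst c)" using assms unfolding smooth_curve_def by blast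
  then show ?thesis by (auto simp: mem_echart elim!: End_chartsE)
qed

lemma End_curve_set:
  assumes "smooth_curve (End_charts B) T \<Gamma>"
  shows "{t\<in>T. \<Gamma> t \<in> fst (echart c V e)} = {t\<in>T. fst (\<Gamma> t) \<in> fst c \<inter> V}"
  using End_curve_mem[OF assms] by (auto simp: mem_echart)

lemma End_curve_local:
  assumes "smooth_curve (End_charts B) T \<Gamma>" "c \<in> charts B" "isfr V e"
  shows "open {t\<in>T. fst (\<Gamma> t) \<in> fst c \<inter> V}"
    "smooth_on {t\<in>T. fst (\<Gamma> t) \<in> fst c \<inter> V} (\<lambda>t. snd c (fst (\<Gamma> t)))"
    "smooth_on {t\<in>T. fst (\<Gamma> t) \<in> fst c \<inter> V} (\<lambda>t. rep e (fst (\<Gamma> t)) (snd (\<Gamma> t)))"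
proof -
  have *: "open {t\<in>T. \<Gamma> t \<in> fst (echart c V e)}"
     "smooth_on {t\<in>T. \<Gamma> t \<in> fst (echart c V e)} (\<lambda>t. snd (echart c V e) (\<Gamma> t))"
    using assms echart_mem[OF assms(2,3)] unfolding smooth_curve_def by blast+
  show o: "open {t\<in>T. fst (\<Gamma> t) \<in> fst c \<inter> V}" using *(1) by (simp add: End_curve_set[OF assms(1)])
  have "smooth_on {t\<in>T. fst (\<Gamma> t) \<in> fst c \<inter> V} (\<lambda>t. (snd c (fst (\<Gamma> t)), rep e (fst (\<Gamma> t)) (snd (\<Gamma> t))))"
    using *(2) by (simp add: End_curve_set[OF assms(1)] snd_echart)
  from smooth_on_compose_linear[OF bounded_linear_fst o this] smooth_on_compose_linear[OF bounded_linear_snd o this]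
  show "smooth_on {t\<in>T. fst (\<Gamma> t) \<in> fst c \<inter> V} (\<lambda>t. snd c (fst (\<Gamma> t)))"
    "smooth_on {t\<in>T. fst (\<Gamma> t) \<in> fst c \<inter> V} (\<lambda>t. rep e (fst (\<Gamma> t)) (snd (\<Gamma> t)))"
    by simp_all
qed

lemma End_curve_base:
  assumes "smooth_curve (End_charts B) T \<Gamma>"
  shows "smooth_curve (charts B) T (\<lambda>t. fst (\<Gamma> t))"
  unfolding smooth_curve_def
proof (intro conjI ballI)
  show "(\<lambda>t. fst (\<Gamma> t)) ` T \<subseteq> (\<Union>c\<in>charts B. fst c)"
  proof
    fix x assume "x \<in> (\<lambda>t. fst (\<Gamma> t)) ` T"
    obtain c where "c \<in> charts B" "x \<in> fst c" by (rule ex_chart)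
    then show "x \<in> (\<Union>c\<in>charts B. fst c)" by blast
  qed
  fix c assume c: "c \<in> charts B"
  have ex: "\<exists>U. open U \<and> t \<in> U \<and> U \<subseteq> {t\<in>T. fst (\<Gamma> t) \<in> fst c} \<and> smooth_on U (\<lambda>t. snd c (fst (\<Gamma> t)))"
    if t: "t \<in> {t\<in>T. fst (\<Gamma> t) \<in> fst c}" for t
  proof -
    obtain V e where e: "isfr V e" "fst (\<Gamma> t) \<in> V" by (rule ex_frame)
    then show ?thesis
      using End_curve_local(1,2)[OF assms c e(1)] t
      by (intro exI[of _ "{t\<in>T. fst (\<Gamma> t) \<in> fst c \<inter> V}"]) auto
  qed
  show "open {t\<in>T. fst (\<Gamma> t) \<in> fst c}" by (subst open_subopen) (use ex in blast)
  show "smooth_on {t\<in>T. fst (\<Gamma> t) \<in> fst c} (\<lambda>t. snd c (fst (\<Gamma> t)))"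
    by (rule smooth_on_local) (use ex in blast)
qed

lemma End_curve_rep:
  assumes "smooth_curve (End_charts B) T \<Gamma>" and e: "isfr V e"
  shows "smooth_on {t\<in>T. fst (\<Gamma> t) \<in> V} (\<lambda>t. rep e (fst (\<Gamma> t)) (snd (\<Gamma> t)))"
proof (rule smooth_on_local)
  fix t assume t: "t \<in> {t\<in>T. fst (\<Gamma> t) \<in> V}"
  obtain c where "c \<in> charts B" "fst (\<Gamma> t) \<in> fst c" by (rule ex_chart)
  then show "\<exists>U. open U \<and> t \<in> U \<and> smooth_on U (\<lambda>t. rep e (fst (\<Gamma> t)) (snd (\<Gamma> t)))"
    using End_curve_local(1,3)[OF assms(1) _ e] t by blast
qed

lemma End_curveI:
  assumes \<gamma>: "smooth_curve (charts B) T \<gamma>" "open T" and e: "isfr V e" "\<gamma> ` T \<subseteq> V"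
    and \<kappa>: "\<And>t. t \<in> T \<Longrightarrow> \<kappa> t \<in> End_fiber B (\<gamma> t)" and M: "smooth_on T (\<lambda>t. rep e (\<gamma> t) (\<kappa> t))"
  shows "smooth_curve (End_charts B) T (\<lambda>t. (\<gamma> t, \<kappa> t))"
  unfolding smooth_curve_def
proof (intro conjI ballI)
  show "(\<lambda>t. (\<gamma> t, \<kappa> t)) ` T \<subseteq> (\<Union>C\<in>End_charts B. fst C)"
  proof
    fix p assume "p \<in> (\<lambda>t. (\<gamma> t, \<kappa> t)) ` T"
    then obtain t where t: "t \<in> T" "p = (\<gamma> t, \<kappa> t)" by blast
    obtain c where "c \<in> charts B" "\<gamma> t \<in> fst c" by (rule ex_chart)
    then have "p \<in> fst (echart c V e)" "echart c V e \<in> End_charts B"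
      using t e \<kappa> echart_mem by (auto simp: mem_echart)
    then show "p \<in> (\<Union>C\<in>End_charts B. fst C)" by blast
  qed
  fix C assume "C \<in> End_charts B"
  then obtain c V' e' where c: "c \<in> charts B" and e': "isfr V' e'" and C: "C = echart c V' e'"
    by (rule End_chartsE)
  have oV: "open (fst c \<inter> V')" using chart_open[OF c] frame_open[OF e'] by blast
  have eq: "{t\<in>T. (\<gamma> t, \<kappa> t) \<in> fst C} = {t\<in>T. \<gamma> t \<in> fst c \<inter> V'}"
    using \<kappa> by (auto simp: C mem_echart)
  have o: "open {t\<in>T. \<gamma> t \<in> fst c \<inter> V'}" by (rule smooth_curve_preimage_open[OF \<gamma>(1) oV])
  then show "open {t\<in>T. (\<gamma> t, \<kappa> t) \<in> fst C}" by (simp add: eq)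
  have sub: "{t\<in>T. \<gamma> t \<in> fst c \<inter> V'} \<subseteq> T" by blast
  note \<gamma>' = smooth_curve_subset[OF \<gamma>(1) o sub]
  have 1: "smooth_on {t\<in>T. \<gamma> t \<in> fst c \<inter> V'} (\<lambda>t. snd c (\<gamma> t))"
    by (rule smooth_on_subset[of "{t\<in>T. \<gamma> t \<in> fst c}"]) (use \<gamma>(1) c in \<open>auto simp: smooth_curve_def\<close>)
  have t1: "smooth_on {t\<in>T. \<gamma> t \<in> fst c \<inter> V'} (\<lambda>t. tmat e e' (\<gamma> t))"
    by (rule curve_fun_smooth[OF \<gamma>' o tmat_smooth[OF e(1) e']])
       (use e frame_open e' in auto)
  have t2: "smooth_on {t\<in>T. \<gamma> t \<in> fst c \<inter> V'} (\<lambda>t. tmat e' e (\<gamma> t))"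
    by (rule curve_fun_smooth[OF \<gamma>' o tmat_smooth[OF e' e(1)]])
       (use e frame_open e' in auto)
  have "smooth_on {t\<in>T. \<gamma> t \<in> fst c \<inter> V'} (\<lambda>t. tmat e e' (\<gamma> t) o\<^sub>L rep e (\<gamma> t) (\<kappa> t) o\<^sub>L tmat e' e (\<gamma> t))"
    by (intro smooth_on_blinfun_compose o t1 t2 smooth_on_subset[OF M sub])
  then have 2: "smooth_on {t\<in>T. \<gamma> t \<in> fst c \<inter> V'} (\<lambda>t. rep e' (\<gamma> t) (\<kappa> t))"
    by (rule smooth_on_cong[OF o, rotated]) (use e \<kappa> in \<open>auto intro: rep_tmat[OF e(1) _ e', symmetric]\<close>)
  show "smooth_on {t\<in>T. (\<gamma> t, \<kappa> t) \<in> fst C} (\<lambda>t. snd C (\<gamma> t, \<kappa> t))"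
    unfolding eq using smooth_on_Pair[OF o 1 2] by (simp add: C snd_echart)
qed

lemma End_velocity:
  assumes \<Gamma>: "smooth_curve (End_charts B) T \<Gamma>" "open T" "t \<in> T"
    and c: "c \<in> charts B" "fst (\<Gamma> t) \<in> fst c" and e: "isfr V e" "fst (\<Gamma> t) \<in> V"
  shows "velocity (End_charts B) \<Gamma> t (echart c V e) = (velocity (charts B) (\<lambda>t. fst (\<Gamma> t)) t c,
     vector_derivative (\<lambda>t. rep e (fst (\<Gamma> t)) (snd (\<Gamma> t))) (at t))"
proof -
  note * = End_curve_local[OF \<Gamma>(1) c(1) e(1)]
  have t: "t \<in> {t\<in>T. fst (\<Gamma> t) \<in> fst c \<inter> V}" using \<Gamma> c e by blast
  have "((\<lambda>t. (snd c (fst (\<Gamma> t)), rep e (fst (\<Gamma> t)) (snd (\<Gamma> t)))) has_vector_derivative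
    (vector_derivative (\<lambda>t. snd c (fst (\<Gamma> t))) (at t), vector_derivative (\<lambda>t. rep e (fst (\<Gamma> t)) (snd (\<Gamma> t))) (at t))) (at t)"
    by (intro has_vector_derivative_Pair smooth_on_vector_derivative[OF *(2) t] smooth_on_vector_derivative[OF *(3) t])
  from vector_derivative_at[OF this] show ?thesis
    using \<Gamma> c e End_curve_mem[OF \<Gamma>(1,3)] echart_mem[OF c(1) e(1)]
    by (simp add: velocity_def snd_echart mem_echart)
qed

lemma velocity_outside: "C \<notin> A \<or> \<Gamma> t \<notin> fst C \<Longrightarrow> velocity A \<Gamma> t C = 0"
  by (auto simp: velocity_def)

subsection \<open>Covariant derivative and parallel transport\<close>

text \<open>The matrix of the covariant derivative of the endomorphisms \<open>\<kappa>\<close> along \<open>\<gamma>\<close>: the ordinary derivative plus the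
  commutator with the connection form.\<close>

definition covD where
  "covD nabla e \<gamma> \<kappa> t = vector_derivative (\<lambda>\<tau>. rep e (\<gamma> \<tau>) (\<kappa> \<tau>)) (at t) +
     (cform nabla e (\<gamma> t) (velocity (charts B) \<gamma> t) o\<^sub>L rep e (\<gamma> t) (\<kappa> t)) -
     (rep e (\<gamma> t) (\<kappa> t) o\<^sub>L cform nabla e (\<gamma> t) (velocity (charts B) \<gamma> t))"

context
  fixes nabla T \<gamma> \<kappa>
  assumes n: "is_connection B nabla" and \<Gamma>: "smooth_curve (End_charts B) T (\<lambda>t. (\<gamma> t, \<kappa> t))" and T: "open T"
begin

lemma base_curve: "smooth_curve (charts B) T \<gamma>"
  using End_curve_base[OF \<Gamma>] by simp

lemma kappa_mem: "t \<in> T \<Longrightarrow> \<kappa> t \<in> End_fiber B (\<gamma> t)"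
  using End_curve_mem[OF \<Gamma>] by simp

lemma rep_smooth: "isfr V e \<Longrightarrow> smooth_on {t\<in>T. \<gamma> t \<in> V} (\<lambda>t. rep e (\<gamma> t) (\<kappa> t))"
  using End_curve_rep[OF \<Gamma>] by simp

lemma coord_kappa:
  assumes e: "isfr V e" "\<gamma> t \<in> V" and t: "t \<in> T" and u: "u \<in> fiber B (\<gamma> t)"
  shows "coord B e (\<gamma> t) (\<kappa> t u) = rep e (\<gamma> t) (\<kappa> t) (coord B e (\<gamma> t) u)"
  using rep_End(1)[OF e kappa_mem[OF t], of "coord B e (\<gamma> t) u"] comb_coord[OF e u] by simp

lemma kappa_section:
  assumes \<sigma>: "smooth_section_along B T \<gamma> \<sigma>"
  shows "smooth_section_along B T \<gamma> (\<lambda>t. \<kappa> t (\<sigma> t))"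
  unfolding smooth_section_along_def
proof (intro conjI ballI, goal_cases)
  case (1 t)
  then show ?case using \<sigma> End_fiberD(1)[OF kappa_mem] unfolding smooth_section_along_def by blast
next
  case (2 p)
  obtain V e where p: "p = (V, e)" by (cases p)
  with 2 have e: "isfr V e" by simp
  have o: "open {t\<in>T. \<gamma> t \<in> V}" by (rule smooth_curve_preimage_open[OF base_curve frame_open[OF e]])
  have "smooth_on {t\<in>T. \<gamma> t \<in> V} (\<lambda>t. coord B e (\<gamma> t) (\<sigma> t))"
    using \<sigma> e unfolding smooth_section_along_def by blast
  from smooth_on_blinfun_apply[OF o rep_smooth[OF e] this]
  have "smooth_on {t\<in>T. \<gamma> t \<in> V} (\<lambda>t. coord B e (\<gamma> t) (\<kappa> t (\<sigma> t)))"
    by (rule smooth_on_cong[OF o, rotated])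
       (use coord_kappa[OF e] \<sigma> in \<open>simp add: smooth_section_along_def\<close>)
  then show ?case by (simp add: p)
qed

text \<open>The product rule \<open>\<nabla>(\<kappa> \<sigma>) = (\<nabla>\<kappa>) \<sigma> + \<kappa> (\<nabla>\<sigma>)\<close>. It identifies \<open>covD\<close> with an object that is independent of
  the frame.\<close>

lemma covD_section:
  assumes \<sigma>: "smooth_section_along B T \<gamma> \<sigma>" and t: "t \<in> T" and e: "isfr V e" "\<gamma> t \<in> V"
  shows "cov_deriv_along B nabla \<gamma> (\<lambda>\<tau>. \<kappa> \<tau> (\<sigma> \<tau>)) t =
    \<kappa> t (cov_deriv_along B nabla \<gamma> \<sigma> t) + comb B e (\<gamma> t) (covD nabla e \<gamma> \<kappa> t (coord B e (\<gamma> t) (\<sigma> t)))"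
proof -
  let ?M = "\<lambda>t. rep e (\<gamma> t) (\<kappa> t)" and ?a = "\<lambda>t. coord B e (\<gamma> t) (\<sigma> t)"
  let ?S = "{t\<in>T. \<gamma> t \<in> V}"
  have tS: "t \<in> ?S" using t e by simp
  have o: "open ?S" by (rule smooth_curve_preimage_open[OF base_curve frame_open[OF e(1)]])
  have da: "(?a has_vector_derivative vector_derivative ?a (at t)) (at t)"
    by (rule smooth_on_vector_derivative[of ?S]) (use \<sigma> e tS in \<open>auto simp: smooth_section_along_def\<close>)
  have dM: "(?M has_vector_derivative vector_derivative ?M (at t)) (at t)"
    by (rule smooth_on_vector_derivative[OF rep_smooth[OF e(1)] tS])
  have mem: "\<sigma> \<tau> \<in> fiber B (\<gamma> \<tau>)" if "\<tau> \<in> T" for \<tau> using \<sigma> that by (simp add: smooth_section_along_def)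
  have "((\<lambda>\<tau>. ?M \<tau> (?a \<tau>)) has_vector_derivative ?M t (vector_derivative ?a (at t)) + vector_derivative ?M (at t) (?a t)) (at t)"
    by (rule bounded_bilinear.has_vector_derivative[OF bounded_bilinear_blinfun_apply dM da])
  then have "((\<lambda>\<tau>. coord B e (\<gamma> \<tau>) (\<kappa> \<tau> (\<sigma> \<tau>))) has_vector_derivative
      ?M t (vector_derivative ?a (at t)) + vector_derivative ?M (at t) (?a t)) (at t)"
    by (rule has_vector_derivative_transform_within_open[OF _ o tS])
       (use coord_kappa[OF e(1)] mem in auto)
  note d = vector_derivative_at[OF this]
  show ?thesis
    unfolding cov_deriv_in_frame[OF n e(1) base_curve T t e(2) kappa_section[OF \<sigma>]]
      cov_deriv_in_frame[OF n e(1) base_curve T t e(2) \<sigma>] d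
      coord_kappa[OF e t mem[OF t]] rep_End(2)[OF e kappa_mem[OF t], symmetric] comb_add[symmetric] covD_def
    by (simp add: blinfun.bilinear_simps algebra_simps)
qed

end

lemma smooth_section_along_comb:
  assumes \<gamma>: "smooth_curve (charts B) T \<gamma>" "open T" and e: "isfr V e" "\<gamma> ` T \<subseteq> V"
  shows "smooth_section_along B T \<gamma> (\<lambda>t. comb B e (\<gamma> t) a)"
  unfolding smooth_section_along_def
proof (intro conjI ballI, goal_cases)
  case (1 t)
  then show ?case using comb_mem[OF e(1)] e(2) by blast
next
  case (2 p)
  obtain V' e' where p: "p = (V', e')" by (cases p)
  with 2 have e': "isfr V' e'" by simp
  have o: "open {t\<in>T. \<gamma> t \<in> V'}" by (rule smooth_curve_preimage_open[OF \<gamma>(1) frame_open[OF e']])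
  have "smooth_on {t\<in>T. \<gamma> t \<in> V'} (\<lambda>t. tmat e e' (\<gamma> t))"
    by (rule curve_fun_smooth[OF smooth_curve_subset[OF \<gamma>(1) o] o tmat_smooth[OF e(1) e']])
       (use e frame_open e' in auto)
  from smooth_on_blinfun_apply[OF o this smooth_on_const[OF o]]
  have "smooth_on {t\<in>T. \<gamma> t \<in> V'} (\<lambda>t. coord B e' (\<gamma> t) (comb B e (\<gamma> t) a))"
    by (rule smooth_on_cong[OF o, rotated]) (use e tmat_apply[OF e(1) _ e'] in auto)
  then show ?case by (simp add: p)
qed

lemma End_curve_subset:
  assumes "smooth_curve (End_charts B) T \<Gamma>" "open T'" "T' \<subseteq> T"
  shows "smooth_curve (End_charts B) T' \<Gamma>"
  unfolding smooth_curve_def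
proof (intro conjI ballI)
  show "\<Gamma> ` T' \<subseteq> (\<Union>c\<in>End_charts B. fst c)" using assms unfolding smooth_curve_def by blast
  fix c assume c: "c \<in> End_charts B"
  have eq: "{t\<in>T'. \<Gamma> t \<in> fst c} = T' \<inter> {t\<in>T. \<Gamma> t \<in> fst c}" using assms(3) by auto
  show "open {t\<in>T'. \<Gamma> t \<in> fst c}" "smooth_on {t\<in>T'. \<Gamma> t \<in> fst c} (\<lambda>t. snd c (\<Gamma> t))"
    unfolding eq using assms c unfolding smooth_curve_def by (auto intro: smooth_on_subset)
qed

lemma covD_change_frame:
  assumes n: "is_connection B nabla" and \<Gamma>: "smooth_curve (End_charts B) T (\<lambda>t. (\<gamma> t, \<kappa> t))" "open T" "t \<in> T"
    and e: "isfr V e" "\<gamma> t \<in> V" and e': "isfr V' e'" "\<gamma> t \<in> V'"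
  shows "comb B e' (\<gamma> t) (covD nabla e' \<gamma> \<kappa> t (tmat e e' (\<gamma> t) a)) = comb B e (\<gamma> t) (covD nabla e \<gamma> \<kappa> t a)"
proof -
  define T' where "T' = {t\<in>T. \<gamma> t \<in> V}"
  have bc: "smooth_curve (charts B) T \<gamma>" using End_curve_base[OF \<Gamma>(1)] by simp
  have T': "open T'" "T' \<subseteq> T" "t \<in> T'" "\<gamma> ` T' \<subseteq> V"
    using smooth_curve_preimage_open[OF bc frame_open[OF e(1)]] \<Gamma> e by (auto simp: T'_def)
  note s = smooth_section_along_comb[OF smooth_curve_subset[OF bc T'(1,2)] T'(1) e(1) T'(4), of a]
  note c = covD_section[OF n End_curve_subset[OF \<Gamma>(1) T'(1,2)] T'(1) s T'(3)]
  show ?thesis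
    using c[OF e] c[OF e'] by (simp add: coord_comb[OF e] tmat_apply[OF e e'])
qed

text \<open>Parallelity is tested on sections defined along the whole curve, which may leave the domain of the
  frame; a bump function extends a section that is constant in the frame.\<close>

lemma parallel_covD:
  assumes n: "is_connection B nabla" and par: "parallel_End_along B nabla {-\<epsilon><..<\<epsilon>} \<gamma> \<kappa>" and \<epsilon>: "\<epsilon> > 0"
    and e: "isfr V e" "\<gamma> 0 \<in> V"
  shows "covD nabla e \<gamma> \<kappa> 0 = 0"
proof (rule blinfun_eqI)
  fix a
  let ?T = "{-\<epsilon><..<\<epsilon>}"
  have \<gamma>: "smooth_curve (charts B) ?T \<gamma>" and \<Gamma>: "smooth_curve (End_charts B) ?T (\<lambda>t. (\<gamma> t, \<kappa> t))"
    using par unfolding parallel_End_along_def by auto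
  have oV: "open {t\<in>?T. \<gamma> t \<in> V}" by (rule smooth_curve_preimage_open[OF \<gamma> frame_open[OF e(1)]])
  moreover have "0 \<in> {t\<in>?T. \<gamma> t \<in> V}" using \<epsilon> e by simp
  ultimately obtain d where d: "d > 0" "ball 0 d \<subseteq> {t\<in>?T. \<gamma> t \<in> V}" by (meson openE)
  obtain \<beta> :: "real \<Rightarrow> real" where \<beta>: "smooth_on UNIV \<beta>" "\<beta> 0 = 1" "\<And>t. \<bar>t\<bar> \<ge> d/2 \<Longrightarrow> \<beta> t = 0"
    using smooth_bump_exists[of "d/2"] d(1) by auto
  \<comment> \<open>Near 0 this is \<open>\<beta>\<close> times a section with constant coefficients; \<open>\<beta>\<close> vanishes before the curve leaves \<open>V\<close>.\<close>
  define \<sigma> where "\<sigma> t = (if \<gamma> t \<in> V then comb B e (\<gamma> t) (\<beta> t *\<^sub>R a) else 0)" for t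
  have \<sigma>: "smooth_section_along B ?T \<gamma> \<sigma>"
    unfolding smooth_section_along_def
  proof (intro conjI ballI, goal_cases)
    case (1 t)
    then show ?case using comb_mem[OF e(1)] fiber_0 by (simp add: \<sigma>_def)
  next
    case (2 p)
    obtain V' e' where p: "p = (V', e')" by (cases p)
    with 2 have e': "isfr V' e'" by simp
    have "smooth_on {t\<in>?T. \<gamma> t \<in> V'} (\<lambda>t. coord B e' (\<gamma> t) (\<sigma> t))"
    proof (rule smooth_on_local)
      fix t assume t: "t \<in> {t\<in>?T. \<gamma> t \<in> V'}"
      show "\<exists>U. open U \<and> t \<in> U \<and> smooth_on U (\<lambda>t. coord B e' (\<gamma> t) (\<sigma> t))"
      proof (cases "\<gamma> t \<in> V")
        case True
        let ?S = "{t\<in>?T. \<gamma> t \<in> V \<inter> V'}"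
        have o: "open (V \<inter> V')" using frame_open e e' by blast
        note oS = smooth_curve_preimage_open[OF \<gamma> o]
        have "smooth_on ?S (\<lambda>t. tmat e e' (\<gamma> t))"
          by (rule curve_fun_smooth[OF smooth_curve_subset[OF \<gamma> oS] oS tmat_smooth[OF e(1) e'] o]) auto
        moreover have "smooth_on ?S (\<lambda>t. \<beta> t *\<^sub>R a)"
          by (rule smooth_on_bilinear[OF bounded_bilinear_scaleR oS smooth_on_subset[OF \<beta>(1)] smooth_on_const[OF oS]]) auto
        ultimately have "smooth_on ?S (\<lambda>t. tmat e e' (\<gamma> t) (\<beta> t *\<^sub>R a))"
          by (rule smooth_on_blinfun_apply[OF oS])
        then have "smooth_on ?S (\<lambda>t. coord B e' (\<gamma> t) (\<sigma> t))"
          by (rule smooth_on_cong[OF oS, rotated]) (use tmat_apply[OF e(1) _ e'] in \<open>auto simp: \<sigma>_def\<close>)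
        then show ?thesis using oS t True by blast
      next
        case False
        let ?S = "{t\<in>?T. \<gamma> t \<in> V'} \<inter> {t. \<bar>t\<bar> > d/2}"
        have oS: "open ?S"
          by (intro open_Int smooth_curve_preimage_open[OF \<gamma> frame_open[OF e']] open_Collect_less continuous_intros)
        have "t \<notin> ball 0 d" using d(2) False by auto
        then have "t \<in> ?S" using t d(1) by (auto simp: dist_norm)
        moreover have "smooth_on ?S (\<lambda>t. coord B e' (\<gamma> t) (\<sigma> t))"
        proof (rule smooth_on_cong[OF oS _ smooth_on_const[OF oS, of 0]])
          fix t assume "t \<in> ?S"
          then have "\<gamma> t \<in> V'" "\<sigma> t = 0" using \<beta>(3)[of t] by (auto simp: \<sigma>_def comb_0)
          then show "0 = coord B e' (\<gamma> t) (\<sigma> t)" using coord_unique[OF e' _ comb_0] by simp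
        qed
        ultimately show ?thesis using oS by blast
      qed
    qed
    then show ?case by (simp add: p)
  qed
  have t0: "0 \<in> ?T" using \<epsilon> by simp
  have "cov_deriv_along B nabla \<gamma> (\<lambda>\<tau>. \<kappa> \<tau> (\<sigma> \<tau>)) 0 = \<kappa> 0 (cov_deriv_along B nabla \<gamma> \<sigma> 0)"
    using par \<sigma> t0 unfolding parallel_End_along_def by blast
  with covD_section[OF n \<Gamma> _ \<sigma> t0 e] have "comb B e (\<gamma> 0) (covD nabla e \<gamma> \<kappa> 0 a) = 0"
    using e coord_comb[OF e] by (simp add: \<sigma>_def \<beta>(2))
  then show "covD nabla e \<gamma> \<kappa> 0 a = blinfun_apply 0 a"
    using coord_comb[OF e, of "covD nabla e \<gamma> \<kappa> 0 a"] coord_unique[OF e comb_0] by simp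
qed

lemma parallelI:
  assumes n: "is_connection B nabla" and \<Gamma>: "smooth_curve (End_charts B) T (\<lambda>t. (\<gamma> t, \<kappa> t))" "open T"
    and e: "isfr V e" "\<gamma> ` T \<subseteq> V" and z: "\<And>t. t \<in> T \<Longrightarrow> covD nabla e \<gamma> \<kappa> t = 0"
  shows "parallel_End_along B nabla T \<gamma> \<kappa>"
  unfolding parallel_End_along_def
proof (intro conjI allI impI ballI)
  show "smooth_curve (charts B) T \<gamma>" using End_curve_base[OF \<Gamma>(1)] by simp
  fix \<sigma> t assume \<sigma>: "smooth_section_along B T \<gamma> \<sigma>" and t: "t \<in> T"
  show "cov_deriv_along B nabla \<gamma> (\<lambda>\<tau>. \<kappa> \<tau> (\<sigma> \<tau>)) t = \<kappa> t (cov_deriv_along B nabla \<gamma> \<sigma> t)"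
    using covD_section[OF n \<Gamma> \<sigma> t e(1)] e(2) t z[OF t] by (auto simp: comb_0)
qed (rule \<Gamma>)

text \<open>Compatibility is expressed by the Gram operators and the connection form in a frame, which is the form
  in which it acts on parallel transport and on tangent vectors.\<close>

definition metric_conn where
  "metric_conn g nabla \<longleftrightarrow> is_connection B nabla \<and> (\<forall>V e x v a b. isfr V e \<longrightarrow> x \<in> V \<longrightarrow> v \<in> tang B x \<longrightarrow>
     dfun (charts B) (gmat g e) x v a \<bullet> b =
       gmat g e x (cform nabla e x v a) \<bullet> b + gmat g e x a \<bullet> cform nabla e x v b)"

lemma metric_connD:
  assumes "metric_conn g nabla" "isfr V e" "x \<in> V" "v \<in> tang B x"
  shows "dfun (charts B) (gmat g e) x v a \<bullet> b =
       gmat g e x (cform nabla e x v a) \<bullet> b + gmat g e x a \<bullet> cform nabla e x v b"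
  using assms unfolding metric_conn_def by blast

lemma cform_along_smooth:
  assumes n: "is_connection B nabla" and e: "isfr V e" and c: "c \<in> charts B"
    and \<gamma>: "smooth_curve (charts B) T \<gamma>" "open T" and sub: "\<gamma> ` T \<subseteq> fst c \<inter> V"
  shows "smooth_on T (\<lambda>t. cform nabla e (\<gamma> t) (velocity (charts B) \<gamma> t))"
proof -
  have eq: "{t\<in>T. \<gamma> t \<in> fst c} = T" using sub by blast
  have z: "smooth_on T (\<lambda>t. snd c (\<gamma> t))"
    using \<gamma>(1) c unfolding smooth_curve_def by (metis (no_types, lifting) eq)
  have o: "open (V \<inter> fst c)" using frame_open[OF e] chart_open[OF c] by blast
  have G: "smooth_on T (\<lambda>t. cform nabla e (\<gamma> t) (coord_vec (charts B) c (\<gamma> t) b))" for b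
    by (rule curve_fun_smooth[OF \<gamma> cform_smooth[OF n e c] o]) (use sub in auto)
  have "smooth_on T (\<lambda>t. \<Sum>b\<in>Basis. (vector_derivative (\<lambda>t. snd c (\<gamma> t)) (at t) \<bullet> b) *\<^sub>R
      cform nabla e (\<gamma> t) (coord_vec (charts B) c (\<gamma> t) b))"
    by (intro smooth_on_sum smooth_on_bilinear[OF bounded_bilinear_scaleR] \<gamma> G
        smooth_on_compose_linear[OF bounded_linear_inner_left] smooth_on_vector_derivative_smooth z)
  then show ?thesis
  proof (rule smooth_on_cong[OF \<gamma>(2), rotated])
    fix t assume t: "t \<in> T"
    then have x: "\<gamma> t \<in> V" "\<gamma> t \<in> fst c" using sub by auto
    show "(\<Sum>b\<in>Basis. (vector_derivative (\<lambda>t. snd c (\<gamma> t)) (at t) \<bullet> b) *\<^sub>R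
      cform nabla e (\<gamma> t) (coord_vec (charts B) c (\<gamma> t) b)) = cform nabla e (\<gamma> t) (velocity (charts B) \<gamma> t)"
      using cform_coord_vec[OF n e x(1) c x(2), of "velocity (charts B) \<gamma> t c"]
        velocity_eq_coord_vec[OF \<gamma> t c x(2)] c x(2) by (simp add: velocity_def)
  qed
qed

text \<open>The frame matrix \<open>U\<close> of parallel transport solves the linear equation \<open>U' = - \<Gamma> U\<close>. Its compatibility
  with the metrics follows because the derivative of \<open>G (U a) \<bullet> U b\<close> vanishes.\<close>

lemma transport_exists:
  assumes n: "metric_conn g nabla" and g: "compatible_metric B g" and v: "v \<in> tang B x" and e: "isfr V e" "x \<in> V"
  obtains \<epsilon> \<gamma> U where "\<epsilon> > 0" "smooth_curve (charts B) {-\<epsilon><..<\<epsilon>} \<gamma>" "\<gamma> 0 = x" "velocity (charts B) \<gamma> 0 = v"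
    "\<gamma> ` {-\<epsilon><..<\<epsilon>} \<subseteq> V" "U 0 = id_blinfun" "smooth_on {-\<epsilon><..<\<epsilon>} U"
    "\<And>t. t \<in> {-\<epsilon><..<\<epsilon>} \<Longrightarrow> invertible_op (U t)"
    "\<And>t. t \<in> {-\<epsilon><..<\<epsilon>} \<Longrightarrow> (U has_vector_derivative
        - (cform nabla e (\<gamma> t) (velocity (charts B) \<gamma> t) o\<^sub>L U t)) (at t)"
    "\<And>t a b. t \<in> {-\<epsilon><..<\<epsilon>} \<Longrightarrow> gmat g e (\<gamma> t) (U t a) \<bullet> U t b = gmat g e x a \<bullet> b"
proof -
  have nc: "is_connection B nabla" using n by (simp add: metric_conn_def)
  obtain \<epsilon>0 \<gamma> where \<epsilon>0: "\<epsilon>0 > 0" and \<gamma>: "smooth_curve (charts B) {-\<epsilon>0<..<\<epsilon>0} \<gamma>" "\<gamma> 0 = x" "v = velocity (charts B) \<gamma> 0"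
    using v unfolding tangent_space_def by blast
  obtain c where c: "c \<in> charts B" "x \<in> fst c" by (rule ex_chart)
  define T where "T = {t\<in>{-\<epsilon>0<..<\<epsilon>0}. \<gamma> t \<in> fst c \<inter> V}"
  have oV: "open (fst c \<inter> V)" using chart_open[OF c(1)] frame_open[OF e(1)] by blast
  have T: "open T" "0 \<in> T" "T \<subseteq> {-\<epsilon>0<..<\<epsilon>0}" "\<gamma> ` T \<subseteq> fst c \<inter> V"
    using smooth_curve_preimage_open[OF \<gamma>(1) oV] \<epsilon>0 \<gamma>(2) c e by (auto simp: T_def)
  let ?\<Gamma> = "\<lambda>t. cform nabla e (\<gamma> t) (velocity (charts B) \<gamma> t)"
  have "smooth_on T ?\<Gamma>"
    by (rule cform_along_smooth[OF nc e(1) c(1) smooth_curve_subset[OF \<gamma>(1) T(1,3)] T(1,4)])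
  then have smn: "smooth_on T (\<lambda>t. - ?\<Gamma> t)" by (rule smooth_on_minus[OF T(1)])
  obtain \<epsilon> U where U: "\<epsilon> > 0" "{-\<epsilon><..<\<epsilon>} \<subseteq> T" "U 0 = id_blinfun" "smooth_on {-\<epsilon><..<\<epsilon>} U"
    "\<And>t. t \<in> {-\<epsilon><..<\<epsilon>} \<Longrightarrow> invertible_op (U t)"
    "\<And>t. t \<in> {-\<epsilon><..<\<epsilon>} \<Longrightarrow> (U has_vector_derivative (- ?\<Gamma> t) o\<^sub>L U t) (at t)"
    by (rule linear_ode_exists[OF T(1,2) smn]) (rule that, assumption+)
  have sub: "{-\<epsilon><..<\<epsilon>} \<subseteq> {-\<epsilon>0<..<\<epsilon>0}" using U(2) T(3) by blast
  have \<gamma>': "smooth_curve (charts B) {-\<epsilon><..<\<epsilon>} \<gamma>" by (rule smooth_curve_subset[OF \<gamma>(1) _ sub]) simp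
  have inV: "\<gamma> t \<in> V" if "t \<in> {-\<epsilon><..<\<epsilon>}" for t using that U(2) T(4) by blast
  have dU: "(U has_vector_derivative - (?\<Gamma> t o\<^sub>L U t)) (at t)" if "t \<in> {-\<epsilon><..<\<epsilon>}" for t
    using U(6)[OF that] by (simp add: bounded_bilinear.minus_left[OF bounded_bilinear_blinfun_compose])
  have iso: "gmat g e (\<gamma> t) (U t a) \<bullet> U t b = gmat g e x a \<bullet> b" if t: "t \<in> {-\<epsilon><..<\<epsilon>}" for t a b
  proof -
    let ?G = "\<lambda>t. gmat g e (\<gamma> t)"
    have "((\<lambda>t. ?G t (U t a) \<bullet> U t b) has_vector_derivative 0) (at t)" if t: "t \<in> {-\<epsilon><..<\<epsilon>}" for t
    proof -
      have dG: "(?G has_vector_derivative dfun (charts B) (gmat g e) (\<gamma> t) (velocity (charts B) \<gamma> t)) (at t)"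
        by (rule curve_fun_derivative[OF \<gamma>' _ t gmat_smooth[OF e(1) g] inV[OF t]]) simp
      have dUa: "((\<lambda>t. U t a) has_vector_derivative - ?\<Gamma> t (U t a)) (at t)" for a
        using bounded_linear.has_vector_derivative[OF blinfun.bounded_linear_left dU[OF t], of a]
        by (simp add: blinfun.minus_left)
      note 1 = bounded_bilinear.has_vector_derivative[OF bounded_bilinear_blinfun_apply dG dUa[of a]]
      note 2 = bounded_bilinear.has_vector_derivative[OF bounded_bilinear_inner 1 dUa[of b]]
      have vt: "velocity (charts B) \<gamma> t \<in> tang B (\<gamma> t)" by (rule velocity_tangent[OF \<gamma>' _ t]) simp
      have "?G t (U t a) \<bullet> - ?\<Gamma> t (U t b) +
          (?G t (- ?\<Gamma> t (U t a)) + dfun (charts B) (gmat g e) (\<gamma> t) (velocity (charts B) \<gamma> t) (U t a)) \<bullet> U t b = 0"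
        unfolding inner_add_left metric_connD[OF n e(1) inV[OF t] vt, of "U t a" "U t b"]
        by (simp add: blinfun.minus_right)
      then show ?thesis using 2 by (simp only:)
    qed
    then have z: "((\<lambda>t. ?G t (U t a) \<bullet> U t b) has_vector_derivative 0) (at t within {-\<epsilon><..<\<epsilon>})"
      if "t \<in> {-\<epsilon><..<\<epsilon>}" for t
      by (rule has_vector_derivative_at_within) (rule that)
    have "\<exists>k. \<forall>t\<in>{-\<epsilon><..<\<epsilon>}. ?G t (U t a) \<bullet> U t b = k"
      by (rule has_vector_derivative_zero_constant[OF convex_real_interval(8) z]) auto
    then obtain k where k: "\<forall>t\<in>{-\<epsilon><..<\<epsilon>}. ?G t (U t a) \<bullet> U t b = k" ..
    have "?G t (U t a) \<bullet> U t b = ?G 0 (U 0 a) \<bullet> U 0 b"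
      using k t U(1) by simp
    then show ?thesis by (simp add: U(3) \<gamma>(2))
  qed
  show thesis
    by (rule that[OF U(1) \<gamma>' \<gamma>(2) \<gamma>(3)[symmetric] _ U(3,4,5) dU iso]) (use inV in auto)
qed

lemma twistor_iff:
  assumes e: "isfr V e" "x \<in> V" and g: "compatible_metric B g"
  shows "(x, K) \<in> twistor_space B g \<longleftrightarrow> K \<in> End_fiber B x \<and> rep e x K \<in> ortho_cs (gmat g e x)"
proof (cases "K \<in> End_fiber B x")
  case K: True
  have ex: "\<exists>a. u = comb B e x a" if "u \<in> fiber B x" for u using comb_coord[OF e that] by metis
  have 1: "(\<forall>u\<in>fiber B x. K (K u) = - u) \<longleftrightarrow> (\<forall>a. rep e x K (rep e x K a) = - a)"
  proof
    assume *: "\<forall>u\<in>fiber B x. K (K u) = - u"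
    show "\<forall>a. rep e x K (rep e x K a) = - a"
    proof
      fix a
      have "comb B e x (rep e x K (rep e x K a)) = comb B e x (- a)"
        using * comb_mem[OF e] by (simp add: rep_End(2)[OF e K] comb_neg)
      then show "rep e x K (rep e x K a) = - a" using coord_comb[OF e] by metis
    qed
  next
    assume *: "\<forall>a. rep e x K (rep e x K a) = - a"
    show "\<forall>u\<in>fiber B x. K (K u) = - u"
    proof
      fix u assume "u \<in> fiber B x"
      then obtain a where "u = comb B e x a" using ex by blast
      then show "K (K u) = - u" using * by (simp add: rep_End(2)[OF e K, symmetric] comb_neg)
    qed
  qed
  have 2: "(\<forall>u\<in>fiber B x. \<forall>w\<in>fiber B x. g x (K u) (K w) = g x u w) \<longleftrightarrow>
      (\<forall>a b. gmat g e x (rep e x K a) \<bullet> rep e x K b = gmat g e x a \<bullet> b)"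
    unfolding gmat_apply[OF e g] rep_End(2)[OF e K] using comb_mem[OF e] ex by metis
  show ?thesis using K 1 2 by (simp add: twistor_space_def ortho_cs_def)
qed (simp add: twistor_space_def)

lemma vertical_iff:
  assumes e: "isfr V e" "x \<in> V" and g: "compatible_metric B g" and K: "K \<in> End_fiber B x" and A: "A \<in> End_fiber B x"
  shows "A \<in> vertical_space B g (x, K) \<longleftrightarrow>
    (\<forall>a b. gmat g e x (rep e x A a) \<bullet> b + gmat g e x a \<bullet> rep e x A b = 0) \<and>
    (\<forall>a. rep e x A (rep e x K a) + rep e x K (rep e x A a) = 0)"
proof -
  have ex: "\<exists>a. u = comb B e x a" if "u \<in> fiber B x" for u using comb_coord[OF e that] by metis
  have z: "comb B e x a = 0 \<longleftrightarrow> a = 0" for a using coord_comb[OF e] comb_0 by metis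
  have "A (K (comb B e x a)) + K (A (comb B e x a)) =
      comb B e x (rep e x A (rep e x K a) + rep e x K (rep e x A a))" for a
    by (simp add: comb_add rep_End(2)[OF e K] rep_End(2)[OF e A])
  then have 1: "(\<forall>u\<in>fiber B x. A (K u) + K (A u) = 0) \<longleftrightarrow>
      (\<forall>a. rep e x A (rep e x K a) + rep e x K (rep e x A a) = 0)"
    using comb_mem[OF e] ex z by metis
  have 2: "(\<forall>u\<in>fiber B x. \<forall>w\<in>fiber B x. g x (A u) w + g x u (A w) = 0) \<longleftrightarrow>
      (\<forall>a b. gmat g e x (rep e x A a) \<bullet> b + gmat g e x a \<bullet> rep e x A b = 0)"
    unfolding gmat_apply[OF e g] rep_End(2)[OF e A] using comb_mem[OF e] ex by metis
  show ?thesis using A 1 2 by (simp add: vertical_space_def)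
qed

text \<open>Conjugation of a curve \<open>N\<close> of orthogonal complex structures of one fiber with parallel transport \<open>U\<close> gives
  a curve in the twistor space over \<open>\<gamma>\<close>, whose covariant derivative is the conjugate of \<open>N'\<close>. A constant \<open>N\<close>
  yields the parallel translates, a varying one every vertical direction.\<close>

lemma transported_curve:
  assumes n: "metric_conn g nabla" and g: "compatible_metric B g" and e: "isfr V e"
    and \<epsilon>: "\<epsilon> > 0" and \<gamma>: "smooth_curve (charts B) {-\<epsilon><..<\<epsilon>} \<gamma>" "\<gamma> ` {-\<epsilon><..<\<epsilon>} \<subseteq> V"
    and U: "smooth_on {-\<epsilon><..<\<epsilon>} U" "\<And>t. t \<in> {-\<epsilon><..<\<epsilon>} \<Longrightarrow> invertible_op (U t)"
      "\<And>t. t \<in> {-\<epsilon><..<\<epsilon>} \<Longrightarrow> (U has_vector_derivative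
        - (cform nabla e (\<gamma> t) (velocity (charts B) \<gamma> t) o\<^sub>L U t)) (at t)"
      "\<And>t a b. t \<in> {-\<epsilon><..<\<epsilon>} \<Longrightarrow> gmat g e (\<gamma> t) (U t a) \<bullet> U t b = gmat g e x a \<bullet> b"
    and N: "smooth_on {-\<epsilon><..<\<epsilon>} N" "\<And>t. t \<in> {-\<epsilon><..<\<epsilon>} \<Longrightarrow> N t \<in> ortho_cs (gmat g e x)"
      "\<And>t. t \<in> {-\<epsilon><..<\<epsilon>} \<Longrightarrow> (N has_vector_derivative N' t) (at t)"
  defines "\<kappa> \<equiv> \<lambda>t. unrep e (\<gamma> t) (U t o\<^sub>L N t o\<^sub>L binv (U t))"
  shows "smooth_curve (End_charts B) {-\<epsilon><..<\<epsilon>} (\<lambda>t. (\<gamma> t, \<kappa> t))"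
    and "\<And>t. t \<in> {-\<epsilon><..<\<epsilon>} \<Longrightarrow> (\<gamma> t, \<kappa> t) \<in> twistor_space B g"
    and "\<And>t. t \<in> {-\<epsilon><..<\<epsilon>} \<Longrightarrow> covD nabla e \<gamma> \<kappa> t = U t o\<^sub>L N' t o\<^sub>L binv (U t)"
proof -
  let ?T = "{-\<epsilon><..<\<epsilon>}"
  let ?M = "\<lambda>t. U t o\<^sub>L N t o\<^sub>L binv (U t)"
  have inV: "\<gamma> t \<in> V" if "t \<in> ?T" for t using that \<gamma>(2) by blast
  have rep: "rep e (\<gamma> t) (\<kappa> t) = ?M t" if "t \<in> ?T" for t
    unfolding \<kappa>_def by (rule rep_unrep[OF e inV[OF that]])
  have End: "\<kappa> t \<in> End_fiber B (\<gamma> t)" if "t \<in> ?T" for t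
    unfolding \<kappa>_def by (rule unrep_End[OF e inV[OF that]])
  have M: "smooth_on ?T ?M"
    by (intro smooth_on_blinfun_compose smooth_on_binv_comp U N) auto
  have rs: "smooth_on ?T (\<lambda>t. rep e (\<gamma> t) (\<kappa> t))"
    by (rule smooth_on_cong[OF _ _ M]) (simp_all add: rep)
  show "smooth_curve (End_charts B) ?T (\<lambda>t. (\<gamma> t, \<kappa> t))"
    by (rule End_curveI[OF \<gamma>(1) _ e \<gamma>(2) End rs]) auto
  show "(\<gamma> t, \<kappa> t) \<in> twistor_space B g" if t: "t \<in> ?T" for t
  proof -
    note inv = binv_apply[OF U(2)[OF t]]
    have "N t (N t a) = - a" "gmat g e x (N t a) \<bullet> N t b = gmat g e x a \<bullet> b" for a b
      using N(2)[OF t] by (auto simp: ortho_cs_def)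
    then have "?M t \<in> ortho_cs (gmat g e (\<gamma> t))"
      unfolding ortho_cs_def using U(4)[OF t, of "binv (U t) a" "binv (U t) b" for a b]
      by (auto simp: inv blinfun.minus_right U(4)[OF t])
    then show ?thesis
      unfolding twistor_iff[OF e inV[OF t] g] rep[OF t] using End[OF t] by simp
  qed
  show "covD nabla e \<gamma> \<kappa> t = U t o\<^sub>L N' t o\<^sub>L binv (U t)" if t: "t \<in> ?T" for t
  proof (rule blinfun_eqI)
    fix b
    let ?\<Gamma> = "cform nabla e (\<gamma> t) (velocity (charts B) \<gamma> t)"
    note inv = binv_apply[OF U(2)[OF t]]
    define D where "D = vector_derivative (\<lambda>\<tau>. rep e (\<gamma> \<tau>) (\<kappa> \<tau>)) (at t)"
    have dM: "((\<lambda>\<tau>. rep e (\<gamma> \<tau>) (\<kappa> \<tau>)) has_vector_derivative D) (at t)"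
      unfolding D_def by (rule smooth_on_vector_derivative[OF rs t])
    have 1: "((\<lambda>\<tau>. rep e (\<gamma> \<tau>) (\<kappa> \<tau>) o\<^sub>L U \<tau>) has_vector_derivative
        (?M t o\<^sub>L - (?\<Gamma> o\<^sub>L U t)) + (D o\<^sub>L U t)) (at t)"
      using bounded_bilinear.has_vector_derivative[OF bounded_bilinear_blinfun_compose dM U(3)[OF t]]
      by (simp add: rep[OF t])
    have 2: "((\<lambda>\<tau>. U \<tau> o\<^sub>L N \<tau>) has_vector_derivative (U t o\<^sub>L N' t) + (- (?\<Gamma> o\<^sub>L U t) o\<^sub>L N t)) (at t)"
      by (rule bounded_bilinear.has_vector_derivative[OF bounded_bilinear_blinfun_compose U(3)[OF t] N(3)[OF t]])
    have "((\<lambda>\<tau>. rep e (\<gamma> \<tau>) (\<kappa> \<tau>) o\<^sub>L U \<tau>) has_vector_derivative (U t o\<^sub>L N' t) + (- (?\<Gamma> o\<^sub>L U t) o\<^sub>L N t)) (at t)"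
    proof (rule has_vector_derivative_transform_within_open[OF 2 _ t])
      fix \<tau> assume \<tau>: "\<tau> \<in> ?T"
      show "U \<tau> o\<^sub>L N \<tau> = rep e (\<gamma> \<tau>) (\<kappa> \<tau>) o\<^sub>L U \<tau>"
        unfolding rep[OF \<tau>] by (rule blinfun_eqI) (simp add: binv_apply[OF U(2)[OF \<tau>]])
    qed simp
    from vector_derivative_unique_at[OF 1 this]
    have "((?M t o\<^sub>L - (?\<Gamma> o\<^sub>L U t)) + (D o\<^sub>L U t)) (binv (U t) b) =
       ((U t o\<^sub>L N' t) + (- (?\<Gamma> o\<^sub>L U t) o\<^sub>L N t)) (binv (U t) b)" by simp
    then show "covD nabla e \<gamma> \<kappa> t b = (U t o\<^sub>L N' t o\<^sub>L binv (U t)) b"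
      unfolding covD_def D_def[symmetric] rep[OF t]
      by (simp add: blinfun.bilinear_simps inv algebra_simps)
  qed
qed

end

section \<open>Horizontal lifts and the almost complex structure in charts\<close>

text \<open>The Cayley transform of \<open>(t/2) M A\<close> conjugates \<open>M\<close> into an orthogonal complex structure; the
  resulting curve has velocity \<open>A\<close>.\<close>

lemma cayley_curve:
  fixes J G M A :: "'a::euclidean_space \<Rightarrow>\<^sub>L 'a"
  assumes G: "herm J G" and M: "M \<in> ortho_cs G"
    and A: "\<And>a b. G (A a) \<bullet> b + G a \<bullet> A b = 0" "\<And>a. A (M a) + M (A a) = 0"
  obtains N :: "real \<Rightarrow> 'a \<Rightarrow>\<^sub>L 'a" where "smooth_on UNIV N" "\<And>t. N t \<in> ortho_cs G" "N 0 = M"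
    "(N has_vector_derivative A) (at 0)" "A = 0 \<Longrightarrow> N = (\<lambda>t. M)"
proof -
  define S where "S = (1/2) *\<^sub>R (M o\<^sub>L A)"
  define P where "P t = id_blinfun + t *\<^sub>R S" for t
  define N where "N t = P t o\<^sub>L M o\<^sub>L binv (P t)" for t
  have MM: "M (M a) = - a" and orth: "G (M a) \<bullet> M b = G a \<bullet> b" for a b using M by (auto simp: ortho_cs_def)
  have sym: "G a \<bullet> b = G b \<bullet> a" for a b using G by (simp add: herm_def)
  have AM: "A (M a) = - M (A a)" for a using A(2)[of a] by (simp add: eq_neg_iff_add_eq_0)
  have S_apply: "S a = (1/2) *\<^sub>R M (A a)" for a by (simp add: S_def blinfun.scaleR_left)
  have SM: "S (M a) = - M (S a)" for a by (simp add: S_apply AM MM blinfun.bilinear_simps)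
  have A1: "G (A a) \<bullet> b = - (G a \<bullet> A b)" for a b using A(1)[of a b] by simp
  have skew: "G (S a) \<bullet> b = - (G a \<bullet> S b)" for a b
    by (simp add: S_apply blinfun.scaleR_right ortho_cs_skew[OF M] A1 AM)
  have Pa: "P t a = a + t *\<^sub>R S a" for t a by (simp add: P_def blinfun.bilinear_simps)
  have P: "invertible_op (P t)" for t
    unfolding invertible_op_def
  proof safe
    fix a assume "P t a = 0"
    then have "G (a + t *\<^sub>R S a) \<bullet> a = 0" by (simp add: Pa blinfun.zero_right)
    moreover have "G (S a) \<bullet> a = 0" using skew[of a a] sym[of a "S a"] by simp
    ultimately have "G a \<bullet> a = 0" by (simp add: blinfun.bilinear_simps inner_add_left)
    then show "a = 0" using G unfolding herm_def by force
  qed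
  note inv = binv_apply[OF P]
  have NP: "N t (P t a) = P t (M a)" for t a by (simp add: N_def inv)
  have met: "G (P t (M a)) \<bullet> P t (M b) = G (P t a) \<bullet> P t b" for t a b
    by (simp add: Pa SM blinfun.bilinear_simps inner_add_left inner_add_right inner_diff_left inner_diff_right orth skew,
        simp add: algebra_simps)
  have ortho: "N t \<in> ortho_cs G" for t
    unfolding ortho_cs_def
  proof safe
    fix a b
    show "N t (N t a) = - a"
      using NP[of t "binv (P t) a"] NP[of t "M (binv (P t) a)"] by (simp add: inv MM blinfun.minus_right)
    show "G (N t a) \<bullet> N t b = G a \<bullet> b"
      using NP[of t "binv (P t) a"] NP[of t "binv (P t) b"] met[of t "binv (P t) a" "binv (P t) b"]
      by (simp add: inv)
  qed
  have smP: "smooth_on UNIV P" unfolding P_def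
    by (intro smooth_on_add smooth_on_const smooth_on_linear bounded_linear_scaleR_left) auto
  have smN: "smooth_on UNIV N" unfolding N_def
    by (intro smooth_on_blinfun_compose smooth_on_binv_comp smP smooth_on_const P) auto
  have P0: "P 0 = id_blinfun" by (simp add: P_def)
  have N0: "N 0 = M" by (rule blinfun_eqI) (use NP[of 0] in \<open>simp add: P0\<close>)
  have dP: "(P has_vector_derivative S) (at 0)"
    unfolding P_def by (auto intro!: derivative_eq_intros)
  have dN: "(N has_vector_derivative vector_derivative N (at 0)) (at 0)"
    by (rule smooth_on_vector_derivative[OF smN]) simp
  have "vector_derivative N (at 0) o\<^sub>L id_blinfun = vector_derivative N (at 0)"
    by (rule blinfun_eqI) simp
  then have 1: "((\<lambda>t. N t o\<^sub>L P t) has_vector_derivative (M o\<^sub>L S) + vector_derivative N (at 0)) (at 0)"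
    using bounded_bilinear.has_vector_derivative[OF bounded_bilinear_blinfun_compose dN dP] by (simp add: N0 P0)
  have 2: "((\<lambda>t. P t o\<^sub>L M) has_vector_derivative S o\<^sub>L M) (at 0)"
    using bounded_linear.has_vector_derivative[OF bounded_bilinear.bounded_linear_left[OF bounded_bilinear_blinfun_compose] dP] .
  have "(\<lambda>t. N t o\<^sub>L P t) = (\<lambda>t. P t o\<^sub>L M)"
    by (rule ext, rule blinfun_eqI) (simp add: NP)
  then have "(M o\<^sub>L S) + vector_derivative N (at 0) = S o\<^sub>L M"
    using vector_derivative_unique_at[OF 1] 2 by simp
  then have "vector_derivative N (at 0) = (S o\<^sub>L M) - (M o\<^sub>L S)" by (simp add: algebra_simps)
  also have "\<dots> = A"
    by (rule blinfun_eqI)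
       (simp add: blinfun.bilinear_simps SM, simp add: S_apply blinfun.bilinear_simps MM flip: scaleR_left.add)
  finally have "(N has_vector_derivative A) (at 0)" using dN by simp
  moreover have "N = (\<lambda>t. M)" if "A = 0"
  proof
    fix t
    have "P t = id_blinfun" by (rule blinfun_eqI) (simp add: Pa S_apply that blinfun.zero_right)
    then show "N t = M" using NP[of t] by (intro blinfun_eqI) simp
  qed
  ultimately show thesis using that smN ortho N0 by blast
qed

text \<open>Vectors tangent to the twistor space become vertical after their horizontal part is removed:
  differentiating the orthogonality of \<open>M\<close> along the base produces \<open>dG\<close>, which the compatibility of \<open>\<Gamma>\<close> with
  the metric cancels.\<close>

lemma metric_derivative_vertical:
  fixes G M X \<Gamma> dG :: "'a::euclidean_space \<Rightarrow>\<^sub>L 'a"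
  assumes M: "M \<in> ortho_cs G" and X: "\<And>a. X (M a) + M (X a) = 0"
    and d: "\<And>a b. dG a \<bullet> b = G (\<Gamma> a) \<bullet> b + G a \<bullet> \<Gamma> b"
    and dm: "\<And>a b. dG (M a) \<bullet> M b + G (X a) \<bullet> M b + G (M a) \<bullet> X b = dG a \<bullet> b"
  defines "A \<equiv> X + (\<Gamma> o\<^sub>L M) - (M o\<^sub>L \<Gamma>)"
  shows "A (M a) + M (A a) = 0" and "G (A a) \<bullet> b + G a \<bullet> A b = 0"
proof -
  have MM: "M (M a) = - a" and orth: "G (M a) \<bullet> M b = G a \<bullet> b" for a b using M by (auto simp: ortho_cs_def)
  have XM: "X (M a) = - M (X a)" for a using X[of a] by (simp add: eq_neg_iff_add_eq_0)
  have AM: "A (M a) = - M (A a)" for a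
    by (simp add: A_def blinfun.bilinear_simps XM MM)
  then show "A (M a) + M (A a) = 0" by simp
  have *: "G (A a) \<bullet> M b + G (M a) \<bullet> A b = 0" for a b
    using dm[of a b] d[of a b] d[of "M a" "M b"]
    by (simp add: A_def blinfun.bilinear_simps inner_diff_left inner_diff_right inner_add_left inner_add_right orth)
  show "G (A a) \<bullet> b + G a \<bullet> A b = 0"
    using *[of a "- M b"] orth[of a "A b"] by (simp add: blinfun.minus_right MM AM)
qed

context hol_bundle
begin

lemma zero_End: "(\<lambda>u. 0) \<in> End_fiber B x"
  by (auto simp: End_fiber_def real_linear_on_def fiber_0)

lemma rep_zero:
  assumes e: "isfr V e" "x \<in> V"
  shows "rep e x (\<lambda>u. 0) = 0"
  by (rule blinfun_eqI) (simp add: rep_End(1)[OF e zero_End] coord_unique[OF e comb_0])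

lemma covD_all_frames:
  assumes n: "is_connection B nabla" and \<Gamma>: "smooth_curve (End_charts B) T (\<lambda>t. (\<gamma> t, \<kappa> t))" "open T" "t \<in> T"
    and e: "isfr V e" "\<gamma> t \<in> V" and e': "isfr V' e'" "\<gamma> t \<in> V'"
    and A: "A \<in> End_fiber B (\<gamma> t)" "covD nabla e \<gamma> \<kappa> t = rep e (\<gamma> t) A"
  shows "covD nabla e' \<gamma> \<kappa> t = rep e' (\<gamma> t) A"
proof (rule blinfun_eqI)
  fix b
  define a where "a = tmat e' e (\<gamma> t) b"
  have b: "tmat e e' (\<gamma> t) a = b"
    unfolding a_def using comb_tmat[OF e' e, of b] coord_comb[OF e'] by (simp add: tmat_apply[OF e e'])
  have "comb B e' (\<gamma> t) (covD nabla e' \<gamma> \<kappa> t b) = A (comb B e (\<gamma> t) a)"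
    using covD_change_frame[OF n \<Gamma> e e', of a] by (simp add: b A(2) rep_End(2)[OF e A(1)])
  also have "comb B e (\<gamma> t) a = comb B e' (\<gamma> t) b" unfolding a_def by (rule comb_tmat[OF e' e])
  finally show "covD nabla e' \<gamma> \<kappa> t b = rep e' (\<gamma> t) A b"
    using coord_comb[OF e', of "covD nabla e' \<gamma> \<kappa> t b"] by (simp add: rep_End(1)[OF e' A(1)])
qed

text \<open>Every pair of a vertical vector and a tangent vector of the base is realized by a curve in the twistor
  space: transport the Cayley curve of \<open>A\<close> along a curve with velocity \<open>v\<close>.\<close>

lemma curve_with_velocity:
  assumes n: "metric_conn g nabla" and g: "compatible_metric B g"
    and p: "(x, K) \<in> twistor_space B g" and A: "A \<in> vertical_space B g (x, K)" and v: "v \<in> tang B x"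
  obtains \<epsilon> \<gamma> \<kappa> where "\<epsilon> > 0" "smooth_curve (End_charts B) {-\<epsilon><..<\<epsilon>} (\<lambda>t. (\<gamma> t, \<kappa> t))"
    "\<And>t. t \<in> {-\<epsilon><..<\<epsilon>} \<Longrightarrow> (\<gamma> t, \<kappa> t) \<in> twistor_space B g" "\<gamma> 0 = x" "\<kappa> 0 = K"
    "velocity (charts B) \<gamma> 0 = v" "\<And>V e. isfr V e \<Longrightarrow> x \<in> V \<Longrightarrow> covD nabla e \<gamma> \<kappa> 0 = rep e x A"
    "A = (\<lambda>u. 0) \<Longrightarrow> parallel_End_along B nabla {-\<epsilon><..<\<epsilon>} \<gamma> \<kappa>"
proof -
  have nc: "is_connection B nabla" using n by (simp add: metric_conn_def)
  obtain V e where e: "isfr V e" "x \<in> V" by (rule ex_frame)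
  obtain \<epsilon> \<gamma> U where \<epsilon>: "\<epsilon> > 0" and \<gamma>: "smooth_curve (charts B) {-\<epsilon><..<\<epsilon>} \<gamma>" "\<gamma> 0 = x" "velocity (charts B) \<gamma> 0 = v"
    "\<gamma> ` {-\<epsilon><..<\<epsilon>} \<subseteq> V" and U0: "U 0 = id_blinfun" and U: "smooth_on {-\<epsilon><..<\<epsilon>} U"
    "\<And>t. t \<in> {-\<epsilon><..<\<epsilon>} \<Longrightarrow> invertible_op (U t)"
    "\<And>t. t \<in> {-\<epsilon><..<\<epsilon>} \<Longrightarrow> (U has_vector_derivative
        - (cform nabla e (\<gamma> t) (velocity (charts B) \<gamma> t) o\<^sub>L U t)) (at t)"
    "\<And>t a b. t \<in> {-\<epsilon><..<\<epsilon>} \<Longrightarrow> gmat g e (\<gamma> t) (U t a) \<bullet> U t b = gmat g e x a \<bullet> b"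
    by (rule transport_exists[OF n g v e]) (rule that, assumption+)
  have KE: "K \<in> End_fiber B x" and M: "rep e x K \<in> ortho_cs (gmat g e x)"
    using p unfolding twistor_iff[OF e g] by auto
  have AE: "A \<in> End_fiber B x" using A by (simp add: vertical_space_def)
  note Av = A[unfolded vertical_iff[OF e g KE AE]]
  obtain N where N: "smooth_on UNIV N" "\<And>t. N t \<in> ortho_cs (gmat g e x)" "N 0 = rep e x K"
    "(N has_vector_derivative rep e x A) (at 0)" "rep e x A = 0 \<Longrightarrow> N = (\<lambda>t. rep e x K)"
    using cayley_curve[OF gmat_herm[OF e g] M, of "rep e x A"] Av by blast
  define \<kappa> where "\<kappa> = (\<lambda>t. unrep e (\<gamma> t) (U t o\<^sub>L N t o\<^sub>L binv (U t)))"
  have Nd: "(N has_vector_derivative vector_derivative N (at t)) (at t)" for t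
    by (rule smooth_on_vector_derivative[OF N(1)]) simp
  have tc: "smooth_curve (End_charts B) {-\<epsilon><..<\<epsilon>} (\<lambda>t. (\<gamma> t, \<kappa> t))"
    "t \<in> {-\<epsilon><..<\<epsilon>} \<Longrightarrow> (\<gamma> t, \<kappa> t) \<in> twistor_space B g"
    "t \<in> {-\<epsilon><..<\<epsilon>} \<Longrightarrow> covD nabla e \<gamma> \<kappa> t = U t o\<^sub>L vector_derivative N (at t) o\<^sub>L binv (U t)" for t
    unfolding \<kappa>_def
    by (rule transported_curve[where x=x and N=N and U=U and N'="\<lambda>t. vector_derivative N (at t)",
          OF n g e(1) \<epsilon> \<gamma>(1,4) U(1)], (use U(2-4) N(2) Nd smooth_on_subset[OF N(1) subset_UNIV] in blast)+)+
  have b1: "binv (id_blinfun :: 'r cop) = id_blinfun" by (rule binv_unique) simp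
  have t0: "0 \<in> {-\<epsilon><..<\<epsilon>}" using \<epsilon> by simp
  have k0: "\<kappa> 0 = K"
  proof (rule End_eqI[OF e _ KE])
    show "\<kappa> 0 \<in> End_fiber B x" unfolding \<kappa>_def \<gamma>(2) by (rule unrep_End[OF e])
    have "U 0 o\<^sub>L N 0 o\<^sub>L binv (U 0) = rep e x K"
      by (rule blinfun_eqI) (simp add: U0 b1 N(3))
    then show "rep e x (\<kappa> 0) = rep e x K"
      unfolding \<kappa>_def \<gamma>(2) by (simp add: rep_unrep[OF e])
  qed
  have cov0: "covD nabla e \<gamma> \<kappa> 0 = rep e x A"
    unfolding tc(3)[OF t0] U0 b1 vector_derivative_at[OF N(4)] by (rule blinfun_eqI) simp
  have cov: "covD nabla e' \<gamma> \<kappa> 0 = rep e' x A" if e': "isfr V' e'" "x \<in> V'" for V' e'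
    using covD_all_frames[OF nc tc(1) _ t0 e(1) _ e'(1)] e e' AE cov0 \<gamma>(2) by simp
  have par: "parallel_End_along B nabla {-\<epsilon><..<\<epsilon>} \<gamma> \<kappa>" if A0: "A = (\<lambda>u. 0)"
  proof (rule parallelI[OF nc tc(1) _ e(1) \<gamma>(4)])
    have "N = (\<lambda>t. rep e x K)" using N(5) rep_zero[OF e] A0 by simp
    then have "vector_derivative N (at t) = 0" for t by simp
    then show "covD nabla e \<gamma> \<kappa> t = 0" if "t \<in> {-\<epsilon><..<\<epsilon>}" for t
      unfolding tc(3)[OF that] by (intro blinfun_eqI) (simp add: blinfun.zero_right)
  qed simp
  show thesis by (rule that[OF \<epsilon> tc(1,2) \<gamma>(2) k0 \<gamma>(3) cov par])
qed

lemma End_charts_cases: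
  obtains "C \<notin> End_charts B \<or> p \<notin> fst C"
  | c V e where "C = echart c V e" "c \<in> charts B" "fst p \<in> fst c" "isfr V e" "fst p \<in> V" "snd p \<in> End_fiber B (fst p)"
proof (cases "C \<in> End_charts B \<and> p \<in> fst C")
  case True
  then obtain c V e where "c \<in> charts B" "isfr V e" "C = echart c V e" using End_chartsE by metis
  then show ?thesis using that(2) True by (simp add: mem_echart)
qed (use that(1) in blast)

text \<open>Along a parallel translate the covariant derivative vanishes, which expresses its velocity by the
  connection form. The velocity in the definition of the lift is therefore unique, and one exists by
  parallel transport.\<close>

lemma horizontal_lift_eq:
  assumes n: "metric_conn g nabla" and g: "compatible_metric B g"
    and p: "(x, K) \<in> twistor_space B g" and v: "v \<in> tang B x"
  shows "c \<in> charts B \<Longrightarrow> x \<in> fst c \<Longrightarrow> isfr V e \<Longrightarrow> x \<in> V \<Longrightarrow>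
      horizontal_lift B nabla (x, K) v (echart c V e) =
      (v c, (rep e x K o\<^sub>L cform nabla e x v) - (cform nabla e x v o\<^sub>L rep e x K))"
    and "C \<notin> End_charts B \<or> (x, K) \<notin> fst C \<Longrightarrow> horizontal_lift B nabla (x, K) v C = 0"
proof -
  define Q where "Q h \<longleftrightarrow> (\<exists>\<epsilon>>0. \<exists>\<gamma> \<kappa>.
     parallel_End_along B nabla {-\<epsilon><..<\<epsilon>} \<gamma> \<kappa> \<and> (\<gamma> 0, \<kappa> 0) = (x, K) \<and>
     velocity (charts B) \<gamma> 0 = v \<and> h = velocity (End_charts B) (\<lambda>t. (\<gamma> t, \<kappa> t)) 0)" for h
  have nc: "is_connection B nabla" using n by (simp add: metric_conn_def)
  have val: "h (echart c V e) = (v c, (rep e x K o\<^sub>L cform nabla e x v) - (cform nabla e x v o\<^sub>L rep e x K))"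
    if Q: "Q h" and c: "c \<in> charts B" "x \<in> fst c" and e: "isfr V e" "x \<in> V" for h c V e
  proof -
    obtain \<epsilon> \<gamma> \<kappa> where \<epsilon>: "\<epsilon> > 0" and par: "parallel_End_along B nabla {-\<epsilon><..<\<epsilon>} \<gamma> \<kappa>"
      and 0: "\<gamma> 0 = x" "\<kappa> 0 = K" "velocity (charts B) \<gamma> 0 = v" "h = velocity (End_charts B) (\<lambda>t. (\<gamma> t, \<kappa> t)) 0"
      using Q unfolding Q_def by blast
    have \<Gamma>: "smooth_curve (End_charts B) {-\<epsilon><..<\<epsilon>} (\<lambda>t. (\<gamma> t, \<kappa> t))"
      using par unfolding parallel_End_along_def by blast
    have "covD nabla e \<gamma> \<kappa> 0 = 0" by (rule parallel_covD[OF nc par \<epsilon> e(1)]) (use 0 e in simp)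
    then have "vector_derivative (\<lambda>\<tau>. rep e (\<gamma> \<tau>) (\<kappa> \<tau>)) (at 0) =
        (rep e x K o\<^sub>L cform nabla e x v) - (cform nabla e x v o\<^sub>L rep e x K)"
      unfolding covD_def 0 by (simp add: algebra_simps)
    then show ?thesis
      using End_velocity[OF \<Gamma>, of 0 c V e] \<epsilon> c e 0 by simp
  qed
  have out: "h C = 0" if Qh: "Q h" and oC: "C \<notin> End_charts B \<or> (x, K) \<notin> fst C" for h C
  proof -
    obtain \<gamma> \<kappa> where "(\<gamma> 0, \<kappa> 0) = (x, K)" "h = velocity (End_charts B) (\<lambda>t. (\<gamma> t, \<kappa> t)) 0"
      using Qh unfolding Q_def by blast
    then show ?thesis using oC velocity_outside[of C "End_charts B" "\<lambda>t. (\<gamma> t, \<kappa> t)" 0] by simp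
  qed
  have z: "(\<lambda>u. 0) \<in> vertical_space B g (x, K)"
  proof -
    obtain V e where e: "isfr V e" "x \<in> V" by (rule ex_frame)
    have K: "K \<in> End_fiber B x" using p unfolding twistor_iff[OF e g] by simp
    show ?thesis
      unfolding vertical_iff[OF e g K zero_End] by (simp add: rep_zero[OF e] blinfun.zero_right)
  qed
  obtain \<epsilon> \<gamma> \<kappa> where "\<epsilon> > 0" "\<gamma> 0 = x" "\<kappa> 0 = K"
    "velocity (charts B) \<gamma> 0 = v" "parallel_End_along B nabla {-\<epsilon><..<\<epsilon>} \<gamma> \<kappa>"
    by (rule curve_with_velocity[OF n g p z v]) (rule that, simp_all)
  then have Q0: "Q (velocity (End_charts B) (\<lambda>t. (\<gamma> t, \<kappa> t)) 0)" unfolding Q_def by blast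
  have uniq: "h = h'" if "Q h" "Q h'" for h h'
  proof
    fix C show "h C = h' C"
    proof (cases rule: End_charts_cases[of C "(x, K)"])
      case 1
      then show ?thesis using out that by metis
    next
      case (2 c V e)
      then show ?thesis using val[OF that(1), of c V e] val[OF that(2), of c V e] by simp
    qed
  qed
  have "horizontal_lift B nabla (x, K) v = (THE h. Q h)"
    unfolding horizontal_lift_def Q_def ..
  moreover have "Q (THE h. Q h)" by (rule theI[of Q, OF Q0]) (rule uniq[OF _ Q0])
  ultimately have Qh: "Q (horizontal_lift B nabla (x, K) v)" by simp
  show "c \<in> charts B \<Longrightarrow> x \<in> fst c \<Longrightarrow> isfr V e \<Longrightarrow> x \<in> V \<Longrightarrow>
      horizontal_lift B nabla (x, K) v (echart c V e) =
      (v c, (rep e x K o\<^sub>L cform nabla e x v) - (cform nabla e x v o\<^sub>L rep e x K))"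
    "C \<notin> End_charts B \<or> (x, K) \<notin> fst C \<Longrightarrow> horizontal_lift B nabla (x, K) v C = 0"
    by (rule val[OF Qh], assumption+) (rule out[OF Qh])
qed

lemma vert_eq:
  assumes K: "K \<in> End_fiber B x" and A: "A \<in> End_fiber B x"
  shows "c \<in> charts B \<Longrightarrow> x \<in> fst c \<Longrightarrow> isfr V e \<Longrightarrow> x \<in> V \<Longrightarrow>
      vert B (x, K) A (echart c V e) = (0, rep e x A)"
    and "C \<notin> End_charts B \<or> (x, K) \<notin> fst C \<Longrightarrow> vert B (x, K) A C = 0"
proof -
  define L where "L t = (\<lambda>u. K u + t *\<^sub>R A u)" for t :: real
  have v: "vert B (x, K) A = velocity (End_charts B) (\<lambda>t. (x, L t)) 0" by (simp add: vert_def L_def)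
  have L0: "L 0 = K" by (simp add: L_def)
  have LE: "L t \<in> End_fiber B x" for t
    using End_fiberD[OF K] End_fiberD[OF A] unfolding L_def End_fiber_def real_linear_on_def
    by (auto simp: fiber_add fiber_scale algebra_simps)
  show "C \<notin> End_charts B \<or> (x, K) \<notin> fst C \<Longrightarrow> vert B (x, K) A C = 0"
    unfolding v using velocity_outside[of C "End_charts B" "\<lambda>t. (x, L t)" 0] L0 by simp
  assume c: "c \<in> charts B" "x \<in> fst c" and e: "isfr V e" "x \<in> V"
  have "rep e x (L t) = rep e x K + t *\<^sub>R rep e x A" for t
    unfolding L_def by (rule blinfun_eqI)
       (simp add: rep_End(1)[OF e LE[unfolded L_def]] blinfun.bilinear_simps rep_End(1)[OF e K] rep_End(1)[OF e A]
        coord_add[OF e] coord_scale[OF e] fiber_scale End_fiberD(1)[OF K] End_fiberD(1)[OF A] comb_mem[OF e])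
  then have "((\<lambda>t. snd (echart c V e) (x, L t)) has_vector_derivative (0, rep e x A)) (at 0)"
    by (auto simp: snd_echart intro!: derivative_eq_intros has_vector_derivative_Pair)
  from vector_derivative_at[OF this] show "vert B (x, K) A (echart c V e) = (0, rep e x A)"
    unfolding v velocity_def using c e L0 K echart_mem[OF c(1) e(1)] by (simp add: mem_echart)
qed

lemma velocity_decompose:
  assumes n: "metric_conn g nabla" and g: "compatible_metric B g"
    and p: "(x, K) \<in> twistor_space B g" and v: "v \<in> tang B x" and A: "A \<in> End_fiber B x"
    and \<Gamma>: "smooth_curve (End_charts B) T (\<lambda>t. (\<gamma> t, \<kappa> t))" "open T" "0 \<in> T"
    and 0: "\<gamma> 0 = x" "\<kappa> 0 = K" "velocity (charts B) \<gamma> 0 = v"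
    and cov: "\<And>V e. isfr V e \<Longrightarrow> x \<in> V \<Longrightarrow> covD nabla e \<gamma> \<kappa> 0 = rep e x A"
  shows "velocity (End_charts B) (\<lambda>t. (\<gamma> t, \<kappa> t)) 0 = vert B (x, K) A + horizontal_lift B nabla (x, K) v"
proof
  have K: "K \<in> End_fiber B x" using p by (simp add: twistor_space_def)
  fix C
  show "velocity (End_charts B) (\<lambda>t. (\<gamma> t, \<kappa> t)) 0 C = (vert B (x, K) A + horizontal_lift B nabla (x, K) v) C"
  proof (cases rule: End_charts_cases[of C "(x, K)"])
    case 1
    then show ?thesis
      using velocity_outside[of C "End_charts B" "\<lambda>t. (\<gamma> t, \<kappa> t)" 0] 0
        vert_eq(2)[OF K A] horizontal_lift_eq(2)[OF n g p v] by simp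
  next
    case (2 c V e)
    then have c: "c \<in> charts B" "x \<in> fst c" and e: "isfr V e" "x \<in> V" by auto
    have "vector_derivative (\<lambda>\<tau>. rep e (\<gamma> \<tau>) (\<kappa> \<tau>)) (at 0) =
        rep e x A + ((rep e x K o\<^sub>L cform nabla e x v) - (cform nabla e x v o\<^sub>L rep e x K))"
      unfolding cov[OF e, symmetric] covD_def 0 by simp
    then show ?thesis
      using End_velocity[OF \<Gamma>, of c V e] c e 0
      by (simp add: 2(1) vert_eq(1)[OF K A c e] horizontal_lift_eq(1)[OF n g p v c e])
  qed
qed

text \<open>The vertical part of a velocity is the covariant derivative of the curve of endomorphisms; it is
  vertical by differentiating the conditions defining the twistor space.\<close>

lemma tangent_decompose:
  assumes n: "metric_conn g nabla" and g: "compatible_metric B g" and p: "(x, K) \<in> twistor_space B g"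
    and \<xi>: "\<xi> \<in> tangent_space (End_charts B) (twistor_space B g) (x, K)"
  obtains A v where "A \<in> vertical_space B g (x, K)" "v \<in> tang B x"
    "\<xi> = vert B (x, K) A + horizontal_lift B nabla (x, K) v"
proof -
  have nc: "is_connection B nabla" using n by (simp add: metric_conn_def)
  obtain \<epsilon> \<Gamma> where \<epsilon>: "\<epsilon> > 0" and \<Gamma>: "smooth_curve (End_charts B) {-\<epsilon><..<\<epsilon>} \<Gamma>"
    "\<Gamma> ` {-\<epsilon><..<\<epsilon>} \<subseteq> twistor_space B g" "\<Gamma> 0 = (x, K)" "\<xi> = velocity (End_charts B) \<Gamma> 0"
    using \<xi> unfolding tangent_space_def by blast
  define \<gamma> \<kappa> where "\<gamma> t = fst (\<Gamma> t)" and "\<kappa> t = snd (\<Gamma> t)" for t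
  have \<Gamma>eq: "\<Gamma> = (\<lambda>t. (\<gamma> t, \<kappa> t))" by (simp add: \<gamma>_def \<kappa>_def)
  have 0: "\<gamma> 0 = x" "\<kappa> 0 = K" using \<Gamma>(3) by (simp_all add: \<gamma>_def \<kappa>_def)
  let ?T = "{-\<epsilon><..<\<epsilon>}"
  have t0: "0 \<in> ?T" using \<epsilon> by simp
  have EC: "smooth_curve (End_charts B) ?T (\<lambda>t. (\<gamma> t, \<kappa> t))" using \<Gamma>(1) by (simp add: \<Gamma>eq)
  have bc: "smooth_curve (charts B) ?T \<gamma>" using End_curve_base[OF EC] by simp
  define v where "v = velocity (charts B) \<gamma> 0"
  have v: "v \<in> tang B x" using velocity_tangent[OF bc _ t0] 0 by (simp add: v_def)
  obtain V e where e: "isfr V e" "x \<in> V" by (rule ex_frame)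
  have KE: "K \<in> End_fiber B x" and M0: "rep e x K \<in> ortho_cs (gmat g e x)"
    using p unfolding twistor_iff[OF e g] by auto
  define S where "S = {t\<in>?T. \<gamma> t \<in> V}"
  have S: "open S" "0 \<in> S"
    unfolding S_def using smooth_curve_preimage_open[OF bc frame_open[OF e(1)]] t0 e 0 by auto
  let ?M = "\<lambda>t. rep e (\<gamma> t) (\<kappa> t)" and ?G = "\<lambda>t. gmat g e (\<gamma> t)"
  have M: "?M t \<in> ortho_cs (?G t)" if "t \<in> S" for t
  proof -
    have "(\<gamma> t, \<kappa> t) \<in> twistor_space B g" "\<gamma> t \<in> V"
      using \<Gamma>(2) that by (auto simp: \<gamma>_def \<kappa>_def S_def)
    then show ?thesis using twistor_iff[OF e(1) _ g] by blast
  qed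
  define X where "X = vector_derivative ?M (at 0)"
  have dM: "(?M has_vector_derivative X) (at 0)"
    unfolding X_def by (rule smooth_on_vector_derivative[OF End_curve_rep[OF EC e(1), simplified]])
      (use S in \<open>simp add: S_def\<close>)
  define dG where "dG = dfun (charts B) (gmat g e) x v"
  have dGd: "(?G has_vector_derivative dG) (at 0)"
    using curve_fun_derivative[OF bc _ t0 gmat_smooth[OF e(1) g]] 0 e by (simp add: dG_def v_def)
  have XM: "X (rep e x K a) + rep e x K (X a) = 0" for a
  proof -
    have 1: "((\<lambda>t. ?M t (?M t a)) has_vector_derivative ?M 0 (X a) + X (?M 0 a)) (at 0)"
      by (rule bounded_bilinear.has_vector_derivative[OF bounded_bilinear_blinfun_apply dM
            bounded_linear.has_vector_derivative[OF blinfun.bounded_linear_left dM]])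
    have "((\<lambda>t. - a) has_vector_derivative 0) (at 0)" by simp
    then have "((\<lambda>t. ?M t (?M t a)) has_vector_derivative 0) (at 0)"
      by (rule has_vector_derivative_transform_within_open[OF _ S]) (use M in \<open>simp add: ortho_cs_def\<close>)
    from vector_derivative_unique_at[OF 1 this] show ?thesis by (simp add: 0 add.commute)
  qed
  have GM: "dG (rep e x K a) \<bullet> rep e x K b + gmat g e x (X a) \<bullet> rep e x K b + gmat g e x (rep e x K a) \<bullet> X b
      = dG a \<bullet> b" for a b
  proof -
    have Ma: "((\<lambda>t. ?M t a) has_vector_derivative X a) (at 0)" for a
      by (rule bounded_linear.has_vector_derivative[OF blinfun.bounded_linear_left dM])
    have 1: "((\<lambda>t. ?G t (?M t a) \<bullet> ?M t b) has_vector_derivative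
        ?G 0 (?M 0 a) \<bullet> X b + (?G 0 (X a) + dG (?M 0 a)) \<bullet> ?M 0 b) (at 0)"
      by (rule bounded_bilinear.has_vector_derivative[OF bounded_bilinear_inner
            bounded_bilinear.has_vector_derivative[OF bounded_bilinear_blinfun_apply dGd Ma] Ma])
    have "((\<lambda>t. ?G t a \<bullet> b) has_vector_derivative dG a \<bullet> b) (at 0)"
      by (rule bounded_linear.has_vector_derivative[OF bounded_linear_entry dGd])
    then have "((\<lambda>t. ?G t (?M t a) \<bullet> ?M t b) has_vector_derivative dG a \<bullet> b) (at 0)"
      by (rule has_vector_derivative_transform_within_open[OF _ S]) (use M in \<open>simp add: ortho_cs_def\<close>)
    from vector_derivative_unique_at[OF 1 this] show ?thesis by (simp add: 0 inner_add_left)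
  qed
  define A where "A = unrep e x (covD nabla e \<gamma> \<kappa> 0)"
  have AE: "A \<in> End_fiber B x" unfolding A_def by (rule unrep_End[OF e])
  have repA: "rep e x A = covD nabla e \<gamma> \<kappa> 0" unfolding A_def by (rule rep_unrep[OF e])
  have "rep e x A = X + (cform nabla e x v o\<^sub>L rep e x K) - (rep e x K o\<^sub>L cform nabla e x v)"
    unfolding repA covD_def X_def v_def 0 ..
  then have "A \<in> vertical_space B g (x, K)"
    unfolding vertical_iff[OF e g KE AE]
    using metric_derivative_vertical[OF M0 XM metric_connD[OF n e v] GM[unfolded dG_def]] by simp
  moreover have "\<xi> = vert B (x, K) A + horizontal_lift B nabla (x, K) v"
    unfolding \<Gamma>(4) \<Gamma>eq
  proof (rule velocity_decompose[OF n g p v AE EC _ t0 0 v_def[symmetric]])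
    fix V' e' assume e': "isfr V' e'" "x \<in> V'"
    show "covD nabla e' \<gamma> \<kappa> 0 = rep e' x A"
      using covD_all_frames[OF nc EC _ t0 e(1) _ e'(1)] e e' AE 0 repA by simp
  qed simp
  ultimately show thesis using that v by blast
qed

lemma comp_vertical:
  assumes g: "compatible_metric B g" and p: "(x, K) \<in> twistor_space B g" and A: "A \<in> vertical_space B g (x, K)"
  shows "K \<circ> A \<in> vertical_space B g (x, K)"
    and "isfr V e \<Longrightarrow> x \<in> V \<Longrightarrow> rep e x (K \<circ> A) = rep e x K o\<^sub>L rep e x A"
proof -
  have K: "K \<in> End_fiber B x" using p by (simp add: twistor_space_def)
  have AE: "A \<in> End_fiber B x" using A by (simp add: vertical_space_def)
  have K0: "K 0 = 0"
    using End_fiberD(2)[OF K] fiber_0[of x] unfolding real_linear_on_def by (metis scaleR_zero_left)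
  have KA: "K \<circ> A \<in> End_fiber B x"
    unfolding End_fiber_def real_linear_on_def
    using End_fiberD[OF K] End_fiberD[OF AE] K0 by (auto simp: real_linear_on_def)
  show rep: "rep e x (K \<circ> A) = rep e x K o\<^sub>L rep e x A" if e: "isfr V e" "x \<in> V" for V e
    by (rule blinfun_eqI)
       (simp add: rep_End(1)[OF e KA] rep_End(1)[OF e K] rep_End(2)[OF e AE])
  obtain V e where e: "isfr V e" "x \<in> V" by (rule ex_frame)
  have M: "rep e x K \<in> ortho_cs (gmat g e x)" using p unfolding twistor_iff[OF e g] by simp
  have MM: "rep e x K (rep e x K a) = - a" for a using M by (simp add: ortho_cs_def)
  have v: "gmat g e x (rep e x A a) \<bullet> b = - (gmat g e x a \<bullet> rep e x A b)"
    "rep e x A (rep e x K a) = - rep e x K (rep e x A a)" for a b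
    using A unfolding vertical_iff[OF e g K AE] by (simp_all add: eq_neg_iff_add_eq_0)
  show "K \<circ> A \<in> vertical_space B g (x, K)"
    unfolding vertical_iff[OF e g K KA] rep[OF e]
    by (simp add: v MM blinfun.minus_right ortho_cs_skew[OF M])
qed

text \<open>For \<open>\<xi>\<close> with components \<open>(a, X)\<close> the vertical part is \<open>A = X + [\<Theta>1, M]\<close>, with \<open>\<Theta>1\<close> the connection form at \<open>v\<close>.
  The image has vertical part \<open>M A\<close> and base component \<open>i a\<close>, whose horizontal lift is \<open>- [\<Theta>2, M]\<close> in the
  fiber, and the sum is \<open>acs_comp\<close>. In particular the definition through a decomposition of \<open>\<xi>\<close> is
  independent of the choice of decomposition.\<close>

theorem twistor_acs_eq:
  assumes n: "metric_conn g nabla" and g: "compatible_metric B g" and p: "(x, K) \<in> twistor_space B g"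
    and \<xi>: "\<xi> \<in> tangent_space (End_charts B) (twistor_space B g) (x, K)"
  shows "twistor_acs B g nabla (x, K) \<xi> \<in> tangent_space (End_charts B) (twistor_space B g) (x, K)"
    and "c \<in> charts B \<Longrightarrow> x \<in> fst c \<Longrightarrow> isfr V e \<Longrightarrow> x \<in> V \<Longrightarrow>
      twistor_acs B g nabla (x, K) \<xi> (echart c V e) =
        (\<i> *s fst (\<xi> (echart c V e)), acs_comp (rep e x K)
          (cform nabla e x (coord_vec (charts B) c x (fst (\<xi> (echart c V e)))))
          (cform nabla e x (coord_vec (charts B) c x (\<i> *s fst (\<xi> (echart c V e)))))
          (snd (\<xi> (echart c V e))))"
proof -
  have K: "K \<in> End_fiber B x" using p by (simp add: twistor_space_def)
  have AE: "A \<in> End_fiber B x" if "A \<in> vertical_space B g (x, K)" for A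
    using that by (simp add: vertical_space_def)
  note hl = horizontal_lift_eq[OF n g p]
  have comp: "(vert B (x, K) A + horizontal_lift B nabla (x, K) v) (echart c V e) =
      (v c, rep e x A + ((rep e x K o\<^sub>L cform nabla e x v) - (cform nabla e x v o\<^sub>L rep e x K)))"
    if "A \<in> vertical_space B g (x, K)" "v \<in> tang B x" "c \<in> charts B" "x \<in> fst c" "isfr V e" "x \<in> V" for A v c V e
    using vert_eq(1)[OF K AE[OF that(1)] that(3-6)] hl(1)[OF that(2-6)] by simp
  define Q where "Q \<eta> \<longleftrightarrow> (\<exists>A\<in>vertical_space B g (x, K). \<exists>v\<in>tang B x.
     \<xi> = vert B (x, K) A + horizontal_lift B nabla (x, K) v \<and>
     \<eta> = vert B (x, K) (K \<circ> A) + horizontal_lift B nabla (x, K) (cplx_I v))" for \<eta>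
  obtain A v where A: "A \<in> vertical_space B g (x, K)" and v: "v \<in> tang B x"
    and dec: "\<xi> = vert B (x, K) A + horizontal_lift B nabla (x, K) v"
    by (rule tangent_decompose[OF n g p \<xi>])
  obtain c0 where c0: "c0 \<in> charts B" "x \<in> fst c0" by (rule ex_chart)
  obtain V0 e0 where e0: "isfr V0 e0" "x \<in> V0" by (rule ex_frame)
  have uniq: "A' = A \<and> v' = v" if A': "A' \<in> vertical_space B g (x, K)" and v': "v' \<in> tang B x"
    and dec': "\<xi> = vert B (x, K) A' + horizontal_lift B nabla (x, K) v'" for A' v'
  proof -
    have eq: "(v' c0, rep e0 x A' + ((rep e0 x K o\<^sub>L cform nabla e0 x v') - (cform nabla e0 x v' o\<^sub>L rep e0 x K)))
      = (v c0, rep e0 x A + ((rep e0 x K o\<^sub>L cform nabla e0 x v) - (cform nabla e0 x v o\<^sub>L rep e0 x K)))"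
      unfolding comp[OF A v c0 e0, symmetric] comp[OF A' v' c0 e0, symmetric] dec[symmetric] dec'[symmetric] ..
    then have "v' c0 = v c0" by simp
    then have vv: "v' = v" using tangent_eq_coord_vec[OF v c0] tangent_eq_coord_vec[OF v' c0] by simp
    with eq have "rep e0 x A' = rep e0 x A" by simp
    then show ?thesis using End_eqI[OF e0 AE[OF A'] AE[OF A]] vv by blast
  qed
  have "twistor_acs B g nabla (x, K) \<xi> = (THE \<eta>. Q \<eta>)"
    unfolding twistor_acs_def Q_def by simp
  also have "\<dots> = vert B (x, K) (K \<circ> A) + horizontal_lift B nabla (x, K) (cplx_I v)"
  proof (rule the_equality)
    show "Q (vert B (x, K) (K \<circ> A) + horizontal_lift B nabla (x, K) (cplx_I v))"
      unfolding Q_def using A v dec by blast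
    fix \<eta> assume "Q \<eta>"
    then show "\<eta> = vert B (x, K) (K \<circ> A) + horizontal_lift B nabla (x, K) (cplx_I v)"
      unfolding Q_def using uniq by blast
  qed
  finally have acs: "twistor_acs B g nabla (x, K) \<xi> =
      vert B (x, K) (K \<circ> A) + horizontal_lift B nabla (x, K) (cplx_I v)" .
  note KA = comp_vertical(1)[OF g p A]
  note Iv = cplx_I_tangent[OF v]
  obtain \<epsilon> \<gamma> \<kappa> where \<epsilon>: "\<epsilon> > 0" and EC: "smooth_curve (End_charts B) {-\<epsilon><..<\<epsilon>} (\<lambda>t. (\<gamma> t, \<kappa> t))"
    "\<And>t. t \<in> {-\<epsilon><..<\<epsilon>} \<Longrightarrow> (\<gamma> t, \<kappa> t) \<in> twistor_space B g" "\<gamma> 0 = x" "\<kappa> 0 = K"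
    "velocity (charts B) \<gamma> 0 = cplx_I v" "\<And>V e. isfr V e \<Longrightarrow> x \<in> V \<Longrightarrow> covD nabla e \<gamma> \<kappa> 0 = rep e x (K \<circ> A)"
    by (rule curve_with_velocity[OF n g p KA Iv]) (rule that, assumption+)
  have "twistor_acs B g nabla (x, K) \<xi> = velocity (End_charts B) (\<lambda>t. (\<gamma> t, \<kappa> t)) 0"
    unfolding acs
    by (rule velocity_decompose[OF n g p Iv AE[OF KA] EC(1) _ _ EC(3-6), symmetric]) (use \<epsilon> in auto)
  then show "twistor_acs B g nabla (x, K) \<xi> \<in> tangent_space (End_charts B) (twistor_space B g) (x, K)"
    unfolding tangent_space_def using \<epsilon> EC(1-4) by blast
  assume c: "c \<in> charts B" "x \<in> fst c" and e: "isfr V e" "x \<in> V"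
  have x1: "\<xi> (echart c V e) = (v c, rep e x A + ((rep e x K o\<^sub>L cform nabla e x v) - (cform nabla e x v o\<^sub>L rep e x K)))"
    unfolding dec by (rule comp[OF A v c e])
  have vc: "coord_vec (charts B) c x (v c) = v" by (rule tangent_eq_coord_vec[OF v c, symmetric])
  have ivc: "coord_vec (charts B) c x (\<i> *s v c) = cplx_I v"
    unfolding coord_vec_linear(3)[OF c] vc ..
  have ic: "cplx_I v c = \<i> *s v c" by (simp add: cplx_I_def)
  show "twistor_acs B g nabla (x, K) \<xi> (echart c V e) =
        (\<i> *s fst (\<xi> (echart c V e)), acs_comp (rep e x K)
          (cform nabla e x (coord_vec (charts B) c x (fst (\<xi> (echart c V e)))))
          (cform nabla e x (coord_vec (charts B) c x (\<i> *s fst (\<xi> (echart c V e)))))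
          (snd (\<xi> (echart c V e))))"
    unfolding acs comp[OF KA Iv c e] x1 fst_conv snd_conv vc ivc ic comp_vertical(2)[OF g p A e] acs_comp_def
    by (simp add: algebra_simps)
qed

end

section \<open>The bundle \<open>E\<^sup>1\<^sup>,\<^sup>0 \<oplus> E\<^sup>*\<^sup>1\<^sup>,\<^sup>0\<close> in terms of a metric\<close>

lemma half_sum: "(1/2) *\<^sub>R (p + q) + (1/2) *\<^sub>R (p - q) = (p :: 'a::real_vector)"
    "(1/2) *\<^sub>R (p + q) - (1/2) *\<^sub>R (p - q) = (q :: 'a::real_vector)"
  by (simp_all add: scaleR_right_distrib scaleR_right_diff_distrib scaleR_left_distrib[symmetric])

context hol_bundle
begin

abbreviation opg where "opg \<equiv> one_plus_g B"

text \<open>The complex linear extension of \<open>g(\<omega>, -)\<close>, restricted to \<open>E\<^sup>1\<^sup>,\<^sup>0\<close>, whose elements are \<open>u - i J u\<close>.\<close>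

definition lam :: "('m \<Rightarrow> 'v \<Rightarrow> 'v \<Rightarrow> real) \<Rightarrow> 'm \<Rightarrow> 'v \<Rightarrow> 'v cplxf \<Rightarrow> complex" where
  "lam g x \<omega> = (\<lambda>z. if z \<in> E10 B x then Complex (g x \<omega> (fst z)) (- g x \<omega> (bJ B x (fst z))) else 0)"

lemma E10_iff: "z \<in> E10 B x \<longleftrightarrow> fst z \<in> fiber B x \<and> snd z = - bJ B x (fst z)"
proof (cases z)
  case (Pair a b)
  have 1: "- bJ B x a \<in> fiber B x \<and> bJ B x (- bJ B x a) = a" if "a \<in> fiber B x"
    using that by (simp add: J_neg J_mem fiber_neg JJ)
  have "(a, b) \<in> E10 B x \<longleftrightarrow> a \<in> fiber B x \<and> b \<in> fiber B x \<and> bJ B x a = - b \<and> bJ B x b = a"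
    by (simp add: E10_def EC_def JC_def cscale_def)
  also have "\<dots> \<longleftrightarrow> a \<in> fiber B x \<and> b = - bJ B x a"
    using 1 by (metis minus_minus)
  finally show ?thesis by (simp add: Pair)
qed

lemma pr_eq:
  "pr10 B x (u, w) = ((1/2) *\<^sub>R (u + bJ B x w), (1/2) *\<^sub>R (w - bJ B x u))"
  "pr01 B x (u, w) = ((1/2) *\<^sub>R (u - bJ B x w), (1/2) *\<^sub>R (w + bJ B x u))"
  unfolding pr10_def pr01_def cscale_def JC_def by simp_all

context
  fixes g and x :: 'm
  assumes g: "compatible_metric B g"
begin

lemma gJ: "u \<in> fiber B x \<Longrightarrow> w \<in> fiber B x \<Longrightarrow> g x (bJ B x u) w = - g x u (bJ B x w)"
  using metricD(2)[OF g, of u x "bJ B x w"] metric_lin(2)[OF g, of "bJ B x u" x w w "-1"]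
  by (simp add: JJ J_mem)

lemma g_neg: "u \<in> fiber B x \<Longrightarrow> w \<in> fiber B x \<Longrightarrow> g x u (- w) = - g x u w"
    "u \<in> fiber B x \<Longrightarrow> w \<in> fiber B x \<Longrightarrow> g x (- w) u = - g x w u"
  using metric_lin(2)[OF g, of u x w w "-1"] metric_lin(4)[OF g, of u x w w "-1"] by simp_all

lemma g_diff: "u \<in> fiber B x \<Longrightarrow> w \<in> fiber B x \<Longrightarrow> w' \<in> fiber B x \<Longrightarrow> g x u (w - w') = g x u w - g x u w'"
    "u \<in> fiber B x \<Longrightarrow> w \<in> fiber B x \<Longrightarrow> w' \<in> fiber B x \<Longrightarrow> g x (w - w') u = g x w u - g x w' u"
  using metric_lin(1)[OF g, of u x w "- w'"] metric_lin(3)[OF g, of u x w "- w'"]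
  by (simp_all add: g_neg fiber_neg)

text \<open>The map \<open>1 \<oplus> g\<close> on \<open>u + i w\<close>, in real terms.\<close>

lemma opg_eq:
  assumes u: "u \<in> fiber B x" and w: "w \<in> fiber B x"
  shows "opg g x (u, w) = (((1/2) *\<^sub>R (u + bJ B x w), - ((1/2) *\<^sub>R bJ B x (u + bJ B x w))), lam g x (u - bJ B x w))"
proof -
  note m = u w J_mem[OF u] J_mem[OF w]
  have 1: "w - bJ B x u = - bJ B x (u + bJ B x w)" "w + bJ B x u = bJ B x (u - bJ B x w)"
    using m by (simp_all add: J_add J_diff JJ)
  have "gC g x ((1/2) *\<^sub>R (u - bJ B x w), (1/2) *\<^sub>R bJ B x (u - bJ B x w)) z =
      Complex (g x (u - bJ B x w) (fst z)) (- g x (u - bJ B x w) (bJ B x (fst z)))" if z: "z \<in> E10 B x" for z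
  proof -
    define \<omega> a where "\<omega> = u - bJ B x w" and "a = fst z"
    have m: "\<omega> \<in> fiber B x" "bJ B x \<omega> \<in> fiber B x" "a \<in> fiber B x" "bJ B x a \<in> fiber B x"
      using u w z by (auto simp: \<omega>_def a_def E10_iff J_mem fiber_diff)
    have z: "fst z = a" "snd z = - bJ B x a" using z by (auto simp: a_def E10_iff)
    show ?thesis
      unfolding gC_def z \<omega>_def[symmetric] fst_conv snd_conv
      using m by (simp add: metric_lin(4)[OF g] g_neg metricD(2)[OF g] gJ fiber_neg)
  qed
  then show ?thesis
    unfolding one_plus_g_def pr_eq g_iso_def lam_def 1 by (simp add: fun_eq_iff)
qed

lemma lam_inj:
  assumes u: "u \<in> fiber B x" and w: "w \<in> fiber B x" and eq: "lam g x u = lam g x w"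
  shows "u = w"
proof -
  define d where "d = u - w"
  have d: "d \<in> fiber B x" unfolding d_def by (rule fiber_diff[OF u w])
  have E: "(d, - bJ B x d) \<in> E10 B x" by (simp add: E10_iff d)
  have "lam g x y (d, - bJ B x d) = Complex (g x y d) (- g x y (bJ B x d))" for y
    by (simp only: lam_def E if_True fst_conv)
  then have "g x u d = g x w d" using eq by (metis complex.sel(1))
  then have "g x d d = 0" using g_diff(2)[OF d u w] by (simp add: d_def[symmetric])
  then have "d = 0" using metricD(3)[OF g d d] by fastforce
  then show "u = w" by (simp add: d_def)
qed

lemma opg_inj:
  assumes "opg g x (u, w) = opg g x (u', w')" "u \<in> fiber B x" "w \<in> fiber B x" "u' \<in> fiber B x" "w' \<in> fiber B x"
  shows "u = u'" "w = w'"
proof -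
  have eq: "(1/2) *\<^sub>R (u + bJ B x w) = (1/2) *\<^sub>R (u' + bJ B x w')" "lam g x (u - bJ B x w) = lam g x (u' - bJ B x w')"
    using assms(1) unfolding opg_eq[OF assms(2,3)] opg_eq[OF assms(4,5)] prod.inject by blast+
  have 1: "u + bJ B x w = u' + bJ B x w'" using eq(1) by simp
  have 2: "u - bJ B x w = u' - bJ B x w'"
    by (rule lam_inj[OF fiber_diff[OF assms(2) J_mem[OF assms(3)]] fiber_diff[OF assms(4) J_mem[OF assms(5)]] eq(2)])
  show "u = u'" by (metis half_sum(1) 1 2)
  have "bJ B x w = bJ B x w'" by (metis half_sum(2) 1 2)
  then have "- w = - w'" by (metis JJ assms(3,5))
  then show "w = w'" by (simp only: neg_equal_iff_equal)
qed

lemma lam_dual: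
  assumes \<omega>: "\<omega> \<in> fiber B x"
  shows "lam g x \<omega> \<in> E10dual B x"
proof -
  have "lam g x \<omega> (z + w) = lam g x \<omega> z + lam g x \<omega> w" if "z \<in> E10 B x" "w \<in> E10 B x" for z w
  proof -
    have "z + w \<in> E10 B x" using that by (simp add: E10_iff fiber_add J_add)
    then show ?thesis
      using that \<omega> by (simp add: lam_def E10_iff J_add metric_lin(1)[OF g] J_mem complex_eq_iff)
  qed
  moreover have "lam g x \<omega> (cscale c z) = c * lam g x \<omega> z" if "z \<in> E10 B x" for c z
  proof -
    define a where "a = fst z"
    have a: "a \<in> fiber B x" "fst z = a" "snd z = - bJ B x a" using that by (auto simp: a_def E10_iff)
    note m = a(1) J_mem[OF a(1)] fiber_scale[OF a(1)] fiber_scale[OF J_mem[OF a(1)]]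
    have f: "fst (cscale c z) = Re c *\<^sub>R a + Im c *\<^sub>R bJ B x a"
      by (simp add: cscale_def a(2,3))
    have J: "bJ B x (Re c *\<^sub>R a + Im c *\<^sub>R bJ B x a) = Re c *\<^sub>R bJ B x a - Im c *\<^sub>R a"
      using m by (simp add: J_add J_scale JJ)
    have E: "cscale c z \<in> E10 B x"
      using m by (simp add: E10_iff f J fiber_add) (simp add: cscale_def a(2,3))
    have 1: "g x \<omega> (Re c *\<^sub>R a + Im c *\<^sub>R bJ B x a) = Re c * g x \<omega> a + Im c * g x \<omega> (bJ B x a)"
      unfolding metric_lin(1)[OF g \<omega> m(3,4)] metric_lin(2)[OF g \<omega> m(1,1)] metric_lin(2)[OF g \<omega> m(2,2)] ..
    have 2: "g x \<omega> (Re c *\<^sub>R bJ B x a - Im c *\<^sub>R a) = Re c * g x \<omega> (bJ B x a) - Im c * g x \<omega> a"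
      unfolding g_diff(1)[OF \<omega> m(4,3)] metric_lin(2)[OF g \<omega> m(1,1)] metric_lin(2)[OF g \<omega> m(2,2)] ..
    show ?thesis
      using E that unfolding lam_def f J 1 2 a(2) by (simp add: complex_eq_iff)
  qed
  ultimately show ?thesis by (simp add: E10dual_def lam_def)
qed

lemma opg_mem: "u \<in> fiber B x \<Longrightarrow> w \<in> fiber B x \<Longrightarrow> opg g x (u, w) \<in> W_fiber B x"
  by (simp add: opg_eq W_fiber_def lam_dual fiber_diff J_mem E10_iff fiber_scale fiber_add J_scale)

text \<open>Riesz representation: a complex linear functional on \<open>E\<^sup>1\<^sup>,\<^sup>0\<close> is determined by its real part, which is
  the product with a vector.\<close>

lemma lam_surj:
  assumes \<mu>: "\<mu> \<in> E10dual B x"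
  obtains \<omega> where "\<omega> \<in> fiber B x" "lam g x \<omega> = \<mu>"
proof -
  obtain V e where e: "isfr V e" "x \<in> V" by (rule ex_frame)
  define \<phi> where "\<phi> y = Re (\<mu> (y, - bJ B x y))" for y
  have E: "(y, - bJ B x y) \<in> E10 B x" if "y \<in> fiber B x" for y using that by (simp add: E10_iff)
  have add: "\<mu> (z + w) = \<mu> z + \<mu> w" if "z \<in> E10 B x" "w \<in> E10 B x" for z w
    using \<mu> that by (simp add: E10dual_def)
  have sc: "\<mu> (cscale c z) = c * \<mu> z" if "z \<in> E10 B x" for c z
    using \<mu> that by (simp add: E10dual_def)
  have \<phi>_add: "\<phi> (y + y') = \<phi> y + \<phi> y'" if "y \<in> fiber B x" "y' \<in> fiber B x" for y y'
    using add[OF E[OF that(1)] E[OF that(2)]] that by (simp add: \<phi>_def J_add)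
  have \<phi>_scale: "\<phi> (r *\<^sub>R y) = r * \<phi> y" if "y \<in> fiber B x" for r y
    using sc[OF E[OF that], of "of_real r"] that by (simp add: \<phi>_def J_scale cscale_def)
  have lin: "linear (\<lambda>a. \<phi> (comb B e x a))"
    by (rule linearI) (simp_all add: comb_add comb_scale \<phi>_add \<phi>_scale comb_mem[OF e])
  define o' where "o' = binv (gmat g e x) (\<Sum>b\<in>Basis. \<phi> (comb B e x b) *\<^sub>R b)"
  define \<omega> where "\<omega> = comb B e x o'"
  have \<omega>: "\<omega> \<in> fiber B x" unfolding \<omega>_def by (rule comb_mem[OF e])
  have "g x \<omega> (comb B e x a) = \<phi> (comb B e x a)" for a
  proof -
    have "g x \<omega> (comb B e x a) = (\<Sum>b\<in>Basis. \<phi> (comb B e x b) *\<^sub>R b) \<bullet> a"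
      unfolding \<omega>_def gmat_apply[OF e g, symmetric] o'_def
      by (simp add: binv_apply herm_invertible[OF gmat_herm[OF e g]])
    also have "\<dots> = (\<Sum>b\<in>Basis. (a \<bullet> b) *\<^sub>R \<phi> (comb B e x b))"
      by (simp add: inner_sum_left inner_commute[of a] mult.commute)
    also have "\<dots> = \<phi> (comb B e x (\<Sum>b\<in>Basis. (a \<bullet> b) *\<^sub>R b))"
      using linear_sum[OF lin, of "\<lambda>b. (a \<bullet> b) *\<^sub>R b" Basis] linear_cmul[OF lin] by simp
    finally show ?thesis by (simp add: euclidean_representation)
  qed
  then have g\<phi>: "g x \<omega> y = \<phi> y" if "y \<in> fiber B x" for y using comb_coord[OF e that] by metis
  have "lam g x \<omega> = \<mu>"
  proof
    fix z
    show "lam g x \<omega> z = \<mu> z"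
    proof (cases "z \<in> E10 B x")
      case True
      define y where "y = fst z"
      have y: "y \<in> fiber B x" "z = (y, - bJ B x y)" using True by (auto simp: y_def E10_iff prod_eq_iff)
      have "cscale \<i> z = (bJ B x y, - bJ B x (bJ B x y))" using y by (simp add: cscale_def JJ)
      then have "\<phi> (bJ B x y) = Re (\<i> * \<mu> z)" using sc[OF True, of \<i>] by (simp add: \<phi>_def)
      then show ?thesis
        using True y g\<phi>[OF y(1)] g\<phi>[OF J_mem[OF y(1)]] by (simp add: lam_def \<phi>_def complex_eq_iff)
    next
      case False
      have "\<forall>z. z \<notin> E10 B x \<longrightarrow> \<mu> z = 0" using \<mu> unfolding E10dual_def by blast
      from this[rule_format, OF False] show ?thesis using False by (simp add: lam_def)
    qed
  qed
  with \<omega> show thesis by (rule that)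
qed

lemma opg_surj:
  assumes "y \<in> W_fiber B x"
  obtains u w where "u \<in> fiber B x" "w \<in> fiber B x" "opg g x (u, w) = y"
proof -
  obtain z \<mu> where y: "y = (z, \<mu>)" "z \<in> E10 B x" "\<mu> \<in> E10dual B x" using assms by (auto simp: W_fiber_def)
  obtain \<omega> where \<omega>: "\<omega> \<in> fiber B x" "lam g x \<omega> = \<mu>" by (rule lam_surj[OF y(3)])
  define \<eta> where "\<eta> = 2 *\<^sub>R fst z"
  have \<eta>: "\<eta> \<in> fiber B x" "z = ((1/2) *\<^sub>R \<eta>, - ((1/2) *\<^sub>R bJ B x \<eta>))"
    using y(2) by (auto simp: \<eta>_def E10_iff fiber_scale J_scale prod_eq_iff)
  define u w where "u = (1/2) *\<^sub>R (\<eta> + \<omega>)" and "w = (1/2) *\<^sub>R bJ B x (\<omega> - \<eta>)"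
  have uw: "u \<in> fiber B x" "w \<in> fiber B x"
    using \<eta> \<omega> by (auto simp: u_def w_def fiber_add fiber_diff fiber_scale J_mem)
  have "bJ B x w = (1/2) *\<^sub>R (\<eta> - \<omega>)"
    unfolding w_def using \<eta> \<omega> by (simp add: J_scale JJ fiber_diff J_mem)
  then have "u + bJ B x w = \<eta>" "u - bJ B x w = \<omega>"
    unfolding u_def by (simp_all only: half_sum)
  then have "opg g x (u, w) = y"
    unfolding opg_eq[OF uw] y(1) \<eta>(2) by (simp add: \<omega>(2))
  with uw show thesis by (rule that)
qed

lemma opg_add:
  assumes "u \<in> fiber B x" "w \<in> fiber B x" "u' \<in> fiber B x" "w' \<in> fiber B x"
  shows "opg g x (u + u', w + w') = opg g x (u, w) + opg g x (u', w')"
proof -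
  have l: "lam g x (p + q) = lam g x p + lam g x q" if "p \<in> fiber B x" "q \<in> fiber B x" for p q
    using that by (auto simp: lam_def fun_eq_iff metric_lin(3)[OF g] E10_iff J_mem complex_eq_iff)
  have eq: "(u + u') - bJ B x (w + w') = (u - bJ B x w) + (u' - bJ B x w')"
    "(u + u') + bJ B x (w + w') = (u + bJ B x w) + (u' + bJ B x w')"
    using assms by (simp_all add: J_add)
  have m: "u - bJ B x w \<in> fiber B x" "u' - bJ B x w' \<in> fiber B x"
    "u + bJ B x w \<in> fiber B x" "u' + bJ B x w' \<in> fiber B x"
    using assms by (simp_all add: fiber_add fiber_diff J_mem)
  show ?thesis
    unfolding opg_eq[OF fiber_add[OF assms(1,3)] fiber_add[OF assms(2,4)]] opg_eq[OF assms(1,2)]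
      opg_eq[OF assms(3,4)] eq l[OF m(1,2)] J_add[OF m(3,4)]
    by (simp add: scaleR_right_distrib)
qed

lemma opg_cscale:
  assumes "u \<in> fiber B x" "w \<in> fiber B x"
  shows "opg g x (cscale c (u, w)) = wscale c (opg g x (u, w))"
proof -
  note m = assms J_mem[OF assms(1)] J_mem[OF assms(2)]
  define \<eta> \<omega> where "\<eta> = u + bJ B x w" and "\<omega> = u - bJ B x w"
  have m': "\<eta> \<in> fiber B x" "\<omega> \<in> fiber B x" "bJ B x \<eta> \<in> fiber B x" "bJ B x \<omega> \<in> fiber B x"
    using m by (auto simp: \<eta>_def \<omega>_def fiber_add fiber_diff J_mem)
  define U W where "U = Re c *\<^sub>R u - Im c *\<^sub>R w" and "W = Re c *\<^sub>R w + Im c *\<^sub>R u"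
  have UW: "U \<in> fiber B x" "W \<in> fiber B x" using m by (auto simp: U_def W_def fiber_add fiber_diff fiber_scale)
  have \<eta>': "U + bJ B x W = Re c *\<^sub>R \<eta> + Im c *\<^sub>R bJ B x \<eta>"
    and \<omega>': "U - bJ B x W = Re c *\<^sub>R \<omega> - Im c *\<^sub>R bJ B x \<omega>"
    unfolding U_def W_def \<eta>_def \<omega>_def using m
    by (simp_all add: J_add J_diff J_scale JJ fiber_scale algebra_simps)
  have lam: "lam g x (Re c *\<^sub>R \<omega> - Im c *\<^sub>R bJ B x \<omega>) = (\<lambda>z. c * lam g x \<omega> z)"
  proof
    fix z
    show "lam g x (Re c *\<^sub>R \<omega> - Im c *\<^sub>R bJ B x \<omega>) z = c * lam g x \<omega> z"
      using m' by (auto simp: lam_def E10_iff g_diff metric_lin(4)[OF g] fiber_scale J_mem gJ metricD(2)[OF g]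
          complex_eq_iff JJ g_neg)
  qed
  have "cscale c (u, w) = (U, W)" by (simp add: cscale_def U_def W_def)
  then show ?thesis
    unfolding wscale_def opg_eq[OF assms] using opg_eq[OF UW]
    unfolding \<eta>' \<omega>' lam \<eta>_def[symmetric] \<omega>_def[symmetric]
    using m' by (simp add: cscale_def J_add J_scale JJ fiber_scale algebra_simps)
qed

text \<open>Up to a factor, \<open>1 \<oplus> g\<close> is an isometry between the complex bilinear extension of \<open>g\<close> and the natural pairing.\<close>

lemma wpair_opg:
  assumes "u \<in> fiber B x" "a \<in> fiber B x" "b \<in> fiber B x"
  shows "Re (wpair (opg g x (u, 0)) (opg g x (a, b))) = (1/2) * g x u a"
proof -
  have J0: "bJ B x 0 = 0" using J_scale[OF fiber_0, of x 0] by simp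
  note m = assms J_mem[OF assms(3)] J_mem[OF assms(1)] fiber_0[of x]
  define \<eta> where "\<eta> = a + bJ B x b"
  have \<eta>: "\<eta> \<in> fiber B x" unfolding \<eta>_def using m by (simp add: fiber_add)
  have E: "((1/2) *\<^sub>R \<eta>, - ((1/2) *\<^sub>R bJ B x \<eta>)) \<in> E10 B x" "((1/2) *\<^sub>R u, - ((1/2) *\<^sub>R bJ B x u)) \<in> E10 B x"
    using \<eta> m by (simp_all add: E10_iff fiber_scale J_scale)
  have "Re (wpair (opg g x (u, 0)) (opg g x (a, b))) = (1/2) * (g x u ((1/2) *\<^sub>R \<eta>) + g x (a - bJ B x b) ((1/2) *\<^sub>R u))"
    unfolding wpair_def opg_eq[OF m(1,6)] opg_eq[OF m(2,3)] \<eta>_def[symmetric] using E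
    by (simp add: lam_def J0)
  also have "\<dots> = (1/2) * g x u a"
    unfolding \<eta>_def using m metricD(1)[OF g, of u x a] metricD(1)[OF g, of u x "bJ B x b"]
    by (simp add: metric_lin(1,2)[OF g] g_diff fiber_add fiber_diff fiber_scale algebra_simps)
  finally show ?thesis .
qed

end

subsection \<open>Coordinates\<close>

text \<open>The components of \<open>g(\<omega>, -)\<close> in the dual frame are the conjugates of those of the Gram operator applied
  to \<open>\<omega>\<close>, because the real inner product of \<open>\<complex>\<^sup>r\<close> is the real part of the Hermitian one.\<close>

definition vcnj :: "complex^'r \<Rightarrow> complex^'r" where "vcnj q = (\<chi> i. cnj (q $ i))"

lemma vcnj_vcnj: "vcnj (vcnj q) = q"
  by (simp add: vcnj_def vec_eq_iff)

lemma bounded_linear_vcnj: "bounded_linear vcnj"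
proof -
  have "linear vcnj" by (rule linearI) (auto simp: vcnj_def vec_eq_iff complex_eq_iff)
  then show ?thesis by (simp add: linear_conv_bounded_linear)
qed

lemma comb10_eq:
  assumes e: "isfr V e" "x \<in> V"
  shows "comb10 B e x a = ((1/2) *\<^sub>R comb B e x a, - ((1/2) *\<^sub>R bJ B x (comb B e x a)))"
proof -
  have J0: "bJ B x 0 = 0" using J_scale[OF fiber_0, of x 0] by simp
  have t: "cscale c (pr10 B x (e i x, 0)) = ((1/2) *\<^sub>R fscale B x c (e i x), - ((1/2) *\<^sub>R bJ B x (fscale B x c (e i x))))" for c i
    using frame_mem[OF e, of i] J0
    by (simp add: pr_eq cscale_def fscale_def J_add J_scale JJ fiber_scale J_mem algebra_simps)
  have "bJ B x (comb B e x a) = (\<Sum>i\<in>UNIV. bJ B x (fscale B x (a $ i) (e i x)))"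
    unfolding comb_def using J_sum[of UNIV "\<lambda>i. fscale B x (a $ i) (e i x)" x] fscale_mem[OF frame_mem[OF e]] by simp
  then show ?thesis
    unfolding comb10_def t comb_def by (simp add: prod_eq_iff fst_sum snd_sum scaleR_sum_right sum_negf)
qed

lemma comb10_inv:
  assumes e: "isfr V e" "x \<in> V"
  shows "inv (comb10 B e x) (comb10 B e x a) = a"
proof -
  have "inj (comb10 B e x)"
  proof (rule injI)
    fix a b assume "comb10 B e x a = comb10 B e x b"
    then have "comb B e x a = comb B e x b" by (simp add: comb10_eq[OF e])
    then show "a = b" using coord_comb[OF e] by metis
  qed
  then show ?thesis by simp
qed

lemma comb10_E10:
  assumes e: "isfr V e" "x \<in> V"
  shows "comb10 B e x a \<in> E10 B x"
  using comb_mem[OF e, of a] by (simp add: comb10_eq[OF e] E10_iff fiber_scale J_scale)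

lemma W_comb_inj:
  assumes e: "isfr V e" "x \<in> V"
  shows "inj (W_comb B e x)"
proof (rule injI)
  fix p p' assume eq: "W_comb B e x p = W_comb B e x p'"
  have "comb10 B e x (fst p) = comb10 B e x (fst p')" using eq by (simp add: W_comb_def)
  then have 1: "fst p = fst p'" using comb10_inv[OF e] by metis
  have "snd p $ i = snd p' $ i" for i
  proof -
    have *: "(\<Sum>j\<in>UNIV. q $ j * axis i 1 $ j) = q $ i" for q :: "complex^'r"
      by (simp add: axis_def if_distrib[of "\<lambda>t. _ * t"] cong: if_cong)
    have "snd (W_comb B e x p) (comb10 B e x (axis i 1)) = snd (W_comb B e x p') (comb10 B e x (axis i 1))"
      using eq by simp
    then show ?thesis
      by (simp add: W_comb_def comb10_E10[OF e] comb10_inv[OF e] *)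
  qed
  then show "p = p'" using 1 by (simp add: prod_eq_iff vec_eq_iff)
qed

lemma inner_cvec: "(p::complex^'r) \<bullet> a = Re (\<Sum>i\<in>UNIV. cnj (p $ i) * a $ i)"
  by (simp add: inner_vec_def inner_complex_def Re_sum)

lemma W_coord_opg:
  assumes e: "isfr V e" "x \<in> V" and g: "compatible_metric B g" and u: "u \<in> fiber B x" and w: "w \<in> fiber B x"
  shows "W_coord B e x (opg g x (u, w)) = (coord B e x (u + bJ B x w),
    (1/2) *\<^sub>R vcnj (gmat g e x (coord B e x (u - bJ B x w))))"
proof -
  define \<eta> \<omega> where "\<eta> = u + bJ B x w" and "\<omega> = u - bJ B x w"
  have m: "\<eta> \<in> fiber B x" "\<omega> \<in> fiber B x"
    using u w by (auto simp: \<eta>_def \<omega>_def fiber_add fiber_diff J_mem)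
  define q where "q = gmat g e x (coord B e x \<omega>)"
  have "W_comb B e x (coord B e x \<eta>, (1/2) *\<^sub>R vcnj q) = opg g x (u, w)"
  proof (rule prod_eqI)
    show "fst (W_comb B e x (coord B e x \<eta>, (1/2) *\<^sub>R vcnj q)) = fst (opg g x (u, w))"
      unfolding opg_eq[OF g u w] \<eta>_def[symmetric] using m
      by (simp add: W_comb_def comb10_eq[OF e] comb_coord[OF e])
    show "snd (W_comb B e x (coord B e x \<eta>, (1/2) *\<^sub>R vcnj q)) = snd (opg g x (u, w))"
    proof
      fix z
      show "snd (W_comb B e x (coord B e x \<eta>, (1/2) *\<^sub>R vcnj q)) z = snd (opg g x (u, w)) z"
      proof (cases "z \<in> E10 B x")
        case True
        define y where "y = fst z"
        have y: "y \<in> fiber B x" "z = (y, - bJ B x y)" using True by (auto simp: y_def E10_iff prod_eq_iff)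
        define a where "a = coord B e x (2 *\<^sub>R y)"
        have a: "comb B e x a = 2 *\<^sub>R y" unfolding a_def by (rule comb_coord[OF e fiber_scale[OF y(1)]])
        have "comb10 B e x a = z" using y by (simp add: comb10_eq[OF e] a J_scale)
        then have ia: "inv (comb10 B e x) z = a" using comb10_inv[OF e] by metis
        define S where "S = (\<Sum>i\<in>UNIV. cnj (q $ i) * a $ i)"
        have half: "((1/2) *\<^sub>R vcnj q) $ i = cnj (q $ i) / 2" for i
          by (simp add: vcnj_def complex_eq_iff)
        have "snd (W_comb B e x (coord B e x \<eta>, (1/2) *\<^sub>R vcnj q)) z = (1/2) * S"
          using True by (simp add: W_comb_def ia S_def sum_divide_distrib half del: vector_scaleR_component)
        moreover have "Re S = 2 * g x \<omega> y"
        proof -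
          have "Re S = q \<bullet> a" by (simp only: S_def inner_cvec)
          then show ?thesis
            using gmat_apply[OF e g, of "coord B e x \<omega>" a] m y
            by (simp add: q_def a comb_coord[OF e] metric_lin(2)[OF g])
        qed
        moreover have "Im S = - 2 * g x \<omega> (bJ B x y)"
        proof -
          have "Re (\<i> * S) = q \<bullet> (\<i> *s a)"
            by (simp only: S_def inner_cvec) (simp add: sum_distrib_left mult_ac)
          also have "\<dots> = g x \<omega> (bJ B x (2 *\<^sub>R y))"
            using gmat_apply[OF e g, of "coord B e x \<omega>" "\<i> *s a"] m
            by (simp add: q_def comb_J[OF e] a comb_coord[OF e])
          also have "\<dots> = 2 * g x \<omega> (bJ B x y)"
            using m y by (simp add: J_scale metric_lin(2)[OF g] J_mem)
          finally show ?thesis by simp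
        qed
        ultimately show ?thesis
          unfolding opg_eq[OF g u w] \<omega>_def[symmetric] using True y
          by (simp add: lam_def complex_eq_iff)
      qed (simp add: W_comb_def opg_eq[OF g u w] lam_def)
    qed
  qed
  then show ?thesis
    unfolding W_coord_def \<eta>_def[symmetric] \<omega>_def[symmetric] q_def[symmetric]
    using inv_f_f[OF W_comb_inj[OF e]] by metis
qed

text \<open>\<open>(1 \<oplus> g') \<Phi> = 1 \<oplus> g\<close>, in a frame.\<close>

lemma ratio_comb:
  assumes e: "isfr V e" "x \<in> V" and g: "compatible_metric B g" and g': "compatible_metric B g'"
  shows "opg g' x (comb B e x (PhR Jop (ratio_op (gmat g e x) (gmat g' e x)) a b),
      comb B e x (PhI Jop (ratio_op (gmat g e x) (gmat g' e x)) a b)) = opg g x (comb B e x a, comb B e x b)"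
proof -
  define h where "h = ratio_op (gmat g e x) (gmat g' e x)"
  note c = comb_mem[OF e]
  note G = gmat_herm[OF e g] and G' = gmat_herm[OF e g']
  have hJ: "h (Jop a) = Jop (h a)" for a unfolding h_def by (rule ratio_op_J[OF G G'])
  have JJ': "Jop (Jop a) = - a" for a using G by (simp add: herm_def)
  have J: "bJ B x (comb B e x a) = comb B e x (Jop a)" for a by (simp add: comb_J[OF e])
  have Jh: "Jop (h (b + Jop a)) = - h (a - Jop b)"
    unfolding hJ[symmetric] by (simp add: blinfun.bilinear_simps JJ' del: Jop_apply)
  have JP: "Jop (PhI Jop h a b) = (1/2) *\<^sub>R (a + Jop b - h (a - Jop b))"
    unfolding PhI_def blinfun.scaleR_right blinfun.add_right[of Jop "b - Jop a"] Jh
    by (simp add: blinfun.diff_right JJ' algebra_simps del: Jop_apply)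
  have 1: "PhR Jop h a b + Jop (PhI Jop h a b) = a + Jop b"
    "PhR Jop h a b - Jop (PhI Jop h a b) = h (a - Jop b)"
    unfolding JP PhR_def by (rule half_sum)+
  have l: "lam g' x (comb B e x (h a)) = lam g x (comb B e x a)" for a
  proof -
    have "g' x (comb B e x (h a)) y = g x (comb B e x a) y" if "y \<in> fiber B x" for y
      using gmat_apply[OF e g', of "h a" "coord B e x y"] gmat_apply[OF e g, of a "coord B e x y"]
      by (simp add: h_def ratio_op_apply[OF G'] comb_coord[OF e that])
    then show ?thesis by (auto simp: lam_def fun_eq_iff E10_iff J_mem)
  qed
  show ?thesis
    unfolding h_def[symmetric] opg_eq[OF g' c c] opg_eq[OF g c c] J comb_add[symmetric] comb_diff[symmetric] 1 l ..
qed

section \<open>The connection forms\<close>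

context
  fixes D' g
  assumes D: "so_form01 B D'" and g: "compatible_metric B g"
begin

lemma so_D:
  assumes "v \<in> tang B x" "y \<in> W_fiber B x"
  shows "D' x v y \<in> W_fiber B x"
    "y' \<in> W_fiber B x \<Longrightarrow> D' x v (y + y') = D' x v y + D' x v y'"
    "y' \<in> W_fiber B x \<Longrightarrow> wpair (D' x v y) y' + wpair y (D' x v y') = 0"
    "D' x v (wscale c y) = wscale c (D' x v y)"
    "v' \<in> tang B x \<Longrightarrow> D' x (v + v') y = D' x v y + D' x v' y"
    "D' x (tscale r v) y = wscale (of_real r) (D' x v y)"
    "D' x (cplx_I v) y = wscale (-\<i>) (D' x v y)"
proof -
  note h = D[unfolded so_form01_def, THEN conjunct1, THEN spec, of x, THEN bspec, OF assms(1), THEN bspec, OF assms(2)]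
  show "D' x v y \<in> W_fiber B x" using h by simp
  show "y' \<in> W_fiber B x \<Longrightarrow> D' x v (y + y') = D' x v y + D' x v y'" using h by simp
  show "y' \<in> W_fiber B x \<Longrightarrow> wpair (D' x v y) y' + wpair y (D' x v y') = 0" using h by simp
  show "D' x v (wscale c y) = wscale c (D' x v y)" using h by simp
  show "v' \<in> tang B x \<Longrightarrow> D' x (v + v') y = D' x v y + D' x v' y" using h by simp
  show "D' x (tscale r v) y = wscale (of_real r) (D' x v y)" using h by simp
  show "D' x (cplx_I v) y = wscale (-\<i>) (D' x v y)" using h by simp
qed

text \<open>The form \<open>\<D>\<^sub>g\<^sup>0\<^sup>,\<^sup>1\<close> maps \<open>E\<close> to \<open>E\<^sub>\<complex>\<close>. With real part \<open>al\<close> and imaginary part \<open>be\<close> it can be handled inside the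
  real bundle \<open>E\<close>.\<close>

definition al where "al x v u = fst (Dg01 B g D' x v (u, 0))"
definition be where "be x v u = snd (Dg01 B g D' x v (u, 0))"

lemma Dg01_opg:
  assumes v: "v \<in> tang B x" and u: "u \<in> fiber B x" and w: "w \<in> fiber B x"
  obtains a b where "Dg01 B g D' x v (u, w) = (a, b)" "a \<in> fiber B x" "b \<in> fiber B x"
    "opg g x (a, b) = D' x v (opg g x (u, w))"
proof -
  obtain a b where ab: "a \<in> fiber B x" "b \<in> fiber B x" "opg g x (a, b) = D' x v (opg g x (u, w))"
    by (rule opg_surj[OF g so_D(1)[OF v opg_mem[OF g u w]]])
  have "inj_on (opg g x) (EC B x)"
  proof (rule inj_onI)
    fix z z' assume "z \<in> EC B x" "z' \<in> EC B x" and eq: "opg g x z = opg g x z'"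
    then have m: "fst z \<in> fiber B x" "snd z \<in> fiber B x" "fst z' \<in> fiber B x" "snd z' \<in> fiber B x"
      by (auto simp: EC_def)
    have "opg g x (fst z, snd z) = opg g x (fst z', snd z')" using eq by simp
    from opg_inj[OF g this m] show "z = z'" by (rule prod_eqI)
  qed
  then have "Dg01 B g D' x v (u, w) = (a, b)"
    unfolding Dg01_def ab(3)[symmetric] using ab(1,2) by (intro inv_into_f_f) (auto simp: EC_def)
  then show thesis by (rule that[OF _ ab])
qed

lemma al_be:
  assumes v: "v \<in> tang B x" and u: "u \<in> fiber B x"
  shows "al x v u \<in> fiber B x" "be x v u \<in> fiber B x"
    "opg g x (al x v u, be x v u) = D' x v (opg g x (u, 0))"
proof -
  obtain a b where *: "Dg01 B g D' x v (u, 0) = (a, b)" "a \<in> fiber B x" "b \<in> fiber B x"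
    "opg g x (a, b) = D' x v (opg g x (u, 0))" by (rule Dg01_opg[OF v u fiber_0])
  show "al x v u \<in> fiber B x" "be x v u \<in> fiber B x"
    "opg g x (al x v u, be x v u) = D' x v (opg g x (u, 0))"
    using *(2-4) by (simp_all add: al_def be_def *(1))
qed

lemma Dg_al: "Dg B g D' x v u = 2 *\<^sub>R al x v u"
  by (simp add: Dg_def DgC_def cconj_def al_def scaleR_2)

lemma opg_eqI:
  assumes "opg g x (u, w) = opg g x (u', w')" "u \<in> fiber B x" "w \<in> fiber B x" "u' \<in> fiber B x" "w' \<in> fiber B x"
  shows "u = u' \<and> w = w'"
  using opg_inj[OF g assms] by blast

lemma al_be_add:
  assumes v: "v \<in> tang B x" and u: "u \<in> fiber B x" "w \<in> fiber B x"
  shows "al x v (u + w) = al x v u + al x v w"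
proof -
  note m = al_be(1,2)[OF v u(1)] al_be(1,2)[OF v u(2)] al_be(1,2)[OF v fiber_add[OF u]]
  have "opg g x (al x v (u + w), be x v (u + w)) = opg g x (al x v u + al x v w, be x v u + be x v w)"
    unfolding al_be(3)[OF v fiber_add[OF u]] opg_add[OF g m(1,2,3,4)] al_be(3)[OF v u(1)] al_be(3)[OF v u(2)]
    using opg_add[OF g u(1) fiber_0 u(2) fiber_0]
    by (simp add: so_D(2)[OF v opg_mem[OF g u(1) fiber_0] opg_mem[OF g u(2) fiber_0]])
  from opg_eqI[OF this] m show ?thesis by (simp add: fiber_add)
qed

lemma al_scale:
  assumes v: "v \<in> tang B x" and u: "u \<in> fiber B x"
  shows "al x v (r *\<^sub>R u) = r *\<^sub>R al x v u"
proof -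
  note m = al_be(1,2)[OF v u] al_be(1,2)[OF v fiber_scale[OF u, of r]]
  have c: "cscale (of_real r) (p, q) = (r *\<^sub>R p, r *\<^sub>R q)" for p q :: 'v by (simp add: cscale_def)
  have "opg g x (al x v (r *\<^sub>R u), be x v (r *\<^sub>R u)) = opg g x (cscale (of_real r) (al x v u, be x v u))"
    unfolding al_be(3)[OF v fiber_scale[OF u]] opg_cscale[OF g m(1,2)] al_be(3)[OF v u]
    using opg_cscale[OF g u fiber_0, of "of_real r"]
    by (simp add: c so_D(4)[OF v opg_mem[OF g u fiber_0]])
  then show ?thesis unfolding c using opg_eqI m by (meson fiber_scale)
qed

lemma al_v_add:
  assumes v: "v \<in> tang B x" "w \<in> tang B x" "v + w \<in> tang B x" and u: "u \<in> fiber B x"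
  shows "al x (v + w) u = al x v u + al x w u"
proof -
  note m = al_be(1,2)[OF v(1) u] al_be(1,2)[OF v(2) u] al_be(1,2)[OF v(3) u]
  have "opg g x (al x (v + w) u, be x (v + w) u) = opg g x (al x v u + al x w u, be x v u + be x w u)"
    unfolding al_be(3)[OF v(3) u] opg_add[OF g m(1,2,3,4)] al_be(3)[OF v(1) u] al_be(3)[OF v(2) u]
    by (rule so_D(5)[OF v(1) opg_mem[OF g u fiber_0] v(2)])
  from opg_eqI[OF this] m show ?thesis by (simp add: fiber_add)
qed

lemma al_v_scale:
  assumes v: "v \<in> tang B x" "tscale r v \<in> tang B x" and u: "u \<in> fiber B x"
  shows "al x (tscale r v) u = r *\<^sub>R al x v u"
proof -
  note m = al_be(1,2)[OF v(1) u] al_be(1,2)[OF v(2) u]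
  have c: "cscale (of_real r) (p, q) = (r *\<^sub>R p, r *\<^sub>R q)" for p q :: 'v by (simp add: cscale_def)
  have "opg g x (al x (tscale r v) u, be x (tscale r v) u) = opg g x (cscale (of_real r) (al x v u, be x v u))"
    unfolding al_be(3)[OF v(2) u] opg_cscale[OF g m(1,2)] al_be(3)[OF v(1) u]
    by (rule so_D(6)[OF v(1) opg_mem[OF g u fiber_0]])
  then show ?thesis unfolding c using opg_eqI m by (meson fiber_scale)
qed

text \<open>Since the form is of type \<open>(0,1)\<close>, its value at \<open>v\<close> is half of \<open>\<D>\<^sub>g(v) + i \<D>\<^sub>g(I v)\<close>.\<close>

lemma be_al:
  assumes v: "v \<in> tang B x" and u: "u \<in> fiber B x"
  shows "be x v u = al x (cplx_I v) u"
proof -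
  note Iv = cplx_I_tangent[OF v]
  note m = al_be(1,2)[OF v u] al_be(1,2)[OF Iv u]
  have c: "cscale (-\<i>) (p, q) = (q, - p)" for p q :: 'v by (simp add: cscale_def)
  have "opg g x (al x (cplx_I v) u, be x (cplx_I v) u) = opg g x (cscale (-\<i>) (al x v u, be x v u))"
    unfolding al_be(3)[OF Iv u] opg_cscale[OF g m(1,2)] al_be(3)[OF v u]
    by (rule so_D(7)[OF v opg_mem[OF g u fiber_0]])
  from opg_eqI[OF this[unfolded c]] m show ?thesis by (simp add: fiber_neg)
qed

lemma Dg01_split:
  assumes v: "v \<in> tang B x" and u: "u \<in> fiber B x" and w: "w \<in> fiber B x"
  shows "D' x v (opg g x (u, w)) =
    opg g x (al x v u - al x (cplx_I v) w, al x v w + al x (cplx_I v) u)"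
proof -
  note m = al_be(1,2)[OF v u] al_be(1,2)[OF v w]
  have c: "cscale \<i> (p, q) = (- q, p)" for p q :: 'v by (simp add: cscale_def)
  have "opg g x (u, w) = opg g x (u, 0) + wscale \<i> (opg g x (w, 0))"
    using opg_add[OF g u fiber_0 fiber_0 w] opg_cscale[OF g w fiber_0, of \<i>] by (simp add: c)
  then have "D' x v (opg g x (u, w)) = D' x v (opg g x (u, 0)) + D' x v (opg g x (cscale \<i> (w, 0)))"
    using so_D(2)[OF v opg_mem[OF g u fiber_0] opg_mem[OF g fiber_0 w]] opg_cscale[OF g w fiber_0, of \<i>]
    by (simp add: c)
  also have "\<dots> = opg g x (al x v u, be x v u) + opg g x (cscale \<i> (al x v w, be x v w))"
    unfolding opg_cscale[OF g w fiber_0] opg_cscale[OF g m(3,4)] al_be(3)[OF v u] al_be(3)[OF v w]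
      so_D(4)[OF v opg_mem[OF g w fiber_0]] ..
  also have "\<dots> = opg g x (al x v u - be x v w, be x v u + al x v w)"
    unfolding c using opg_add[OF g m(1,2) fiber_neg[OF m(4)] m(3)] by simp
  finally show ?thesis by (simp add: be_al[OF v u] be_al[OF v w] add.commute)
qed

text \<open>Skewness of \<open>D'\<close> for the natural pairing, transferred by the isometry \<open>1 \<oplus> g\<close>. It makes
  \<open>\<nabla>\<^sup>C\<^sup>h + \<D>\<^sub>g\<close> a metric connection.\<close>

lemma al_skew:
  assumes v: "v \<in> tang B x" and u: "u \<in> fiber B x" and w: "w \<in> fiber B x"
  shows "g x (al x v u) w + g x u (al x v w) = 0"
proof -
  note m = al_be(1,2)[OF v u] al_be(1,2)[OF v w]
  note o = opg_mem[OF g u fiber_0] opg_mem[OF g w fiber_0]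
  have comm: "wpair p q = wpair q p" for p q :: "'v wvec" by (simp add: wpair_def)
  have "wpair (opg g x (w, 0)) (opg g x (al x v u, be x v u)) + wpair (opg g x (u, 0)) (opg g x (al x v w, be x v w)) = 0"
    using so_D(3)[OF v o] unfolding al_be(3)[OF v u] al_be(3)[OF v w] comm[of "opg g x (w, 0)"] .
  then have "Re (wpair (opg g x (w, 0)) (opg g x (al x v u, be x v u))) + Re (wpair (opg g x (u, 0)) (opg g x (al x v w, be x v w))) = 0"
    by (metis plus_complex.sel(1) zero_complex.sel(1))
  then show ?thesis
    unfolding wpair_opg[OF g w m(1,2)] wpair_opg[OF g u m(3,4)] using metricD(1)[OF g w m(1)] by simp
qed

lemma Dg_mem: "v \<in> tang B x \<Longrightarrow> u \<in> fiber B x \<Longrightarrow> Dg B g D' x v u \<in> fiber B x"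
  by (simp add: Dg_al fiber_scale al_be)

lemma Dg_lin: "v \<in> tang B x \<Longrightarrow> real_linear_on (fiber B x) (Dg B g D' x v)"
  unfolding real_linear_on_def Dg_al by (simp add: al_be_add al_scale scaleR_right_distrib)

lemma rep_Dg:
  assumes "isfr V e" "x \<in> V" "v \<in> tang B x"
  shows "rep e x (Dg B g D' x v) a = coord B e x (Dg B g D' x v (comb B e x a))"
    "comb B e x (rep e x (Dg B g D' x v) a) = Dg B g D' x v (comb B e x a)"
  using rep_apply[OF assms(1,2) Dg_mem[OF assms(3)] Dg_lin[OF assms(3)]] by blast+

lemma opg_smooth_section:
  assumes e: "isfr V e"
  shows "smooth_W_section B V (\<lambda>x. opg g x (comb B e x a, 0))"
  unfolding smooth_W_section_def
proof (intro conjI ballI, goal_cases)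
  case (1 x)
  then show ?case by (rule opg_mem[OF g comb_mem[OF e] fiber_0])
next
  case (2 p)
  obtain V' e' where p: "p = (V', e')" by (cases p)
  with 2 have e': "isfr V' e'" by simp
  have J0: "bJ B x 0 = 0" for x using J_scale[OF fiber_0, of x 0] by simp
  have o: "open (V \<inter> V')" using frame_open e e' by blast
  have t: "smooth_fun (charts B) (V \<inter> V') (\<lambda>x. tmat e e' x a)"
    by (rule smooth_fun_apply[OF o tmat_smooth[OF e e'] smooth_fun_const[OF o]])
  have G: "smooth_fun (charts B) (V \<inter> V') (\<lambda>x. (1/2) *\<^sub>R vcnj (gmat g e' x (tmat e e' x a)))"
    by (intro smooth_fun_linear[OF bounded_linear_scaleR_right o] smooth_fun_linear[OF bounded_linear_vcnj o]
        smooth_fun_apply[OF o smooth_fun_subset[OF gmat_smooth[OF e' g]] t]) auto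
  have "smooth_fun (charts B) (V \<inter> V') (\<lambda>x. (tmat e e' x a, (1/2) *\<^sub>R vcnj (gmat g e' x (tmat e e' x a))))"
    unfolding smooth_fun_def
  proof
    fix c assume c: "c \<in> charts B"
    show "smooth_on (snd c ` (V \<inter> V' \<inter> fst c)) (\<lambda>z. (tmat e e' (chart_inv c z) a,
        (1/2) *\<^sub>R vcnj (gmat g e' (chart_inv c z) (tmat e e' (chart_inv c z) a))))"
      by (rule smooth_on_Pair[OF chart_img_open[OF c o]]) (use t G c in \<open>simp_all add: smooth_fun_def\<close>)
  qed
  then have "smooth_fun (charts B) (V \<inter> V') (\<lambda>x. W_coord B e' x (opg g x (comb B e x a, 0)))"
  proof (rule smooth_fun_cong[OF o, rotated])
    fix x assume "x \<in> V \<inter> V'"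
    then have x: "x \<in> V" "x \<in> V'" by auto
    show "(tmat e e' x a, (1/2) *\<^sub>R vcnj (gmat g e' x (tmat e e' x a))) = W_coord B e' x (opg g x (comb B e x a, 0))"
      unfolding W_coord_opg[OF e' x(2) g comb_mem[OF e x(1)] fiber_0] J0 by (simp add: tmat_apply[OF e x(1) e' x(2)])
  qed
  then show ?case by (simp add: p)
qed

text \<open>The form \<open>\<D>\<^sub>g\<close> is obtained from the smooth form \<open>D'\<close> by matrices that are smooth in a frame.\<close>

lemma Dg_smooth:
  assumes e: "isfr V e" and c: "c \<in> charts B"
  shows "smooth_fun (charts B) (V \<inter> fst c) (\<lambda>x. rep e x (Dg B g D' x (coord_vec (charts B) c x a)))"
proof (rule smooth_fun_blinfunI)
  show o: "open (V \<inter> fst c)" using frame_open[OF e] chart_open[OF c] by blast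
  fix b :: "complex^'r"
  let ?v = "\<lambda>x. coord_vec (charts B) c x a"
  let ?y = "\<lambda>x. W_coord B e x (D' x (?v x) (opg g x (comb B e x b, 0)))"
  have "smooth_W_section B (V \<inter> fst c) (\<lambda>x. D' x (?v x) (opg g x (comb B e x b, 0)))"
    using D[unfolded so_form01_def, THEN conjunct2, THEN spec, THEN spec, THEN mp,
        OF conjI[OF frame_open[OF e] opg_smooth_section[OF e, of b]]] c by blast
  then have "smooth_fun (charts B) (V \<inter> fst c \<inter> V) ?y"
    using e unfolding smooth_W_section_def by blast
  then have y: "smooth_fun (charts B) (V \<inter> fst c) ?y" by (rule smooth_fun_subset) blast
  have Ginv: "smooth_fun (charts B) (V \<inter> fst c) (\<lambda>x. binv (gmat g e x))"
    by (rule smooth_fun_binv[OF o smooth_fun_subset[OF gmat_smooth[OF e g]]])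
       (auto intro: herm_invertible[OF gmat_herm[OF e _ g]])
  have "smooth_fun (charts B) (V \<inter> fst c) (\<lambda>x. fst (?y x) + 2 *\<^sub>R binv (gmat g e x) (vcnj (snd (?y x))))"
    by (intro smooth_fun_add o smooth_fun_linear[OF bounded_linear_fst o y]
        smooth_fun_linear[OF bounded_linear_scaleR_right o] smooth_fun_apply[OF o Ginv]
        smooth_fun_linear[OF bounded_linear_vcnj o] smooth_fun_linear[OF bounded_linear_snd o y])
  then show "smooth_fun (charts B) (V \<inter> fst c) (\<lambda>x. rep e x (Dg B g D' x (?v x)) b)"
  proof (rule smooth_fun_cong[OF o, rotated])
    fix x assume "x \<in> V \<inter> fst c"
    then have x: "x \<in> V" "x \<in> fst c" by auto
    have v: "?v x \<in> tang B x" by (rule coord_vec_tangent[OF c x(2)])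
    note u = comb_mem[OF e x(1), of b]
    define p q where "p = al x (?v x) (comb B e x b)" and "q = be x (?v x) (comb B e x b)"
    have m: "p \<in> fiber B x" "q \<in> fiber B x" unfolding p_def q_def using al_be[OF v u] by auto
    have J: "bJ B x q \<in> fiber B x" using m by (simp add: J_mem)
    have y: "?y x = (coord B e x (p + bJ B x q), (1/2) *\<^sub>R vcnj (gmat g e x (coord B e x (p - bJ B x q))))"
      unfolding al_be(3)[OF v u, symmetric] p_def[symmetric] q_def[symmetric] by (rule W_coord_opg[OF e x(1) g m])
    have vs: "vcnj ((1/2) *\<^sub>R q) = (1/2) *\<^sub>R vcnj q" for q
      using linear_cmul[OF bounded_linear.linear[OF bounded_linear_vcnj]] .
    have "fst (?y x) + 2 *\<^sub>R binv (gmat g e x) (vcnj (snd (?y x))) =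
        coord B e x (p + bJ B x q) + coord B e x (p - bJ B x q)"
      unfolding y by (simp add: vs vcnj_vcnj blinfun.scaleR_right binv_apply herm_invertible[OF gmat_herm[OF e x(1) g]])
    also have "\<dots> = coord B e x (2 *\<^sub>R p)"
      using m J by (simp add: coord_add[OF e x(1), symmetric] fiber_add fiber_diff scaleR_2)
    also have "\<dots> = rep e x (Dg B g D' x (?v x)) b"
      unfolding rep_Dg(1)[OF e x(1) v] Dg_al p_def ..
    finally show "fst (?y x) + 2 *\<^sub>R binv (gmat g e x) (vcnj (snd (?y x))) = rep e x (Dg B g D' x (?v x)) b" .
  qed
qed

lemma rep_Dg_skew:
  assumes e: "isfr V e" "x \<in> V" and v: "v \<in> tang B x"
  shows "gmat g e x (rep e x (Dg B g D' x v) a) \<bullet> b + gmat g e x a \<bullet> rep e x (Dg B g D' x v) b = 0"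
proof -
  note c = comb_mem[OF e]
  note m = al_be(1)[OF v c]
  show ?thesis
    unfolding gmat_apply[OF e g] rep_Dg(2)[OF e v] Dg_al metric_lin(4)[OF g c m m] metric_lin(2)[OF g c m m]
    using al_skew[OF v c c, of a b] by simp
qed

lemma Dg_comb:
  assumes e: "isfr V e" "x \<in> V" and v: "v \<in> tang B x"
  shows "D' x v (opg g x (comb B e x a, comb B e x b)) = wscale (1/2) (opg g x
    (comb B e x (rep e x (Dg B g D' x v) a - rep e x (Dg B g D' x (cplx_I v)) b),
     comb B e x (rep e x (Dg B g D' x v) b + rep e x (Dg B g D' x (cplx_I v)) a)))"
proof -
  note Iv = cplx_I_tangent[OF v]
  note c = comb_mem[OF e]
  have "al x v u = (1/2) *\<^sub>R Dg B g D' x v u" for v u by (simp add: Dg_al)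
  then have al: "al x v (comb B e x a) = (1/2) *\<^sub>R comb B e x (rep e x (Dg B g D' x v) a)"
    if "v \<in> tang B x" for v a by (simp add: rep_Dg(2)[OF e that])
  have h: "cscale (1/2) (p, q) = ((1/2) *\<^sub>R p, (1/2) *\<^sub>R q)" for p q :: 'v by (simp add: cscale_def)
  show ?thesis
    unfolding Dg01_split[OF v c c] al[OF v] al[OF Iv] opg_cscale[OF g c c, symmetric] h
    by (simp add: comb_diff comb_add scaleR_right_diff_distrib scaleR_right_distrib)
qed

end

text \<open>\<open>\<Phi>\<close> intertwines the two forms, as both correspond to the same form on
  \<open>E\<^sup>1\<^sup>,\<^sup>0 \<oplus> E\<^sup>*\<^sup>1\<^sup>,\<^sup>0\<close>.\<close>

lemma Dg_intertwine:
  assumes D: "so_form01 B D'" and g: "compatible_metric B g" and g': "compatible_metric B g'"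
    and e: "isfr V e" "x \<in> V" and v: "v \<in> tang B x"
  defines "h \<equiv> ratio_op (gmat g e x) (gmat g' e x)"
    and "\<Delta>1 \<equiv> rep e x (Dg B g D' x v)" and "\<Delta>2 \<equiv> rep e x (Dg B g D' x (cplx_I v))"
    and "\<Delta>1' \<equiv> rep e x (Dg B g' D' x v)" and "\<Delta>2' \<equiv> rep e x (Dg B g' D' x (cplx_I v))"
  shows "\<Delta>1' (PhR Jop h a b) - \<Delta>2' (PhI Jop h a b) = PhR Jop h (\<Delta>1 a - \<Delta>2 b) (\<Delta>1 b + \<Delta>2 a)"
    and "\<Delta>1' (PhI Jop h a b) + \<Delta>2' (PhR Jop h a b) = PhI Jop h (\<Delta>1 a - \<Delta>2 b) (\<Delta>1 b + \<Delta>2 a)"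
proof -
  note c = comb_mem[OF e]
  note ratio = ratio_comb[OF e g g', folded h_def]
  have two: "wscale 2 (wscale (1/2) y) = y" for y :: "'v wvec"
    by (simp add: wscale_def cscale_def)
  have "opg g' x (comb B e x (\<Delta>1' (PhR Jop h a b) - \<Delta>2' (PhI Jop h a b)), comb B e x (\<Delta>1' (PhI Jop h a b) + \<Delta>2' (PhR Jop h a b)))
     = wscale 2 (D' x v (opg g' x (comb B e x (PhR Jop h a b), comb B e x (PhI Jop h a b))))"
    unfolding Dg_comb[OF D g' e v] two \<Delta>1'_def \<Delta>2'_def ..
  also have "\<dots> = opg g x (comb B e x (\<Delta>1 a - \<Delta>2 b), comb B e x (\<Delta>1 b + \<Delta>2 a))"
    unfolding ratio Dg_comb[OF D g e v] two \<Delta>1_def \<Delta>2_def ..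
  also have "\<dots> = opg g' x (comb B e x (PhR Jop h (\<Delta>1 a - \<Delta>2 b) (\<Delta>1 b + \<Delta>2 a)),
      comb B e x (PhI Jop h (\<Delta>1 a - \<Delta>2 b) (\<Delta>1 b + \<Delta>2 a)))"
    by (rule ratio[symmetric])
  finally have "comb B e x (\<Delta>1' (PhR Jop h a b) - \<Delta>2' (PhI Jop h a b)) = comb B e x (PhR Jop h (\<Delta>1 a - \<Delta>2 b) (\<Delta>1 b + \<Delta>2 a))
     \<and> comb B e x (\<Delta>1' (PhI Jop h a b) + \<Delta>2' (PhR Jop h a b)) = comb B e x (PhI Jop h (\<Delta>1 a - \<Delta>2 b) (\<Delta>1 b + \<Delta>2 a))"
    using opg_inj[OF g' _ c c c c] by blast
  then show "\<Delta>1' (PhR Jop h a b) - \<Delta>2' (PhI Jop h a b) = PhR Jop h (\<Delta>1 a - \<Delta>2 b) (\<Delta>1 b + \<Delta>2 a)"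
    "\<Delta>1' (PhI Jop h a b) + \<Delta>2' (PhR Jop h a b) = PhI Jop h (\<Delta>1 a - \<Delta>2 b) (\<Delta>1 b + \<Delta>2 a)"
    using coord_comb[OF e] by metis+
qed

end

context hol_bundle
begin

subsection \<open>Chern connections\<close>

context
  fixes g nabla
  assumes g: "compatible_metric B g" and ch: "chern_connection B g nabla"
begin

lemma chern_conn: "is_connection B nabla"
  using ch unfolding chern_connection_def by blast

lemma chern_metric:
  assumes "open U" "smooth_section B U s" "smooth_section B U t" "x \<in> U" "v \<in> tang B x"
  shows "dfun (charts B) (\<lambda>y. g y (s y) (t y)) x v = g x (nabla s x v) (t x) + g x (s x) (nabla t x v)"
  using ch[unfolded chern_connection_def, THEN conjunct2, THEN conjunct1, THEN spec, THEN spec, THEN spec, THEN mp]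
    assms by blast

lemma chern_J:
  assumes "open U" "smooth_section B U s" "x \<in> U" "v \<in> tang B x"
  shows "nabla (\<lambda>y. bJ B y (s y)) x v = bJ B x (nabla s x v)"
    "(1/2) *\<^sub>R (nabla s x v + bJ B x (nabla s x (cplx_I v))) = dbar_E B s x v"
proof -
  note h = ch[unfolded chern_connection_def, THEN conjunct2, THEN conjunct2, THEN spec, THEN spec, THEN mp,
      OF conjI[OF assms(1,2)], THEN bspec, OF assms(3), THEN bspec, OF assms(4)]
  show "nabla (\<lambda>y. bJ B y (s y)) x v = bJ B x (nabla s x v)" using h by (rule conjunct1)
  show "(1/2) *\<^sub>R (nabla s x v + bJ B x (nabla s x (cplx_I v))) = dbar_E B s x v" using h by (rule conjunct2)
qed

lemma chern_metric_conn: "metric_conn g nabla"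
  unfolding metric_conn_def
proof (intro conjI allI impI chern_conn)
  fix V e x v a b assume e: "isfr V e" and x: "x \<in> V" and v: "v \<in> tang B x"
  note o = frame_open[OF e]
  obtain c where c: "c \<in> charts B" "x \<in> fst c" by (rule ex_chart)
  note d = smooth_fun_has_derivative[OF gmat_smooth[OF e g] x c]
  have d': "((\<lambda>z. g (chart_inv c z) (comb B e (chart_inv c z) a) (comb B e (chart_inv c z) b)) has_derivative
      (\<lambda>h. frechet_derivative (\<lambda>z. gmat g e (chart_inv c z)) (at (snd c x)) h a \<bullet> b)) (at (snd c x))"
  proof (rule has_derivative_transform_within_open[OF bounded_linear.has_derivative[OF bounded_linear_entry d]])
    show "open (snd c ` (V \<inter> fst c))" by (rule chart_img_open[OF c(1) o])
    show "snd c x \<in> snd c ` (V \<inter> fst c)" using x c by blast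
    fix z assume "z \<in> snd c ` (V \<inter> fst c)"
    then have "chart_inv c z \<in> V" unfolding chart_img_iff[OF c(1)] by blast
    then show "gmat g e (chart_inv c z) a \<bullet> b = g (chart_inv c z) (comb B e (chart_inv c z) a) (comb B e (chart_inv c z) b)"
      by (rule gmat_apply[OF e _ g])
  qed
  have "dfun (charts B) (gmat g e) x v a \<bullet> b = dfun (charts B) (\<lambda>y. g y (comb B e y a) (comb B e y b)) x v"
    unfolding dfun_eq[OF c v d] dfun_eq[where f="\<lambda>y. g y (comb B e y a) (comb B e y b)", OF c v d'] ..
  also have "\<dots> = g x (nabla (\<lambda>y. comb B e y a) x v) (comb B e x b) + g x (comb B e x a) (nabla (\<lambda>y. comb B e y b) x v)"
    by (rule chern_metric[OF o const_section[OF e] const_section[OF e] x v])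
  also have "\<dots> = gmat g e x (cform nabla e x v a) \<bullet> b + gmat g e x a \<bullet> cform nabla e x v b"
    unfolding gmat_apply[OF e x g] cform_apply(2)[OF chern_conn e x v] ..
  finally show "dfun (charts B) (gmat g e) x v a \<bullet> b =
      gmat g e x (cform nabla e x v a) \<bullet> b + gmat g e x a \<bullet> cform nabla e x v b" .
qed

text \<open>Sections with constant coefficients in a holomorphic frame are holomorphic. As the Chern connection
  has the \<open>(0,1)\<close>-part given by the \<open>\<partial>\<close>-bar operator, its form in such a frame has type \<open>(1,0)\<close>.\<close>

lemma chern_cform:
  assumes e: "isfr V e" "x \<in> V" and v: "v \<in> tang B x"
  shows "cform nabla e x v (Jop a) = Jop (cform nabla e x v a)"
    and "cform nabla e x (cplx_I v) = Jop o\<^sub>L cform nabla e x v"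
proof -
  note o = frame_open[OF e(1)] and s = const_section[OF e(1)]
  note ca = cform_apply[OF chern_conn e]
  have "nabla (\<lambda>y. comb B e y (\<i> *s a)) x v = nabla (\<lambda>y. bJ B y (comb B e y a)) x v"
    by (rule connD(7)[OF chern_conn o s _ e(2) v]) (rule comb_J[OF e(1)])
  then have "comb B e x (cform nabla e x v (\<i> *s a)) = comb B e x (\<i> *s cform nabla e x v a)"
    unfolding ca(2)[OF v] comb_J[OF e] chern_J(1)[OF o s e(2) v] .
  then show "cform nabla e x v (Jop a) = Jop (cform nabla e x v a)"
    unfolding Jop_apply by (metis coord_comb[OF e])
  show "cform nabla e x (cplx_I v) = Jop o\<^sub>L cform nabla e x v"
  proof (rule blinfun_eqI)
    fix a
    note Iv = cplx_I_tangent[OF v]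
    define e0 where "e0 = frame_at B x"
    obtain V0 where e0: "isfr V0 e0" "x \<in> V0" unfolding e0_def by (rule frame_at)
    have "dbar_vec (charts B) (\<lambda>y. coord B e0 y (comb B e y a)) x v = 0"
      unfolding dbar_vec_def vec_eq_iff
      using holomorphic_dbar_fun[OF coord_comb_holomorphic[OF e(1) e0(1)] _ v] e e0 by simp
    then have "dbar_E B (\<lambda>y. comb B e y a) x v = 0"
      unfolding dbar_E_def e0_def[symmetric] Let_def by (simp add: comb_0)
    with chern_J(2)[OF o s e(2) v, of a]
    have "nabla (\<lambda>y. comb B e y a) x v + bJ B x (nabla (\<lambda>y. comb B e y a) x (cplx_I v)) = 0" by simp
    then have "comb B e x (cform nabla e x v a + \<i> *s cform nabla e x (cplx_I v) a) = 0"
      unfolding comb_add comb_J[OF e] ca(2)[OF v] ca(2)[OF Iv] .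
    then have "cform nabla e x v a + \<i> *s cform nabla e x (cplx_I v) a = 0"
      using coord_unique[OF e] comb_0 coord_comb[OF e] by metis
    then have "\<i> *s cform nabla e x v a = - (\<i> *s (\<i> *s cform nabla e x (cplx_I v) a))"
      by (metis eq_neg_iff_add_eq_0 vector_add_ldistrib vector_smult_rzero)
    then show "cform nabla e x (cplx_I v) a = (Jop o\<^sub>L cform nabla e x v) a"
      by (simp add: vec_eq_iff)
  qed
qed

end

subsection \<open>The connection \<open>\<nabla>\<^sup>C\<^sup>h + \<D>\<^sub>g\<close>\<close>

lemma tangent_add: "v \<in> tang B x \<Longrightarrow> w \<in> tang B x \<Longrightarrow> v + w \<in> tang B x"
proof -
  assume v: "v \<in> tang B x" and w: "w \<in> tang B x"
  obtain c where c: "c \<in> charts B" "x \<in> fst c" by (rule ex_chart)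
  have "v + w = coord_vec (charts B) c x (v c + w c)"
    unfolding coord_vec_linear(1)[OF c] tangent_eq_coord_vec[OF v c, symmetric] tangent_eq_coord_vec[OF w c, symmetric] ..
  then show ?thesis using coord_vec_tangent[OF c, of "v c + w c"] by simp
qed

lemma tangent_scale: "v \<in> tang B x \<Longrightarrow> tscale r v \<in> tang B x"
proof -
  assume v: "v \<in> tang B x"
  obtain c where c: "c \<in> charts B" "x \<in> fst c" by (rule ex_chart)
  have "tscale r v = coord_vec (charts B) c x (r *\<^sub>R v c)"
    unfolding coord_vec_linear(2)[OF c] tangent_eq_coord_vec[OF v c, symmetric] ..
  then show ?thesis using coord_vec_tangent[OF c, of "r *\<^sub>R v c"] by simp
qed

lemma smooth_section_add:
  assumes U: "open U" and s: "smooth_section B U s" and t: "smooth_section B U t"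
  shows "smooth_section B U (\<lambda>x. s x + t x)"
  unfolding smooth_section_def
proof (intro conjI ballI, goal_cases)
  case (1 x)
  then show ?case using s t by (simp add: smooth_section_def fiber_add)
next
  case (2 p)
  obtain V e where p: "p = (V, e)" by (cases p)
  with 2 have e: "isfr V e" by simp
  have o: "open (U \<inter> V)" using U frame_open[OF e] by blast
  have "smooth_fun (charts B) (U \<inter> V) (\<lambda>x. coord B e x (s x) + coord B e x (t x))"
    by (rule smooth_fun_add[OF o smooth_section_coord[OF s e] smooth_section_coord[OF t e]])
  then have "smooth_fun (charts B) (U \<inter> V) (\<lambda>x. coord B e x (s x + t x))"
    by (rule smooth_fun_cong[OF o, rotated])
       (use s t in \<open>simp add: smooth_section_def coord_add[OF e]\<close>)
  then show ?case by (simp add: p)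
qed

context
  fixes D' g nCh
  assumes D: "so_form01 B D'" and g: "compatible_metric B g" and ch: "chern_connection B g nCh"
begin

text \<open>The connection \<open>\<nabla>\<^sup>C\<^sup>h + \<D>\<^sub>g\<close> that defines the almost complex structure of the twistor space.\<close>

definition tot where "tot = (\<lambda>s x v. nCh s x v + Dg B g D' x v (s x))"

lemma Dg_section:
  assumes U: "open U" and s: "smooth_section B U s" and c: "c \<in> charts B"
  shows "smooth_section B (U \<inter> fst c) (\<lambda>x. Dg B g D' x (coord_vec (charts B) c x a) (s x))"
  unfolding smooth_section_def
proof (intro conjI ballI, goal_cases)
  case (1 x)
  then show ?case
    using s Dg_mem[OF D g coord_vec_tangent[OF c]] by (simp add: smooth_section_def)
next
  case (2 p)
  obtain V e where p: "p = (V, e)" by (cases p)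
  with 2 have e: "isfr V e" by simp
  have o: "open (U \<inter> fst c \<inter> V)" using U frame_open[OF e] chart_open[OF c] by blast
  have "smooth_fun (charts B) (U \<inter> fst c \<inter> V)
      (\<lambda>x. rep e x (Dg B g D' x (coord_vec (charts B) c x a)) (coord B e x (s x)))"
    by (rule smooth_fun_apply[OF o smooth_fun_subset[OF Dg_smooth[OF D g e c]]
          smooth_fun_subset[OF smooth_section_coord[OF s e]]]) auto
  then have "smooth_fun (charts B) (U \<inter> fst c \<inter> V) (\<lambda>x. coord B e x (Dg B g D' x (coord_vec (charts B) c x a) (s x)))"
  proof (rule smooth_fun_cong[OF o, rotated])
    fix x assume "x \<in> U \<inter> fst c \<inter> V"
    then have x: "x \<in> U" "x \<in> fst c" "x \<in> V" by auto
    have "s x \<in> fiber B x" using s x by (simp add: smooth_section_def)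
    then show "rep e x (Dg B g D' x (coord_vec (charts B) c x a)) (coord B e x (s x)) =
        coord B e x (Dg B g D' x (coord_vec (charts B) c x a) (s x))"
      by (simp add: rep_Dg(1)[OF D g e x(3) coord_vec_tangent[OF c x(2)]] comb_coord[OF e x(3)])
  qed
  then show ?case by (simp add: p)
qed

lemma tot_connection: "is_connection B tot"
  unfolding is_connection_def
proof (intro allI impI, elim conjE)
  fix U s assume U: "open U" and s: "smooth_section B U s"
  note n = connD[OF chern_conn[OF g ch] U s]
  have sm: "s x \<in> fiber B x" if "x \<in> U" for x using s that by (simp add: smooth_section_def)
  have lin: "Dg B g D' x v (u + w) = Dg B g D' x v u + Dg B g D' x v w"
    "Dg B g D' x v (r *\<^sub>R u) = r *\<^sub>R Dg B g D' x v u"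
    if "v \<in> tang B x" "u \<in> fiber B x" "w \<in> fiber B x" for x v u w r
    using Dg_lin[OF D g that(1)] that(2,3) unfolding real_linear_on_def by blast+
  have P1: "\<forall>c\<in>charts B. \<forall>a. smooth_section B (U \<inter> fst c) (\<lambda>x. tot s x (coord_vec (charts B) c x a))"
    unfolding tot_def using U chart_open
    by (intro ballI allI smooth_section_add n(1) Dg_section[OF U s]) auto
  have P2: "\<forall>x\<in>U. \<forall>v\<in>tang B x. tot s x v \<in> fiber B x \<and>
        (\<forall>w\<in>tang B x. tot s x (v + w) = tot s x v + tot s x w) \<and>
        (\<forall>r. tot s x (tscale r v) = r *\<^sub>R tot s x v)"
  proof (intro ballI conjI allI)
    fix x v assume x: "x \<in> U" and v: "v \<in> tang B x"
    show "tot s x v \<in> fiber B x"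
      unfolding tot_def by (rule fiber_add[OF n(2)[OF x v] Dg_mem[OF D g v sm[OF x]]])
    show "tot s x (v + w) = tot s x v + tot s x w" if w: "w \<in> tang B x" for w
      unfolding tot_def n(3)[OF x v w] Dg_al[OF D g] al_v_add[OF D g v w tangent_add[OF v w] sm[OF x]]
      by (simp add: scaleR_right_distrib)
    show "tot s x (tscale r v) = r *\<^sub>R tot s x v" for r
      unfolding tot_def n(4)[OF x v] Dg_al[OF D g] al_v_scale[OF D g v tangent_scale[OF v] sm[OF x]]
      by (simp add: scaleR_right_distrib)
  qed
  have P3: "\<forall>t. smooth_section B U t \<longrightarrow> (\<forall>x\<in>U. \<forall>v\<in>tang B x. tot (\<lambda>y. s y + t y) x v = tot s x v + tot t x v)"
  proof (intro allI impI ballI)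
    fix t x v assume t: "smooth_section B U t" and x: "x \<in> U" and v: "v \<in> tang B x"
    have tm: "t x \<in> fiber B x" using t x by (simp add: smooth_section_def)
    show "tot (\<lambda>y. s y + t y) x v = tot s x v + tot t x v"
      unfolding tot_def n(5)[OF t x v] lin(1)[OF v sm[OF x] tm] by simp
  qed
  have P4: "\<forall>f. smooth_fun (charts B) U f \<longrightarrow> (\<forall>x\<in>U. \<forall>v\<in>tang B x.
        tot (\<lambda>y. f y *\<^sub>R s y) x v = dfun (charts B) f x v *\<^sub>R s x + f x *\<^sub>R tot s x v)"
  proof (intro allI impI ballI)
    fix f :: "'m \<Rightarrow> real" and x v assume f: "smooth_fun (charts B) U f" and x: "x \<in> U" and v: "v \<in> tang B x"
    show "tot (\<lambda>y. f y *\<^sub>R s y) x v = dfun (charts B) f x v *\<^sub>R s x + f x *\<^sub>R tot s x v"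
      unfolding tot_def n(6)[OF f x v] lin(2)[OF v sm[OF x] sm[OF x]] by (simp add: scaleR_right_distrib)
  qed
  have P5: "\<forall>t. (\<forall>x\<in>U. s x = t x) \<longrightarrow> (\<forall>x\<in>U. \<forall>v\<in>tang B x. tot s x v = tot t x v)"
  proof (intro allI impI ballI)
    fix t x v assume t: "\<forall>x\<in>U. s x = t x" and x: "x \<in> U" and v: "v \<in> tang B x"
    have "nCh s x v = nCh t x v" by (rule n(7)[OF _ x v]) (use t in blast)
    then show "tot s x v = tot t x v" unfolding tot_def using t x by simp
  qed
  show "(\<forall>c\<in>charts B. \<forall>a. smooth_section B (U \<inter> fst c) (\<lambda>x. tot s x (coord_vec (charts B) c x a))) \<and>
     (\<forall>x\<in>U. \<forall>v\<in>tang B x. tot s x v \<in> fiber B x \<and>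
        (\<forall>w\<in>tang B x. tot s x (v + w) = tot s x v + tot s x w) \<and>
        (\<forall>r. tot s x (tscale r v) = r *\<^sub>R tot s x v)) \<and>
     (\<forall>t. smooth_section B U t \<longrightarrow> (\<forall>x\<in>U. \<forall>v\<in>tang B x. tot (\<lambda>y. s y + t y) x v = tot s x v + tot t x v)) \<and>
     (\<forall>f. smooth_fun (charts B) U f \<longrightarrow> (\<forall>x\<in>U. \<forall>v\<in>tang B x.
        tot (\<lambda>y. f y *\<^sub>R s y) x v = dfun (charts B) f x v *\<^sub>R s x + f x *\<^sub>R tot s x v)) \<and>
     (\<forall>t. (\<forall>x\<in>U. s x = t x) \<longrightarrow> (\<forall>x\<in>U. \<forall>v\<in>tang B x. tot s x v = tot t x v))"
    by (intro conjI P1 P2 P3 P4 P5)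
qed

lemma tot_cform:
  assumes e: "isfr V e" "x \<in> V" and v: "v \<in> tang B x"
  shows "cform tot e x v = cform nCh e x v + rep e x (Dg B g D' x v)"
proof (rule blinfun_eqI)
  fix a
  have "nCh (\<lambda>y. comb B e y a) x v \<in> fiber B x"
    by (rule connD(2)[OF chern_conn[OF g ch] frame_open[OF e(1)] const_section[OF e(1)] e(2) v])
  moreover have "tot (\<lambda>y. comb B e y a) x v = nCh (\<lambda>y. comb B e y a) x v + Dg B g D' x v (comb B e x a)"
    by (simp add: tot_def)
  ultimately show "cform tot e x v a = (cform nCh e x v + rep e x (Dg B g D' x v)) a"
    unfolding cform_apply(1)[OF tot_connection e v] plus_blinfun.rep_eq cform_apply(1)[OF chern_conn[OF g ch] e v]
      rep_Dg(1)[OF D g e v]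
    using Dg_mem[OF D g v comb_mem[OF e]] by (simp add: coord_add[OF e])
qed

lemma tot_metric_conn: "metric_conn g tot"
  unfolding metric_conn_def
proof (intro conjI allI impI tot_connection)
  fix V e x v a b assume e: "isfr V e" "x \<in> V" and v: "v \<in> tang B x"
  show "dfun (charts B) (gmat g e) x v a \<bullet> b =
      gmat g e x (cform tot e x v a) \<bullet> b + gmat g e x a \<bullet> cform tot e x v b"
    unfolding metric_connD[OF chern_metric_conn[OF g ch] e v] tot_cform[OF e v]
    using rep_Dg_skew[OF D g e v, of a b]
    by (simp add: blinfun.add_left blinfun.add_right inner_add_left inner_add_right)
qed

end

section \<open>The biholomorphism\<close>

text \<open>The image of \<open>K\<close> is the orthogonal complex structure for \<open>g'\<close> whose \<open>-i\<close>-eigenspace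
  \<open>{w + i K' w}\<close> corresponds to the same isotropic subspace of \<open>E\<^sup>1\<^sup>,\<^sup>0 \<oplus> E\<^sup>*\<^sup>1\<^sup>,\<^sup>0\<close> as that of \<open>K\<close>.\<close>

definition same_subspace where
  "same_subspace g g' x K K' \<longleftrightarrow>
     (\<forall>u\<in>fiber B x. \<exists>w\<in>fiber B x. opg g' x (w, K' w) = opg g x (u, K u))"

definition Fmap :: "('m \<Rightarrow> 'v \<Rightarrow> 'v \<Rightarrow> real) \<Rightarrow> ('m \<Rightarrow> 'v \<Rightarrow> 'v \<Rightarrow> real) \<Rightarrow> 'm \<times> ('v \<Rightarrow> 'v) \<Rightarrow> 'm \<times> ('v \<Rightarrow> 'v)" where
  "Fmap g g' p = (fst p, THE K'. K' \<in> End_fiber B (fst p) \<and> same_subspace g g' (fst p) (snd p) K')"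

definition hmat where "hmat g g' e x = ratio_op (gmat g e x) (gmat g' e x)"

text \<open>A \<open>K'\<close> with the same subspace as \<open>K\<close> has \<open>K' P = P K\<close> in every frame, which forces it to be the transported
  structure; conversely this structure has the same subspace. The frame-free characterization shows that
  the matrices found in different frames define one endomorphism.\<close>

lemma Fmap_rep:
  assumes g: "compatible_metric B g" and g': "compatible_metric B g'" and p: "(x, K) \<in> twistor_space B g"
  obtains K' where "Fmap g g' (x, K) = (x, K')" "(x, K') \<in> twistor_space B g'" "K' \<in> End_fiber B x"
    "\<And>V e. isfr V e \<Longrightarrow> x \<in> V \<Longrightarrow> rep e x K' = transport_cs Jop (hmat g g' e x) (rep e x K)"
proof -
  have KE: "K \<in> End_fiber B x" using p by (simp add: twistor_space_def)
  have val: "rep e x K' = transport_cs Jop (hmat g g' e x) (rep e x K)"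
    if K': "K' \<in> End_fiber B x" and sub: "same_subspace g g' x K K'" and e: "isfr V e" "x \<in> V" for K' V e
  proof -
    define M h P where "M = rep e x K" and "h = hmat g g' e x" and "P = transport_op Jop h M"
    note h = h_def[unfolded hmat_def]
    have M: "M \<in> ortho_cs (gmat g e x)" using p unfolding twistor_iff[OF e g] M_def by simp
    note G = gmat_herm[OF e g] and G' = gmat_herm[OF e g']
    note c = comb_mem[OF e]
    have inv: "invertible_op P" unfolding P_def by (rule transport_op_invertible[OF G G' h M])
    have K'P: "rep e x K' (P a) = P (M a)" for a
    proof -
      obtain w where w: "w \<in> fiber B x" "opg g' x (w, K' w) = opg g x (comb B e x a, K (comb B e x a))"
        using sub c unfolding same_subspace_def by blast
      have "opg g x (comb B e x a, K (comb B e x a)) = opg g' x (comb B e x (P a), comb B e x (P (M a)))"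
        using ratio_comb[OF e g g', of a "M a"]
        unfolding h[symmetric] transport_op_PhR[OF G G' h M] transport_op_PhI[OF G G' h M] P_def[symmetric]
        by (simp add: M_def rep_End(2)[OF e KE])
      with w(2) have eq: "opg g' x (w, K' w) = opg g' x (comb B e x (P a), comb B e x (P (M a)))" by simp
      note i = opg_inj[OF g' eq w(1) End_fiberD(1)[OF K' w(1)] c c]
      have "K' (comb B e x (P a)) = comb B e x (P (M a))" using i by simp
      then show ?thesis by (simp add: rep_End(1)[OF e K'] coord_comb[OF e])
    qed
    show ?thesis
    proof (rule blinfun_eqI)
      fix b
      show "rep e x K' b = transport_cs Jop (hmat g g' e x) (rep e x K) b"
        using K'P[of "binv P b"] unfolding transport_cs_def h_def[symmetric] M_def[symmetric] P_def[symmetric]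
        by (simp add: binv_apply[OF inv])
    qed
  qed
  obtain V e where e: "isfr V e" "x \<in> V" by (rule ex_frame)
  define M h P where "M = rep e x K" and "h = hmat g g' e x" and "P = transport_op Jop h M"
  note h = h_def[unfolded hmat_def]
  have M: "M \<in> ortho_cs (gmat g e x)" using p unfolding twistor_iff[OF e g] M_def by simp
  note G = gmat_herm[OF e g] and G' = gmat_herm[OF e g']
  note c = comb_mem[OF e]
  define K' where "K' = unrep e x (transport_cs Jop h M)"
  have K': "K' \<in> End_fiber B x" unfolding K'_def by (rule unrep_End[OF e])
  have rK': "rep e x K' = transport_cs Jop h M" unfolding K'_def by (rule rep_unrep[OF e])
  have sub: "same_subspace g g' x K K'"
    unfolding same_subspace_def
  proof
    fix u assume u: "u \<in> fiber B x"
    define a where "a = coord B e x u"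
    have ua: "u = comb B e x a" unfolding a_def by (rule comb_coord[OF e u, symmetric])
    have "opg g x (comb B e x a, K (comb B e x a)) = opg g' x (comb B e x (P a), comb B e x (P (M a)))"
      using ratio_comb[OF e g g', of a "M a"]
      unfolding h[symmetric] transport_op_PhR[OF G G' h M] transport_op_PhI[OF G G' h M] P_def[symmetric]
      by (simp add: M_def rep_End(2)[OF e KE])
    moreover have "K' (comb B e x (P a)) = comb B e x (P (M a))"
      unfolding K'_def unrep_apply[OF e] P_def transport_cs_apply[OF G G' h M] ..
    ultimately show "\<exists>w\<in>fiber B x. opg g' x (w, K' w) = opg g x (u, K u)"
      unfolding ua by (intro bexI[of _ "comb B e x (P a)"] c) simp
  qed
  have "(THE K'. K' \<in> End_fiber B x \<and> same_subspace g g' x K K') = K'"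
    by (rule the_equality) (use K' sub val[OF _ _ e] End_eqI[OF e] in metis)+
  then have F: "Fmap g g' (x, K) = (x, K')" by (simp add: Fmap_def)
  have "(x, K') \<in> twistor_space B g'"
    unfolding twistor_iff[OF e g'] rK' using K' transport_cs_ortho[OF G G' h M] by blast
  with F show thesis using K' val[OF K' sub] by (rule that)
qed

text \<open>Exchanging the metrics exchanges the roles of \<open>K\<close> and \<open>K'\<close>.\<close>

lemma Fmap_inverse:
  assumes g: "compatible_metric B g" and g': "compatible_metric B g'" and p: "p \<in> twistor_space B g"
  shows "Fmap g' g (Fmap g g' p) = p"
proof -
  obtain x K where pxK: "p = (x, K)" by (cases p)
  note p = p[unfolded pxK]
  have K: "K \<in> End_fiber B x" using p by (simp add: twistor_space_def)
  obtain K' where K': "Fmap g g' (x, K) = (x, K')" "(x, K') \<in> twistor_space B g'"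
    "\<And>V e. isfr V e \<Longrightarrow> x \<in> V \<Longrightarrow> rep e x K' = transport_cs Jop (hmat g g' e x) (rep e x K)"
    by (rule Fmap_rep[OF g g' p]) (rule that, assumption+)
  obtain K2 where K2: "Fmap g' g (x, K') = (x, K2)" "K2 \<in> End_fiber B x"
    "\<And>V e. isfr V e \<Longrightarrow> x \<in> V \<Longrightarrow> rep e x K2 = transport_cs Jop (hmat g' g e x) (rep e x K')"
    by (rule Fmap_rep[OF g' g K'(2)]) (rule that, assumption+)
  obtain V e where e: "isfr V e" "x \<in> V" by (rule ex_frame)
  have M: "rep e x K \<in> ortho_cs (gmat g e x)" using p unfolding twistor_iff[OF e g] by simp
  have "rep e x K2 = rep e x K"
    unfolding K2(3)[OF e] K'(3)[OF e] hmat_def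
    by (rule transport_cs_inverse[OF gmat_herm[OF e g] gmat_herm[OF e g'] refl M])
  then have "K2 = K" by (rule End_eqI[OF e K2(2) K])
  then show ?thesis by (simp add: pxK K'(1) K2(1))
qed

lemma Fmap_mem:
  assumes g: "compatible_metric B g" and g': "compatible_metric B g'" and p: "p \<in> twistor_space B g"
  shows "Fmap g g' p \<in> twistor_space B g'"
proof -
  obtain x K where pxK: "p = (x, K)" by (cases p)
  show ?thesis unfolding pxK by (rule Fmap_rep[OF g g' p[unfolded pxK]]) simp
qed

lemma Fmap_bij:
  assumes g: "compatible_metric B g" and g': "compatible_metric B g'"
  shows "bij_betw (Fmap g g') (twistor_space B g) (twistor_space B g')"
  by (rule bij_betwI[where g="Fmap g' g"])
     (auto intro: Fmap_mem[OF g g'] Fmap_mem[OF g' g] Fmap_inverse[OF g g'] Fmap_inverse[OF g' g])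

end

context hol_bundle
begin

context
  fixes g g'
  assumes g: "compatible_metric B g" and g': "compatible_metric B g'"
begin

definition hloc where "hloc c e z = hmat g g' e (chart_inv c z)"

definition Ploc where "Ploc c e q = transport_op Jop (hloc c e (fst q)) (snd q)"

text \<open>The map in a bundle chart, extended from the twistor space to an open set of the model space: there
  \<open>P\<close> is merely required to be invertible.\<close>

definition Floc where "Floc c e q = (fst q, transport_cs Jop (hloc c e (fst q)) (snd q))"

definition Wloc where
  "Wloc c V e = {q. fst q \<in> snd c ` (V \<inter> fst c) \<and> invertible_op (Ploc c e q)}"

context
  fixes c V e
  assumes c: "c \<in> charts B" and e: "isfr V e"
begin

lemma V_open: "open (snd c ` (V \<inter> fst c))"
  by (rule chart_img_open[OF c frame_open[OF e]])

lemma hloc_smooth: "smooth_on (snd c ` (V \<inter> fst c)) (hloc c e)"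
proof -
  have "smooth_fun (charts B) V (\<lambda>x. binv (gmat g' e x) o\<^sub>L gmat g e x)"
    by (intro smooth_fun_bilinear[OF bounded_bilinear_blinfun_compose] frame_open[OF e] smooth_fun_binv
        gmat_smooth[OF e g] gmat_smooth[OF e g'] herm_invertible[OF gmat_herm[OF e _ g']])
  then show ?thesis
    using c unfolding smooth_fun_def hloc_def[abs_def] hmat_def ratio_op_def by blast
qed

lemma Ploc_smooth: "smooth_on (snd c ` (V \<inter> fst c) \<times> UNIV) (Ploc c e)"
proof -
  let ?S = "snd c ` (V \<inter> fst c) \<times> (UNIV :: 'r cop set)"
  have o: "open ?S" by (intro open_Times V_open open_UNIV)
  have h: "smooth_on ?S (\<lambda>q. hloc c e (fst q))"
    by (rule smooth_on_compose[OF fin_dim_euclidean o V_open _ smooth_on_linear[OF o bounded_linear_fst] hloc_smooth]) auto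
  have M: "smooth_on ?S snd" by (rule smooth_on_linear[OF o bounded_linear_snd])
  show ?thesis
    unfolding Ploc_def[abs_def] transport_op_def
    by (intro smooth_on_compose_linear[OF bounded_linear_scaleR_right] smooth_on_add smooth_on_diff
        smooth_on_blinfun_compose smooth_on_const o h M)
qed

lemma Wloc_open: "open (Wloc c V e)"
proof -
  have "open ((snd c ` (V \<inter> fst c) \<times> UNIV) \<inter> Ploc c e -` {M. invertible_op M})"
    by (rule continuous_open_preimage[OF smooth_on_continuous_on[OF Ploc_smooth] _ open_invertible_op])
       (intro open_Times V_open open_UNIV)
  moreover have "(snd c ` (V \<inter> fst c) \<times> UNIV) \<inter> Ploc c e -` {M. invertible_op M} = Wloc c V e"
    unfolding Wloc_def by auto
  ultimately show ?thesis by simp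
qed

lemma Floc_smooth: "smooth_on (Wloc c V e) (Floc c e)"
proof -
  have sub: "Wloc c V e \<subseteq> snd c ` (V \<inter> fst c) \<times> UNIV" unfolding Wloc_def by auto
  note o = Wloc_open
  note P = smooth_on_subset[OF Ploc_smooth sub]
  have "smooth_on (Wloc c V e) (\<lambda>q. Ploc c e q o\<^sub>L snd q o\<^sub>L binv (Ploc c e q))"
    by (intro smooth_on_blinfun_compose smooth_on_binv_comp o P smooth_on_linear bounded_linear_snd)
       (simp add: Wloc_def)
  then show ?thesis
    unfolding Floc_def[abs_def] transport_cs_def Ploc_def[symmetric]
    by (rule smooth_on_Pair[OF o smooth_on_linear[OF o bounded_linear_fst]])
qed

lemma twistor_loc:
  assumes p: "(x, K) \<in> twistor_space B g" and x: "x \<in> fst c" "x \<in> V"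
  shows "(x, K) \<in> fst (echart c V e)" and "snd (echart c V e) (x, K) = (snd c x, rep e x K)"
    and "(snd c x, rep e x K) \<in> Wloc c V e"
    and "Fmap g g' (x, K) \<in> fst (echart c V e)"
    and "snd (echart c V e) (Fmap g g' (x, K)) = Floc c e (snd c x, rep e x K)"
    and "rep e x (snd (Fmap g g' (x, K))) = transport_cs Jop (hmat g g' e x) (rep e x K)"
    and "fst (Fmap g g' (x, K)) = x"
proof -
  have KE: "K \<in> End_fiber B x" using p by (simp add: twistor_space_def)
  have M: "rep e x K \<in> ortho_cs (gmat g e x)" using p unfolding twistor_iff[OF e x(2) g] by simp
  have h: "hloc c e (snd c x) = hmat g g' e x" by (simp add: hloc_def c x)
  show "(x, K) \<in> fst (echart c V e)" "snd (echart c V e) (x, K) = (snd c x, rep e x K)"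
    using KE x by (simp_all add: mem_echart snd_echart)
  have "invertible_op (transport_op Jop (hmat g g' e x) (rep e x K))"
    unfolding hmat_def
    by (rule transport_op_invertible[OF gmat_herm[OF e x(2) g] gmat_herm[OF e x(2) g'] refl M])
  then show "(snd c x, rep e x K) \<in> Wloc c V e"
    using x by (simp add: Wloc_def Ploc_def h)
  obtain K' where K': "Fmap g g' (x, K) = (x, K')" "K' \<in> End_fiber B x"
    "rep e x K' = transport_cs Jop (hmat g g' e x) (rep e x K)"
    by (rule Fmap_rep[OF g g' p]) (rule that, assumption+, use e x in blast)
  show "Fmap g g' (x, K) \<in> fst (echart c V e)"
    "snd (echart c V e) (Fmap g g' (x, K)) = Floc c e (snd c x, rep e x K)"
    "rep e x (snd (Fmap g g' (x, K))) = transport_cs Jop (hmat g g' e x) (rep e x K)"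
    "fst (Fmap g g' (x, K)) = x"
    using K' x by (simp_all add: mem_echart snd_echart Floc_def h)
qed

end

lemma twistor_in_chart:
  assumes "p \<in> twistor_space B g"
  obtains c V e where "c \<in> charts B" "isfr V e" "fst p \<in> fst c" "fst p \<in> V" "p \<in> fst (echart c V e)"
proof -
  obtain x K where p: "p = (x, K)" by (cases p)
  obtain c where c: "c \<in> charts B" "x \<in> fst c" by (rule ex_chart)
  obtain V e where e: "isfr V e" "x \<in> V" by (rule ex_frame)
  show thesis by (rule that[OF c(1) e(1)]) (use c e assms p in \<open>auto simp: mem_echart twistor_space_def\<close>)
qed

lemma Fmap_smooth: "smooth_map (End_charts B) (twistor_space B g) (End_charts B) (Fmap g g')"
  unfolding smooth_map_def
proof
  fix p assume p: "p \<in> twistor_space B g"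
  then obtain c V e where c: "c \<in> charts B" "fst p \<in> fst c" and e: "isfr V e" "fst p \<in> V"
    by (rule twistor_in_chart)
  let ?C = "echart c V e"
  have C: "?C \<in> End_charts B" by (rule echart_mem[OF c(1) e(1)])
  have loc: "Fmap g g' q \<in> fst ?C \<and> snd ?C (Fmap g g' q) = Floc c e (snd ?C q) \<and> snd ?C q \<in> Wloc c V e \<and> q \<in> fst ?C"
    if q: "q \<in> twistor_space B g" and "fst q \<in> fst c" "fst q \<in> V" for q
    using twistor_loc[OF c(1) e(1), of "fst q" "snd q"] that by simp
  have "\<forall>q\<in>twistor_space B g \<inter> fst ?C. snd ?C q \<in> Wloc c V e \<longrightarrow>
      Fmap g g' q \<in> fst ?C \<and> snd ?C (Fmap g g' q) = Floc c e (snd ?C q)"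
    using loc by (simp add: mem_echart)
  moreover have "p \<in> fst ?C" "Fmap g g' p \<in> fst ?C" "snd ?C p \<in> Wloc c V e"
    using loc[OF p c(2) e(2)] by simp_all
  ultimately show "\<exists>c\<in>End_charts B. \<exists>d\<in>End_charts B. p \<in> fst c \<and> Fmap g g' p \<in> fst d \<and>
     (\<exists>W G. open W \<and> snd c p \<in> W \<and> smooth_on W G \<and>
        (\<forall>q\<in>twistor_space B g \<inter> fst c. snd c q \<in> W \<longrightarrow> Fmap g g' q \<in> fst d \<and> snd d (Fmap g g' q) = G (snd c q)))"
    using C Wloc_open[OF c(1) e(1)] Floc_smooth[OF c(1) e(1)] by blast
qed

lemma Fmap_curve:
  assumes \<Gamma>: "smooth_curve (End_charts B) T \<Gamma>" "open T" "\<Gamma> ` T \<subseteq> twistor_space B g"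
  shows "smooth_curve (End_charts B) T (\<lambda>t. Fmap g g' (\<Gamma> t))"
    and "t \<in> T \<Longrightarrow> c \<in> charts B \<Longrightarrow> isfr V e \<Longrightarrow> fst (\<Gamma> t) \<in> fst c \<Longrightarrow> fst (\<Gamma> t) \<in> V \<Longrightarrow>
      velocity (End_charts B) (\<lambda>t. Fmap g g' (\<Gamma> t)) t (echart c V e) =
        frechet_derivative (Floc c e) (at (snd (echart c V e) (\<Gamma> t))) (velocity (End_charts B) \<Gamma> t (echart c V e))"
proof -
  have loc: "Fmap g g' (\<Gamma> t) \<in> fst (echart c V e) \<and>
      snd (echart c V e) (Fmap g g' (\<Gamma> t)) = Floc c e (snd (echart c V e) (\<Gamma> t)) \<and>
      snd (echart c V e) (\<Gamma> t) \<in> Wloc c V e \<and> \<Gamma> t \<in> fst (echart c V e)"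
    if t: "t \<in> T" and "c \<in> charts B" "isfr V e" "fst (\<Gamma> t) \<in> fst c" "fst (\<Gamma> t) \<in> V" for t c V e
  proof -
    have "(fst (\<Gamma> t), snd (\<Gamma> t)) \<in> twistor_space B g" using \<Gamma>(3) t by auto
    from twistor_loc[OF that(2,3) this that(4,5)] show ?thesis by simp
  qed
  have fstF: "fst (Fmap g g' (\<Gamma> t)) = fst (\<Gamma> t)" for t by (simp add: Fmap_def)
  have set: "{t\<in>T. Fmap g g' (\<Gamma> t) \<in> fst (echart c V e)} = {t\<in>T. fst (\<Gamma> t) \<in> fst c \<inter> V}"
    and set': "{t\<in>T. \<Gamma> t \<in> fst (echart c V e)} = {t\<in>T. fst (\<Gamma> t) \<in> fst c \<inter> V}"
    if "c \<in> charts B" "isfr V e" for c V e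
  proof -
    have "Fmap g g' (\<Gamma> t) \<in> fst (echart c V e) \<longleftrightarrow> fst (\<Gamma> t) \<in> fst c \<inter> V"
      "\<Gamma> t \<in> fst (echart c V e) \<longleftrightarrow> fst (\<Gamma> t) \<in> fst c \<inter> V" if "t \<in> T" for t
      using loc[OF that \<open>c \<in> charts B\<close> \<open>isfr V e\<close>] by (auto simp: mem_echart fstF)
    then show "{t\<in>T. Fmap g g' (\<Gamma> t) \<in> fst (echart c V e)} = {t\<in>T. fst (\<Gamma> t) \<in> fst c \<inter> V}"
      "{t\<in>T. \<Gamma> t \<in> fst (echart c V e)} = {t\<in>T. fst (\<Gamma> t) \<in> fst c \<inter> V}" by blast+
  qed
  have sm: "open {t\<in>T. fst (\<Gamma> t) \<in> fst c \<inter> V}" "smooth_on {t\<in>T. fst (\<Gamma> t) \<in> fst c \<inter> V} (\<lambda>t. snd (echart c V e) (\<Gamma> t))"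
    if "c \<in> charts B" "isfr V e" for c V e
    using \<Gamma>(1) echart_mem[OF that] unfolding smooth_curve_def set'[OF that, symmetric] by blast+
  have fd: "fin_dim TYPE((complex^'n) \<times> 'r cop)"
    by (intro fin_dim_prod fin_dim_euclidean fin_dim_blinfun)
  show "smooth_curve (End_charts B) T (\<lambda>t. Fmap g g' (\<Gamma> t))"
    unfolding smooth_curve_def
  proof (intro conjI ballI)
    show "(\<lambda>t. Fmap g g' (\<Gamma> t)) ` T \<subseteq> (\<Union>C\<in>End_charts B. fst C)"
    proof
      fix p assume "p \<in> (\<lambda>t. Fmap g g' (\<Gamma> t)) ` T"
      then obtain t where t: "t \<in> T" "p = Fmap g g' (\<Gamma> t)" by blast
      obtain c where c: "c \<in> charts B" "fst (\<Gamma> t) \<in> fst c" by (rule ex_chart)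
      obtain V e where e: "isfr V e" "fst (\<Gamma> t) \<in> V" by (rule ex_frame)
      show "p \<in> (\<Union>C\<in>End_charts B. fst C)"
        using loc[OF t(1) c(1) e(1) c(2) e(2)] echart_mem[OF c(1) e(1)] t(2) by blast
    qed
    fix C assume "C \<in> End_charts B"
    then obtain c V e where c: "c \<in> charts B" and e: "isfr V e" and C: "C = echart c V e" by (rule End_chartsE)
    let ?S = "{t\<in>T. fst (\<Gamma> t) \<in> fst c \<inter> V}"
    note s = sm[OF c e]
    show "open {t\<in>T. Fmap g g' (\<Gamma> t) \<in> fst C}" unfolding C set[OF c e] by (rule s(1))
    have "smooth_on ?S (\<lambda>t. Floc c e (snd C (\<Gamma> t)))"
      unfolding C by (rule smooth_on_compose[OF fd s(1) Wloc_open[OF c e] _ s(2) Floc_smooth[OF c e]])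
         (use loc[OF _ c e] in auto)
    then have "smooth_on ?S (\<lambda>t. snd C (Fmap g g' (\<Gamma> t)))"
      by (rule smooth_on_cong[OF s(1), rotated]) (use loc[OF _ c e] C in auto)
    then show "smooth_on {t\<in>T. Fmap g g' (\<Gamma> t) \<in> fst C} (\<lambda>t. snd C (Fmap g g' (\<Gamma> t)))"
      unfolding C set[OF c e] .
  qed
  assume t: "t \<in> T" and c: "c \<in> charts B" and e: "isfr V e" and x: "fst (\<Gamma> t) \<in> fst c" "fst (\<Gamma> t) \<in> V"
  let ?C = "echart c V e" and ?S = "{t\<in>T. fst (\<Gamma> t) \<in> fst c \<inter> V}"
  note s = sm[OF c e]
  have tS: "t \<in> ?S" using t x by simp
  note l = loc[OF t c e x]
  have d1: "((\<lambda>t. snd ?C (\<Gamma> t)) has_vector_derivative velocity (End_charts B) \<Gamma> t ?C) (at t)"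
    using smooth_on_vector_derivative[OF s(2) tS] echart_mem[OF c e] l by (simp add: velocity_def)
  have d2: "(Floc c e has_derivative frechet_derivative (Floc c e) (at (snd ?C (\<Gamma> t)))) (at (snd ?C (\<Gamma> t)))"
    by (rule smooth_on_has_derivative[OF Floc_smooth[OF c e]]) (use l in blast)
  have "((\<lambda>t. Floc c e (snd ?C (\<Gamma> t))) has_vector_derivative
      frechet_derivative (Floc c e) (at (snd ?C (\<Gamma> t))) (velocity (End_charts B) \<Gamma> t ?C)) (at t)"
    using diff_chain_at[OF d1[unfolded has_vector_derivative_def] d2]
    unfolding has_vector_derivative_def o_def by (simp only: linear_cmul[OF has_derivative_linear[OF d2]])
  then have "((\<lambda>t. snd ?C (Fmap g g' (\<Gamma> t))) has_vector_derivative
      frechet_derivative (Floc c e) (at (snd ?C (\<Gamma> t))) (velocity (End_charts B) \<Gamma> t ?C)) (at t)"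
    by (rule has_vector_derivative_transform_within_open[OF _ s(1) tS]) (use loc[OF _ c e] in auto)
  then show "velocity (End_charts B) (\<lambda>t. Fmap g g' (\<Gamma> t)) t ?C =
        frechet_derivative (Floc c e) (at (snd ?C (\<Gamma> t))) (velocity (End_charts B) \<Gamma> t ?C)"
    using echart_mem[OF c e] l vector_derivative_at unfolding velocity_def by auto
qed

text \<open>The differential is defined by moving along curves, and the chart expression of the map is smooth on an
  open set containing the chart image of the twistor space.\<close>

lemma Fmap_differential:
  assumes p: "(x, K) \<in> twistor_space B g"
    and \<xi>: "\<xi> \<in> tangent_space (End_charts B) (twistor_space B g) (x, K)"
  shows "differential (End_charts B) (twistor_space B g) (End_charts B) (Fmap g g') (x, K) \<xi>
      \<in> tangent_space (End_charts B) (twistor_space B g') (Fmap g g' (x, K))"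
    and "c \<in> charts B \<Longrightarrow> isfr V e \<Longrightarrow> x \<in> fst c \<Longrightarrow> x \<in> V \<Longrightarrow>
      differential (End_charts B) (twistor_space B g) (End_charts B) (Fmap g g') (x, K) \<xi> (echart c V e) =
        frechet_derivative (Floc c e) (at (snd c x, rep e x K)) (\<xi> (echart c V e))"
proof -
  define Q where "Q \<eta> \<longleftrightarrow> (\<exists>\<epsilon>>0. \<exists>\<gamma>. smooth_curve (End_charts B) {-\<epsilon><..<\<epsilon>} \<gamma> \<and>
     \<gamma> ` {-\<epsilon><..<\<epsilon>} \<subseteq> twistor_space B g \<and> \<gamma> 0 = (x, K) \<and> \<xi> = velocity (End_charts B) \<gamma> 0 \<and>
     \<eta> = velocity (End_charts B) (\<lambda>t. Fmap g g' (\<gamma> t)) 0)" for \<eta>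
  have val: "\<eta> (echart c V e) = frechet_derivative (Floc c e) (at (snd c x, rep e x K)) (\<xi> (echart c V e))"
    if Q: "Q \<eta>" and c: "c \<in> charts B" "x \<in> fst c" and e: "isfr V e" "x \<in> V" for \<eta> c V e
  proof -
    obtain \<epsilon> \<gamma> where \<gamma>: "\<epsilon> > 0" "smooth_curve (End_charts B) {-\<epsilon><..<\<epsilon>} \<gamma>"
     "\<gamma> ` {-\<epsilon><..<\<epsilon>} \<subseteq> twistor_space B g" "\<gamma> 0 = (x, K)" "\<xi> = velocity (End_charts B) \<gamma> 0"
     "\<eta> = velocity (End_charts B) (\<lambda>t. Fmap g g' (\<gamma> t)) 0"
      using Q unfolding Q_def by blast
    show ?thesis
      unfolding \<gamma>(5,6) using Fmap_curve(2)[OF \<gamma>(2) _ \<gamma>(3) _ c(1) e(1), of 0] \<gamma>(1,4) c e by (simp add: snd_echart)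
  qed
  have tg: "\<eta> \<in> tangent_space (End_charts B) (twistor_space B g') (Fmap g g' (x, K))" if Q: "Q \<eta>" for \<eta>
  proof -
    obtain \<epsilon> \<gamma> where \<gamma>: "\<epsilon> > 0" "smooth_curve (End_charts B) {-\<epsilon><..<\<epsilon>} \<gamma>"
     "\<gamma> ` {-\<epsilon><..<\<epsilon>} \<subseteq> twistor_space B g" "\<gamma> 0 = (x, K)"
     "\<eta> = velocity (End_charts B) (\<lambda>t. Fmap g g' (\<gamma> t)) 0"
      using Q unfolding Q_def by blast
    have "smooth_curve (End_charts B) {-\<epsilon><..<\<epsilon>} (\<lambda>t. Fmap g g' (\<gamma> t))"
      by (rule Fmap_curve(1)[OF \<gamma>(2) _ \<gamma>(3)]) simp
    moreover have "(\<lambda>t. Fmap g g' (\<gamma> t)) ` {-\<epsilon><..<\<epsilon>} \<subseteq> twistor_space B g'"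
      using \<gamma>(3) Fmap_mem[OF g g'] by blast
    moreover have "Fmap g g' (\<gamma> 0) = Fmap g g' (x, K)" using \<gamma>(4) by simp
    ultimately show ?thesis
      unfolding tangent_space_def using \<gamma>(1,5) by blast
  qed
  have out: "\<eta> C = 0" if Q: "Q \<eta>" and C: "C \<notin> End_charts B \<or> Fmap g g' (x, K) \<notin> fst C" for \<eta> C
  proof -
    obtain \<gamma> where \<gamma>: "\<gamma> 0 = (x, K)" "\<eta> = velocity (End_charts B) (\<lambda>t. Fmap g g' (\<gamma> t)) 0"
      using Q unfolding Q_def by blast
    show ?thesis using velocity_outside[of C "End_charts B" "\<lambda>t. Fmap g g' (\<gamma> t)" 0] C \<gamma> by simp
  qed
  have uniq: "\<eta> = \<eta>'" if Q: "Q \<eta>" "Q \<eta>'" for \<eta> \<eta>'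
  proof
    fix C show "\<eta> C = \<eta>' C"
    proof (cases rule: End_charts_cases[of C "Fmap g g' (x, K)"])
      case 1
      show ?thesis unfolding out[OF Q(1) 1] out[OF Q(2) 1] ..
    next
      case (2 c V e)
      have "x \<in> fst c" "x \<in> V" using 2 by (simp_all add: Fmap_def)
      then show ?thesis
        unfolding 2(1) using val[OF Q(1) 2(2) _ 2(4)] val[OF Q(2) 2(2) _ 2(4)] by simp
    qed
  qed
  obtain \<eta>0 where Q0: "Q \<eta>0" using \<xi> unfolding tangent_space_def Q_def by blast
  have "differential (End_charts B) (twistor_space B g) (End_charts B) (Fmap g g') (x, K) \<xi> = (THE \<eta>. Q \<eta>)"
    unfolding differential_def Q_def ..
  moreover have "Q (THE \<eta>. Q \<eta>)" by (rule theI[of Q, OF Q0]) (rule uniq[OF _ Q0])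
  ultimately have Q: "Q (differential (End_charts B) (twistor_space B g) (End_charts B) (Fmap g g') (x, K) \<xi>)" by simp
  show "differential (End_charts B) (twistor_space B g) (End_charts B) (Fmap g g') (x, K) \<xi>
      \<in> tangent_space (End_charts B) (twistor_space B g') (Fmap g g' (x, K))" by (rule tg[OF Q])
  show "c \<in> charts B \<Longrightarrow> isfr V e \<Longrightarrow> x \<in> fst c \<Longrightarrow> x \<in> V \<Longrightarrow>
      differential (End_charts B) (twistor_space B g) (End_charts B) (Fmap g g') (x, K) \<xi> (echart c V e) =
        frechet_derivative (Floc c e) (at (snd c x, rep e x K)) (\<xi> (echart c V e))"
    by (rule val[OF Q])
qed

text \<open>The derivative of \<open>P M P\<^sup>-\<^sup>1\<close>, obtained by differentiating \<open>(P M P\<^sup>-\<^sup>1) P = P M\<close>.\<close>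

lemma Floc_derivative:
  assumes c: "c \<in> charts B" "x \<in> fst c" and e: "isfr V e" "x \<in> V" and W: "(snd c x, M) \<in> Wloc c V e"
  defines "P \<equiv> transport_op Jop (hmat g g' e x) M" and "M' \<equiv> transport_cs Jop (hmat g g' e x) M"
    and "H \<equiv> frechet_derivative (hloc c e) (at (snd c x))"
  obtains D :: "'r cop" where "fst (frechet_derivative (Floc c e) (at (snd c x, M)) (a, X)) = a"
    "\<And>u. D u = (1/2) *\<^sub>R (Jop (X u) + H a (u - Jop (M u)) - hmat g g' e x (Jop (X u)))"
    "\<And>u. snd (frechet_derivative (Floc c e) (at (snd c x, M)) (a, X)) (P u) + M' (D u) = D (M u) + P (X u)"
proof -
  let ?q = "(snd c x, M)"
  have h: "hloc c e (snd c x) = hmat g g' e x" by (simp add: hloc_def c)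
  have z: "snd c x \<in> snd c ` (V \<inter> fst c)" using c e by blast
  have F: "(Floc c e has_derivative frechet_derivative (Floc c e) (at ?q)) (at ?q)"
    by (rule smooth_on_has_derivative[OF Floc_smooth[OF c(1) e(1)] W])
  define F1 F2 where "F1 y = fst (frechet_derivative (Floc c e) (at ?q) y)"
    and "F2 y = snd (frechet_derivative (Floc c e) (at ?q) y)" for y
  have dF1: "((\<lambda>q. fst (Floc c e q)) has_derivative F1) (at ?q)"
    unfolding F1_def[abs_def] by (rule bounded_linear.has_derivative[OF bounded_linear_fst F])
  have dF2: "((\<lambda>q. snd (Floc c e q)) has_derivative F2) (at ?q)"
    unfolding F2_def[abs_def] by (rule bounded_linear.has_derivative[OF bounded_linear_snd F])
  have "((\<lambda>q. fst (Floc c e q)) has_derivative fst) (at ?q)"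
    unfolding Floc_def by (simp add: bounded_linear_imp_has_derivative bounded_linear_fst)
  then have "F1 = fst" using has_derivative_unique[OF dF1] by blast
  then have 1: "F1 (a, X) = a" by simp
  have dh: "((\<lambda>q. hloc c e (fst q)) has_derivative (\<lambda>y. H (fst y))) (at ?q)"
  proof -
    have "(hloc c e has_derivative H) (at (fst ?q))"
      unfolding H_def fst_conv by (rule smooth_on_has_derivative[OF hloc_smooth[OF c(1) e(1)] z])
    from diff_chain_at[OF bounded_linear_imp_has_derivative[OF bounded_linear_fst] this]
    show ?thesis by (simp add: o_def)
  qed
  have dM: "(snd has_derivative snd) (at ?q)" by (rule bounded_linear_imp_has_derivative[OF bounded_linear_snd])
  have dJM: "((\<lambda>q. Jop o\<^sub>L snd q) has_derivative (\<lambda>y. Jop o\<^sub>L snd y)) (at ?q)"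
    by (rule bounded_linear.has_derivative[OF bounded_bilinear.bounded_linear_right[OF bounded_bilinear_blinfun_compose] dM])
  define DP where "DP = (\<lambda>y :: (complex^'n) \<times> 'r cop. (1/2) *\<^sub>R (0 + (Jop o\<^sub>L snd y) +
      ((hmat g g' e x o\<^sub>L (0 - (Jop o\<^sub>L snd y))) + (H (fst y) o\<^sub>L (id_blinfun - (Jop o\<^sub>L M))))))"
  have dP: "(Ploc c e has_derivative DP) (at ?q)"
    unfolding Ploc_def[abs_def] transport_op_def DP_def
    using bounded_bilinear.FDERIV[OF bounded_bilinear_blinfun_compose dh
        has_derivative_diff[OF has_derivative_const[of id_blinfun] dJM]]
    by (intro has_derivative_scaleR_right has_derivative_add has_derivative_const dJM) (simp add: h)
  have "((\<lambda>q. snd (Floc c e q) o\<^sub>L Ploc c e q) has_derivative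
      (\<lambda>y. (snd (Floc c e ?q) o\<^sub>L DP y) + (F2 y o\<^sub>L Ploc c e ?q))) (at ?q)"
    by (rule bounded_bilinear.FDERIV[OF bounded_bilinear_blinfun_compose dF2 dP])
  moreover have "((\<lambda>q. snd (Floc c e q) o\<^sub>L Ploc c e q) has_derivative
      (\<lambda>y. (Ploc c e ?q o\<^sub>L snd y) + (DP y o\<^sub>L snd ?q))) (at ?q)"
  proof (rule has_derivative_transform_within_open[OF bounded_bilinear.FDERIV[OF bounded_bilinear_blinfun_compose dP dM]
        Wloc_open[OF c(1) e(1)] W])
    fix q assume "q \<in> Wloc c V e"
    then have "invertible_op (Ploc c e q)" by (simp add: Wloc_def)
    then show "Ploc c e q o\<^sub>L snd q = snd (Floc c e q) o\<^sub>L Ploc c e q"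
      by (intro blinfun_eqI) (simp add: Floc_def transport_cs_def Ploc_def[symmetric] binv_apply)
  qed
  ultimately have "(\<lambda>y. (snd (Floc c e ?q) o\<^sub>L DP y) + (F2 y o\<^sub>L Ploc c e ?q)) =
      (\<lambda>y. (Ploc c e ?q o\<^sub>L snd y) + (DP y o\<^sub>L snd ?q))"
    by (rule has_derivative_unique)
  then have "(snd (Floc c e ?q) o\<^sub>L DP (a, X)) + (F2 (a, X) o\<^sub>L Ploc c e ?q) =
      (Ploc c e ?q o\<^sub>L X) + (DP (a, X) o\<^sub>L M)" by (metis snd_conv)
  then have eq: "(M' o\<^sub>L DP (a, X)) + (F2 (a, X) o\<^sub>L P) = (P o\<^sub>L X) + (DP (a, X) o\<^sub>L M)"
    by (simp add: Floc_def Ploc_def h M'_def P_def)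
  show thesis
  proof (rule that[of "DP (a, X)"])
    show "fst (frechet_derivative (Floc c e) (at ?q) (a, X)) = a" using 1 by (simp add: F1_def)
    show "DP (a, X) u = (1/2) *\<^sub>R (Jop (X u) + H a (u - Jop (M u)) - hmat g g' e x (Jop (X u)))" for u
      unfolding DP_def by (simp add: blinfun.bilinear_simps algebra_simps del: Jop_apply)
    show "snd (frechet_derivative (Floc c e) (at ?q) (a, X)) (P u) + M' (DP (a, X) u) = DP (a, X) (M u) + P (X u)" for u
      using arg_cong[OF eq, of "\<lambda>L. blinfun_apply L u"] by (simp add: F2_def blinfun.add_left add.commute)
  qed
qed

text \<open>The derivative of \<open>M\<^sup>2 = - 1\<close>.\<close>

lemma tangent_anticommute:
  assumes n: "metric_conn g nabla" and p: "(x, K) \<in> twistor_space B g"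
    and \<xi>: "\<xi> \<in> tangent_space (End_charts B) (twistor_space B g) (x, K)"
    and c: "c \<in> charts B" "x \<in> fst c" and e: "isfr V e" "x \<in> V"
  shows "snd (\<xi> (echart c V e)) (rep e x K u) = - rep e x K (snd (\<xi> (echart c V e)) u)"
proof -
  obtain A v where A: "A \<in> vertical_space B g (x, K)" and v: "v \<in> tang B x"
    and dec: "\<xi> = vert B (x, K) A + horizontal_lift B nabla (x, K) v"
    by (rule tangent_decompose[OF n g p \<xi>])
  have K: "K \<in> End_fiber B x" using p by (simp add: twistor_space_def)
  have AE: "A \<in> End_fiber B x" using A by (simp add: vertical_space_def)
  have MM: "rep e x K (rep e x K a) = - a" for a
    using p unfolding twistor_iff[OF e g] by (simp add: ortho_cs_def)
  have AM: "rep e x A (rep e x K a) = - rep e x K (rep e x A a)" for a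
    using A unfolding vertical_iff[OF e g K AE] by (simp add: eq_neg_iff_add_eq_0)
  show ?thesis
    unfolding dec using vert_eq(1)[OF K AE c e] horizontal_lift_eq(1)[OF n g p v c e]
    by (simp add: blinfun.bilinear_simps AM MM)
qed

text \<open>The hypotheses of \<open>chern_ratio\<close> are verified by differentiating the Gram operators and \<open>G = G' h\<close> in a chart
  of the base.\<close>

lemma chern_intertwine:
  fixes a :: "complex^'n"
  assumes ch: "chern_connection B g nCh" and ch': "chern_connection B g' nCh'"
    and c: "c \<in> charts B" "x \<in> fst c" and e: "isfr V e" "x \<in> V"
  defines "H \<equiv> frechet_derivative (hloc c e) (at (snd c x))" and "h \<equiv> hmat g g' e x"
    and "v \<equiv> coord_vec (charts B) c x a"
  shows "h (cform nCh e x v b) = cform nCh' e x v (h b) + (1/2) *\<^sub>R (H a b - Jop (H (\<i> *s a) b))"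
    and "H a' (Jop b) = Jop (H a' b)"
proof -
  have z: "snd c x \<in> snd c ` (V \<inter> fst c)" using c e by blast
  note o = V_open[OF c(1) e(1)]
  have v: "v \<in> tang B x" unfolding v_def by (rule coord_vec_tangent[OF c])
  have vc: "v c = a" unfolding v_def by (simp add: c)
  have Iv: "cplx_I v = coord_vec (charts B) c x (\<i> *s a)" unfolding v_def coord_vec_linear(3)[OF c] ..
  have Ivc: "cplx_I v c = \<i> *s a" unfolding Iv by (simp add: c)
  note tIv = cplx_I_tangent[OF v]
  define dG dG' where "dG = frechet_derivative (\<lambda>z. gmat g e (chart_inv c z)) (at (snd c x))"
    and "dG' = frechet_derivative (\<lambda>z. gmat g' e (chart_inv c z)) (at (snd c x))"
  have G: "((\<lambda>z. gmat g e (chart_inv c z)) has_derivative dG) (at (snd c x))"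
    unfolding dG_def by (rule smooth_fun_has_derivative[OF gmat_smooth[OF e(1) g] e(2) c])
  have G': "((\<lambda>z. gmat g' e (chart_inv c z)) has_derivative dG') (at (snd c x))"
    unfolding dG'_def by (rule smooth_fun_has_derivative[OF gmat_smooth[OF e(1) g'] e(2) c])
  have H: "(hloc c e has_derivative H) (at (snd c x))"
    unfolding H_def by (rule smooth_on_has_derivative[OF hloc_smooth[OF c(1) e(1)] z])
  have h0: "hloc c e (snd c x) = h" by (simp add: hloc_def c h_def)
  have inV: "chart_inv c z \<in> V" if "z \<in> snd c ` (V \<inter> fst c)" for z
    using that unfolding chart_img_iff[OF c(1)] by blast
  have eq: "(\<lambda>y. (gmat g' e x o\<^sub>L H y) + (dG' y o\<^sub>L h)) = dG"
  proof (rule has_derivative_unique)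
    show "((\<lambda>z. gmat g' e (chart_inv c z) o\<^sub>L hloc c e z) has_derivative
        (\<lambda>y. (gmat g' e x o\<^sub>L H y) + (dG' y o\<^sub>L h))) (at (snd c x))"
      using bounded_bilinear.FDERIV[OF bounded_bilinear_blinfun_compose G' H] by (simp add: h0 c)
    show "((\<lambda>z. gmat g' e (chart_inv c z) o\<^sub>L hloc c e z) has_derivative dG) (at (snd c x))"
    proof (rule has_derivative_transform_within_open[OF G o z])
      fix z assume "z \<in> snd c ` (V \<inter> fst c)"
      note gh = gmat_herm[OF e(1) inV[OF this] g']
      show "gmat g e (chart_inv c z) = gmat g' e (chart_inv c z) o\<^sub>L hloc c e z"
        by (rule blinfun_eqI) (simp add: hloc_def hmat_def ratio_op_apply[OF gh])
    qed
  qed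
  have GH: "dG' y (h b) + gmat g' e x (H y b) = dG y b" for y b
    unfolding fun_cong[OF eq, of y, symmetric] by (simp add: blinfun.add_left add.commute)
  have HJ: "H y (Jop b) = Jop (H y b)" for y b
  proof -
    have "(\<lambda>y. H y (Jop b)) = (\<lambda>y. Jop (H y b))"
    proof (rule has_derivative_unique)
      show "((\<lambda>z. hloc c e z (Jop b)) has_derivative (\<lambda>y. H y (Jop b))) (at (snd c x))"
        by (rule bounded_linear.has_derivative[OF blinfun.bounded_linear_left H])
      have "((\<lambda>z. Jop (hloc c e z b)) has_derivative (\<lambda>y. Jop (H y b))) (at (snd c x))"
        by (rule bounded_linear.has_derivative[OF blinfun.bounded_linear_right
              bounded_linear.has_derivative[OF blinfun.bounded_linear_left H]])
      then show "((\<lambda>z. hloc c e z (Jop b)) has_derivative (\<lambda>y. Jop (H y b))) (at (snd c x))"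
      proof (rule has_derivative_transform_within_open[OF _ o z])
        fix z assume "z \<in> snd c ` (V \<inter> fst c)"
        note gh = gmat_herm[OF e(1) inV[OF this] g] gmat_herm[OF e(1) inV[OF this] g']
        show "Jop (hloc c e z b) = hloc c e z (Jop b)"
          unfolding hloc_def hmat_def by (rule ratio_op_J[OF gh, symmetric])
      qed
    qed
    then show ?thesis by (rule fun_cong)
  qed
  show "H a' (Jop b) = Jop (H a' b)" by (rule HJ)
  note m = metric_connD[OF chern_metric_conn[OF g ch] e] and m' = metric_connD[OF chern_metric_conn[OF g' ch'] e]
  have dGa: "dfun (charts B) (gmat g e) x w = dG (w c)" "dfun (charts B) (gmat g' e) x w = dG' (w c)"
    if "w \<in> tang B x" for w by (rule dfun_eq[OF c that G] dfun_eq[OF c that G'])+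
  note cf = chern_cform[OF g ch e v] and cf' = chern_cform[OF g' ch' e v]
  have hr: "h = ratio_op (gmat g e x) (gmat g' e x)" unfolding h_def hmat_def ..
  have J1: "blinfun_apply (Jop o\<^sub>L L) q = Jop (L q)" for L :: "'r cop" and q by simp
  show "h (cform nCh e x v b) = cform nCh' e x v (h b) + (1/2) *\<^sub>R (H a b - Jop (H (\<i> *s a) b))"
  proof (rule chern_ratio[OF gmat_herm[OF e g] gmat_herm[OF e g'] hr])
    fix p q
    show "dG a p \<bullet> q = gmat g e x (cform nCh e x v p) \<bullet> q + gmat g e x p \<bullet> cform nCh e x v q"
      using m[OF v] unfolding dGa[OF v] vc .
    show "dG' a p \<bullet> q = gmat g' e x (cform nCh' e x v p) \<bullet> q + gmat g' e x p \<bullet> cform nCh' e x v q"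
      using m'[OF v] unfolding dGa[OF v] vc .
    show "dG (\<i> *s a) p \<bullet> q = gmat g e x (Jop (cform nCh e x v p)) \<bullet> q + gmat g e x p \<bullet> Jop (cform nCh e x v q)"
      using m[OF tIv] unfolding dGa[OF tIv] Ivc cf(2) J1 .
    show "dG' (\<i> *s a) p \<bullet> q = gmat g' e x (Jop (cform nCh' e x v p)) \<bullet> q + gmat g' e x p \<bullet> Jop (cform nCh' e x v q)"
      using m'[OF tIv] unfolding dGa[OF tIv] Ivc cf'(2) J1 .
    show "cform nCh e x v (Jop p) = Jop (cform nCh e x v p)" "cform nCh' e x v (Jop p) = Jop (cform nCh' e x v p)"
      by (rule cf(1) cf'(1))+
    show "dG' a (h p) + gmat g' e x (H a p) = dG a p" "dG' (\<i> *s a) (h p) + gmat g' e x (H (\<i> *s a) p) = dG (\<i> *s a) p"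
      by (rule GH)+
  qed
qed

text \<open>In a bundle chart both almost complex structures are given by \<open>acs_comp\<close>. The connection forms are
  intertwined by \<open>\<Phi>\<close>, by \<open>chern_intertwine\<close> for the Chern part and \<open>Dg_intertwine\<close> for the rest, and
  \<open>acs_comp_transport\<close> turns this into the commutation of the differential with the structures.\<close>

theorem Fmap_holomorphic:
  assumes D: "so_form01 B D'" and ch: "chern_connection B g nCh" and ch': "chern_connection B g' nCh'"
    and p: "(x, K) \<in> twistor_space B g" and \<xi>: "\<xi> \<in> tangent_space (End_charts B) (twistor_space B g) (x, K)"
  defines "n \<equiv> \<lambda>s x v. nCh s x v + Dg B g D' x v (s x)" and "n' \<equiv> \<lambda>s x v. nCh' s x v + Dg B g' D' x v (s x)"
  shows "differential (End_charts B) (twistor_space B g) (End_charts B) (Fmap g g') (x, K) (twistor_acs B g n (x, K) \<xi>) =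
    twistor_acs B g' n' (Fmap g g' (x, K))
      (differential (End_charts B) (twistor_space B g) (End_charts B) (Fmap g g') (x, K) \<xi>)"
    (is "?d ?J\<xi> = ?J' (?d \<xi>)")
proof
  have mc: "metric_conn g n" and mc': "metric_conn g' n'"
    unfolding n_def n'_def using tot_metric_conn[OF D g ch] tot_metric_conn[OF D g' ch']
    unfolding tot_def[OF D g ch] tot_def[OF D g' ch'] .
  note J\<xi> = twistor_acs_eq(1)[OF mc g p \<xi>]
  obtain K' where F: "Fmap g g' (x, K) = (x, K')" and p': "(x, K') \<in> twistor_space B g'"
    by (rule Fmap_rep[OF g g' p]) (rule that, assumption+)
  note d\<xi> = Fmap_differential(1)[OF p \<xi>, unfolded F]
  note dJ\<xi> = Fmap_differential(1)[OF p J\<xi>, unfolded F]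
  note Jd\<xi> = twistor_acs_eq(1)[OF mc' g' p' d\<xi>]
  fix C
  show "?d ?J\<xi> C = ?J' (?d \<xi>) C"
  proof (cases rule: End_charts_cases[of C "(x, K')"])
    case 1
    \<comment> \<open>Tangent vectors have the component 0 in a chart that does not contain their base point.\<close>
    have zero: "\<zeta> C = 0" if "\<zeta> \<in> tangent_space (End_charts B) (twistor_space B g') (x, K')" for \<zeta>
    proof -
      note \<zeta> = that
      obtain \<gamma> where \<gamma>: "\<gamma> 0 = (x, K')" "\<zeta> = velocity (End_charts B) \<gamma> 0"
        using \<zeta> unfolding tangent_space_def mem_Collect_eq by (elim exE conjE) (rule that)
      have "C \<notin> End_charts B \<or> \<gamma> 0 \<notin> fst C" unfolding \<gamma>(1) by (rule 1)
      then show ?thesis unfolding \<gamma>(2) by (rule velocity_outside)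
    qed
    have "?d ?J\<xi> C = 0" by (rule zero[OF dJ\<xi>])
    moreover have "?J' (?d \<xi>) C = 0" unfolding F by (rule zero[OF Jd\<xi>])
    ultimately show ?thesis by (rule trans[OF _ sym])
  next
    case (2 c V e)
    note C = 2(1) and c = 2(2) 2(3)[unfolded fst_conv] and e = 2(4) 2(5)[unfolded fst_conv]
    define M where "M = rep e x K"
    obtain a X where aX: "\<xi> C = (a, X)" by (cases "\<xi> C")
    define v where "v = coord_vec (charts B) c x a"
    have v: "v \<in> tang B x" unfolding v_def by (rule coord_vec_tangent[OF c])
    have Iv: "coord_vec (charts B) c x (\<i> *s a) = cplx_I v" unfolding v_def coord_vec_linear(3)[OF c] ..
    note tIv = cplx_I_tangent[OF v]
    define \<Theta>1 \<Theta>2 \<Theta>1' \<Theta>2' where "\<Theta>1 = cform n e x v" and "\<Theta>2 = cform n e x (cplx_I v)"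
      and "\<Theta>1' = cform n' e x v" and "\<Theta>2' = cform n' e x (cplx_I v)"
    define Y where "Y = acs_comp M \<Theta>1 \<Theta>2 X"
    have J\<xi>C: "?J\<xi> C = (\<i> *s a, Y)"
      using twistor_acs_eq(2)[OF mc g p \<xi> c e] unfolding C[symmetric] aX fst_conv snd_conv Iv
      unfolding v_def[symmetric] M_def[symmetric] \<Theta>1_def[symmetric] \<Theta>2_def[symmetric] Y_def[symmetric] .
    define h P M' H where "h = hmat g g' e x" and "P = transport_op Jop h M" and "M' = transport_cs Jop h M"
      and "H = frechet_derivative (hloc c e) (at (snd c x))"
    note hr = h_def[unfolded hmat_def]
    note tl = twistor_loc[OF c(1) e(1) p c(2) e(2)]
    have W: "(snd c x, M) \<in> Wloc c V e" using tl(3) by (simp add: M_def)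
    have repK': "rep e x K' = M'" using tl(6) unfolding F by (simp add: M'_def h_def M_def)
    define \<phi> where "\<phi> = frechet_derivative (Floc c e) (at (snd c x, M))"
    obtain D1 :: "'r cop" where D1: "fst (\<phi> (a, X)) = a" "\<And>u. D1 u = (1/2) *\<^sub>R (Jop (X u) + H a (u - Jop (M u)) - h (Jop (X u)))"
      "\<And>u. snd (\<phi> (a, X)) (P u) + M' (D1 u) = D1 (M u) + P (X u)"
      by (rule Floc_derivative[OF c e W, where a = a and X = X, folded h_def, folded P_def M'_def H_def \<phi>_def]) (rule that, assumption+)
    obtain D2 :: "'r cop" where D2: "fst (\<phi> (\<i> *s a, Y)) = \<i> *s a"
      "\<And>u. D2 u = (1/2) *\<^sub>R (Jop (Y u) + H (\<i> *s a) (u - Jop (M u)) - h (Jop (Y u)))"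
      "\<And>u. snd (\<phi> (\<i> *s a, Y)) (P u) + M' (D2 u) = D2 (M u) + P (Y u)"
      by (rule Floc_derivative[OF c e W, where a = "\<i> *s a" and X = Y, folded h_def, folded P_def M'_def H_def \<phi>_def]) (rule that, assumption+)
    define X' Y' where "X' = snd (\<phi> (a, X))" and "Y' = snd (\<phi> (\<i> *s a, Y))"
    have d\<xi>C: "?d \<xi> C = (a, X')"
      using Fmap_differential(2)[OF p \<xi> c(1) e(1) c(2) e(2)] unfolding C[symmetric] aX M_def[symmetric] \<phi>_def[symmetric]
      using D1(1) by (simp add: X'_def prod_eq_iff)
    have dJ\<xi>C: "?d ?J\<xi> C = (\<i> *s a, Y')"
      using Fmap_differential(2)[OF p J\<xi> c(1) e(1) c(2) e(2)] unfolding C[symmetric] J\<xi>C M_def[symmetric] \<phi>_def[symmetric]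
      using D2(1) by (simp add: Y'_def prod_eq_iff)
    have Jd\<xi>C: "?J' (?d \<xi>) C = (\<i> *s a, acs_comp M' \<Theta>1' \<Theta>2' X')"
      unfolding F
      using twistor_acs_eq(2)[OF mc' g' p' d\<xi> c e] unfolding C[symmetric] d\<xi>C fst_conv snd_conv Iv
      unfolding v_def[symmetric] repK' \<Theta>1'_def[symmetric] \<Theta>2'_def[symmetric] .
    have M: "M \<in> ortho_cs (gmat g e x)" using p unfolding twistor_iff[OF e g] M_def by simp
    note G = gmat_herm[OF e g] and G' = gmat_herm[OF e g']
    have JJ': "Jop (Jop b) = - b" for b :: "complex^'r" using G by (simp add: herm_def)
    have MM: "M (M b) = - b" for b using M by (simp add: ortho_cs_def)
    have M'o: "M' \<in> ortho_cs (gmat g' e x)"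
      unfolding M'_def by (rule transport_cs_ortho[OF G G' hr M])
    then have MM': "M' (M' b) = - b" for b by (simp add: ortho_cs_def)
    have \<Theta>: "\<Theta>1 = cform nCh e x v + rep e x (Dg B g D' x v)"
      "\<Theta>2 = (Jop o\<^sub>L cform nCh e x v) + rep e x (Dg B g D' x (cplx_I v))"
      "\<Theta>1' = cform nCh' e x v + rep e x (Dg B g' D' x v)"
      "\<Theta>2' = (Jop o\<^sub>L cform nCh' e x v) + rep e x (Dg B g' D' x (cplx_I v))"
      unfolding \<Theta>1_def \<Theta>2_def \<Theta>1'_def \<Theta>2'_def n_def n'_def
      unfolding tot_def[OF D g ch, symmetric] tot_def[OF D g' ch', symmetric]
      unfolding tot_cform[OF D g ch e v] tot_cform[OF D g ch e tIv] tot_cform[OF D g' ch' e v] tot_cform[OF D g' ch' e tIv]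
        chern_cform(2)[OF g ch e v] chern_cform(2)[OF g' ch' e v] by simp_all
    note ci = chern_intertwine(1)[OF ch ch' c e, folded H_def h_def, of a, folded v_def]
    note HJ = chern_intertwine(2)[OF ch ch' c e, folded H_def]
    note isum = intertwine_sum[OF JJ' ratio_op_J[OF G G', folded hr] HJ HJ
        chern_cform(1)[OF g ch e v] chern_cform(1)[OF g' ch' e v] ci
        Dg_intertwine[OF D g g' e v, folded hr], folded \<Theta>]
    have "Y' = acs_comp M' \<Theta>1' \<Theta>2' X'"
    proof (rule acs_comp_transport[OF JJ' MM MM' _ _ _ D1(2) D2(2) _ _ _ _ Y_def isum])
      show "P u = (1/2) *\<^sub>R (u + Jop (M u) + h (u - Jop (M u)))" for u
        unfolding P_def by (rule transport_op_apply)
      show "M' (P u) = P (M u)" for u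
        unfolding M'_def P_def by (rule transport_cs_apply[OF G G' hr M])
      show "invertible_op P" unfolding P_def by (rule transport_op_invertible[OF G G' hr M])
      show "X (M u) = - M (X u)" for u
        using tangent_anticommute[OF mc p \<xi> c e, of u] unfolding C[symmetric] aX M_def[symmetric] by simp
      show "Y (M u) = - M (Y u)" for u
        using tangent_anticommute[OF mc p J\<xi> c e, of u] unfolding C[symmetric] J\<xi>C M_def[symmetric] by simp
      show "X' (P u) + M' (D1 u) = D1 (M u) + P (X u)" for u unfolding X'_def by (rule D1(3))
      show "Y' (P u) + M' (D2 u) = D2 (M u) + P (Y u)" for u unfolding Y'_def by (rule D2(3))
    qed
    then show ?thesis unfolding dJ\<xi>C Jd\<xi>C by simp
  qed
qed

end

lemma smooth_map_cong:
  assumes "smooth_map A S A' F" "\<And>p. p \<in> S \<Longrightarrow> F p = G p"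
  shows "smooth_map A S A' G"
  unfolding smooth_map_def
proof
  fix p assume p: "p \<in> S"
  obtain c d W f where *: "c \<in> A" "d \<in> A'" "p \<in> fst c" "F p \<in> fst d" "open W" "snd c p \<in> W" "smooth_on W f"
    "\<forall>q\<in>S \<inter> fst c. snd c q \<in> W \<longrightarrow> F q \<in> fst d \<and> snd d (F q) = f (snd c q)"
    using assms(1)[unfolded smooth_map_def, THEN bspec, OF p] by blast
  have "\<forall>q\<in>S \<inter> fst c. snd c q \<in> W \<longrightarrow> G q \<in> fst d \<and> snd d (G q) = f (snd c q)"
  proof
    fix q assume q: "q \<in> S \<inter> fst c"
    show "snd c q \<in> W \<longrightarrow> G q \<in> fst d \<and> snd d (G q) = f (snd c q)"
      using *(8)[THEN bspec, OF q] unfolding assms(2)[OF IntD1[OF q]] .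
  qed
  then show "\<exists>c\<in>A. \<exists>d\<in>A'. p \<in> fst c \<and> G p \<in> fst d \<and>
     (\<exists>W Ga. open W \<and> snd c p \<in> W \<and> smooth_on W Ga \<and>
        (\<forall>q\<in>S \<inter> fst c. snd c q \<in> W \<longrightarrow> G q \<in> fst d \<and> snd d (G q) = Ga (snd c q)))"
    using *(1-7) unfolding assms(2)[OF p] by blast
qed

end

theorem proposition5p17:
  fixes B :: "('m::{t2_space, second_countable_topology}, 'n::finite, 'v::real_vector, 'r::finite) hbundle"
    and g g' :: "'m \<Rightarrow> 'v \<Rightarrow> 'v \<Rightarrow> real"
    and D' :: "'m \<Rightarrow> ('m, complex^'n) tvec \<Rightarrow> 'v wvec \<Rightarrow> 'v wvec"
    and nablaCh nablaCh' :: "('m \<Rightarrow> 'v) \<Rightarrow> 'm \<Rightarrow> ('m, complex^'n) tvec \<Rightarrow> 'v"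
  assumes "holomorphic_vector_bundle B"
    and "compatible_metric B g"
    and "compatible_metric B g'"
    and "so_form01 B D'"
    and "dbar_operator_W B (\<lambda>s x v. dbar_W B s x v + D' x v (s x))"
    and "chern_connection B g nablaCh"
    and "chern_connection B g' nablaCh'"
  shows "\<exists>F. (\<forall>p\<in>twistor_space B g. fst (F p) = fst p) \<and>
    biholomorphism
      (End_charts B) (twistor_space B g)
      (twistor_acs B g (\<lambda>s x v. nablaCh s x v + Dg B g D' x v (s x)))
      (End_charts B) (twistor_space B g')
      (twistor_acs B g' (\<lambda>s x v. nablaCh' s x v + Dg B g' D' x v (s x)))
      F"
proof -
  interpret hol_bundle B using assms(1) by unfold_locales
  note g = assms(2) and g' = assms(3)
  let ?F = "Fmap g g'"
  have bij: "bij_betw ?F (twistor_space B g) (twistor_space B g')" by (rule Fmap_bij[OF g g'])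
  \<comment> \<open>The inverse is the map for the exchanged metrics, which is smooth for the same reason.\<close>
  have inv: "Fmap g' g p = inv_into (twistor_space B g) ?F p" if p: "p \<in> twistor_space B g'" for p
  proof -
    have "inv_into (twistor_space B g) ?F (?F (Fmap g' g p)) = Fmap g' g p"
      using bij Fmap_mem[OF g' g p] unfolding bij_betw_def by (intro inv_into_f_f) auto
    then show ?thesis using Fmap_inverse[OF g' g p] by simp
  qed
  have "biholomorphism
      (End_charts B) (twistor_space B g)
      (twistor_acs B g (\<lambda>s x v. nablaCh s x v + Dg B g D' x v (s x)))
      (End_charts B) (twistor_space B g')
      (twistor_acs B g' (\<lambda>s x v. nablaCh' s x v + Dg B g' D' x v (s x))) ?F"
    unfolding biholomorphism_def
  proof (intro conjI ballI bij Fmap_smooth[OF g g'])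
    show "smooth_map (End_charts B) (twistor_space B g') (End_charts B) (inv_into (twistor_space B g) ?F)"
      by (rule smooth_map_cong[OF Fmap_smooth[OF g' g] inv])
    fix p \<xi> assume "p \<in> twistor_space B g" "\<xi> \<in> tangent_space (End_charts B) (twistor_space B g) p"
    then show "differential (End_charts B) (twistor_space B g) (End_charts B) ?F p
        (twistor_acs B g (\<lambda>s x v. nablaCh s x v + Dg B g D' x v (s x)) p \<xi>) =
      twistor_acs B g' (\<lambda>s x v. nablaCh' s x v + Dg B g' D' x v (s x)) (?F p)
        (differential (End_charts B) (twistor_space B g) (End_charts B) ?F p \<xi>)"
      using Fmap_holomorphic[OF g g' assms(4,6,7)] by (cases p) blast
  qed
  then show ?thesis
    by (intro exI[of _ ?F] conjI ballI) (simp_all add: Fmap_def)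
qed


end
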